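(* Let $1<\alpha<2$, $\beta=\alpha/2$, $\sigma=1-\frac{\beta}{2}$, $r\ge 1$. Consider the time fractional sine-Gordon problem on $\Omega=(0,L)^2$ and its linearized Alikhanov finite difference scheme on quasi-graded temporal meshes with grading $r$ (both described in the context). Suppose that the functions $\bar u(\bm{x},t)=u(\bm{x},t)-t\phi(\bm{x})$ and $p=D_t^{\beta}\bar u$ satisfy: $\bar u\in C^{4,1}_{\bm{x},t}(\bar\Omega\times[0,T])$, $p\in C^{2,0}_{\bm{x},t}(\bar\Omega\times[0,T])$, and for $l=0,1,2,3$, all $\bm{x}\in\bar\Omega$ and $t\in(0,T]$, $$\sum_{0\le j\le 2}\left|\partial_{\bm{x}}^j\frac{\partial^l\bar u(\bm{x},t)}{\partial t^l}\right|\le C(1+t^{\alpha-l}),\qquad \sum_{0\le j\le 2}\left|\partial_{\bm{x}}^j\frac{\partial^l p(\bm{x},t)}{\partial t^l}\right|\le C(1+t^{\alpha/2-l}).$$ Suppose that the coefficients $g_{n,k}$ of $\delta_t^{\beta,*}$ satisfy (P1) $g_{n,k+1}>g_{n,k}>0$ for $1\le k\le n-1\le N-1$; (P2) $(2\sigma-1)g_{n,n}>\sigma g_{n,n-1}$ for $2\le n\le N$. Let $(P^n,\bar U^n)$ be the solution of the scheme, and put $\tilde p^n=p^n-P^n$ and $\tilde u^n=\bar u^n-\bar U^n$, where $p^n,\bar u^n$ are the grid restrictions of $p(\cdot,t_n),\bar u(\cdot,t_n)$. Then, provided $\tau=\max_n\tau_n$ is sufficiently small, for $1\le n\le N$, $$\|\tilde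 p^n\|+\|\nabla_h\tilde u^n\|\lesssim\begin{cases}\tau_1t_n^{\beta-1}+h^2t_n^{\beta}, & 1\le r\le \frac{2}{\beta+1},\\[2pt] \tau_1t_n^{\beta-1}+\tau_1^{2/r}t_n^{2\beta-2/r}+h^2t_n^{\beta}, & \frac{2}{\beta+1}<r<3-\beta,\\[2pt] \bigl(1+\ln(t_n/\tau_1)\bigr)\tau_1t_n^{\beta-1}+\tau_1^{2/r}t_n^{2\beta-2/r}+h^2t_n^{\beta}, & r=3-\beta,\\[2pt] \tau_1^{\frac{3-\beta}{r}}t_n^{\beta-\frac{3-\beta}{r}}+\tau_1^{2/r}t_n^{2\beta-2/r}+h^2t_n^{\beta}, & r>3-\beta.\end{cases}$$ Here $a\lesssim b$ means $a\le Cb$ with a constant $C>0$ independent of $n$ and of the mesh sizes (of $N$, $M$).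
   Context: **Continuous problem.** $\nu>0$, $\kappa$ and $T>0$ are constants, $f(u)=\kappa^2\sin u$, and $u$ solves $D_t^{\alpha}u-\nu\Delta u+f(u)=0$ in $\Omega\times(0,T]$, $u(\cdot,0)=\psi$, $u_t(\cdot,0)=\phi$ in $\Omega$, $u=0$ on $\partial\Omega\times[0,T]$, where $\phi\in C^2(\bar\Omega)$ vanishes on $\partial\Omega$. For $1<\delta<2$ the Caputo derivative is $D_t^{\delta}v(t)=\frac{1}{\Gamma(2-\delta)}\int_0^t(t-s)^{1-\delta}v''(s)\,ds$, and for $0<\delta<1$ it is $D_t^{\delta}v(t)=\frac1{\Gamma(1-\delta)}\int_0^t(t-s)^{-\delta}v'(s)\,ds$. With $\bar u=u-t\phi$ and $p=D_t^\beta\bar u$ the problem is equivalent to the system $D_t^{\beta}p-\nu\Delta\bar u+f(\bar u+t\phi)=\nu t\Delta\phi$, $D_t^\beta\bar u=p$ in $\Omega\times(0,T]$, with $\bar u(\cdot,0)=\psi$, $p(\cdot,0)=0$ and $\bar u=p=0$ on $\partial\Omega\times[0,T]$. $\partial_{\bm x}^jv$ denotes any derivative $\frac{\partial^{j_1+j_2}v}{\partial x^{j_1}\partial y^{j_2}}$ with $j_1,j_2\ge 0$, $j_1+j_2=j$. $C^{m,k}_{\bm x,t}$ denotes functions with continuous space derivatives up to order $m$ and continuous time derivatives up to order $k$. **Temporal mesh.** For each $N$, $0=t_0<t_1<\dots<t_N=T$, $\tau_n=t_n-t_{n-1}$, $\tau=\max_n\tau_n$. The meshes are quasi-graded: $\tau_1\simeq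 N^{-r}$, $t_n\simeq\tau_1n^r$, $\tau_n\simeq\tau_1^{1/r}t_n^{1-1/r}$ for $1\le n\le N$, where $a\simeq b$ means that $a/b$ is bounded above and below by positive constants independent of $n$ and $N$. Put $t_n^*=t_n-(1-\sigma)\tau_n$ and, for a sequence $v^n$, $v^{n,*}=\sigma v^n+(1-\sigma)v^{n-1}$. **Discrete fractional derivative (Alikhanov).** $\delta_t^{\beta,*}v^n=\frac1{\Gamma(1-\beta)}\Bigl[\sum_{k=1}^{n-1}\int_{t_{k-1}}^{t_k}(t_n^*-s)^{-\beta}\partial_s\Pi_{2,k}v(s)\,ds+\int_{t_{n-1}}^{t_n^*}(t_n^*-s)^{-\beta}\partial_s\Pi_{1,n}v(s)\,ds\Bigr]$, where $\Pi_{2,k}v$ is the quadratic interpolant of $v$ at $t_{k-1},t_k,t_{k+1}$ and $\Pi_{1,n}v$ the linear interpolant at $t_{n-1},t_n$. Written as $\delta_t^{\beta,*}v^n=\sum_{k=1}^ng_{n,k}(v^k-v^{k-1})$, this defines the coefficients $g_{n,k}$. Explicitly, with $a_{n,n}=\frac{\sigma^{1-\beta}}{\Gamma(2-\beta)}\tau_{n+1}^{1-\beta}$, $a_{n,k}=\frac1{\Gamma(1-\beta)}\int_{t_k}^{t_{k+1}}(t_{n+1}^*-\eta)^{-\beta}d\eta$ and $b_{n,k}=\frac{1}{\Gamma(1-\beta)}\frac{2}{t_{k+2}-t_k}\int_{t_k}^{t_{k+1}}(t_{n+1}^*-\eta)^{-\beta}(\eta-\frac{t_k+t_{k+1}}2)d\eta$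 for $0\le k\le n-1$, one has $g_{1,1}=\tau_1^{-1}a_{0,0}$, and for $n\ge2$: $g_{n,1}=\tau_1^{-1}(a_{n-1,0}-b_{n-1,0})$, $g_{n,k}=\tau_k^{-1}(a_{n-1,k-1}+b_{n-1,k-2}-b_{n-1,k-1})$ for $2\le k\le n-1$, $g_{n,n}=\tau_n^{-1}(a_{n-1,n-1}+b_{n-1,n-2})$. **Space grid.** $h=L/M$, $\bar\Omega_h=\{(x_i,y_j)=(ih,jh):0\le i,j\le M\}$, $\Omega_h=\bar\Omega_h\cap\Omega$, $\partial\Omega_h=\bar\Omega_h\cap\partial\Omega$; $\Delta_h$ is the standard five-point discrete Laplacian. For grid functions vanishing on $\partial\Omega_h$: $(U,V)=h^2\sum_{i,j=1}^{M-1}U_{i,j}V_{i,j}$, $\|U\|=\sqrt{(U,U)}$, and $\|\nabla_hU\|^2=h^2\sum_{i=1}^{M}\sum_{j=1}^{M-1}\bigl(\frac{U_{i,j}-U_{i-1,j}}h\bigr)^2+h^2\sum_{i=1}^{M-1}\sum_{j=1}^{M}\bigl(\frac{U_{i,j}-U_{i,j-1}}h\bigr)^2$. **Scheme.** For $(x_i,y_j)\in\Omega_h$ and $1\le n\le N$: $\delta_t^{\beta,*}P_{i,j}^n-\nu\Delta_h\bar U_{i,j}^{n,*}+F(U_{i,j}^{n,*})=\nu t_n^*\Delta\phi_{i,j}$, $\ \delta_t^{\beta,*}\bar U_{i,j}^n=P_{i,j}^{n,*}$, $\ U_{i,j}^n=\bar U_{i,j}^n+t_n\phi_{i,j}$,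 with $\bar U^0_{i,j}=\psi_{i,j}$, $P^0_{i,j}=0$ on $\Omega_h$ and $\bar U^n_{i,j}=P^n_{i,j}=0$ on $\partial\Omega_h$ for $0\le n\le N$, where $F(U^{n,*}):=f(U^{n-1})+\sigma f'(U^{n-1})(U^n-U^{n-1})$. *)

theory Defs
  imports "HOL-Analysis.Analysis"
begin

section \<open>Derivatives on closed domains\<close>

text \<open>
  Derivatives are taken within the closed interval \<open>S\<close>, so they are one-sided at its
  end points.  Where a derivative fails to exist the value below is unspecified; existence is
  always required separately.
\<close>

primrec nderiv :: "nat \<Rightarrow> real set \<Rightarrow> (real \<Rightarrow> real) \<Rightarrow> real \<Rightarrow> real" where
  "nderiv 0 S f = f"
| "nderiv (Suc k) S f = (\<lambda>s. vector_derivative (nderiv k S f) (at s within S))"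

definition diff_upto :: "nat \<Rightarrow> real set \<Rightarrow> (real \<Rightarrow> real) \<Rightarrow> bool" where
  "diff_upto k S f \<longleftrightarrow> (\<forall>i<k. \<forall>s\<in>S. nderiv i S f differentiable (at s within S))"

text \<open>\<open>dxy L j1 j2 v x y\<close> is $\partial^{j_1+j_2}v/\partial x^{j_1}\partial y^{j_2}$
  on $[0,L]^2$.\<close>

definition dxy :: "real \<Rightarrow> nat \<Rightarrow> nat \<Rightarrow> (real \<Rightarrow> real \<Rightarrow> real) \<Rightarrow> real \<Rightarrow> real \<Rightarrow> real" where
  "dxy L j1 j2 v x y = nderiv j1 {0..L} (\<lambda>\<xi>. nderiv j2 {0..L} (v \<xi>) y) x"

text \<open>All the derivatives \<open>dxy L j1 j2 v\<close> with \<open>j1 + j2 \<le> m\<close> exist on $[0,L]^2$.\<close>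

definition space_diff :: "real \<Rightarrow> nat \<Rightarrow> (real \<Rightarrow> real \<Rightarrow> real) \<Rightarrow> bool" where
  "space_diff L m v \<longleftrightarrow>
     (\<forall>x\<in>{0..L}. diff_upto m {0..L} (v x)) \<and>
     (\<forall>j\<le>m. \<forall>y\<in>{0..L}. diff_upto (m - j) {0..L} (\<lambda>\<xi>. nderiv j {0..L} (v \<xi>) y))"

definition laplacian :: "real \<Rightarrow> (real \<Rightarrow> real \<Rightarrow> real) \<Rightarrow> real \<Rightarrow> real \<Rightarrow> real" where
  "laplacian L v x y = dxy L 2 0 v x y + dxy L 0 2 v x y"

definition C_space :: "real \<Rightarrow> nat \<Rightarrow> (real \<Rightarrow> real \<Rightarrow> real) \<Rightarrow> bool" where
  "C_space L m v \<longleftrightarrow> space_diff L m v \<and>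
     (\<forall>j1 j2. j1 + j2 \<le> m \<longrightarrow> continuous_on ({0..L} \<times> {0..L}) (\<lambda>(x, y). dxy L j1 j2 v x y))"

text \<open>$C^{m,k}_{\mathbf{x},t}([0,L]^2\times[0,T])$: pure space derivatives up to order \<open>m\<close> and pure
  time derivatives up to order \<open>k\<close>.\<close>

definition C_space_time ::
  "real \<Rightarrow> real \<Rightarrow> nat \<Rightarrow> nat \<Rightarrow> (real \<Rightarrow> real \<Rightarrow> real \<Rightarrow> real) \<Rightarrow> bool" where
  "C_space_time L T m k v \<longleftrightarrow>
     (\<forall>t\<in>{0..T}. space_diff L m (\<lambda>x y. v x y t)) \<and>
     (\<forall>j1 j2. j1 + j2 \<le> m \<longrightarrow>
        continuous_on ({0..L} \<times> {0..L} \<times> {0..T}) (\<lambda>(x, y, t). dxy L j1 j2 (\<lambda>x y. v x y t) x y)) \<and>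
     (\<forall>x\<in>{0..L}. \<forall>y\<in>{0..L}. diff_upto k {0..T} (v x y)) \<and>
     (\<forall>l\<le>k. continuous_on ({0..L} \<times> {0..L} \<times> {0..T}) (\<lambda>(x, y, t). nderiv l {0..T} (v x y) t))"

text \<open>
  The derivatives $\partial_{\mathbf{x}}^j\partial_t^l v$, $j\le 2$, $l\le 3$, exist on
  $[0,L]^2\times(0,T]$ and
  $\sum_{0\le j\le 2}|\partial_{\mathbf{x}}^j\partial_t^l v|\le C(1+t^{\gamma-l})$.
\<close>

definition weakly_singular ::
  "real \<Rightarrow> real \<Rightarrow> real \<Rightarrow> real \<Rightarrow> (real \<Rightarrow> real \<Rightarrow> real \<Rightarrow> real) \<Rightarrow> bool" where
  "weakly_singular L T C \<gamma> v \<longleftrightarrow>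
     (\<forall>x\<in>{0..L}. \<forall>y\<in>{0..L}. \<forall>t\<in>{0<..T}. \<forall>l<3.
        nderiv l {0..T} (v x y) differentiable (at t within {0..T})) \<and>
     (\<forall>t\<in>{0<..T}. \<forall>l\<le>3. space_diff L 2 (\<lambda>x y. nderiv l {0..T} (v x y) t)) \<and>
     (\<forall>x\<in>{0..L}. \<forall>y\<in>{0..L}. \<forall>t\<in>{0<..T}. \<forall>l\<le>3.
        (\<Sum>(j1, j2)\<in>{(j1, j2). j1 + j2 \<le> 2}. \<bar>dxy L j1 j2 (\<lambda>x y. nderiv l {0..T} (v x y) t) x y\<bar>)
          \<le> C * (1 + t powr (\<gamma> - real l)))"


section \<open>The continuous problem\<close>

text \<open>Caputo derivative of order \<open>\<delta>\<close>; only used for $0<\delta<1$ and $1<\delta<2$.  The derivatives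
  of \<open>v\<close> need not exist at the single point $s=0$.\<close>

definition caputo :: "real \<Rightarrow> (real \<Rightarrow> real) \<Rightarrow> real \<Rightarrow> real" where
  "caputo \<delta> v t =
     (if \<delta> < 1
      then 1 / Gamma (1 - \<delta>) * integral {0..t} (\<lambda>s. (t - s) powr (- \<delta>) * nderiv 1 {0..t} v s)
      else 1 / Gamma (2 - \<delta>) * integral {0..t} (\<lambda>s. (t - s) powr (1 - \<delta>) * nderiv 2 {0..t} v s))"

definition sgf :: "real \<Rightarrow> real \<Rightarrow> real" where
  "sgf \<kappa> u = \<kappa>\<^sup>2 * sin u"

definition sine_gordon_solution ::
  "real \<Rightarrow> real \<Rightarrow> real \<Rightarrow> real \<Rightarrow> real \<Rightarrow> (real \<Rightarrow> real \<Rightarrow> real) \<Rightarrow> (real \<Rightarrow> real \<Rightarrow> real) \<Rightarrow>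
   (real \<Rightarrow> real \<Rightarrow> real \<Rightarrow> real) \<Rightarrow> bool" where
  "sine_gordon_solution L T \<alpha> \<nu> \<kappa> \<psi> \<phi> u \<longleftrightarrow>
     (\<forall>x\<in>{0<..<L}. \<forall>y\<in>{0<..<L}. \<forall>t\<in>{0<..T}.
        caputo \<alpha> (u x y) t - \<nu> * laplacian L (\<lambda>x y. u x y t) x y + sgf \<kappa> (u x y t) = 0) \<and>
     (\<forall>x\<in>{0<..<L}. \<forall>y\<in>{0<..<L}. u x y 0 = \<psi> x y) \<and>
     (\<forall>x\<in>{0<..<L}. \<forall>y\<in>{0<..<L}. (u x y has_real_derivative \<phi> x y) (at 0 within {0..T})) \<and>
     (\<forall>x\<in>{0..L}. \<forall>y\<in>{0..L}. \<forall>t\<in>{0..T}. x \<in> {0, L} \<or> y \<in> {0, L} \<longrightarrow> u x y t = 0)"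


section \<open>Temporal meshes\<close>

text \<open>A mesh is a sequence \<open>t 0, t 1, \<dots>\<close>, of which only \<open>t 0, \<dots>, t N\<close> matter; a family of meshes
  is \<open>\<lambda>N. t N\<close>.\<close>

definition mstep :: "(nat \<Rightarrow> real) \<Rightarrow> nat \<Rightarrow> real" where
  "mstep t n = t n - t (n - 1)"

definition max_step :: "nat \<Rightarrow> (nat \<Rightarrow> real) \<Rightarrow> real" where
  "max_step N t = Max (mstep t ` {1..N})"

definition is_mesh :: "real \<Rightarrow> nat \<Rightarrow> (nat \<Rightarrow> real) \<Rightarrow> bool" where
  "is_mesh T N t \<longleftrightarrow> t 0 = 0 \<and> (\<forall>n<N. t n < t (Suc n)) \<and> t N = T"

text \<open>$a\simeq b$, for positive quantities indexed by $1\le n\le N$\<close>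

definition mesh_equiv :: "(nat \<Rightarrow> nat \<Rightarrow> real) \<Rightarrow> (nat \<Rightarrow> nat \<Rightarrow> real) \<Rightarrow> bool" where
  "mesh_equiv a b \<longleftrightarrow>
     (\<exists>c>0. \<exists>C>0. \<forall>N\<ge>1. \<forall>n\<in>{1..N}. c \<le> a N n / b N n \<and> a N n / b N n \<le> C)"

definition quasi_graded :: "real \<Rightarrow> (nat \<Rightarrow> nat \<Rightarrow> real) \<Rightarrow> bool" where
  "quasi_graded r t \<longleftrightarrow>
     mesh_equiv (\<lambda>N n. mstep (t N) 1) (\<lambda>N n. real N powr (- r)) \<and>
     mesh_equiv (\<lambda>N n. t N n) (\<lambda>N n. mstep (t N) 1 * real n powr r) \<and>
     mesh_equiv (\<lambda>N n. mstep (t N) n)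
       (\<lambda>N n. mstep (t N) 1 powr (1 / r) * t N n powr (1 - 1 / r))"

definition tstar :: "real \<Rightarrow> (nat \<Rightarrow> real) \<Rightarrow> nat \<Rightarrow> real" where
  "tstar \<sigma> t n = t n - (1 - \<sigma>) * mstep t n"

definition vstar :: "real \<Rightarrow> (nat \<Rightarrow> real) \<Rightarrow> nat \<Rightarrow> real" where
  "vstar \<sigma> v n = \<sigma> * v n + (1 - \<sigma>) * v (n - 1)"


section \<open>The Alikhanov discretisation\<close>

definition lin_interp :: "(nat \<Rightarrow> real) \<Rightarrow> (nat \<Rightarrow> real) \<Rightarrow> nat \<Rightarrow> real \<Rightarrow> real" where
  "lin_interp t v n s =
     v (n - 1) * ((s - t n) / (t (n - 1) - t n)) + v n * ((s - t (n - 1)) / (t n - t (n - 1)))"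

definition quad_interp :: "(nat \<Rightarrow> real) \<Rightarrow> (nat \<Rightarrow> real) \<Rightarrow> nat \<Rightarrow> real \<Rightarrow> real" where
  "quad_interp t v k s =
     v (k - 1) * ((s - t k) * (s - t (k + 1)) / ((t (k - 1) - t k) * (t (k - 1) - t (k + 1)))) +
     v k * ((s - t (k - 1)) * (s - t (k + 1)) / ((t k - t (k - 1)) * (t k - t (k + 1)))) +
     v (k + 1) * ((s - t (k - 1)) * (s - t k) / ((t (k + 1) - t (k - 1)) * (t (k + 1) - t k)))"

definition alikhanov ::
  "real \<Rightarrow> real \<Rightarrow> (nat \<Rightarrow> real) \<Rightarrow> (nat \<Rightarrow> real) \<Rightarrow> nat \<Rightarrow> real" where
  "alikhanov \<beta> \<sigma> t v n =
     1 / Gamma (1 - \<beta>) *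
       ((\<Sum>k=1..n - 1. integral {t (k - 1)..t k}
            (\<lambda>s. (tstar \<sigma> t n - s) powr (- \<beta>) * deriv (quad_interp t v k) s)) +
        integral {t (n - 1)..tstar \<sigma> t n}
            (\<lambda>s. (tstar \<sigma> t n - s) powr (- \<beta>) * deriv (lin_interp t v n) s))"

definition acoef :: "real \<Rightarrow> real \<Rightarrow> (nat \<Rightarrow> real) \<Rightarrow> nat \<Rightarrow> nat \<Rightarrow> real" where
  "acoef \<beta> \<sigma> t n k =
     (if k = n then \<sigma> powr (1 - \<beta>) / Gamma (2 - \<beta>) * mstep t (n + 1) powr (1 - \<beta>)
      else 1 / Gamma (1 - \<beta>) *
             integral {t k..t (k + 1)} (\<lambda>\<eta>. (tstar \<sigma> t (n + 1) - \<eta>) powr (- \<beta>)))"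

definition bcoef :: "real \<Rightarrow> real \<Rightarrow> (nat \<Rightarrow> real) \<Rightarrow> nat \<Rightarrow> nat \<Rightarrow> real" where
  "bcoef \<beta> \<sigma> t n k =
     1 / Gamma (1 - \<beta>) * (2 / (t (k + 2) - t k)) *
       integral {t k..t (k + 1)}
         (\<lambda>\<eta>. (tstar \<sigma> t (n + 1) - \<eta>) powr (- \<beta>) * (\<eta> - (t k + t (k + 1)) / 2))"

definition gcoef :: "real \<Rightarrow> real \<Rightarrow> (nat \<Rightarrow> real) \<Rightarrow> nat \<Rightarrow> nat \<Rightarrow> real" where
  "gcoef \<beta> \<sigma> t n k =
     (if n = 1 then acoef \<beta> \<sigma> t 0 0
      else if k = 1 then acoef \<beta> \<sigma> t (n - 1) 0 - bcoef \<beta> \<sigma> t (n - 1) 0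
      else if k < n then
        acoef \<beta> \<sigma> t (n - 1) (k - 1) + bcoef \<beta> \<sigma> t (n - 1) (k - 2) - bcoef \<beta> \<sigma> t (n - 1) (k - 1)
      else acoef \<beta> \<sigma> t (n - 1) (n - 1) + bcoef \<beta> \<sigma> t (n - 1) (n - 2)) / mstep t k"

text \<open>\<open>gcoef\<close> really gives the coefficients of \<open>alikhanov\<close>; see \<open>alikhanov_eq_gcoef\<close>.\<close>

lemma deriv_lin_interp:
  assumes "t (n - 1) \<noteq> t n"
  shows "deriv (lin_interp t v n) s = (v n - v (n - 1)) / mstep t n"
proof (rule DERIV_imp_deriv)
  define d where "d = t n - t (n - 1)"
  have d: "d \<noteq> 0" "t (n - 1) - t n = - d" using assms by (auto simp: d_def)
  have "((\<lambda>s. v (n - 1) * ((s - t n) / (- d)) + v n * ((s - t (n - 1)) / d)) has_field_derivative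
      v (n - 1) * (1 / (- d)) + v n * (1 / d)) (at s)"
    by (intro DERIV_add DERIV_cmult DERIV_cdivide) (auto intro!: derivative_eq_intros)
  also have "v (n - 1) * (1 / (- d)) + v n * (1 / d) = (v n - v (n - 1)) / d"
    by (simp add: diff_divide_distrib)
  finally show "(lin_interp t v n has_field_derivative (v n - v (n - 1)) / mstep t n) (at s)"
    unfolding lin_interp_def mstep_def d_def[symmetric] d(2) .
qed

lemma deriv_quad_interp:
  assumes "t (k - 1) < t k" "t k < t (k + 1)"
  shows "deriv (quad_interp t v k) s = (v k - v (k - 1)) / mstep t k
    + 2 / (t (k + 1) - t (k - 1)) * (s - (t (k - 1) + t k) / 2)
      * ((v (k + 1) - v k) / mstep t (k + 1) - (v k - v (k - 1)) / mstep t k)"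
proof (rule DERIV_imp_deriv)
  define a b c where "a = t (k - 1)" and "b = t k" and "c = t (k + 1)"
  have ne: "a - b \<noteq> 0" "b - a \<noteq> 0" "b - c \<noteq> 0" "c - b \<noteq> 0" "a - c \<noteq> 0" "c - a \<noteq> 0"
    using assms by (auto simp: a_def b_def c_def)
  define p q w where "p = v (k - 1)" and "q = v k" and "w = v (k + 1)"
  have "((\<lambda>s. p * ((s - b) * (s - c) / ((a - b) * (a - c))) +
     q * ((s - a) * (s - c) / ((b - a) * (b - c))) +
     w * ((s - a) * (s - b) / ((c - a) * (c - b)))) has_field_derivative
     (p * ((2 * s - b - c) / ((a - b) * (a - c))) +
     q * ((2 * s - a - c) / ((b - a) * (b - c))) +
     w * ((2 * s - a - b) / ((c - a) * (c - b))))) (at s)"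
    by (intro DERIV_add DERIV_cmult DERIV_cdivide) (auto intro!: derivative_eq_intros)
  also have "p * ((2 * s - b - c) / ((a - b) * (a - c))) +
     q * ((2 * s - a - c) / ((b - a) * (b - c))) +
     w * ((2 * s - a - b) / ((c - a) * (c - b))) =
     (q - p) / (b - a) + 2 / (c - a) * (s - (a + b) / 2) * ((w - q) / (c - b) - (q - p) / (b - a))"
  proof -
    define x y where "x = b - a" and "y = c - b"
    have xy: "b = a + x" "c = a + x + y" "x > 0" "y > 0"
      using assms by (auto simp: x_def y_def a_def b_def c_def)
    then have nz: "x \<noteq> 0" "y \<noteq> 0" "x + y \<noteq> 0" by auto
    have e: "a - b = - x" "a - c = - (x + y)" "b - a = x" "b - c = - y" "c - a = x + y" "c - b = y"
      by (simp_all add: xy)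
    show ?thesis
      unfolding e using nz by (simp add: divide_simps xy(1,2)) algebra
  qed
  finally show "(quad_interp t v k has_field_derivative (v k - v (k - 1)) / mstep t k
    + 2 / (t (k + 1) - t (k - 1)) * (s - (t (k - 1) + t k) / 2)
      * ((v (k + 1) - v k) / mstep t (k + 1) - (v k - v (k - 1)) / mstep t k)) (at s)"
    unfolding quad_interp_def mstep_def a_def b_def c_def p_def q_def w_def by simp
qed

lemma integral_powr_end:
  fixes a c \<beta> :: real
  assumes "a \<le> c" "\<beta> < 1"
  shows "((\<lambda>s. (c - s) powr (- \<beta>)) has_integral (c - a) powr (1 - \<beta>) / (1 - \<beta>)) {a..c}"
proof -
  have "((\<lambda>x. x powr (- \<beta>)) has_integral (c - a) powr (- \<beta> + 1) / (- \<beta> + 1)) {0..c - a}"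
    using assms by (intro has_integral_powr_from_0) auto
  from has_integral_affinity[OF this[unfolded cbox_interval[symmetric]], of "-1" c]
  show ?thesis using assms by (simp add: algebra_simps)
qed

lemma alikhanov_eq_gcoef:
  assumes "0 < \<beta>" "\<beta> < 1" "0 < \<sigma>" "is_mesh T N t" "n \<in> {1..N}"
  shows "alikhanov \<beta> \<sigma> t v n = (\<Sum>k=1..n. gcoef \<beta> \<sigma> t n k * (v k - v (k - 1)))"
proof -
  define c where "c = tstar \<sigma> t n"
  define D where "D k = (v k - v (k - 1)) / mstep t k" for k
  have inc: "t (k - 1) < t k" if "k \<in> {1..N}" for k
    using assms(4) that unfolding is_mesh_def by (cases k) auto
  have inc': "i \<le> j \<Longrightarrow> j \<le> N \<Longrightarrow> t i \<le> t j" for i j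
  proof (induction j)
    case (Suc j)
    then show ?case using inc[of "Suc j"] by (cases "i = Suc j") auto
  qed auto
  have c: "c = t (n - 1) + \<sigma> * mstep t n"
    by (simp add: c_def tstar_def mstep_def algebra_simps)
  have taun: "mstep t n > 0" using inc[of n] assms by (simp add: mstep_def)
  have c1: "t (n - 1) < c" using taun assms by (simp add: c)
  have G: "Gamma (2 - \<beta>) = (1 - \<beta>) * Gamma (1 - \<beta>)"
    using Gamma_plus1[of "1 - \<beta>"] assms
    by (metis (no_types, lifting) add.commute diff_add_eq diff_gt_0_iff_gt less_irrefl
        nonpos_Ints_nonpos not_less one_add_one)
  have last: "1 / Gamma (1 - \<beta>) * integral {t (n - 1)..c} (\<lambda>s. (c - s) powr (- \<beta>) * deriv (lin_interp t v n) s)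
    = acoef \<beta> \<sigma> t (n - 1) (n - 1) * D n"
  proof -
    have "integral {t (n - 1)..c} (\<lambda>s. (c - s) powr (- \<beta>)) = (c - t (n - 1)) powr (1 - \<beta>) / (1 - \<beta>)"
      using integral_powr_end c1 assms by (intro integral_unique) auto
    also have "\<dots> = \<sigma> powr (1 - \<beta>) * mstep t n powr (1 - \<beta>) / (1 - \<beta>)"
      using taun assms by (simp add: c powr_mult)
    finally show ?thesis
      using assms inc[of n] by (simp add: deriv_lin_interp D_def acoef_def G)
  qed
  have mid: "1 / Gamma (1 - \<beta>) * integral {t (k - 1)..t k} (\<lambda>s. (c - s) powr (- \<beta>) * deriv (quad_interp t v k) s)
    = acoef \<beta> \<sigma> t (n - 1) (k - 1) * D k + bcoef \<beta> \<sigma> t (n - 1) (k - 1) * (D (k + 1) - D k)"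
    if k: "k \<in> {1..n - 1}" for k
  proof -
    have kn: "t k \<le> t (n - 1)" using k assms by (intro inc') auto
    have ct: "continuous_on {t (k - 1)..t k} (\<lambda>s. (c - s) powr (- \<beta>))"
      using c1 kn by (intro continuous_intros) auto
    have i1: "(\<lambda>s. (c - s) powr (- \<beta>)) integrable_on {t (k - 1)..t k}"
      using ct by (rule integrable_continuous_interval)
    have i2: "(\<lambda>s. (c - s) powr (- \<beta>) * (s - (t (k - 1) + t k) / 2)) integrable_on {t (k - 1)..t k}"
      by (intro integrable_continuous_interval continuous_on_mult ct continuous_intros) auto
    define E where "E = 2 / (t (k + 1) - t (k - 1)) * (D (k + 1) - D k)"
    have "t (k - 1) < t k" "t k < t (k + 1)"
      using inc[of k] inc[of "k + 1"] k assms by auto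
    then have "deriv (quad_interp t v k) s = D k + E * (s - (t (k - 1) + t k) / 2)" for s
      by (subst deriv_quad_interp) (simp_all only: D_def E_def mult_ac diff_add_inverse2)
    then have "integral {t (k - 1)..t k} (\<lambda>s. (c - s) powr (- \<beta>) * deriv (quad_interp t v k) s)
      = integral {t (k - 1)..t k} (\<lambda>s. (c - s) powr (- \<beta>) * D k
          + (c - s) powr (- \<beta>) * (s - (t (k - 1) + t k) / 2) * E)"
      by (simp only: distrib_left mult.assoc mult.commute[of _ E] mult.left_commute[of _ E])
    also have "\<dots> = integral {t (k - 1)..t k} (\<lambda>s. (c - s) powr (- \<beta>)) * D k
      + integral {t (k - 1)..t k} (\<lambda>s. (c - s) powr (- \<beta>) * (s - (t (k - 1) + t k) / 2)) * E"
      by (subst integral_add) (use i1 i2 in \<open>auto intro: integrable_on_mult_left\<close>)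
    finally have eq: "integral {t (k - 1)..t k} (\<lambda>s. (c - s) powr (- \<beta>) * deriv (quad_interp t v k) s)
      = integral {t (k - 1)..t k} (\<lambda>s. (c - s) powr (- \<beta>)) * D k
      + integral {t (k - 1)..t k} (\<lambda>s. (c - s) powr (- \<beta>) * (s - (t (k - 1) + t k) / 2)) * E" .
    have idx: "k - 1 \<noteq> n - 1" "k - 1 + 1 = k" "k - 1 + 2 = k + 1" "n - 1 + 1 = n"
      using k by auto
    show ?thesis
      unfolding eq acoef_def bcoef_def idx c_def[symmetric] E_def distrib_left
      using idx(1) by (simp only: if_False mult_ac)
  qed
  let ?A = "\<lambda>k. acoef \<beta> \<sigma> t (n - 1) (k - 1)" and ?B = "\<lambda>k. bcoef \<beta> \<sigma> t (n - 1) (k - 1)"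
  have "alikhanov \<beta> \<sigma> t v n = (\<Sum>k=1..n - 1. ?A k * D k + ?B k * (D (k + 1) - D k)) + ?A n * D n"
    unfolding alikhanov_def c_def[symmetric] distrib_left sum_distrib_left last
    using mid by (intro arg_cong2[where f = "(+)"] sum.cong) auto
  also have "\<dots> = (\<Sum>k=1..n. ?A k * D k) - (\<Sum>k=1..n - 1. ?B k * D k) + (\<Sum>k=1..n - 1. ?B k * D (k + 1))"
  proof -
    have "(\<Sum>k=1..n. ?A k * D k) = (\<Sum>k=1..n - 1. ?A k * D k) + ?A n * D n"
      using assms(5) by (cases n) auto
    then show ?thesis by (simp add: sum.distrib sum_subtractf algebra_simps)
  qed
  also have "(\<Sum>k=1..n - 1. ?B k * D k) = (\<Sum>k=1..n. (if k < n then ?B k else 0) * D k)"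
    by (rule sum.mono_neutral_cong_left) auto
  also have "(\<Sum>k=1..n - 1. ?B k * D (k + 1)) = (\<Sum>k=2..n. ?B (k - 1) * D k)"
    using assms(5) by (intro sum.reindex_bij_witness[of _ "\<lambda>k. k - 1" "\<lambda>k. k + 1"]) auto
  also have "\<dots> = (\<Sum>k=1..n. (if 2 \<le> k then ?B (k - 1) else 0) * D k)"
    by (rule sum.mono_neutral_cong_left) auto
  finally have "alikhanov \<beta> \<sigma> t v n = (\<Sum>k=1..n. (?A k - (if k < n then ?B k else 0)
      + (if 2 \<le> k then ?B (k - 1) else 0)) * D k)"
    by (simp add: sum.distrib sum_subtractf algebra_simps)
  also have "\<dots> = (\<Sum>k=1..n. gcoef \<beta> \<sigma> t n k * (v k - v (k - 1)))"
    using assms(5) by (intro sum.cong) (auto simp: gcoef_def D_def numeral_2_eq_2)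
  finally show ?thesis .
qed

definition P1 :: "real \<Rightarrow> real \<Rightarrow> nat \<Rightarrow> (nat \<Rightarrow> real) \<Rightarrow> bool" where
  "P1 \<beta> \<sigma> N t \<longleftrightarrow>
     (\<forall>n\<in>{2..N}. \<forall>k\<in>{1..n - 1}.
        gcoef \<beta> \<sigma> t n (k + 1) > gcoef \<beta> \<sigma> t n k \<and> gcoef \<beta> \<sigma> t n k > 0)"

definition P2 :: "real \<Rightarrow> real \<Rightarrow> nat \<Rightarrow> (nat \<Rightarrow> real) \<Rightarrow> bool" where
  "P2 \<beta> \<sigma> N t \<longleftrightarrow>
     (\<forall>n\<in>{2..N}. (2 * \<sigma> - 1) * gcoef \<beta> \<sigma> t n n > \<sigma> * gcoef \<beta> \<sigma> t n (n - 1))"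


section \<open>Space grid and scheme\<close>

text \<open>Grid functions are indexed by \<open>i, j \<in> {0..M}\<close>.\<close>

definition laplacian_h :: "real \<Rightarrow> (nat \<Rightarrow> nat \<Rightarrow> real) \<Rightarrow> nat \<Rightarrow> nat \<Rightarrow> real" where
  "laplacian_h h U i j =
     (U (i + 1) j - 2 * U i j + U (i - 1) j) / h\<^sup>2 + (U i (j + 1) - 2 * U i j + U i (j - 1)) / h\<^sup>2"

definition grid_inner ::
  "real \<Rightarrow> nat \<Rightarrow> (nat \<Rightarrow> nat \<Rightarrow> real) \<Rightarrow> (nat \<Rightarrow> nat \<Rightarrow> real) \<Rightarrow> real" where
  "grid_inner h M U V = h\<^sup>2 * (\<Sum>i=1..M - 1. \<Sum>j=1..M - 1. U i j * V i j)"

definition grid_norm :: "real \<Rightarrow> nat \<Rightarrow> (nat \<Rightarrow> nat \<Rightarrow> real) \<Rightarrow> real" where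
  "grid_norm h M U = sqrt (grid_inner h M U U)"

definition grid_grad_norm :: "real \<Rightarrow> nat \<Rightarrow> (nat \<Rightarrow> nat \<Rightarrow> real) \<Rightarrow> real" where
  "grid_grad_norm h M U =
     sqrt (h\<^sup>2 * (\<Sum>i=1..M. \<Sum>j=1..M - 1. ((U i j - U (i - 1) j) / h)\<^sup>2) +
           h\<^sup>2 * (\<Sum>i=1..M - 1. \<Sum>j=1..M. ((U i j - U i (j - 1)) / h)\<^sup>2))"

text \<open>$F(U^{n,*})$, a function of $U^{n-1}$ and $U^n$\<close>

definition F_lin :: "real \<Rightarrow> real \<Rightarrow> (nat \<Rightarrow> real) \<Rightarrow> nat \<Rightarrow> real" where
  "F_lin \<kappa> \<sigma> U n = sgf \<kappa> (U (n - 1)) + \<sigma> * deriv (sgf \<kappa>) (U (n - 1)) * (U n - U (n - 1))"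

text \<open>\<open>P n i j\<close> and \<open>Ub n i j\<close> stand for $P^n_{i,j}$ and $\bar U^n_{i,j}$.\<close>

definition scheme_solution ::
  "real \<Rightarrow> real \<Rightarrow> real \<Rightarrow> real \<Rightarrow> real \<Rightarrow> (real \<Rightarrow> real \<Rightarrow> real) \<Rightarrow> (real \<Rightarrow> real \<Rightarrow> real) \<Rightarrow>
   nat \<Rightarrow> (nat \<Rightarrow> real) \<Rightarrow> nat \<Rightarrow>
   (nat \<Rightarrow> nat \<Rightarrow> nat \<Rightarrow> real) \<Rightarrow> (nat \<Rightarrow> nat \<Rightarrow> nat \<Rightarrow> real) \<Rightarrow> bool" where
  "scheme_solution L \<beta> \<sigma> \<nu> \<kappa> \<psi> \<phi> N t M P Ub \<longleftrightarrow>
     (let h = L / real M;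
          x = (\<lambda>i. real i * h);
          U = (\<lambda>n i j. Ub n i j + t n * \<phi> (x i) (x j))
      in
       (\<forall>n\<in>{1..N}. \<forall>i\<in>{1..M - 1}. \<forall>j\<in>{1..M - 1}.
          alikhanov \<beta> \<sigma> t (\<lambda>m. P m i j) n
            - \<nu> * laplacian_h h (\<lambda>i j. vstar \<sigma> (\<lambda>m. Ub m i j) n) i j
            + F_lin \<kappa> \<sigma> (\<lambda>m. U m i j) n
          = \<nu> * tstar \<sigma> t n * laplacian L \<phi> (x i) (x j) \<and>
          alikhanov \<beta> \<sigma> t (\<lambda>m. Ub m i j) n = vstar \<sigma> (\<lambda>m. P m i j) n) \<and>
       (\<forall>i\<in>{1..M - 1}. \<forall>j\<in>{1..M - 1}. Ub 0 i j = \<psi> (x i) (x j) \<and> P 0 i j = 0) \<and>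
       (\<forall>n\<le>N. \<forall>i\<le>M. \<forall>j\<le>M. i \<in> {0, M} \<or> j \<in> {0, M} \<longrightarrow> Ub n i j = 0 \<and> P n i j = 0))"

end

theory Submission
  imports Defs
begin

text \<open>
  Let \<open>e\<^sup>n\<close> be the pair of the error of \<open>p\<close> and the discrete gradient of the error of \<open>u\<close>, the latter scaled by the root of \<open>\<nu>\<close>, and
  let \<open>W n\<close> be its norm.  The errors solve the scheme with the residuals of the exact solution as sources.  The scheme is a skew first
  order system: tested with the weighted mean of \<open>e\<^sup>n\<close> and \<open>e\<^sup>n\<^sup>-\<^sup>1\<close>, the Laplacian in one equation cancels against the
  gradient of the other (\<open>energy_identity\<close>).  What remains are the residuals and the difference of the linearised nonlinearities, which the
  discrete Poincare inequality bounds by a multiple of \<open>W n + W (n - 1)\<close>.  By (P1) and (P2) the fractional difference of the norm is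
  controlled by the tested fractional difference (\<open>energy_inequality\<close>), and division by the weighted mean of the norms leaves the scalar
  inequality
  \<open>\<delta> W\<^sup>n \<le> \<lambda> (W n + W (n - 1)) + A (n\<^sup>-\<^sup>q + t\<^sub>n\<^sup>\<beta> n\<^sup>-\<^sup>2 + h\<^sup>2)\<close> with \<open>q = min {r (\<beta> + 1), 3 - \<beta>}\<close>.

  The first source is the truncation error of the fractional difference (\<open>truncation_weak\<close>), the second the error of replacing values at
  \<open>t\<^sub>n\<^sup>*\<close> by weighted means (\<open>interpolation_error\<close>), the third that of the five-point stencil.  The residual of the
  equation for \<open>p\<close> involves the derivative of order \<open>\<beta>\<close> of \<open>p\<close>, whereas the problem is posed with the derivative of order
  \<open>2 \<beta>\<close> of \<open>u\<close>; both agree because \<open>u - t \<phi>\<close> has vanishing initial velocity (\<open>caputo_twice\<close>).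

  The scalar inequality is solved by majorants: by (P1) the fractional difference obeys a comparison principle (\<open>comparison\<close>).  The function
  \<open>s\<^sup>\<beta>\<^sup>-\<^sup>1\<close> has vanishing Riemann-Liouville derivative of order \<open>\<beta>\<close>; if it is frozen before a node \<open>t\<^sub>K\<close>, its derivative is that of a
  response to a source located before \<open>t\<^sub>K\<close>.  Superposition of these cut-off powers with weights \<open>k\<^sup>-\<^sup>1\<^sup>-\<^sup>s\<close> yields a majorant for the source
  \<open>t\<^sub>n\<^sup>-\<^sup>1 n\<^sup>-\<^sup>s\<close> (\<open>superposed_barrier\<close>), whose size is \<open>t\<^sub>n\<^sup>\<beta>\<^sup>-\<^sup>1\<close> times the sum of the weights.  On a graded mesh each of
  the three sources is of that form, and the different regimes of \<open>r\<close> are those of a convergent, a logarithmically divergent and a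
  divergent sum.  The term with \<open>\<lambda>\<close> is absorbed by an exponential barrier (\<open>exp_barrier\<close>), which requires small steps.
\<close>

section \<open>Quasi-graded temporal meshes\<close>

lemma powr_diff_le:
  fixes x y r :: real
  assumes "0 \<le> x" "x \<le> y" "1 \<le> r"
  shows "y powr r - x powr r \<le> r * (y - x) * y powr (r - 1)"
    and "(y - x) * y powr (r - 1) \<le> y powr r - x powr r"
proof -
  show "(y - x) * y powr (r - 1) \<le> y powr r - x powr r"
  proof (cases "x = 0")
    case True
    then show ?thesis using assms by (cases "y = 0") (auto simp: powr_mult_base)
  next
    case False
    then have p: "0 < x" "0 < y" using assms by auto
    have "x * x powr (r - 1) \<le> x * y powr (r - 1)"
      using p assms by (intro mult_left_mono powr_mono2) auto
    then show ?thesis using p by (simp add: powr_mult_base algebra_simps)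
  qed
  show "y powr r - x powr r \<le> r * (y - x) * y powr (r - 1)"
  proof (cases "x = 0 \<or> x = y")
    case True
    then show ?thesis using assms by (cases "y = 0") (auto simp: powr_mult_base mult.assoc)
  next
    case False
    then have p: "0 < x" "x < y" using assms by auto
    have d: "((\<lambda>z. z powr r) has_real_derivative r * z powr (r - 1)) (at z)" if "x \<le> z" for z
      using p that by (auto intro!: derivative_eq_intros)
    obtain z where z: "x < z" "z < y" "y powr r - x powr r = (y - x) * (r * z powr (r - 1))"
      using MVT2[OF p(2), of "\<lambda>z. z powr r" "\<lambda>z. r * z powr (r - 1)"] d by blast
    have "z powr (r - 1) \<le> y powr (r - 1)" using z p assms by (intro powr_mono2) auto
    then have "(y - x) * r * z powr (r - 1) \<le> (y - x) * r * y powr (r - 1)"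
      using p assms by (intro mult_left_mono) auto
    then show ?thesis using z(3) by (simp add: mult_ac)
  qed
qed

text \<open>The two-sided bounds of a quasi-graded family with one constant for all meshes; the condition on the steps appears in the
  equivalent form \<open>\<tau>\<^sub>n \<simeq> t\<^sub>n / n\<close>.\<close>

locale quasi_graded_meshes =
  fixes \<beta> \<sigma> r T Q :: real and t :: "nat \<Rightarrow> nat \<Rightarrow> real"
  assumes \<beta>_gt: "1 / 2 < \<beta>" and \<beta>_lt: "\<beta> < 1" and \<sigma>_eq: "\<sigma> = 1 - \<beta> / 2"
    and r_ge: "1 \<le> r" and T_pos: "0 < T" and Q_ge: "1 \<le> Q"
    and mesh: "\<And>N. 1 \<le> N \<Longrightarrow> is_mesh T N (t N)"
    and t_upper: "\<And>N n. 1 \<le> n \<Longrightarrow> n \<le> N \<Longrightarrow> t N n \<le> Q * (t N 1 * real n powr r)"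
    and t_lower: "\<And>N n. 1 \<le> n \<Longrightarrow> n \<le> N \<Longrightarrow> t N 1 * real n powr r \<le> Q * t N n"
    and step_upper: "\<And>N n. 1 \<le> n \<Longrightarrow> n \<le> N \<Longrightarrow> mstep (t N) n \<le> Q * (t N n / real n)"
    and step_lower: "\<And>N n. 1 \<le> n \<Longrightarrow> n \<le> N \<Longrightarrow> t N n / real n \<le> Q * mstep (t N) n"
    and P1: "\<And>N. 1 \<le> N \<Longrightarrow> P1 \<beta> \<sigma> N (t N)"
begin

lemma \<sigma>_bounds: "1 / 2 < \<sigma>" "\<sigma> < 1" "0 < \<sigma>"
  using \<beta>_gt \<beta>_lt by (auto simp: \<sigma>_eq)

lemma t_0: "1 \<le> N \<Longrightarrow> t N 0 = 0" and t_N: "1 \<le> N \<Longrightarrow> t N N = T"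
  and t_step: "n < N \<Longrightarrow> t N n < t N (Suc n)"
  using mesh[of N] by (auto simp: is_mesh_def)

lemma t_less: "i < j \<Longrightarrow> j \<le> N \<Longrightarrow> t N i < t N j"
proof (induction j)
  case (Suc j)
  then show ?case using t_step[of j N] by (cases "i = j") auto
qed auto

lemma t_le: "i \<le> j \<Longrightarrow> j \<le> N \<Longrightarrow> t N i \<le> t N j"
  using t_less[of i j N] by (cases "i = j") auto

lemma t_pos: "1 \<le> n \<Longrightarrow> n \<le> N \<Longrightarrow> 0 < t N n"
  using t_less[of 0 n N] t_0[of N] by auto

lemma t_nonneg: "n \<le> N \<Longrightarrow> 1 \<le> N \<Longrightarrow> 0 \<le> t N n"
  using t_pos[of n N] t_0[of N] by (cases n) (auto intro: less_imp_le)

lemma t_le_T: "1 \<le> N \<Longrightarrow> n \<le> N \<Longrightarrow> t N n \<le> T"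
  using t_le[of n N N] t_N[of N] by auto

lemma mstep_pos: "1 \<le> n \<Longrightarrow> n \<le> N \<Longrightarrow> 0 < mstep (t N) n"
  using t_less[of "n - 1" n N] by (auto simp: mstep_def)

lemma mstep_1: "1 \<le> N \<Longrightarrow> mstep (t N) 1 = t N 1"
  by (simp add: mstep_def t_0)

lemma t_ratio:
  assumes "1 \<le> k" "k \<le> N" "1 \<le> n" "n \<le> N"
  shows "t N k \<le> Q\<^sup>2 * t N n * (real k / real n) powr r"
proof -
  have e: "real n powr r * (real k / real n) powr r = real k powr r"
    using assms by (simp add: powr_divide)
  have "t N k \<le> Q * (t N 1 * real k powr r)" using t_upper assms by auto
  also have "\<dots> = Q * ((t N 1 * real n powr r) * (real k / real n) powr r)"
    by (simp add: e[symmetric] mult_ac)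
  also have "\<dots> \<le> Q * ((Q * t N n) * (real k / real n) powr r)"
    using t_lower[of n N] assms Q_ge by (intro mult_left_mono mult_right_mono) auto
  finally show ?thesis by (simp add: power2_eq_square mult_ac)
qed

text \<open>Bounds the ratio of neighbouring nodes and of neighbouring steps.\<close>

definition "E = Q ^ 4 * 2 powr r"

lemma Q_pow: "1 \<le> Q ^ k" using Q_ge by (rule one_le_power)

lemma E_ge: "2 * Q\<^sup>2 \<le> E" "1 \<le> E" "Q \<le> E"
proof -
  have a: "2 powr 1 \<le> 2 powr r" using r_ge by (intro powr_mono) auto
  have b: "Q\<^sup>2 \<le> Q ^ 4" using Q_ge by (intro power_increasing) auto
  have "Q\<^sup>2 * 2 \<le> Q ^ 4 * 2 powr r" using a b Q_ge by (intro mult_mono) auto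
  then show c: "2 * Q\<^sup>2 \<le> E" by (simp add: E_def)
  then show "1 \<le> E" using Q_pow[of 2] by linarith
  have "Q * 1 \<le> Q * Q" using Q_ge by (intro mult_left_mono) auto
  then show "Q \<le> E" using c Q_ge unfolding power2_eq_square by linarith
qed

lemma t_Suc_le: assumes "1 \<le> k" "Suc k \<le> N" shows "t N (Suc k) \<le> E * t N k"
proof -
  have "t N (Suc k) \<le> Q\<^sup>2 * t N k * (real (Suc k) / real k) powr r"
    using assms by (intro t_ratio) auto
  also have "\<dots> \<le> Q\<^sup>2 * t N k * 2 powr r"
    using assms t_pos[of k N] r_ge Q_ge
    by (intro mult_left_mono powr_mono2) (auto simp: field_simps)
  also have "\<dots> = (Q\<^sup>2 * 2 powr r) * t N k" by simp
  also have "\<dots> \<le> E * t N k"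
    unfolding E_def using Q_ge t_pos[of k N] assms
    by (intro mult_right_mono power_increasing) auto
  finally show ?thesis .
qed

lemma mstep_Suc_le:
  assumes "1 \<le> k" "Suc k \<le> N"
  shows "mstep (t N) (Suc k) \<le> E * mstep (t N) k" "mstep (t N) k \<le> E * mstep (t N) (Suc k)"
proof -
  have tp: "0 < t N k" "0 < t N (Suc k)" using assms t_pos by auto
  have "mstep (t N) (Suc k) \<le> Q * (t N (Suc k) / real (Suc k))" using assms by (intro step_upper) auto
  also have "\<dots> \<le> Q * ((Q\<^sup>2 * 2 powr r * t N k) / real k)"
  proof (intro mult_left_mono frac_le)
    have "t N (Suc k) \<le> Q\<^sup>2 * t N k * (real (Suc k) / real k) powr r"
      using assms by (intro t_ratio) auto
    also have "\<dots> \<le> Q\<^sup>2 * t N k * 2 powr r"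
      using assms t_pos[of k N] r_ge Q_ge
      by (intro mult_left_mono powr_mono2) (auto simp: field_simps)
    finally show "t N (Suc k) \<le> Q\<^sup>2 * 2 powr r * t N k" by (simp add: mult_ac)
  qed (use assms Q_ge tp in auto)
  also have "\<dots> = Q ^ 3 * 2 powr r * (t N k / real k)" by (simp add: power3_eq_cube power2_eq_square)
  also have "\<dots> \<le> Q ^ 3 * 2 powr r * (Q * mstep (t N) k)"
    using assms Q_ge by (intro mult_left_mono step_lower) auto
  also have "\<dots> = E * mstep (t N) k" by (simp add: E_def power_def numeral_eq_Suc)
  finally show "mstep (t N) (Suc k) \<le> E * mstep (t N) k" .
  have "mstep (t N) k \<le> Q * (t N k / real k)" using assms by (intro step_upper) auto
  also have "\<dots> \<le> Q * (2 * (t N (Suc k) / real (Suc k)))"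
  proof (intro mult_left_mono)
    have "t N k / real k \<le> t N (Suc k) / real k" using assms tp t_le by (intro divide_right_mono) auto
    also have "\<dots> \<le> 2 * (t N (Suc k) / real (Suc k))" using assms tp by (simp add: field_simps)
    finally show "t N k / real k \<le> 2 * (t N (Suc k) / real (Suc k))" .
  qed (use Q_ge in auto)
  also have "\<dots> \<le> Q * (2 * (Q * mstep (t N) (Suc k)))"
    using assms Q_ge by (intro mult_left_mono step_lower) auto
  also have "\<dots> = 2 * Q\<^sup>2 * mstep (t N) (Suc k)" by (simp add: power2_eq_square)
  also have "\<dots> \<le> E * mstep (t N) (Suc k)"
    using E_ge mstep_pos[of "Suc k" N] assms by (intro mult_right_mono) auto
  finally show "mstep (t N) k \<le> E * mstep (t N) (Suc k)" .
qed

lemma tstar_bounds: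
  assumes "1 \<le> n" "n \<le> N"
  shows "t N (n - 1) < tstar \<sigma> (t N) n" "tstar \<sigma> (t N) n < t N n"
    and "tstar \<sigma> (t N) n - t N (n - 1) = \<sigma> * mstep (t N) n"
    and "tstar \<sigma> (t N) n = \<sigma> * t N n + (1 - \<sigma>) * t N (n - 1)" "0 < tstar \<sigma> (t N) n"
    and "tstar \<sigma> (t N) n \<le> T"
proof -
  have m: "0 < mstep (t N) n" using mstep_pos assms by auto
  show e: "tstar \<sigma> (t N) n - t N (n - 1) = \<sigma> * mstep (t N) n"
    by (simp add: tstar_def mstep_def algebra_simps)
  show "tstar \<sigma> (t N) n = \<sigma> * t N n + (1 - \<sigma>) * t N (n - 1)"
    by (simp add: tstar_def mstep_def algebra_simps)
  have "0 < \<sigma> * mstep (t N) n" using m \<sigma>_bounds by auto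
  then show l: "t N (n - 1) < tstar \<sigma> (t N) n" using e by linarith
  have "0 < (1 - \<sigma>) * mstep (t N) n" using m \<sigma>_bounds by auto
  then show u: "tstar \<sigma> (t N) n < t N n" by (simp add: tstar_def)
  show "0 < tstar \<sigma> (t N) n" using l t_nonneg[of "n - 1" N] assms by linarith
  show "tstar \<sigma> (t N) n \<le> T" using u t_le_T[of N n] assms by auto
qed

definition "G = 2 * r * Q ^ 3"

lemma G_ge: "1 \<le> G"
proof -
  have "1 * 1 \<le> r * Q ^ 3" using r_ge Q_pow[of 3] by (intro mult_mono) auto
  then show ?thesis by (simp add: G_def)
qed

lemma t_diff_lower:
  assumes "k \<le> n" "n \<le> N" "1 \<le> N"
  shows "t N 1 * (real n powr r - real k powr r) \<le> r * Q\<^sup>2 * (t N n - t N k)"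
  using assms(1,2)
proof (induction n rule: dec_induct)
  case base
  then show ?case by simp
next
  case (step n)
  have t1: "0 < t N 1" using assms t_pos by auto
  have "real (Suc n) powr r - real n powr r \<le> r * real (Suc n) powr (r - 1)"
    using powr_diff_le(1)[of "real n" "real (Suc n)" r] r_ge by simp
  then have "t N 1 * (real (Suc n) powr r - real n powr r) \<le> t N 1 * (r * real (Suc n) powr (r - 1))"
    using t1 by (intro mult_left_mono) auto
  also have "\<dots> = r * ((t N 1 * real (Suc n) powr r) / real (Suc n))"
    by (simp add: powr_diff)
  also have "\<dots> \<le> r * ((Q * t N (Suc n)) / real (Suc n))"
    using step.prems r_ge by (intro mult_left_mono divide_right_mono t_lower) auto
  also have "\<dots> = r * Q * (t N (Suc n) / real (Suc n))" by simp
  also have "\<dots> \<le> r * Q * (Q * mstep (t N) (Suc n))"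
    using step.prems r_ge Q_ge by (intro mult_left_mono step_lower) auto
  also have "\<dots> = r * Q\<^sup>2 * (t N (Suc n) - t N n)" by (simp add: mstep_def power2_eq_square)
  finally show ?case using step by (simp add: algebra_simps)
qed

text \<open>The distance to the evaluation point is at least that on a uniform mesh, up to a constant:
  grading to the power \<open>r \<ge> 1\<close> only spreads the later nodes.\<close>

lemma tstar_gap:
  assumes "k < n" "n \<le> N"
  shows "t N n * (real (n - k) / real n) \<le> G * (tstar \<sigma> (t N) n - t N k)"
proof -
  have N: "1 \<le> N" using assms by auto
  have t1: "0 < t N 1" using N t_pos by auto
  have "t N n * (real (n - k) / real n) \<le> Q * (t N 1 * real n powr r) * (real (n - k) / real n)"
    using t_upper[of n N] assms by (intro mult_right_mono) auto
  also have "\<dots> = Q * t N 1 * ((real n - real k) * real n powr (r - 1))"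
    using assms by (simp add: powr_diff of_nat_diff)
  also have "\<dots> \<le> Q * t N 1 * (real n powr r - real k powr r)"
    using powr_diff_le(2)[of "real k" "real n" r] assms t1 Q_ge r_ge
    by (intro mult_left_mono) auto
  also have "\<dots> \<le> Q * (r * Q\<^sup>2 * (t N n - t N k))"
    using mult_left_mono[OF t_diff_lower[of k n N], of Q] assms Q_ge N by (simp add: mult_ac)
  also have "\<dots> \<le> Q * (r * Q\<^sup>2 * (2 * (tstar \<sigma> (t N) n - t N k)))"
  proof (intro mult_left_mono)
    have "t N k \<le> t N (n - 1)" using assms by (intro t_le) auto
    then have a: "0 \<le> (1 - \<sigma>) * (t N (n - 1) - t N k)" using \<sigma>_bounds by simp
    have "tstar \<sigma> (t N) n - t N k = \<sigma> * (t N n - t N k) + (1 - \<sigma>) * (t N (n - 1) - t N k)"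
      using tstar_bounds(4)[of n N] assms by (simp add: algebra_simps)
    moreover have "(1/2) * (t N n - t N k) \<le> \<sigma> * (t N n - t N k)"
      using \<sigma>_bounds t_less[of k n N] assms by (intro mult_right_mono) auto
    ultimately show "t N n - t N k \<le> 2 * (tstar \<sigma> (t N) n - t N k)" using a by simp
  qed (use Q_ge r_ge in auto)
  also have "\<dots> = G * (tstar \<sigma> (t N) n - t N k)" by (simp add: G_def power3_eq_cube power2_eq_square)
  finally show ?thesis .
qed

end

section \<open>The kernel and its coefficients\<close>

lemma kernel_continuous: "b < c \<Longrightarrow> continuous_on {a..b} (\<lambda>s. (c - s) powr (- \<beta>))" for a b c \<beta> :: real
  by (intro continuous_intros) auto

lemma kernel_mono: "s \<le> s' \<Longrightarrow> s' < c \<Longrightarrow> 0 \<le> \<beta> \<Longrightarrow> (c - s) powr (- \<beta>) \<le> (c - s') powr (- \<beta>)"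
  for s s' c \<beta> :: real
  by (intro powr_mono2') auto

lemma has_integral_centered: "a \<le> b \<Longrightarrow> ((\<lambda>s. s - (a + b) / 2) has_integral 0) {a..b}" for a b :: real
proof -
  assume "a \<le> b"
  then have "((\<lambda>s. s - (a + b) / 2) has_integral (b\<^sup>2 / 2 - (a + b) / 2 * b) - (a\<^sup>2 / 2 - (a + b) / 2 * a)) {a..b}"
    by (intro fundamental_theorem_of_calculus)
      (auto intro!: derivative_eq_intros simp flip: has_real_derivative_iff_has_vector_derivative)
  also have "(b\<^sup>2 / 2 - (a + b) / 2 * b) - (a\<^sup>2 / 2 - (a + b) / 2 * a) = 0"
    by (simp add: field_simps power2_eq_square)
  finally show ?thesis .
qed

text \<open>Integrating the kernel against a function of mean zero only sees the oscillation of the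
  kernel, which gains a factor: step length over distance to the singularity.\<close>

lemma kernel_oscillation:
  fixes a b c \<beta> Y :: real
  assumes "a \<le> b" "b < c" "0 < \<beta>"
    and i1: "(\<lambda>s. (c - s) powr (- \<beta>) * \<xi> s) integrable_on {a..b}"
    and i2: "(\<xi> has_integral 0) {a..b}"
    and i3: "(\<eta> has_integral Y) {a..b}" and le: "\<And>s. s \<in> {a<..<b} \<Longrightarrow> \<bar>\<xi> s\<bar> \<le> \<eta> s"
  shows "\<bar>integral {a..b} (\<lambda>s. (c - s) powr (- \<beta>) * \<xi> s)\<bar> \<le> \<beta> * (b - a) * (c - b) powr (- \<beta> - 1) * Y"
proof -
  define A where "A = \<beta> * (b - a) * (c - b) powr (- \<beta> - 1)"
  have k: "\<bar>(c - s) powr (- \<beta>) - (c - b) powr (- \<beta>)\<bar> \<le> A" if "s \<in> {a<..<b}" for s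
  proof -
    have d: "((\<lambda>z. (c - z) powr (- \<beta>)) has_real_derivative \<beta> * (c - z) powr (- \<beta> - 1)) (at z)"
      if "z \<le> b" for z
      using that assms by (auto intro!: derivative_eq_intros)
    have sb: "s < b" using that by auto
    obtain z where z: "s < z" "z < b"
      "(c - b) powr (- \<beta>) - (c - s) powr (- \<beta>) = (b - s) * (\<beta> * (c - z) powr (- \<beta> - 1))"
      using MVT2[OF sb, of "\<lambda>z. (c - z) powr (- \<beta>)" "\<lambda>z. \<beta> * (c - z) powr (- \<beta> - 1)"] d by blast
    have "(c - z) powr (- \<beta> - 1) \<le> (c - b) powr (- \<beta> - 1)"
      using z assms by (intro powr_mono2') auto
    then have "(b - s) * (\<beta> * (c - z) powr (- \<beta> - 1)) \<le> (b - a) * (\<beta> * (c - b) powr (- \<beta> - 1))"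
      using that assms by (intro mult_mono) auto
    moreover have "0 \<le> (b - s) * (\<beta> * (c - z) powr (- \<beta> - 1))" using that assms by auto
    ultimately show ?thesis using z(3) by (simp add: A_def mult_ac)
  qed
  have i4: "((\<lambda>s. (c - s) powr (- \<beta>) * \<xi> s - (c - b) powr (- \<beta>) * \<xi> s) has_integral
      integral {a..b} (\<lambda>s. (c - s) powr (- \<beta>) * \<xi> s) - (c - b) powr (- \<beta>) * 0) {a..b}"
    by (intro has_integral_diff integrable_integral i1 has_integral_mult_right i2)
  have i5: "((\<lambda>s. A * \<eta> s) has_integral A * Y) {a..b}" by (intro has_integral_mult_right i3)
  have "\<bar>integral {a<..<b} (\<lambda>s. (c - s) powr (- \<beta>) * \<xi> s - (c - b) powr (- \<beta>) * \<xi> s)\<bar>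
     \<le> integral {a<..<b} (\<lambda>s. A * \<eta> s)"
    unfolding real_norm_def[symmetric]
  proof (rule integral_norm_bound_integral)
    show "(\<lambda>s. (c - s) powr (- \<beta>) * \<xi> s - (c - b) powr (- \<beta>) * \<xi> s) integrable_on {a<..<b}"
      using i4 has_integral_Icc_iff_Ioo by blast
    show "(\<lambda>s. A * \<eta> s) integrable_on {a<..<b}"
      using i5 has_integral_Icc_iff_Ioo by blast
    fix s assume s: "s \<in> {a<..<b}"
    have "\<bar>((c - s) powr (- \<beta>) - (c - b) powr (- \<beta>)) * \<xi> s\<bar> \<le> A * \<eta> s"
      unfolding abs_mult using k[OF s] le[OF s] by (intro mult_mono) auto
    then show "norm ((c - s) powr (- \<beta>) * \<xi> s - (c - b) powr (- \<beta>) * \<xi> s) \<le> A * \<eta> s"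
      by (simp add: left_diff_distrib)
  qed
  then have "\<bar>integral {a..b} (\<lambda>s. (c - s) powr (- \<beta>) * \<xi> s) - (c - b) powr (- \<beta>) * 0\<bar> \<le> A * Y"
    unfolding i4[unfolded has_integral_Icc_iff_Ioo, THEN integral_unique]
      i5[unfolded has_integral_Icc_iff_Ioo, THEN integral_unique] .
  then show ?thesis by (simp add: A_def)
qed

lemma Gamma_2_minus: "0 < \<beta> \<Longrightarrow> \<beta> < 1 \<Longrightarrow> Gamma (2 - \<beta>) = (1 - \<beta>) * Gamma (1 - \<beta>)" for \<beta> :: real
  using Gamma_plus1[of "1 - \<beta>"]
  by (metis (no_types, lifting) add.commute diff_add_eq diff_gt_0_iff_gt less_irrefl
        nonpos_Ints_nonpos not_less one_add_one)

text \<open>The kernel is increasing, so its covariance with the identity on a cell is nonnegative.\<close>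

lemma kernel_first_moment:
  fixes a b c \<beta> :: real
  assumes "a < b" "b < c" "0 < \<beta>"
  shows "0 \<le> integral {a..b} (\<lambda>s. (c - s) powr (- \<beta>) * (s - (a + b) / 2))"
    and "integral {a..b} (\<lambda>s. (c - s) powr (- \<beta>) * (s - (a + b) / 2))
      \<le> \<beta> * (b - a) ^ 3 / 2 * (c - b) powr (- \<beta> - 1)"
proof -
  let ?m = "(a + b) / 2"
  have int: "(\<lambda>s. (c - s) powr (- \<beta>) * (s - ?m)) integrable_on {a..b}"
    using kernel_continuous[of b c a \<beta>] assms by (intro integrable_continuous_interval continuous_intros) auto
  have h: "((\<lambda>s. (c - ?m) powr (- \<beta>) * (s - ?m)) has_integral (c - ?m) powr (- \<beta>) * 0) {a..b}"
    using has_integral_centered[of a b] assms by (intro has_integral_mult_right) auto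
  have "integral {a..b} (\<lambda>s. (c - ?m) powr (- \<beta>) * (s - ?m)) \<le> integral {a..b} (\<lambda>s. (c - s) powr (- \<beta>) * (s - ?m))"
  proof (rule integral_le)
    fix s assume s: "s \<in> {a..b}"
    show "(c - ?m) powr (- \<beta>) * (s - ?m) \<le> (c - s) powr (- \<beta>) * (s - ?m)"
    proof (cases "s \<le> ?m")
      case True
      then show ?thesis using kernel_mono[of s ?m c \<beta>] assms s by (intro mult_right_mono_neg) auto
    next
      case False
      then show ?thesis using kernel_mono[of ?m s c \<beta>] assms s by (intro mult_right_mono) auto
    qed
  qed (use h int in auto)
  then show "0 \<le> integral {a..b} (\<lambda>s. (c - s) powr (- \<beta>) * (s - ?m))"
    unfolding integral_unique[OF h] mult_zero_right .
  have "\<bar>integral {a..b} (\<lambda>s. (c - s) powr (- \<beta>) * (s - ?m))\<bar>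
     \<le> \<beta> * (b - a) * (c - b) powr (- \<beta> - 1) * ((b - a) * ((b - a) / 2))"
  proof (rule kernel_oscillation[where \<eta> = "\<lambda>_. (b - a) / 2"])
    show "((\<lambda>_. (b - a) / 2) has_integral (b - a) * ((b - a) / 2)) {a..b}"
      using has_integral_const_real[of "(b - a) / 2" a b] assms by simp
  qed (use assms int has_integral_centered[of a b] in \<open>auto simp: abs_le_iff field_simps\<close>)
  then show "integral {a..b} (\<lambda>s. (c - s) powr (- \<beta>) * (s - (a + b) / 2))
      \<le> \<beta> * (b - a) ^ 3 / 2 * (c - b) powr (- \<beta> - 1)"
    by (simp add: power3_eq_cube mult_ac)
qed

text \<open>The right-hand side is the integral of the kernel against the weight \<open>1 - 2 (s - (a + b)/2)/(d - a)\<close>.  This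
  weight has mean one and, because of \<open>b < d\<close>, is positive, so the smallest value of the kernel, at \<open>a\<close>, bounds the weighted mean.\<close>

lemma kernel_weighted_lower:
  fixes a b c d \<beta> :: real
  assumes "a < b" "b < c" "0 < \<beta>" "b < d"
  shows "(b - a) * (c - a) powr (- \<beta>) \<le> integral {a..b} (\<lambda>s. (c - s) powr (- \<beta>))
     - 2 / (d - a) * integral {a..b} (\<lambda>s. (c - s) powr (- \<beta>) * (s - (a + b) / 2))"
proof -
  let ?m = "(a + b) / 2"
  have i1: "(\<lambda>s. (c - s) powr (- \<beta>)) integrable_on {a..b}"
    using kernel_continuous[of b c a \<beta>] assms by (intro integrable_continuous_interval) auto
  have i2: "(\<lambda>s. (c - s) powr (- \<beta>) * (s - ?m)) integrable_on {a..b}"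
    using kernel_continuous[of b c a \<beta>] assms by (intro integrable_continuous_interval continuous_intros) auto
  have i3: "((\<lambda>s. (c - s) powr (- \<beta>) - 2 / (d - a) * ((c - s) powr (- \<beta>) * (s - ?m))) has_integral
      integral {a..b} (\<lambda>s. (c - s) powr (- \<beta>)) - 2 / (d - a) * integral {a..b} (\<lambda>s. (c - s) powr (- \<beta>) * (s - ?m))) {a..b}"
    using i1 i2 by (intro has_integral_diff has_integral_mult_right integrable_integral)
  have "((\<lambda>s. (c - a) powr (- \<beta>) - (c - a) powr (- \<beta>) * (2 / (d - a) * (s - ?m))) has_integral
      (b - a) * (c - a) powr (- \<beta>) - (c - a) powr (- \<beta>) * (2 / (d - a) * 0)) {a..b}"
    using has_integral_const_real[of "(c - a) powr (- \<beta>)" a b] assms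
    by (intro has_integral_diff has_integral_mult_right has_integral_centered) auto
  then have i4: "((\<lambda>s. (c - a) powr (- \<beta>) - (c - a) powr (- \<beta>) * (2 / (d - a) * (s - ?m))) has_integral
      (b - a) * (c - a) powr (- \<beta>)) {a..b}" by simp
  show ?thesis
  proof (rule has_integral_le[OF i4 i3])
    fix s assume s: "s \<in> {a..b}"
    have "2 * (s - ?m) \<le> d - a" using s assms by (simp add: field_simps)
    then have w: "0 \<le> 1 - 2 / (d - a) * (s - ?m)" using assms by (simp add: field_simps)
    have "(c - a) powr (- \<beta>) * (1 - 2 / (d - a) * (s - ?m)) \<le> (c - s) powr (- \<beta>) * (1 - 2 / (d - a) * (s - ?m))"
      using kernel_mono[of a s c \<beta>] s assms w by (intro mult_right_mono) auto
    moreover have "x - x * (p * q) = x * (1 - p * q)" "x - p * (x * q) = x * (1 - p * q)" for x p q :: real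
      by (simp_all add: right_diff_distrib mult_ac)
    ultimately show "(c - a) powr (- \<beta>) - (c - a) powr (- \<beta>) * (2 / (d - a) * (s - ?m))
        \<le> (c - s) powr (- \<beta>) - 2 / (d - a) * ((c - s) powr (- \<beta>) * (s - ?m))"
      by (simp only:)
  qed
qed

lemma sum_by_parts_weights:
  fixes g v :: "nat \<Rightarrow> real"
  assumes "1 \<le> n"
  shows "(\<Sum>k=1..n. g k * (v k - v (k - 1))) = g n * v n - (\<Sum>k=1..<n. (g (Suc k) - g k) * v k) - g 1 * v 0"
  using assms
proof (induction n rule: dec_induct)
  case (step n)
  then show ?case by (simp add: algebra_simps)
qed (simp add: algebra_simps)

context quasi_graded_meshes
begin

abbreviation "\<Gamma>\<beta> \<equiv> Gamma (1 - \<beta>)"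

abbreviation "g N \<equiv> gcoef \<beta> \<sigma> (t N)"

abbreviation "\<delta> N \<equiv> alikhanov \<beta> \<sigma> (t N)"

lemma \<beta>_pos: "0 < \<beta>" using \<beta>_gt by simp

lemma \<Gamma>\<beta>_pos: "0 < \<Gamma>\<beta>" using \<beta>_lt by (intro Gamma_real_pos) auto

lemma \<delta>_eq: "1 \<le> n \<Longrightarrow> n \<le> N \<Longrightarrow> \<delta> N v n = (\<Sum>k=1..n. g N n k * (v k - v (k - 1)))"
  using alikhanov_eq_gcoef[of \<beta> \<sigma> T N "t N" n v] \<beta>_pos \<beta>_lt \<sigma>_bounds mesh[of N] by auto

lemma \<delta>_eq_parts:
  assumes "1 \<le> n" "n \<le> N"
  shows "\<delta> N v n = g N n n * v n - (\<Sum>k=1..<n. (g N n (Suc k) - g N n k) * v k) - g N n 1 * v 0"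
  using sum_by_parts_weights[OF assms(1), of "g N n" v] \<delta>_eq[OF assms, of v] by simp

lemma g_mono: "1 \<le> k \<Longrightarrow> k < n \<Longrightarrow> n \<le> N \<Longrightarrow> g N n k < g N n (Suc k)"
  using P1[of N] by (auto simp: P1_def)

lemma bcoef_nonneg:
  assumes "Suc k < n" "n \<le> N"
  shows "0 \<le> bcoef \<beta> \<sigma> (t N) (n - 1) k"
proof -
  have n: "n - 1 + 1 = n" using assms by auto
  have a: "t N k < t N (k + 1)" "t N k < t N (k + 2)" using assms t_less by auto
  have "t N (k + 1) \<le> t N (n - 1)" using assms by (intro t_le) auto
  also have "\<dots> < tstar \<sigma> (t N) n" using tstar_bounds assms by auto
  finally show ?thesis
    unfolding bcoef_def n using kernel_first_moment(1)[OF a(1), of "tstar \<sigma> (t N) n" \<beta>] a \<Gamma>\<beta>_pos \<beta>_pos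
    by (intro mult_nonneg_nonneg) auto
qed

lemma bcoef_upper:
  assumes "1 \<le> k" "k < n" "n \<le> N"
  shows "bcoef \<beta> \<sigma> (t N) (n - 1) (k - 1) \<le> mstep (t N) k ^ 2 * (tstar \<sigma> (t N) n - t N k) powr (- \<beta> - 1) / \<Gamma>\<beta>"
proof -
  define c where "c = tstar \<sigma> (t N) n"
  have n: "n - 1 + 1 = n" "k - 1 + 1 = k" "k - 1 + 2 = k + 1" using assms by auto
  have a: "t N (k - 1) < t N k" "t N k < t N (k + 1)" using assms t_less by auto
  have "t N k \<le> t N (n - 1)" using assms by (intro t_le) auto
  also have "\<dots> < c" using tstar_bounds assms by (auto simp: c_def)
  finally have kc: "t N k < c" .
  define X where "X = (c - t N k) powr (- \<beta> - 1)"
  have X: "0 \<le> X" by (simp add: X_def)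
  have "2 / (t N (k + 1) - t N (k - 1)) * integral {t N (k - 1)..t N k} (\<lambda>s. (c - s) powr (- \<beta>) * (s - (t N (k - 1) + t N k) / 2))
     \<le> 2 / mstep (t N) k * (\<beta> * mstep (t N) k ^ 3 / 2 * X)"
    using kernel_first_moment[OF a(1) kc \<beta>_pos] a
    by (intro mult_mono frac_le) (auto simp: mstep_def X_def)
  also have "\<dots> = \<beta> * (mstep (t N) k ^ 2 * X)"
    using mstep_pos[of k N] assms by (simp add: power3_eq_cube power2_eq_square)
  also have "\<dots> \<le> mstep (t N) k ^ 2 * X"
    using \<beta>_lt X by (intro mult_left_le_one_le) (auto simp: less_imp_le \<beta>_pos)
  finally have "2 / (t N (k + 1) - t N (k - 1)) * integral {t N (k - 1)..t N k} (\<lambda>s. (c - s) powr (- \<beta>) * (s - (t N (k - 1) + t N k) / 2))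
    \<le> mstep (t N) k ^ 2 * X" .
  from divide_right_mono[OF this, of \<Gamma>\<beta>] show ?thesis
    unfolding bcoef_def n c_def[symmetric] X_def[symmetric] using \<Gamma>\<beta>_pos by (simp add: mult.commute)
qed

text \<open>The correction by \<open>bcoef\<close> never costs anything: it turns the mean of the kernel over a cell
  into a weighted mean with positive weights.\<close>

lemma g_lower:
  assumes "1 \<le> k" "k \<le> n" "n \<le> N"
  shows "(tstar \<sigma> (t N) n - t N (k - 1)) powr (- \<beta>) / \<Gamma>\<beta> \<le> g N n k"
proof -
  define c where "c = tstar \<sigma> (t N) n"
  have m: "0 < mstep (t N) k" using mstep_pos assms by auto
  show ?thesis
  proof (cases "k = n")
    case True
    define A where "A = acoef \<beta> \<sigma> (t N) (n - 1) (n - 1)"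
    have cn: "c - t N (n - 1) = \<sigma> * mstep (t N) n" using tstar_bounds assms by (simp add: c_def)
    have s: "0 < \<sigma> * mstep (t N) n" using m True \<sigma>_bounds by auto
    have "A = (\<sigma> * mstep (t N) n) powr (1 - \<beta>) / Gamma (2 - \<beta>)"
      using assms True m \<sigma>_bounds by (simp add: A_def acoef_def powr_mult)
    also have "\<dots> = (\<sigma> * mstep (t N) n) * (\<sigma> * mstep (t N) n) powr (- \<beta>) / ((1 - \<beta>) * \<Gamma>\<beta>)"
      using s by (simp add: Gamma_2_minus \<beta>_pos \<beta>_lt powr_mult_base)
    finally have "A / mstep (t N) n = \<sigma> / (1 - \<beta>) * ((\<sigma> * mstep (t N) n) powr (- \<beta>) / \<Gamma>\<beta>)"
      using m True by simp
    moreover have "1 * ((\<sigma> * mstep (t N) n) powr (- \<beta>) / \<Gamma>\<beta>) \<le> \<sigma> / (1 - \<beta>) * ((\<sigma> * mstep (t N) n) powr (- \<beta>) / \<Gamma>\<beta>)"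
      using \<beta>_lt \<beta>_pos \<Gamma>\<beta>_pos by (intro mult_right_mono) (auto simp: \<sigma>_eq field_simps)
    moreover have "A / mstep (t N) n \<le> g N n n"
    proof (cases "n = 1")
      case False
      then have "0 \<le> bcoef \<beta> \<sigma> (t N) (n - 1) (n - 2)" using assms True by (intro bcoef_nonneg) auto
      then show ?thesis using False True m by (auto simp: gcoef_def A_def intro!: divide_right_mono)
    qed (simp add: gcoef_def A_def)
    ultimately show ?thesis unfolding True c_def[symmetric] cn by linarith
  next
    case False
    then have kn: "k < n" using assms by auto
    define B where "B = (if k = 1 then 0 else bcoef \<beta> \<sigma> (t N) (n - 1) (k - 2))"
    have B: "0 \<le> B" using bcoef_nonneg[of "k - 2" n N] kn assms by (auto simp: B_def)
    have n: "n - 1 + 1 = n" "k - 1 + 1 = k" "k - 1 + 2 = k + 1" "k - 1 \<noteq> n - 1" using assms kn by auto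
    have a: "t N (k - 1) < t N k" "t N k < t N (k + 1)" using assms kn t_less by auto
    have "t N k \<le> t N (n - 1)" using assms kn by (intro t_le) auto
    also have "\<dots> < c" using tstar_bounds assms by (auto simp: c_def)
    finally have kc: "t N k < c" .
    have "mstep (t N) k * (c - t N (k - 1)) powr (- \<beta>) / \<Gamma>\<beta>
       \<le> acoef \<beta> \<sigma> (t N) (n - 1) (k - 1) - bcoef \<beta> \<sigma> (t N) (n - 1) (k - 1)"
      using divide_right_mono[OF kernel_weighted_lower[OF a(1) kc \<beta>_pos a(2)], of \<Gamma>\<beta>] \<Gamma>\<beta>_pos n
      unfolding acoef_def bcoef_def n c_def[symmetric] mstep_def by (simp add: diff_divide_distrib mult.commute)
    then have "mstep (t N) k * (c - t N (k - 1)) powr (- \<beta>) / \<Gamma>\<beta>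
       \<le> acoef \<beta> \<sigma> (t N) (n - 1) (k - 1) + B - bcoef \<beta> \<sigma> (t N) (n - 1) (k - 1)" using B by linarith
    from divide_right_mono[OF this, of "mstep (t N) k"] show ?thesis
      unfolding c_def[symmetric] gcoef_def B_def using kn assms m by (auto split: if_splits)
  qed
qed

lemma g_lower':
  assumes "1 \<le> k" "k \<le> n" "n \<le> N"
  shows "(t N n - t N (k - 1)) powr (- \<beta>) / \<Gamma>\<beta> \<le> g N n k"
proof -
  have "t N (k - 1) \<le> t N (n - 1)" using assms by (intro t_le) auto
  then have "(t N n - t N (k - 1)) powr (- \<beta>) \<le> (tstar \<sigma> (t N) n - t N (k - 1)) powr (- \<beta>)"
    using tstar_bounds[of n N] assms \<beta>_pos by (intro powr_mono2') auto
  then show ?thesis using g_lower[OF assms] \<Gamma>\<beta>_pos by (meson divide_right_mono less_imp_le order_trans)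
qed

lemma g_1_pos: "1 \<le> n \<Longrightarrow> n \<le> N \<Longrightarrow> 0 < g N n 1"
  using g_lower'[of 1 n N] t_pos[of n N] t_0[of N] \<Gamma>\<beta>_pos
  by (smt (verit) cancel_comm_monoid_add_class.diff_cancel diff_zero divide_pos_pos le_refl order_trans powr_gt_zero)

lemma g_pos: "1 \<le> k \<Longrightarrow> k \<le> n \<Longrightarrow> n \<le> N \<Longrightarrow> 0 < g N n k"
proof (induction k rule: dec_induct)
  case base
  then show ?case using g_1_pos[of n N] by auto
next
  case (step k)
  then show ?case using g_mono[of k n N] by auto
qed

section \<open>Comparison principle\<close>

text \<open>Induction on \<open>n\<close>: in the form \<open>\<delta>_eq_parts\<close> all earlier values enter with a nonnegative weight by (P1), and
  \<open>lam < g N n n\<close> leaves the diagonal term dominant.\<close>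

lemma comparison:
  assumes m: "m \<le> N" and lam: "0 \<le> lam" and g: "\<And>n. 1 \<le> n \<Longrightarrow> n \<le> m \<Longrightarrow> lam < g N n n"
    and le0: "W 0 \<le> B 0"
    and le: "\<And>n. 1 \<le> n \<Longrightarrow> n \<le> m \<Longrightarrow>
      \<delta> N W n - lam * (W n + W (n - 1)) \<le> \<delta> N B n - lam * (B n + B (n - 1))"
    and n: "n \<le> m"
  shows "W n \<le> B n"
  using n
proof (induction n rule: less_induct)
  case (less n)
  show ?case
  proof (cases "n = 0")
    case False
    then have n: "1 \<le> n" "n \<le> m" "n \<le> N" using less m by auto
    define D where "D k = W k - B k" for k
    have D: "D k \<le> 0" if "k < n" for k using less.IH[of k] that n by (auto simp: D_def)
    have "g N n n * D n - (\<Sum>k=1..<n. (g N n (Suc k) - g N n k) * D k) - g N n 1 * D 0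
      = \<delta> N W n - \<delta> N B n"
      unfolding \<delta>_eq_parts[OF n(1,3)] by (simp add: D_def sum_subtractf right_diff_distrib)
    also have "\<dots> \<le> lam * (D n + D (n - 1))"
      using le[OF n(1,2)] by (simp add: D_def right_diff_distrib distrib_left)
    also have "\<dots> \<le> lam * D n" using D[of "n - 1"] n lam by (intro mult_left_mono) auto
    finally have "(g N n n - lam) * D n \<le> (\<Sum>k=1..<n. (g N n (Suc k) - g N n k) * D k) + g N n 1 * D 0"
      by (simp add: left_diff_distrib)
    also have "\<dots> \<le> 0"
    proof (intro add_nonpos_nonpos sum_nonpos mult_nonneg_nonpos)
      show "0 \<le> g N n 1" using g_1_pos[of n N] n by auto
    next
      fix k assume k: "k \<in> {1..<n}"
      then show "0 \<le> g N n (Suc k) - g N n k" using g_mono[of k n N] n by auto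
      show "D k \<le> 0" using D k by auto
    qed (use D n in auto)
    finally show ?thesis using g[OF n(1,2)] by (auto simp: D_def mult_le_0_iff)
  qed (use le0 in auto)
qed

lemma mstep_le_max_step: "1 \<le> n \<Longrightarrow> n \<le> N \<Longrightarrow> mstep (t N) n \<le> max_step N (t N)"
  unfolding max_step_def by (intro Max_ge) auto

lemma g_diag_lower:
  assumes "0 < \<tau>0" "max_step N (t N) \<le> \<tau>0" "1 \<le> n" "n \<le> N"
  shows "\<tau>0 powr (- \<beta>) / \<Gamma>\<beta> \<le> g N n n"
proof -
  have "mstep (t N) n \<le> \<tau>0" using mstep_le_max_step[of n N] assms by auto
  then have "\<tau>0 powr (- \<beta>) \<le> (t N n - t N (n - 1)) powr (- \<beta>)"
    using mstep_pos[of n N] assms \<beta>_pos by (intro powr_mono2') (auto simp: mstep_def)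
  then show ?thesis using g_lower'[of n n N] assms \<Gamma>\<beta>_pos
    by (meson divide_right_mono le_refl less_imp_le order_trans)
qed

text \<open>All increments have nonnegative weights, so those up to \<open>j\<close> may be dropped; the others have at least the weight that
  belongs to \<open>j\<close>.\<close>

lemma \<delta>_lower_increasing:
  assumes n: "1 \<le> n" "n \<le> N" and j: "j < n" and F: "\<And>k. 1 \<le> k \<Longrightarrow> k \<le> n \<Longrightarrow> F (k - 1) \<le> F k"
  shows "(t N n - t N j) powr (- \<beta>) / \<Gamma>\<beta> * (F n - F j) \<le> \<delta> N F n"
proof -
  define A where "A = (t N n - t N j) powr (- \<beta>) / \<Gamma>\<beta>"
  have A: "A \<le> g N n k" if "k \<in> {Suc j..n}" for k
  proof -
    have "t N j \<le> t N (k - 1)" "t N (k - 1) < t N n"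
      using that n j by (auto intro: t_le t_less)
    then have "(t N n - t N j) powr (- \<beta>) \<le> (t N n - t N (k - 1)) powr (- \<beta>)"
      using \<beta>_pos by (intro powr_mono2') auto
    then have "A \<le> (t N n - t N (k - 1)) powr (- \<beta>) / \<Gamma>\<beta>"
      unfolding A_def using \<Gamma>\<beta>_pos by (intro divide_right_mono) auto
    also have "\<dots> \<le> g N n k" using that n by (intro g_lower') auto
    finally show ?thesis .
  qed
  have "A * (F n - F j) = (\<Sum>k=Suc j..n. A * (F k - F (k - 1)))"
    using j sum_telescope''[of j n F] by (simp flip: sum_distrib_left)
  also have "\<dots> \<le> (\<Sum>k=Suc j..n. g N n k * (F k - F (k - 1)))"
    using A F j by (intro sum_mono mult_right_mono) auto
  also have "\<dots> \<le> (\<Sum>k=1..n. g N n k * (F k - F (k - 1)))"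
    using F n j less_imp_le[OF g_pos[of _ n N]] by (intro sum_mono2 mult_nonneg_nonneg) auto
  also have "\<dots> = \<delta> N F n" using \<delta>_eq n by simp
  finally show ?thesis by (simp add: A_def)
qed

text \<open>The increasing barrier that takes care of the Gronwall term.  On an interval of fixed length \<open>\<epsilon>\<close> before \<open>t\<^sub>n\<close> the kernel is at
  least \<open>\<epsilon>\<^sup>-\<^sup>\<beta>\<close>, which is large if \<open>\<epsilon>\<close> is small, and an exponential of sufficiently high rate grows by half of its value there.  The jump
  at \<open>0\<close> contributes the singular term \<open>t\<^sub>n\<^sup>-\<^sup>\<beta>\<close>.\<close>

lemma exp_barrier:
  assumes "0 \<le> lam"
  obtains \<mu> \<tau>0 where "0 \<le> \<mu>" "0 < \<tau>0"
    "\<And>N n. 1 \<le> n \<Longrightarrow> n \<le> N \<Longrightarrow> max_step N (t N) \<le> \<tau>0 \<Longrightarrow>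
      lam * exp (\<mu> * t N n) + t N n powr (- \<beta>) / (2 * \<Gamma>\<beta>) \<le> \<delta> N (\<lambda>k. if k = 0 then 0 else exp (\<mu> * t N k)) n"
proof -
  define \<epsilon> where "\<epsilon> = (4 * \<Gamma>\<beta> * lam + 1) powr (- 1 / \<beta>)"
  \<comment> \<open>the exponential doubles over \<open>\<epsilon> / 2\<close>; the other half of \<open>\<epsilon>\<close> leaves room for one step\<close>
  define \<mu> where "\<mu> = 2 * ln 2 / \<epsilon>"
  have p: "0 < 4 * \<Gamma>\<beta> * lam + 1" using \<Gamma>\<beta>_pos assms by (intro add_nonneg_pos) auto
  have \<epsilon>: "0 < \<epsilon>" using p by (simp add: \<epsilon>_def)
  have \<mu>: "0 \<le> \<mu>" using \<epsilon> by (simp add: \<mu>_def)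
  have \<epsilon>': "\<epsilon> powr (- \<beta>) = 4 * \<Gamma>\<beta> * lam + 1"
    using p \<beta>_pos by (simp add: \<epsilon>_def powr_powr)
  have half: "2 * lam \<le> \<epsilon> powr (- \<beta>) / \<Gamma>\<beta> * (1 / 2)"
    unfolding \<epsilon>' using \<Gamma>\<beta>_pos by (simp add: field_simps)
  have main: "lam * exp (\<mu> * t N n) + t N n powr (- \<beta>) / (2 * \<Gamma>\<beta>) \<le> \<delta> N (\<lambda>k. if k = 0 then 0 else exp (\<mu> * t N k)) n"
    if n: "1 \<le> n" "n \<le> N" and ms: "max_step N (t N) \<le> \<epsilon> / 2" for N n
  proof -
    define F where "F = (\<lambda>k. if k = 0 then 0 else exp (\<mu> * t N k))"
    have F: "F (k - 1) \<le> F k" if "1 \<le> k" "k \<le> n" for k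
      using that n t_le[of "k - 1" k N] \<mu> by (auto simp: F_def intro!: mult_left_mono)
    have Fn: "F n = exp (\<mu> * t N n)" using n by (simp add: F_def)
    have F1: "1 \<le> F n" unfolding Fn using \<mu> t_nonneg[of n N] n by simp
    have tn: "0 < t N n" using t_pos n by auto
    have low: "t N n powr (- \<beta>) / \<Gamma>\<beta> * F n \<le> \<delta> N F n"
      using \<delta>_lower_increasing[OF n, of 0 F] F n t_0[of N] by (simp add: F_def)
    have "t N n powr (- \<beta>) / \<Gamma>\<beta> * 1 \<le> t N n powr (- \<beta>) / \<Gamma>\<beta> * F n"
      using F1 \<Gamma>\<beta>_pos by (intro mult_left_mono) auto
    then have one: "t N n powr (- \<beta>) / \<Gamma>\<beta> \<le> \<delta> N F n" using low by simp
    have two: "2 * lam * F n \<le> \<delta> N F n"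
    proof (cases "t N n \<le> \<epsilon>")
      case True
      have "0 \<le> \<epsilon> powr (- \<beta>) / \<Gamma>\<beta>" using \<Gamma>\<beta>_pos by simp
      then have "2 * lam \<le> \<epsilon> powr (- \<beta>) / \<Gamma>\<beta>"
        by (intro order_trans[OF half] mult_right_le_one_le) auto
      also have "\<dots> \<le> t N n powr (- \<beta>) / \<Gamma>\<beta>"
        using True tn \<beta>_pos \<Gamma>\<beta>_pos by (intro divide_right_mono powr_mono2') auto
      finally have "2 * lam * F n \<le> t N n powr (- \<beta>) / \<Gamma>\<beta> * F n" using F1 by (intro mult_right_mono) auto
      then show ?thesis using low by linarith
    next
      case False
      define J where "J = {k. k \<le> n \<and> t N k \<le> t N n - \<epsilon> / 2}"
      define j where "j = Max J"
      have fin: "finite J" by (simp add: J_def)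
      have "0 \<in> J" using False \<epsilon> n t_0[of N] by (simp add: J_def)
      then have jJ: "j \<in> J" unfolding j_def using fin by (intro Max_in) auto
      have jn: "j < n" using jJ \<epsilon> by (cases "j = n") (auto simp: J_def)
      have "Suc j \<notin> J" using fin Max_ge[of J "Suc j"] unfolding j_def by linarith
      then have "t N n - \<epsilon> / 2 < t N (Suc j)" using jn by (auto simp: J_def)
      moreover have "t N (Suc j) - t N j \<le> \<epsilon> / 2"
        using mstep_le_max_step[of "Suc j" N] jn n ms by (simp add: mstep_def)
      ultimately have dj: "t N n - t N j \<le> \<epsilon>" by linarith
      have "F j \<le> exp (\<mu> * (t N n - \<epsilon> / 2))"
        using jJ \<mu> by (auto simp: F_def J_def intro!: mult_left_mono)
      also have "\<dots> = F n * exp (- (\<mu> * \<epsilon> / 2))" by (simp add: Fn flip: exp_add) (simp add: algebra_simps)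
      also have "\<mu> * \<epsilon> / 2 = ln 2" using \<epsilon> by (simp add: \<mu>_def)
      also have "exp (- ln 2) = (1/2 :: real)" by (simp add: exp_minus)
      finally have Fj: "F j \<le> F n * (1/2)" .
      have tj: "0 < t N n - t N j" using t_less[of j n N] jn n by auto
      have "2 * lam * F n \<le> \<epsilon> powr (- \<beta>) / \<Gamma>\<beta> * (1 / 2) * F n" using half F1 by (intro mult_right_mono) auto
      also have "\<dots> \<le> (t N n - t N j) powr (- \<beta>) / \<Gamma>\<beta> * (F n - F j)"
        unfolding mult.assoc using Fj dj tj F1 \<beta>_pos \<Gamma>\<beta>_pos
        by (intro mult_mono divide_right_mono powr_mono2') auto
      also have "\<dots> \<le> \<delta> N F n" by (intro \<delta>_lower_increasing n jn F)
      finally show ?thesis .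
    qed
    have "t N n powr (- \<beta>) / (2 * \<Gamma>\<beta>) = (t N n powr (- \<beta>) / \<Gamma>\<beta>) / 2" by simp
    then show ?thesis using one two unfolding F_def[symmetric] Fn[symmetric] by linarith
  qed
  show thesis by (rule that[of \<mu> "\<epsilon> / 2"]) (use \<mu> \<epsilon> main in auto)
qed

end

section \<open>Truncation error away from the initial singularity\<close>

text \<open>Iterated, this gives the Taylor estimates: each integration raises the power by one.\<close>

lemma deriv_bound_power:
  fixes f f' :: "real \<Rightarrow> real"
  assumes d: "\<And>z. z \<in> {a..b} \<Longrightarrow> (f has_real_derivative f' z) (at z within {a..b})"
    and x: "x \<in> {a..b}" and s: "s \<in> {a..b}" and f0: "f x = 0" and M: "0 \<le> M"
    and le: "\<And>z. z \<in> {a..b} \<Longrightarrow> \<bar>f' z\<bar> \<le> M * \<bar>z - x\<bar> ^ k"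
  shows "\<bar>f s\<bar> \<le> M * \<bar>s - x\<bar> ^ Suc k"
proof -
  have "\<exists>z\<in>{a..b}. \<bar>z - x\<bar> \<le> \<bar>s - x\<bar> \<and> \<bar>f s\<bar> = \<bar>f' z\<bar> * \<bar>s - x\<bar>"
  proof (cases s x rule: linorder_cases)
    case less
    obtain z where z: "z \<in> {s<..<x}" "f x - f s = f' z * (x - s)"
      using mvt_simple[OF less, of f "\<lambda>z h. f' z * h"] d x s
      by (smt (verit, ccfv_SIG) atLeastAtMost_iff has_derivative_subset has_field_derivative_def subsetI mult.commute mult_commute_abs)
    have "\<bar>f s\<bar> = \<bar>f' z\<bar> * \<bar>s - x\<bar>"
      using arg_cong[OF z(2), of abs] f0 by (simp add: abs_mult abs_minus_commute)
    then show ?thesis using z less x s by (intro bexI[of _ z]) auto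
  next
    case greater
    obtain z where z: "z \<in> {x<..<s}" "f s - f x = f' z * (s - x)"
      using mvt_simple[OF greater, of f "\<lambda>z h. f' z * h"] d x s
      by (smt (verit, ccfv_SIG) atLeastAtMost_iff has_derivative_subset has_field_derivative_def subsetI mult.commute mult_commute_abs)
    show ?thesis using z greater x s f0
      by (intro bexI[of _ z]) (auto simp: abs_mult)
  qed (use x f0 in auto)
  then obtain z where z: "z \<in> {a..b}" "\<bar>z - x\<bar> \<le> \<bar>s - x\<bar>" "\<bar>f s\<bar> = \<bar>f' z\<bar> * \<bar>s - x\<bar>" by blast
  have "\<bar>f' z\<bar> \<le> M * \<bar>s - x\<bar> ^ k"
    using le[OF z(1)] z(2) M by (meson abs_ge_zero mult_left_mono order_trans power_mono)
  then have "\<bar>f' z\<bar> * \<bar>s - x\<bar> \<le> M * \<bar>s - x\<bar> ^ k * \<bar>s - x\<bar>" by (intro mult_right_mono) auto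
  then show ?thesis using z(3) by (simp add: mult_ac)
qed

lemma taylor_third_order:
  fixes v v1 v2 v3 :: "real \<Rightarrow> real"
  assumes d0: "\<And>z. z \<in> {a..b} \<Longrightarrow> (v has_real_derivative v1 z) (at z within {a..b})"
    and d1: "\<And>z. z \<in> {a..b} \<Longrightarrow> (v1 has_real_derivative v2 z) (at z within {a..b})"
    and d2: "\<And>z. z \<in> {a..b} \<Longrightarrow> (v2 has_real_derivative v3 z) (at z within {a..b})"
    and M: "\<And>z. z \<in> {a..b} \<Longrightarrow> \<bar>v3 z\<bar> \<le> M" and x: "x \<in> {a..b}" and s: "s \<in> {a..b}"
  shows "\<bar>v1 s - v1 x - v2 x * (s - x)\<bar> \<le> M * \<bar>s - x\<bar> ^ 2"
    and "\<bar>v s - v x - v1 x * (s - x) - v2 x * (s - x)\<^sup>2 / 2\<bar> \<le> M * \<bar>s - x\<bar> ^ 3"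
proof -
  have M0: "0 \<le> M" using M[OF x] by linarith
  have e2: "\<bar>v2 z - v2 x\<bar> \<le> M * \<bar>z - x\<bar> ^ Suc 0" if "z \<in> {a..b}" for z
    by (rule deriv_bound_power[where f' = v3 and a = a and b = b])
      (use x that M M0 in \<open>auto intro!: derivative_eq_intros d2\<close>)
  have e1: "\<bar>v1 z - v1 x - v2 x * (z - x)\<bar> \<le> M * \<bar>z - x\<bar> ^ Suc (Suc 0)" if "z \<in> {a..b}" for z
    by (rule deriv_bound_power[where f' = "\<lambda>z. v2 z - v2 x" and a = a and b = b])
      (use x that e2 M0 in \<open>auto intro!: derivative_eq_intros d1\<close>)
  have e0: "\<bar>v z - v x - v1 x * (z - x) - v2 x * (z - x)\<^sup>2 / 2\<bar> \<le> M * \<bar>z - x\<bar> ^ Suc (Suc (Suc 0))"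
    if "z \<in> {a..b}" for z
    by (rule deriv_bound_power[where f' = "\<lambda>z. v1 z - v1 x - v2 x * (z - x)" and a = a and b = b])
      (use x that e1 M0 in \<open>auto intro!: derivative_eq_intros d0\<close>)
  show "\<bar>v1 s - v1 x - v2 x * (s - x)\<bar> \<le> M * \<bar>s - x\<bar> ^ 2"
    using e1[OF s] by (simp add: numeral_2_eq_2)
  show "\<bar>v s - v x - v1 x * (s - x) - v2 x * (s - x)\<^sup>2 / 2\<bar> \<le> M * \<bar>s - x\<bar> ^ 3"
    using e0[OF s] by (simp add: numeral_3_eq_3)
qed

text \<open>Both interpolants are compared with the Taylor polynomial of \<open>v'\<close> at the right end \<open>b\<close> of the cell.
  The linear interpolant has the wrong slope of its derivative, namely \<open>0\<close>; that discrepancy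
  is kept explicit because it is annihilated by the kernel in the last cell.\<close>

lemma interpolant_deriv_error:
  fixes v v1 v2 v3 :: "real \<Rightarrow> real"
  assumes d0: "\<And>z. z \<in> {a..d} \<Longrightarrow> (v has_real_derivative v1 z) (at z within {a..d})"
    and d1: "\<And>z. z \<in> {a..d} \<Longrightarrow> (v1 has_real_derivative v2 z) (at z within {a..d})"
    and d2: "\<And>z. z \<in> {a..d} \<Longrightarrow> (v2 has_real_derivative v3 z) (at z within {a..d})"
    and M: "\<And>z. z \<in> {a..d} \<Longrightarrow> \<bar>v3 z\<bar> \<le> M" and ab: "a < b" and s: "s \<in> {a..b}"
  shows "b \<le> d \<Longrightarrow> \<bar>v1 s - (v b - v a) / (b - a) - v2 b * (s - (a + b) / 2)\<bar> \<le> 2 * M * (b - a)\<^sup>2"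
    and "b < d \<Longrightarrow> \<bar>v1 s - ((v b - v a) / (b - a) + 2 / (d - a) * (s - (a + b) / 2) *
      ((v d - v b) / (d - b) - (v b - v a) / (b - a)))\<bar> \<le> 4 * M * (d - a)\<^sup>2"
proof -
  define \<rho>1 where "\<rho>1 = (v b - v a) / (b - a) - (v1 b - v2 b * (b - a) / 2)"
  have e1: "\<bar>v1 s - v1 b - v2 b * (s - b)\<bar> \<le> M * (b - a)\<^sup>2"
    and r1: "\<bar>\<rho>1\<bar> \<le> M * (b - a)\<^sup>2" and M0: "0 \<le> M" if bd: "b \<le> d"
  proof -
    have b: "b \<in> {a..d}" using ab bd by auto
    then show M0: "0 \<le> M" using M[OF b] by linarith
    have "\<bar>v1 s - v1 b - v2 b * (s - b)\<bar> \<le> M * \<bar>s - b\<bar> ^ 2"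
      using s bd ab by (intro taylor_third_order(1)[OF d0 d1 d2 M b]) auto
    also have "\<dots> \<le> M * (b - a)\<^sup>2" using s M0 by (intro mult_left_mono power_mono) auto
    finally show "\<bar>v1 s - v1 b - v2 b * (s - b)\<bar> \<le> M * (b - a)\<^sup>2" .
    have "\<bar>v a - v b - v1 b * (a - b) - v2 b * (a - b)\<^sup>2 / 2\<bar> \<le> M * \<bar>a - b\<bar> ^ 3"
      using bd ab by (intro taylor_third_order(2)[OF d0 d1 d2 M b]) auto
    moreover have "v a - v b - v1 b * (a - b) - v2 b * (a - b)\<^sup>2 / 2 = - \<rho>1 * (b - a)"
      using ab by (simp add: \<rho>1_def field_simps power2_eq_square)
    ultimately have "\<bar>\<rho>1\<bar> * (b - a) \<le> M * (b - a)\<^sup>2 * (b - a)"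
      using ab by (simp add: abs_mult power3_eq_cube power2_eq_square abs_minus_commute mult_ac)
    then show "\<bar>\<rho>1\<bar> \<le> M * (b - a)\<^sup>2" using ab by simp
  qed
  show "\<bar>v1 s - (v b - v a) / (b - a) - v2 b * (s - (a + b) / 2)\<bar> \<le> 2 * M * (b - a)\<^sup>2" if bd: "b \<le> d"
  proof -
    have "v1 s - (v b - v a) / (b - a) - v2 b * (s - (a + b) / 2) = (v1 s - v1 b - v2 b * (s - b)) - \<rho>1"
      by (simp add: \<rho>1_def field_simps)
    then show ?thesis using e1[OF bd] r1[OF bd] by linarith
  qed
  show "\<bar>v1 s - ((v b - v a) / (b - a) + 2 / (d - a) * (s - (a + b) / 2) *
      ((v d - v b) / (d - b) - (v b - v a) / (b - a)))\<bar> \<le> 4 * M * (d - a)\<^sup>2" if bd: "b < d"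
  proof -
    have b: "b \<in> {a..d}" using ab bd by auto
    have H: "(b - a)\<^sup>2 \<le> (d - a)\<^sup>2" "(d - b)\<^sup>2 \<le> (d - a)\<^sup>2" using ab bd by (auto intro!: power_mono)
    define MH where "MH = M * (d - a)\<^sup>2"
    have MH: "M * (b - a)\<^sup>2 \<le> MH" "M * (d - b)\<^sup>2 \<le> MH"
      unfolding MH_def using H M0 bd by (auto intro!: mult_left_mono)
    define \<rho>2 where "\<rho>2 = (v d - v b) / (d - b) - (v1 b + v2 b * (d - b) / 2)"
    have "\<bar>v d - v b - v1 b * (d - b) - v2 b * (d - b)\<^sup>2 / 2\<bar> \<le> M * \<bar>d - b\<bar> ^ 3"
      using bd ab by (intro taylor_third_order(2)[OF d0 d1 d2 M b]) auto
    moreover have "v d - v b - v1 b * (d - b) - v2 b * (d - b)\<^sup>2 / 2 = \<rho>2 * (d - b)"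
      using bd by (simp add: \<rho>2_def field_simps power2_eq_square)
    ultimately have "\<bar>\<rho>2\<bar> * (d - b) \<le> M * (d - b)\<^sup>2 * (d - b)"
      using bd by (simp add: abs_mult power3_eq_cube power2_eq_square mult_ac)
    then have r2: "\<bar>\<rho>2\<bar> \<le> M * (d - b)\<^sup>2" using bd by simp
    define w where "w = 2 / (d - a) * (s - (a + b) / 2)"
    have w: "\<bar>w\<bar> \<le> 1" using s ab bd by (auto simp: w_def abs_le_iff field_simps)
    have wH: "w * (d - a) = 2 * s - a - b" using ab bd by (simp add: w_def field_simps)
    have "(v d - v b) / (d - b) - (v b - v a) / (b - a) = v2 b * (d - a) / 2 + (\<rho>2 - \<rho>1)"
      by (simp add: \<rho>1_def \<rho>2_def field_simps)
    note DD = this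
    have D1: "(v b - v a) / (b - a) = v1 b - v2 b * (b - a) / 2 + \<rho>1" by (simp add: \<rho>1_def)
    have "(v b - v a) / (b - a) + w * ((v d - v b) / (d - b) - (v b - v a) / (b - a))
      = v1 b - v2 b * (b - a) / 2 + \<rho>1 + (v2 b * (w * (d - a)) / 2 + w * (\<rho>2 - \<rho>1))"
      by (simp only: DD) (simp add: D1 distrib_left mult_ac)
    also have "\<dots> = v1 b + v2 b * (s - b) + (\<rho>1 + w * (\<rho>2 - \<rho>1))"
      unfolding wH by (simp add: field_simps)
    finally have eq: "v1 s - ((v b - v a) / (b - a) + w * ((v d - v b) / (d - b) - (v b - v a) / (b - a)))
       = (v1 s - v1 b - v2 b * (s - b)) - (\<rho>1 + w * (\<rho>2 - \<rho>1))" by simp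
    have "\<bar>w * (\<rho>2 - \<rho>1)\<bar> \<le> 1 * \<bar>\<rho>2 - \<rho>1\<bar>" unfolding abs_mult using w by (intro mult_right_mono) auto
    moreover have "\<bar>\<rho>2 - \<rho>1\<bar> \<le> MH + MH"
      by (rule order_trans[OF abs_triangle_ineq4])
        (intro add_mono order_trans[OF r2 MH(2)] order_trans[OF r1[OF less_imp_le[OF bd]] MH(1)])
    ultimately have "\<bar>w * (\<rho>2 - \<rho>1)\<bar> \<le> 2 * MH" by simp
    moreover have "\<bar>v1 s - v1 b - v2 b * (s - b)\<bar> \<le> MH" "\<bar>\<rho>1\<bar> \<le> MH"
      using e1[OF less_imp_le[OF bd]] r1[OF less_imp_le[OF bd]] MH by linarith+
    ultimately have "\<bar>v1 s - ((v b - v a) / (b - a) + w * ((v d - v b) / (d - b) - (v b - v a) / (b - a)))\<bar>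
      \<le> 4 * MH" unfolding eq by linarith
    then show ?thesis by (simp add: w_def MH_def)
  qed
qed

text \<open>This is what singles out \<open>\<sigma> = 1 - \<beta>/2\<close>: with \<open>c = a + \<sigma> (b - a)\<close> the kernel
  is orthogonal to \<open>s - (a + b)/2\<close> on \<open>[a, c]\<close>, so linear interpolation in the last
  cell has third order.\<close>

lemma alikhanov_orthogonality:
  fixes a b c \<beta> :: real
  assumes "0 < \<beta>" "\<beta> < 1" "a < b" "c = a + (1 - \<beta> / 2) * (b - a)"
  shows "((\<lambda>s. (c - s) powr (- \<beta>) * (s - (a + b) / 2)) has_integral 0) {a..c}"
proof -
  define l where "l = c - a"
  have l: "l = (1 - \<beta> / 2) * (b - a)" "0 < l" using assms by (auto simp: l_def)
  have ac: "a \<le> c" using l by (simp add: l_def)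
  have "((\<lambda>s. (c - (a + b) / 2) * (c - s) powr (- \<beta>) - (c - s) powr (- (\<beta> - 1))) has_integral
     (c - (a + b) / 2) * ((c - a) powr (1 - \<beta>) / (1 - \<beta>)) - (c - a) powr (1 - (\<beta> - 1)) / (1 - (\<beta> - 1))) {a..c}"
    using assms ac by (intro has_integral_diff has_integral_mult_right integral_powr_end) auto
  moreover have "(c - (a + b) / 2) * ((c - a) powr (1 - \<beta>) / (1 - \<beta>)) - (c - a) powr (1 - (\<beta> - 1)) / (1 - (\<beta> - 1)) = 0"
  proof -
    have "(c - a) powr (1 - (\<beta> - 1)) = l * l powr (1 - \<beta>)"
      using l(2) by (simp add: l_def powr_mult_base)
    moreover have "c - (a + b) / 2 = (1 - \<beta>) / 2 * (b - a)" by (simp add: assms(4) field_simps)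
    ultimately show ?thesis using assms by (simp add: l_def[symmetric] l(1)) (simp add: field_simps)
  qed
  moreover have "(c - (a + b) / 2) * (c - s) powr (- \<beta>) - (c - s) powr (- (\<beta> - 1)) = (c - s) powr (- \<beta>) * (s - (a + b) / 2)"
    if "s \<in> {a..c}" for s
  proof (cases "s = c")
    case False
    then have "(c - s) powr (- (\<beta> - 1)) = (c - s) * (c - s) powr (- \<beta>)"
      using that by (simp add: powr_mult_base)
    then show ?thesis by (simp only:) (simp add: algebra_simps)
  qed auto
  ultimately show ?thesis by (metis (no_types, lifting) has_integral_eq)
qed

lemma kernel_integral_bound:
  fixes a c \<beta> B :: real
  assumes "a \<le> c" "\<beta> < 1" and f: "continuous_on {a..c} f" and B: "\<And>s. s \<in> {a..c} \<Longrightarrow> \<bar>f s\<bar> \<le> B"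
  shows "(\<lambda>s. (c - s) powr (- \<beta>) * f s) integrable_on {a..c}"
    and "\<bar>integral {a..c} (\<lambda>s. (c - s) powr (- \<beta>) * f s)\<bar> \<le> B * ((c - a) powr (1 - \<beta>) / (1 - \<beta>))"
proof -
  have h: "((\<lambda>s. (c - s) powr (- \<beta>)) has_integral (c - a) powr (1 - \<beta>) / (1 - \<beta>)) {a..c}"
    using assms by (intro integral_powr_end) auto
  then have "(\<lambda>s. (c - s) powr (- \<beta>)) absolutely_integrable_on {a..c}"
    by (intro nonnegative_absolutely_integrable_1) (auto simp: integrable_on_def)
  then have "(\<lambda>s. f s * (c - s) powr (- \<beta>)) absolutely_integrable_on {a..c}"
  proof (rule absolutely_integrable_bounded_measurable_product_real[rotated -1])
    show "f \<in> borel_measurable (lebesgue_on {a..c})"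
      using f by (intro continuous_imp_measurable_on_sets_lebesgue) auto
    show "bounded (f ` {a..c})" using B by (auto simp: bounded_iff intro!: exI[of _ B])
  qed auto
  then show i: "(\<lambda>s. (c - s) powr (- \<beta>) * f s) integrable_on {a..c}"
    by (simp add: mult.commute set_lebesgue_integral_eq_integral(1))
  have h2: "((\<lambda>s. B * (c - s) powr (- \<beta>)) has_integral B * ((c - a) powr (1 - \<beta>) / (1 - \<beta>))) {a..c}"
    by (intro has_integral_mult_right h)
  have "norm (integral {a..c} (\<lambda>s. (c - s) powr (- \<beta>) * f s)) \<le> integral {a..c} (\<lambda>s. B * (c - s) powr (- \<beta>))"
    using i h2 B by (intro integral_norm_bound_integral) (auto simp: abs_mult mult.commute intro!: mult_right_mono)
  then show "\<bar>integral {a..c} (\<lambda>s. (c - s) powr (- \<beta>) * f s)\<bar> \<le> B * ((c - a) powr (1 - \<beta>) / (1 - \<beta>))"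
    unfolding integral_unique[OF h2] by simp
qed

lemma sum_powr_le_suminf:
  fixes p :: real assumes "p < - 1"
  shows "(\<Sum>k=1..n. real k powr p) \<le> (\<Sum>k. real (Suc k) powr p)"
proof -
  have s: "summable (\<lambda>k. real (Suc k) powr p)"
    using summable_real_powr_iff[of p] assms by (subst summable_Suc_iff[of "\<lambda>k. real k powr p"]) auto
  have "(\<Sum>k=1..n. real k powr p) = (\<Sum>k<n. real (Suc k) powr p)"
    by (rule sum.reindex_bij_witness[of _ Suc "\<lambda>k. k - 1"]) auto
  also have "\<dots> \<le> (\<Sum>k. real (Suc k) powr p)" using s by (intro sum_le_suminf) auto
  finally show ?thesis .
qed

text \<open>The identity \<open>n/(k(n-k)) = 1/k + 1/(n-k)\<close> turns the convolution-type sum that collects the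
  errors of all cells into two convergent series.\<close>

lemma convolution_sum_bound:
  fixes x \<beta> :: real
  assumes "0 < \<beta>" "x + \<beta> - 3 \<le> 0"
  obtains Z where "0 < Z" "\<And>K n. 1 \<le> K \<Longrightarrow> (\<Sum>k=Suc K..n - 1. real k powr (- 4) * (real k / real n) powr x * (real n / real (n - k)) powr (\<beta> + 1))
    \<le> Z * real n powr (- x) * real K powr (x + \<beta> - 3)"
proof -
  define S where "S = (\<Sum>k. real (Suc k) powr (- \<beta> - 1))"
  define Z where "Z = 2 powr (\<beta> + 1) * (2 * S)"
  have "1 \<le> S" using sum_powr_le_suminf[of "- \<beta> - 1" 1] assms by (simp add: S_def)
  then have Z: "0 < Z" by (simp add: Z_def)
  show thesis
  proof (rule that[OF Z])
    fix K n :: nat assume K: "1 \<le> K"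
    have "(\<Sum>k=Suc K..n - 1. real k powr (- 4) * (real k / real n) powr x * (real n / real (n - k)) powr (\<beta> + 1))
      \<le> (\<Sum>k=Suc K..n - 1. (real n powr (- x) * real K powr (x + \<beta> - 3)) * (2 powr (\<beta> + 1) * (real k powr (- \<beta> - 1) + real (n - k) powr (- \<beta> - 1))))"
    proof (rule sum_mono)
      fix k assume k: "k \<in> {Suc K..n - 1}"
      define a b where "a = real k" and "b = real (n - k)"
      have ab: "0 < a" "0 < b" "real n = a + b" "real K \<le> a" "0 < real K" using k K by (auto simp: a_def b_def)
      have "a powr (- 4) * (a / (a + b)) powr x * ((a + b) / b) powr (\<beta> + 1)
         = (a + b) powr (- x) * a powr (x + \<beta> - 3) * ((a + b) / (a * b)) powr (\<beta> + 1)"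
        using ab by (simp add: powr_divide powr_mult powr_minus powr_add powr_diff field_simps)
          (simp add: eval_nat_numeral algebra_simps)
      also have "\<dots> \<le> (a + b) powr (- x) * real K powr (x + \<beta> - 3) * (2 powr (\<beta> + 1) * (a powr (- \<beta> - 1) + b powr (- \<beta> - 1)))"
      proof (intro mult_mono mult_nonneg_nonneg)
        show "a powr (x + \<beta> - 3) \<le> real K powr (x + \<beta> - 3)" using ab assms by (intro powr_mono2') auto
        have "(a + b) / (a * b) \<le> 2 / min a b" using ab by (auto simp: min_def field_simps)
        then have "((a + b) / (a * b)) powr (\<beta> + 1) \<le> (2 / min a b) powr (\<beta> + 1)"
          using ab assms by (intro powr_mono2) auto
        also have "\<dots> = 2 powr (\<beta> + 1) * min a b powr (- \<beta> - 1)"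
          using ab powr_minus_divide[of "min a b" "\<beta> + 1"] by (simp add: powr_divide)
        also have "\<dots> \<le> 2 powr (\<beta> + 1) * (a powr (- \<beta> - 1) + b powr (- \<beta> - 1))"
          by (intro mult_left_mono) (auto simp: min_def)
        finally show "((a + b) / (a * b)) powr (\<beta> + 1) \<le> 2 powr (\<beta> + 1) * (a powr (- \<beta> - 1) + b powr (- \<beta> - 1))" .
      qed auto
      finally show "real k powr (- 4) * (real k / real n) powr x * (real n / real (n - k)) powr (\<beta> + 1) \<le>
        (real n powr (- x) * real K powr (x + \<beta> - 3)) * (2 powr (\<beta> + 1) * (real k powr (- \<beta> - 1) + real (n - k) powr (- \<beta> - 1)))"
        by (simp only: a_def[symmetric] b_def[symmetric] ab(3))
    qed
    also have "\<dots> = (real n powr (- x) * real K powr (x + \<beta> - 3)) * (2 powr (\<beta> + 1) *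
       ((\<Sum>k=Suc K..n - 1. real k powr (- \<beta> - 1)) + (\<Sum>k=Suc K..n - 1. real (n - k) powr (- \<beta> - 1))))"
      by (simp only: sum_distrib_left[symmetric] sum.distrib)
    also have "\<dots> \<le> (real n powr (- x) * real K powr (x + \<beta> - 3)) * (2 powr (\<beta> + 1) * (S + S))"
    proof (intro mult_left_mono add_mono)
      have "(\<Sum>k=Suc K..n - 1. real k powr (- \<beta> - 1)) \<le> (\<Sum>k=1..n. real k powr (- \<beta> - 1))"
        by (intro sum_mono2) auto
      also have "\<dots> \<le> S" unfolding S_def using assms by (intro sum_powr_le_suminf) auto
      finally show "(\<Sum>k=Suc K..n - 1. real k powr (- \<beta> - 1)) \<le> S" .
      have "(\<Sum>k=Suc K..n - 1. real (n - k) powr (- \<beta> - 1)) = (\<Sum>k\<in>(\<lambda>k. n - k) ` {Suc K..n - 1}. real k powr (- \<beta> - 1))"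
        by (subst sum.reindex) (auto simp: inj_on_def)
      also have "\<dots> \<le> (\<Sum>k=1..n. real k powr (- \<beta> - 1))"
        by (intro sum_mono2) auto
      also have "\<dots> \<le> S" unfolding S_def using assms by (intro sum_powr_le_suminf) auto
      finally show "(\<Sum>k=Suc K..n - 1. real (n - k) powr (- \<beta> - 1)) \<le> S" .
    qed auto
    also have "\<dots> = Z * real n powr (- x) * real K powr (x + \<beta> - 3)" by (simp add: Z_def)
    finally show "(\<Sum>k=Suc K..n - 1. real k powr (- 4) * (real k / real n) powr x * (real n / real (n - k)) powr (\<beta> + 1))
    \<le> Z * real n powr (- x) * real K powr (x + \<beta> - 3)" .
  qed
qed

context quasi_graded_meshes
begin

text \<open>The left-hand side is the contribution of the \<open>k\<close>-th cell to the truncation error.  On a graded mesh the power of \<open>t\<^sub>n\<close> factors out,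
  and the dependence on \<open>k\<close> is that of the sum in \<open>convolution_sum_bound\<close>.\<close>

lemma cell_error:
  assumes "1 \<le> k" "k < n" "n \<le> N" "- 1 \<le> \<mu>" "\<mu> \<le> 1" "x \<le> r * (\<mu> + 1)"
  shows "mstep (t N) k ^ 4 * (tstar \<sigma> (t N) n - t N k) powr (- \<beta> - 1) * t N k powr (\<mu> - 3)
    \<le> Q ^ 4 * G powr (\<beta> + 1) * (Q\<^sup>2) powr (\<mu> + 1) * t N n powr (\<mu> - \<beta>)
      * (real k powr (- 4) * (real k / real n) powr x * (real n / real (n - k)) powr (\<beta> + 1))"
proof -
  define c where "c = tstar \<sigma> (t N) n"
  have tp: "0 < t N k" "0 < t N n" using t_pos assms by auto
  have kn: "0 < real k" "0 < real n" "0 < real (n - k)" "real k / real n \<le> 1" using assms by auto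
  have "mstep (t N) k ^ 4 \<le> (Q * (t N k / real k)) ^ 4"
    using step_upper[of k N] mstep_pos[of k N] assms by (intro power_mono) auto
  also have "\<dots> = Q ^ 4 * real k powr (- 4) * t N k powr 4"
    using tp kn by (simp add: power_mult_distrib power_divide powr_minus divide_inverse power_inverse)
  finally have 1: "mstep (t N) k ^ 4 \<le> Q ^ 4 * real k powr (- 4) * t N k powr 4" .
  have "t N n * (real (n - k) / real n) / G \<le> c - t N k"
    using tstar_gap[of k n N] assms G_ge by (simp add: c_def field_simps)
  then have "(c - t N k) powr (- \<beta> - 1) \<le> (t N n * (real (n - k) / real n) / G) powr (- \<beta> - 1)"
    using tp kn G_ge \<beta>_pos by (intro powr_mono2') auto
  also have "\<dots> = G powr (\<beta> + 1) * t N n powr (- \<beta> - 1) * (real n / real (n - k)) powr (\<beta> + 1)"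
  proof -
    have "y powr (- \<beta> - 1) = 1 / y powr (\<beta> + 1)" for y :: real
      using powr_minus_divide[of y "\<beta> + 1"] by simp
    then show ?thesis using tp kn G_ge by (simp add: powr_divide powr_mult)
  qed
  finally have 2: "(c - t N k) powr (- \<beta> - 1) \<le> G powr (\<beta> + 1) * t N n powr (- \<beta> - 1) * (real n / real (n - k)) powr (\<beta> + 1)" .
  have "t N k powr (\<mu> + 1) \<le> (Q\<^sup>2 * t N n * (real k / real n) powr r) powr (\<mu> + 1)"
    using t_ratio[of k N n] tp assms by (intro powr_mono2) auto
  also have "\<dots> = (Q\<^sup>2) powr (\<mu> + 1) * t N n powr (\<mu> + 1) * (real k / real n) powr (r * (\<mu> + 1))"
    using tp Q_ge by (simp add: powr_mult powr_powr)
  also have "\<dots> \<le> (Q\<^sup>2) powr (\<mu> + 1) * t N n powr (\<mu> + 1) * (real k / real n) powr x"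
    using assms kn by (intro mult_left_mono powr_mono') auto
  finally have 3: "t N k powr (\<mu> + 1) \<le> (Q\<^sup>2) powr (\<mu> + 1) * t N n powr (\<mu> + 1) * (real k / real n) powr x" .
  have "mstep (t N) k ^ 4 * (c - t N k) powr (- \<beta> - 1) * t N k powr (\<mu> - 3)
    \<le> (Q ^ 4 * real k powr (- 4) * t N k powr 4) * (G powr (\<beta> + 1) * t N n powr (- \<beta> - 1) * (real n / real (n - k)) powr (\<beta> + 1)) * t N k powr (\<mu> - 3)"
    using 1 2 mstep_pos[of k N] assms by (intro mult_mono) (auto simp: less_imp_le)
  also have "\<dots> = (Q ^ 4 * G powr (\<beta> + 1) * real k powr (- 4) * t N n powr (- \<beta> - 1) * (real n / real (n - k)) powr (\<beta> + 1)) * (t N k powr 4 * t N k powr (\<mu> - 3))"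
    by (simp only: mult_ac)
  also have "t N k powr 4 * t N k powr (\<mu> - 3) = t N k powr (\<mu> + 1)"
    by (simp only: powr_add[symmetric]) (simp add: add.commute)
  also have "(Q ^ 4 * G powr (\<beta> + 1) * real k powr (- 4) * t N n powr (- \<beta> - 1) * (real n / real (n - k)) powr (\<beta> + 1)) * t N k powr (\<mu> + 1)
    \<le> (Q ^ 4 * G powr (\<beta> + 1) * real k powr (- 4) * t N n powr (- \<beta> - 1) * (real n / real (n - k)) powr (\<beta> + 1)) * ((Q\<^sup>2) powr (\<mu> + 1) * t N n powr (\<mu> + 1) * (real k / real n) powr x)"
    using 3 Q_ge by (intro mult_left_mono) auto
  also have "\<dots> = Q ^ 4 * G powr (\<beta> + 1) * (Q\<^sup>2) powr (\<mu> + 1) * (t N n powr (- \<beta> - 1) * t N n powr (\<mu> + 1))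
      * (real k powr (- 4) * (real k / real n) powr x * (real n / real (n - k)) powr (\<beta> + 1))"
    by (simp only: mult_ac)
  also have "t N n powr (- \<beta> - 1) * t N n powr (\<mu> + 1) = t N n powr (\<mu> - \<beta>)"
    by (simp only: powr_add[symmetric]) simp
  finally show ?thesis by (simp only: c_def)
qed

lemma t_pred_powr:
  assumes "2 \<le> k" "k \<le> N" "\<mu> \<le> 1"
  shows "t N (k - 1) powr (\<mu> - 3) \<le> E powr (3 - \<mu>) * t N k powr (\<mu> - 3)"
proof -
  have tp: "0 < t N (k - 1)" "0 < t N k" using assms t_pos by auto
  have "t N k / E \<le> t N (k - 1)"
    using t_Suc_le[of "k - 1" N] assms E_ge by (simp add: field_simps)
  then have "t N (k - 1) powr (\<mu> - 3) \<le> (t N k / E) powr (\<mu> - 3)"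
    using tp E_ge assms by (intro powr_mono2') auto
  also have "\<dots> = E powr (3 - \<mu>) * t N k powr (\<mu> - 3)"
    using tp E_ge powr_minus_divide[of E "\<mu> - 3"] by (simp add: powr_divide)
  finally show ?thesis .
qed

text \<open>The interpolant agrees with \<open>v\<close> at both ends of the cell, so the error of its derivative has mean zero and only the
  oscillation of the kernel counts.\<close>

lemma quad_cell_integral:
  assumes k: "1 \<le> k" "k < n" "n \<le> N"
    and d0: "\<And>z. z \<in> {t N (k - 1)..t N (k + 1)} \<Longrightarrow> (v has_real_derivative v1 z) (at z within {t N (k - 1)..t N (k + 1)})"
    and d1: "\<And>z. z \<in> {t N (k - 1)..t N (k + 1)} \<Longrightarrow> (v1 has_real_derivative v2 z) (at z within {t N (k - 1)..t N (k + 1)})"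
    and d2: "\<And>z. z \<in> {t N (k - 1)..t N (k + 1)} \<Longrightarrow> (v2 has_real_derivative v3 z) (at z within {t N (k - 1)..t N (k + 1)})"
    and M: "\<And>z. z \<in> {t N (k - 1)..t N (k + 1)} \<Longrightarrow> \<bar>v3 z\<bar> \<le> M"
    and V: "V (k - 1) = v (t N (k - 1))" "V k = v (t N k)" "V (k + 1) = v (t N (k + 1))"
  shows "\<bar>integral {t N (k - 1)..t N k} (\<lambda>s. (tstar \<sigma> (t N) n - s) powr (- \<beta>) * (v1 s - deriv (quad_interp (t N) V k) s))\<bar>
     \<le> 4 * (1 + E)\<^sup>2 * M * mstep (t N) k ^ 4 * (tstar \<sigma> (t N) n - t N k) powr (- \<beta> - 1)"
proof -
  define a b d c where "a = t N (k - 1)" and "b = t N k" and "d = t N (k + 1)" and "c = tstar \<sigma> (t N) n"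
  have ab: "a < b" "b < d" using k t_less by (auto simp: a_def b_def d_def)
  have "t N k \<le> t N (n - 1)" using k by (intro t_le) auto
  also have "\<dots> < c" using tstar_bounds k by (auto simp: c_def)
  finally have bc: "b < c" by (simp add: b_def)
  define q where "q s = (v b - v a) / (b - a) + 2 / (d - a) * (s - (a + b) / 2) *
      ((v d - v b) / (d - b) - (v b - v a) / (b - a))" for s
  have q: "deriv (quad_interp (t N) V k) s = q s" for s
    using deriv_quad_interp[of "t N" k V s] ab V by (simp add: q_def a_def b_def d_def mstep_def)
  have M0: "0 \<le> M" using M[of "t N k"] ab unfolding a_def b_def d_def by fastforce
  have err: "\<bar>v1 s - q s\<bar> \<le> 4 * M * (d - a)\<^sup>2" if "s \<in> {a..b}" for s
    unfolding q_def using d0 d1 d2 M ab that unfolding a_def b_def d_def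
    by (intro interpolant_deriv_error(2)[of _ _ v v1 v2 v3]) auto
  have sub: "{a..b} \<subseteq> {a..d}" using ab by auto
  have v1c: "continuous_on {a..b} v1"
    using continuous_on_subset[OF DERIV_continuous_on[OF d1] sub[unfolded a_def b_def d_def]]
    unfolding a_def b_def d_def .
  have hv: "(v1 has_integral v b - v a) {a..b}"
  proof (rule fundamental_theorem_of_calculus)
    fix z assume z: "z \<in> {a..b}"
    then have "(v has_real_derivative v1 z) (at z within {a..d})"
      using d0 sub unfolding a_def b_def d_def by blast
    then show "(v has_vector_derivative v1 z) (at z within {a..b})"
      using sub by (simp add: DERIV_subset flip: has_real_derivative_iff_has_vector_derivative)
  qed (use ab in auto)
  have hq: "(q has_integral (v b - v a)) {a..b}"
  proof -
    have "(q has_integral (b - a) *\<^sub>R ((v b - v a) / (b - a)) + 2 / (d - a) * 0 *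
      ((v d - v b) / (d - b) - (v b - v a) / (b - a))) {a..b}"
      unfolding q_def using has_integral_const_real[of "(v b - v a) / (b - a)" a b] ab
      by (intro has_integral_add has_integral_mult_right has_integral_mult_left has_integral_centered) auto
    then show ?thesis using ab by simp
  qed
  have qc: "continuous_on {a..b} q"
    unfolding q_def using ab by (intro continuous_intros) auto
  have z: "((\<lambda>s. v1 s - q s) has_integral 0) {a..b}" using has_integral_diff[OF hv hq] by simp
  have "\<bar>integral {a..b} (\<lambda>s. (c - s) powr (- \<beta>) * (v1 s - q s))\<bar>
     \<le> \<beta> * (b - a) * (c - b) powr (- \<beta> - 1) * ((b - a) * (4 * M * (d - a)\<^sup>2))"
  proof (rule kernel_oscillation[where \<eta> = "\<lambda>_. 4 * M * (d - a)\<^sup>2"])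
    show "((\<lambda>_. 4 * M * (d - a)\<^sup>2) has_integral (b - a) * (4 * M * (d - a)\<^sup>2)) {a..b}"
      using has_integral_const_real[of "4 * M * (d - a)\<^sup>2" a b] ab by simp
    show "(\<lambda>s. (c - s) powr (- \<beta>) * (v1 s - q s)) integrable_on {a..b}"
      by (intro integrable_continuous_interval continuous_on_mult kernel_continuous[OF bc] continuous_on_diff v1c qc)
  qed (use ab bc \<beta>_pos z err in auto)
  also have "\<dots> \<le> 1 * (b - a) * (c - b) powr (- \<beta> - 1) * ((b - a) * (4 * M * ((1 + E) * (b - a))\<^sup>2))"
  proof (intro mult_mono mult_nonneg_nonneg power_mono)
    have "d - b \<le> E * (b - a)" using mstep_Suc_le(1)[of k N] k by (simp add: a_def b_def d_def mstep_def)
    then show "d - a \<le> (1 + E) * (b - a)" by (simp add: algebra_simps)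
  qed (use ab \<beta>_lt \<beta>_pos M0 E_ge in auto)
  also have "\<dots> = 4 * (1 + E)\<^sup>2 * M * (b - a) ^ 4 * (c - b) powr (- \<beta> - 1)"
    by (simp add: eval_nat_numeral power_mult_distrib mult_ac)
  finally show ?thesis unfolding q by (simp only: a_def b_def c_def mstep_def)
qed

lemma last_cell_integral:
  assumes n: "1 \<le> n" "n \<le> N"
    and d0: "\<And>z. z \<in> {t N (n - 1)..t N n} \<Longrightarrow> (v has_real_derivative v1 z) (at z within {t N (n - 1)..t N n})"
    and d1: "\<And>z. z \<in> {t N (n - 1)..t N n} \<Longrightarrow> (v1 has_real_derivative v2 z) (at z within {t N (n - 1)..t N n})"
    and d2: "\<And>z. z \<in> {t N (n - 1)..t N n} \<Longrightarrow> (v2 has_real_derivative v3 z) (at z within {t N (n - 1)..t N n})"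
    and M: "\<And>z. z \<in> {t N (n - 1)..t N n} \<Longrightarrow> \<bar>v3 z\<bar> \<le> M"
    and V: "V (n - 1) = v (t N (n - 1))" "V n = v (t N n)"
  shows "\<bar>integral {t N (n - 1)..tstar \<sigma> (t N) n} (\<lambda>s. (tstar \<sigma> (t N) n - s) powr (- \<beta>) * (v1 s - deriv (lin_interp (t N) V n) s))\<bar>
     \<le> 2 * M * mstep (t N) n powr (3 - \<beta>) / (1 - \<beta>)"
proof -
  define a b c where "a = t N (n - 1)" and "b = t N n" and "c = tstar \<sigma> (t N) n"
  have ab: "a < b" "a < c" "c < b" using n t_less[of "n - 1" n N] tstar_bounds[of n N] by (auto simp: a_def b_def c_def)
  have ca: "c - a = \<sigma> * (b - a)" using tstar_bounds[of n N] n by (simp add: a_def b_def c_def mstep_def)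
  have M0: "0 \<le> M" using M[of "t N n"] ab unfolding a_def b_def by fastforce
  define D where "D = (v b - v a) / (b - a)"
  have l: "deriv (lin_interp (t N) V n) s = D" for s
    using deriv_lin_interp[of "t N" n V s] ab V by (simp add: D_def a_def b_def mstep_def)
  have err: "\<bar>v1 s - D - v2 b * (s - (a + b) / 2)\<bar> \<le> 2 * M * (b - a)\<^sup>2" if "s \<in> {a..c}" for s
    unfolding D_def using d0 d1 d2 M ab that unfolding a_def b_def
    by (intro interpolant_deriv_error(1)[of _ _ v v1 v2 v3]) auto
  have v1c: "continuous_on {a..c} v1"
    using ab unfolding a_def b_def by (intro continuous_on_subset[OF DERIV_continuous_on[OF d1]]) auto
  have o: "((\<lambda>s. (c - s) powr (- \<beta>) * (s - (a + b) / 2)) has_integral 0) {a..c}"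
    using alikhanov_orthogonality[of \<beta> a b c] \<beta>_pos \<beta>_lt ab ca by (simp add: \<sigma>_eq algebra_simps)
  have cf: "continuous_on {a..c} (\<lambda>s. v1 s - D - v2 b * (s - (a + b) / 2))"
    using v1c by (intro continuous_intros) auto
  note kb = kernel_integral_bound[OF less_imp_le[OF ab(2)] \<beta>_lt cf err]
  have "((\<lambda>s. (c - s) powr (- \<beta>) * (v1 s - D - v2 b * (s - (a + b) / 2)) + v2 b * ((c - s) powr (- \<beta>) * (s - (a + b) / 2)))
     has_integral integral {a..c} (\<lambda>s. (c - s) powr (- \<beta>) * (v1 s - D - v2 b * (s - (a + b) / 2))) + v2 b * 0) {a..c}"
    using kb(1) by (intro has_integral_add has_integral_mult_right o integrable_integral)
  moreover have "(\<lambda>s. (c - s) powr (- \<beta>) * (v1 s - D - v2 b * (s - (a + b) / 2)) + v2 b * ((c - s) powr (- \<beta>) * (s - (a + b) / 2)))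
     = (\<lambda>s. (c - s) powr (- \<beta>) * (v1 s - D))"
    by (intro ext) (simp add: algebra_simps)
  ultimately have "integral {a..c} (\<lambda>s. (c - s) powr (- \<beta>) * (v1 s - D)) =
      integral {a..c} (\<lambda>s. (c - s) powr (- \<beta>) * (v1 s - D - v2 b * (s - (a + b) / 2)))"
    by (simp add: integral_unique)
  then have "\<bar>integral {a..c} (\<lambda>s. (c - s) powr (- \<beta>) * (v1 s - D))\<bar> \<le> 2 * M * (b - a)\<^sup>2 * ((c - a) powr (1 - \<beta>) / (1 - \<beta>))"
    using kb(2) by simp
  also have "\<dots> \<le> 2 * M * (b - a)\<^sup>2 * ((b - a) powr (1 - \<beta>) / (1 - \<beta>))"
    using M0 ab \<beta>_lt by (intro mult_left_mono divide_right_mono powr_mono2) auto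
  also have "(b - a)\<^sup>2 * ((b - a) powr (1 - \<beta>) / (1 - \<beta>)) = (b - a) powr (3 - \<beta>) / (1 - \<beta>)"
    using ab powr_add[of "b - a" 2 "1 - \<beta>"] by simp
  then have "2 * M * (b - a)\<^sup>2 * ((b - a) powr (1 - \<beta>) / (1 - \<beta>)) = 2 * M * (b - a) powr (3 - \<beta>) / (1 - \<beta>)"
    using \<beta>_lt by auto
  finally show ?thesis unfolding l by (simp only: a_def b_def c_def mstep_def)
qed

text \<open>The truncation error that is accumulated from \<open>t\<^sub>K\<close> on, for functions that behave like \<open>s\<^sup>\<mu>\<close>.  The
  estimate is applied with \<open>K = 1\<close> to the solution, and to the barriers from their kink \<open>t\<^sub>K\<close> on, where the decay in \<open>K\<close> matters.\<close>

definition truncation_rate :: "real \<Rightarrow> real \<Rightarrow> real \<Rightarrow> bool" where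
  "truncation_rate \<mu> x C \<longleftrightarrow> (\<forall>N n K M v v1 v2 v3 V. 1 \<le> K \<longrightarrow> K < n \<longrightarrow> n \<le> N \<longrightarrow> 0 \<le> M \<longrightarrow>
     (\<forall>z \<in> {t N K..t N n}. (v has_real_derivative v1 z) (at z within {t N K..t N n})) \<longrightarrow>
     (\<forall>z \<in> {t N K..t N n}. (v1 has_real_derivative v2 z) (at z within {t N K..t N n})) \<longrightarrow>
     (\<forall>z \<in> {t N K..t N n}. (v2 has_real_derivative v3 z) (at z within {t N K..t N n})) \<longrightarrow>
     (\<forall>z \<in> {t N K..t N n}. \<bar>v3 z\<bar> \<le> M * z powr (\<mu> - 3)) \<longrightarrow>
     (\<forall>k \<in> {K..n}. V k = v (t N k)) \<longrightarrow>
     \<bar>(\<Sum>k=Suc K..n - 1. integral {t N (k - 1)..t N k} (\<lambda>s. (tstar \<sigma> (t N) n - s) powr (- \<beta>) * (v1 s - deriv (quad_interp (t N) V k) s)))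
      + integral {t N (n - 1)..tstar \<sigma> (t N) n} (\<lambda>s. (tstar \<sigma> (t N) n - s) powr (- \<beta>) * (v1 s - deriv (lin_interp (t N) V n) s))\<bar>
     \<le> C * M * t N n powr (\<mu> - \<beta>) * real n powr (- x) * real K powr (x + \<beta> - 3))"

lemma truncation_smooth:
  assumes \<mu>: "- 1 \<le> \<mu>" "\<mu> \<le> 1" and x: "x \<le> r * (\<mu> + 1)" "x \<le> 3 - \<beta>"
  obtains C where "0 < C" "truncation_rate \<mu> x C"
proof -
  obtain Z where Z: "0 < Z" "\<And>K n. 1 \<le> K \<Longrightarrow> (\<Sum>k=Suc K..n - 1. real k powr (- 4) * (real k / real n) powr x * (real n / real (n - k)) powr (\<beta> + 1))
    \<le> Z * real n powr (- x) * real K powr (x + \<beta> - 3)"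
    using convolution_sum_bound[of \<beta> x] \<beta>_pos x by auto
  define C1 where "C1 = 4 * (1 + E)\<^sup>2 * E powr (3 - \<mu>) * (Q ^ 4 * G powr (\<beta> + 1) * (Q\<^sup>2) powr (\<mu> + 1))"
  define C2 where "C2 = 2 * E powr (3 - \<mu>) * Q powr (3 - \<beta>) / (1 - \<beta>)"
  have C: "0 < C1" "0 < C2" using E_ge Q_ge G_ge \<beta>_lt by (auto simp: C1_def C2_def)
  show thesis
  proof (rule that[of "C1 * Z + C2"])
    show "0 < C1 * Z + C2" using C Z(1) by (intro add_pos_pos mult_pos_pos)
    show "truncation_rate \<mu> x (C1 * Z + C2)"
      unfolding truncation_rate_def
    proof (intro allI impI)
    fix N n K :: nat and M :: real and v v1 v2 v3 :: "real \<Rightarrow> real" and V :: "nat \<Rightarrow> real"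
    assume K: "1 \<le> K" "K < n" "n \<le> N" and M: "0 \<le> M"
      and d0': "\<forall>z\<in>{t N K..t N n}. (v has_real_derivative v1 z) (at z within {t N K..t N n})"
      and d1': "\<forall>z\<in>{t N K..t N n}. (v1 has_real_derivative v2 z) (at z within {t N K..t N n})"
      and d2': "\<forall>z\<in>{t N K..t N n}. (v2 has_real_derivative v3 z) (at z within {t N K..t N n})"
      and v3': "\<forall>z\<in>{t N K..t N n}. \<bar>v3 z\<bar> \<le> M * z powr (\<mu> - 3)"
      and V': "\<forall>k\<in>{K..n}. V k = v (t N k)"
    note d0 = d0'[rule_format] and d1 = d1'[rule_format] and d2 = d2'[rule_format] and v3 = v3'[rule_format]
    have V: "V k = v (t N k)" if "K \<le> k" "k \<le> n" for k using V' that by auto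
    define c where "c = tstar \<sigma> (t N) n"
    define R where "R = real n powr (- x) * real K powr (x + \<beta> - 3)"
    have tp: "0 < t N k" if "k \<in> {K..n}" for k using that K t_pos by auto
    have sub: "{t N i..t N j} \<subseteq> {t N K..t N n}" if "K \<le> i" "j \<le> n" "i \<le> n" for i j
      using that K t_le[of K i N] t_le[of j n N] by (intro atLeastatMost_subset_iff[THEN iffD2]) auto
    have M3: "\<bar>v3 z\<bar> \<le> M * E powr (3 - \<mu>) * t N k powr (\<mu> - 3)"
      if k: "k \<in> {Suc K..n}" and z: "z \<in> {t N (k - 1)..t N n}" for k z
    proof -
      have "{t N (k - 1)..t N n} \<subseteq> {t N K..t N n}" using k K by (intro sub) auto
      then have "z \<in> {t N K..t N n}" using z by blast
      then have "\<bar>v3 z\<bar> \<le> M * z powr (\<mu> - 3)" by (rule v3)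
      moreover have tk: "0 < t N (k - 1)" using k K by (intro t_pos) auto
      moreover have "M * z powr (\<mu> - 3) \<le> M * t N (k - 1) powr (\<mu> - 3)"
        using z tk M \<mu> by (intro mult_left_mono powr_mono2') auto
      moreover have "M * t N (k - 1) powr (\<mu> - 3) \<le> M * (E powr (3 - \<mu>) * t N k powr (\<mu> - 3))"
        using k K M \<mu> by (intro mult_left_mono t_pred_powr) auto
      ultimately show ?thesis by (simp add: mult.assoc)
    qed
    have cell: "\<bar>integral {t N (k - 1)..t N k} (\<lambda>s. (c - s) powr (- \<beta>) * (v1 s - deriv (quad_interp (t N) V k) s))\<bar>
       \<le> C1 * M * t N n powr (\<mu> - \<beta>) * (real k powr (- 4) * (real k / real n) powr x * (real n / real (n - k)) powr (\<beta> + 1))"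
      if k: "k \<in> {Suc K..n - 1}" for k
    proof -
      have s: "{t N (k - 1)..t N (k + 1)} \<subseteq> {t N K..t N n}" using k K by (intro sub) auto
      have s': "{t N (k - 1)..t N (k + 1)} \<subseteq> {t N (k - 1)..t N n}" using k K t_le[of "k + 1" n N] by auto
      have "\<bar>integral {t N (k - 1)..t N k} (\<lambda>s. (c - s) powr (- \<beta>) * (v1 s - deriv (quad_interp (t N) V k) s))\<bar>
        \<le> 4 * (1 + E)\<^sup>2 * (M * E powr (3 - \<mu>) * t N k powr (\<mu> - 3)) * mstep (t N) k ^ 4 * (c - t N k) powr (- \<beta> - 1)"
        unfolding c_def
      proof (rule quad_cell_integral)
        fix z assume z: "z \<in> {t N (k - 1)..t N (k + 1)}"
        show "(v has_real_derivative v1 z) (at z within {t N (k - 1)..t N (k + 1)})"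
          "(v1 has_real_derivative v2 z) (at z within {t N (k - 1)..t N (k + 1)})"
          "(v2 has_real_derivative v3 z) (at z within {t N (k - 1)..t N (k + 1)})"
          using z s d0 d1 d2 by (blast intro: DERIV_subset)+
        show "\<bar>v3 z\<bar> \<le> M * E powr (3 - \<mu>) * t N k powr (\<mu> - 3)" using z s' k by (intro M3) auto
      qed (use k K V in auto)
      also have "\<dots> = 4 * (1 + E)\<^sup>2 * M * E powr (3 - \<mu>) * (mstep (t N) k ^ 4 * (c - t N k) powr (- \<beta> - 1) * t N k powr (\<mu> - 3))"
        by (simp only: mult_ac)
      also have "\<dots> \<le> 4 * (1 + E)\<^sup>2 * M * E powr (3 - \<mu>) * (Q ^ 4 * G powr (\<beta> + 1) * (Q\<^sup>2) powr (\<mu> + 1) * t N n powr (\<mu> - \<beta>)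
      * (real k powr (- 4) * (real k / real n) powr x * (real n / real (n - k)) powr (\<beta> + 1)))"
        unfolding c_def using k K \<mu> x M E_ge by (intro mult_left_mono cell_error) auto
      finally show ?thesis by (simp only: C1_def mult_ac)
    qed
    have "\<bar>\<Sum>k=Suc K..n - 1. integral {t N (k - 1)..t N k} (\<lambda>s. (c - s) powr (- \<beta>) * (v1 s - deriv (quad_interp (t N) V k) s))\<bar>
      \<le> (\<Sum>k=Suc K..n - 1. C1 * M * t N n powr (\<mu> - \<beta>) * (real k powr (- 4) * (real k / real n) powr x * (real n / real (n - k)) powr (\<beta> + 1)))"
      using cell by (intro order_trans[OF sum_abs] sum_mono) auto
    also have "\<dots> \<le> C1 * M * t N n powr (\<mu> - \<beta>) * (Z * real n powr (- x) * real K powr (x + \<beta> - 3))"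
      unfolding sum_distrib_left[symmetric] using C M K by (intro mult_left_mono Z(2)) auto
    finally have A: "\<bar>\<Sum>k=Suc K..n - 1. integral {t N (k - 1)..t N k} (\<lambda>s. (c - s) powr (- \<beta>) * (v1 s - deriv (quad_interp (t N) V k) s))\<bar>
      \<le> C1 * Z * (M * t N n powr (\<mu> - \<beta>) * R)" by (simp only: R_def mult_ac)
    have s: "{t N (n - 1)..t N n} \<subseteq> {t N K..t N n}" using K by (intro sub) auto
    have "\<bar>integral {t N (n - 1)..c} (\<lambda>s. (c - s) powr (- \<beta>) * (v1 s - deriv (lin_interp (t N) V n) s))\<bar>
      \<le> 2 * (M * E powr (3 - \<mu>) * t N n powr (\<mu> - 3)) * mstep (t N) n powr (3 - \<beta>) / (1 - \<beta>)"
      unfolding c_def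
    proof (rule last_cell_integral)
      fix z assume z: "z \<in> {t N (n - 1)..t N n}"
      show "(v has_real_derivative v1 z) (at z within {t N (n - 1)..t N n})"
          "(v1 has_real_derivative v2 z) (at z within {t N (n - 1)..t N n})"
          "(v2 has_real_derivative v3 z) (at z within {t N (n - 1)..t N n})"
        using z s d0 d1 d2 by (blast intro: DERIV_subset)+
      show "\<bar>v3 z\<bar> \<le> M * E powr (3 - \<mu>) * t N n powr (\<mu> - 3)" using z K by (intro M3) auto
    qed (use K V in auto)
    also have "\<dots> \<le> 2 * (M * E powr (3 - \<mu>) * t N n powr (\<mu> - 3)) * (Q * (t N n / real n)) powr (3 - \<beta>) / (1 - \<beta>)"
      using K M \<beta>_lt step_upper[of n N] mstep_pos[of n N]
      by (intro divide_right_mono mult_left_mono powr_mono2) auto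
    also have "(Q * (t N n / real n)) powr (3 - \<beta>) = Q powr (3 - \<beta>) * t N n powr (3 - \<beta>) * real n powr (\<beta> - 3)"
      using tp[of n] Q_ge K powr_minus_divide[of "real n" "3 - \<beta>"] by (simp add: powr_mult powr_divide)
    also have "2 * (M * E powr (3 - \<mu>) * t N n powr (\<mu> - 3)) * (Q powr (3 - \<beta>) * t N n powr (3 - \<beta>) * real n powr (\<beta> - 3)) / (1 - \<beta>)
      = C2 * (M * (t N n powr (\<mu> - 3) * t N n powr (3 - \<beta>)) * real n powr (\<beta> - 3))"
      by (simp add: C2_def)
    also have "t N n powr (\<mu> - 3) * t N n powr (3 - \<beta>) = t N n powr (\<mu> - \<beta>)"
      by (simp only: powr_add[symmetric]) simp
    also have "real n powr (\<beta> - 3) = real n powr (- x) * real n powr (x + \<beta> - 3)"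
      by (simp only: powr_add[symmetric]) simp
    also have "C2 * (M * t N n powr (\<mu> - \<beta>) * (real n powr (- x) * real n powr (x + \<beta> - 3))) \<le> C2 * (M * t N n powr (\<mu> - \<beta>) * R)"
      unfolding R_def using C M K x by (intro mult_left_mono powr_mono2') auto
    finally have B: "\<bar>integral {t N (n - 1)..c} (\<lambda>s. (c - s) powr (- \<beta>) * (v1 s - deriv (lin_interp (t N) V n) s))\<bar>
      \<le> C2 * (M * t N n powr (\<mu> - \<beta>) * R)" .
    have "(C1 * Z + C2) * M * t N n powr (\<mu> - \<beta>) * real n powr (- x) * real K powr (x + \<beta> - 3)
       = C1 * Z * (M * t N n powr (\<mu> - \<beta>) * R) + C2 * (M * t N n powr (\<mu> - \<beta>) * R)"
      by (simp add: R_def algebra_simps)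
    then show "\<bar>(\<Sum>k=Suc K..n - 1. integral {t N (k - 1)..t N k} (\<lambda>s. (tstar \<sigma> (t N) n - s) powr (- \<beta>) * (v1 s - deriv (quad_interp (t N) V k) s)))
      + integral {t N (n - 1)..tstar \<sigma> (t N) n} (\<lambda>s. (tstar \<sigma> (t N) n - s) powr (- \<beta>) * (v1 s - deriv (lin_interp (t N) V n) s))\<bar>
     \<le> (C1 * Z + C2) * M * t N n powr (\<mu> - \<beta>) * real n powr (- x) * real K powr (x + \<beta> - 3)"
      using A B unfolding c_def by linarith
    qed
  qed
qed

end

section \<open>Decaying barriers and stability\<close>

text \<open>The kernel of the Caputo derivative applied to \<open>s\<^sup>\<beta>\<^sup>-\<^sup>1\<close>, whose Riemann-Liouville derivative
  vanishes, has an elementary primitive.\<close>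

lemma kernel_power_integral:
  fixes a c \<beta> :: real
  assumes "0 < a" "a < c" "0 < \<beta>" "\<beta> < 1"
  shows "((\<lambda>s. (c - s) powr (- \<beta>) * s powr (\<beta> - 2)) has_integral ((c - a) / a) powr (1 - \<beta>) / ((1 - \<beta>) * c)) {a..c}"
proof -
  define F where "F s = - (((c - s) / s) powr (1 - \<beta>) / ((1 - \<beta>) * c))" for s
  have "((\<lambda>s. (c - s) powr (- \<beta>) * s powr (\<beta> - 2)) has_integral F c - F a) {a..c}"
  proof (rule fundamental_theorem_of_calculus_interior)
    show "a \<le> c" using assms by simp
    show "continuous_on {a..c} F"
      unfolding F_def using assms by (intro continuous_intros continuous_on_powr') auto
    fix s assume s: "s \<in> {a<..<c}"
    have p: "0 < s" "0 < c - s" using s assms by auto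
    have "((\<lambda>s. (c - s) / s) has_real_derivative - c / s\<^sup>2) (at s)"
      using p by (auto intro!: derivative_eq_intros simp: field_simps power2_eq_square)
    from DERIV_fun_powr[OF this, of "1 - \<beta>"]
    have "((\<lambda>s. ((c - s) / s) powr (1 - \<beta>)) has_real_derivative
        (1 - \<beta>) * ((c - s) / s) powr (1 - \<beta> - 1) * (- c / s\<^sup>2)) (at s)" using p by simp
    then have "(F has_real_derivative - ((1 - \<beta>) * ((c - s) / s) powr (1 - \<beta> - 1) * (- c / s\<^sup>2) / ((1 - \<beta>) * c))) (at s)"
      unfolding F_def by (intro DERIV_minus DERIV_cdivide)
    also have "- ((1 - \<beta>) * ((c - s) / s) powr (1 - \<beta> - 1) * (- c / s\<^sup>2) / ((1 - \<beta>) * c)) = ((c - s) / s) powr (- \<beta>) / s\<^sup>2"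
      using assms p by (simp add: field_simps)
    also have "\<dots> = (c - s) powr (- \<beta>) * s powr (\<beta> - 2)"
      using p by (simp add: powr_divide powr_minus powr_diff field_simps)
    finally show "(F has_vector_derivative (c - s) powr (- \<beta>) * s powr (\<beta> - 2)) (at s)"
      by (simp flip: has_real_derivative_iff_has_vector_derivative)
  qed
  then show ?thesis by (simp add: F_def)
qed

text \<open>Hence a function that equals \<open>a\<^sup>\<beta>\<^sup>-\<^sup>1\<close> on \<open>(0, a]\<close> and \<open>s\<^sup>\<beta>\<^sup>-\<^sup>1\<close> afterwards has positive derivative of order
  \<open>\<beta>\<close>, of the size that a unit source on \<open>(0, a]\<close> produces.\<close>

lemma cutoff_derivative_lower:
  fixes a c \<beta> :: real
  assumes "0 < a" "a < c" "0 < \<beta>" "\<beta> < 1"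
  shows "(1 - \<beta>) * a powr \<beta> * c powr (- \<beta> - 1)
    \<le> a powr (\<beta> - 1) * c powr (- \<beta>) + (\<beta> - 1) * integral {a..c} (\<lambda>s. (c - s) powr (- \<beta>) * s powr (\<beta> - 2))"
proof -
  have d: "((\<lambda>z. z powr (1 - \<beta>)) has_real_derivative (1 - \<beta>) * z powr (- \<beta>)) (at z)"
    if "0 < z" for z
    using that by (auto intro!: derivative_eq_intros)
  have ca: "c - a < c" using assms by simp
  obtain z where z: "c - a < z" "z < c" "c powr (1 - \<beta>) - (c - a) powr (1 - \<beta>) = (c - (c - a)) * ((1 - \<beta>) * z powr (- \<beta>))"
    using MVT2[OF ca, of "\<lambda>z. z powr (1 - \<beta>)" "\<lambda>z. (1 - \<beta>) * z powr (- \<beta>)"] d assms by auto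
  have "c powr (- \<beta>) \<le> z powr (- \<beta>)" using z assms by (intro powr_mono2') auto
  then have "a * ((1 - \<beta>) * c powr (- \<beta>)) \<le> c powr (1 - \<beta>) - (c - a) powr (1 - \<beta>)"
    unfolding z(3) using assms by (intro mult_mono) auto
  then have "a powr (\<beta> - 1) / c * (a * ((1 - \<beta>) * c powr (- \<beta>))) \<le> a powr (\<beta> - 1) / c * (c powr (1 - \<beta>) - (c - a) powr (1 - \<beta>))"
    using assms by (intro mult_left_mono) auto
  moreover have "a powr (\<beta> - 1) / c * (a * ((1 - \<beta>) * c powr (- \<beta>))) = (1 - \<beta>) * a powr \<beta> * c powr (- \<beta> - 1)"
    using assms by (simp add: powr_diff field_simps)
  moreover have "a powr (\<beta> - 1) / c * (c powr (1 - \<beta>) - (c - a) powr (1 - \<beta>))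
    = a powr (\<beta> - 1) * c powr (- \<beta>) + (\<beta> - 1) * (((c - a) / a) powr (1 - \<beta>) / ((1 - \<beta>) * c))"
  proof -
    have q: "((c - a) / a) powr (1 - \<beta>) = (c - a) powr (1 - \<beta>) * a powr (\<beta> - 1)"
      using assms powr_minus_divide[of a "1 - \<beta>"] by (simp add: powr_divide)
    have e: "(\<beta> - 1) * (((c - a) / a) powr (1 - \<beta>) / ((1 - \<beta>) * c)) = - ((c - a) powr (1 - \<beta>) * a powr (\<beta> - 1) / c)"
      unfolding q using assms by (simp add: field_simps)
    have "c powr (1 - \<beta>) = c * c powr (- \<beta>)" using assms by (simp add: powr_mult_base)
    then show ?thesis unfolding e using assms by (simp add: field_simps)
  qed
  ultimately show ?thesis using integral_unique[OF kernel_power_integral[OF assms]] by simp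
qed

lemma sum_powr_upper:
  fixes x :: real assumes "0 < x"
  shows "(\<Sum>k=1..n. real k powr (x - 1)) \<le> (1 + 1 / x) * real n powr x"
proof (cases "1 \<le> x")
  case True
  have "(\<Sum>k=1..n. real k powr (x - 1)) \<le> (\<Sum>k=1..n. real n powr (x - 1))"
    using True by (intro sum_mono powr_mono2) auto
  also have "\<dots> = real n powr x" by (cases "n = 0") (auto simp: powr_diff)
  also have "\<dots> \<le> (1 + 1 / x) * real n powr x" using assms by (simp add: field_simps)
  finally show ?thesis .
next
  case False
  have "x * (\<Sum>k=1..n. real k powr (x - 1)) \<le> real n powr x"
  proof (induction n)
    case (Suc n)
    have "x * real (Suc n) powr (x - 1) \<le> real (Suc n) powr x - real n powr x"
    proof (cases "n = 0")
      case False
      have d: "((\<lambda>z. z powr x) has_real_derivative x * z powr (x - 1)) (at z)" if "0 < z" for z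
        using that by (auto intro!: derivative_eq_intros)
      obtain z where z: "real n < z" "z < real (Suc n)"
        "real (Suc n) powr x - real n powr x = (real (Suc n) - real n) * (x * z powr (x - 1))"
        using MVT2[of "real n" "real (Suc n)" "\<lambda>z. z powr x" "\<lambda>z. x * z powr (x - 1)"] d False by auto
      have "real (Suc n) powr (x - 1) \<le> z powr (x - 1)" using z \<open>\<not> 1 \<le> x\<close> by (intro powr_mono2') auto
      then show ?thesis unfolding z(3) using assms by simp
    qed (use False in auto)
    then show ?case using Suc by (simp add: algebra_simps)
  qed auto
  then have "(\<Sum>k=1..n. real k powr (x - 1)) \<le> 1 / x * real n powr x" using assms by (simp add: field_simps)
  also have "\<dots> \<le> (1 + 1 / x) * real n powr x" by (intro mult_right_mono) auto
  finally show ?thesis .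
qed

context quasi_graded_meshes
begin

lemma integral_cells:
  fixes f :: "real \<Rightarrow> real"
  assumes f: "f integrable_on {t N K..c}" and "K \<le> m" "m \<le> N" "t N m \<le> c"
  shows "(\<Sum>k=Suc K..m. integral {t N (k - 1)..t N k} f) = integral {t N K..t N m} f"
  using assms(2-)
proof (induction m rule: dec_induct)
  case (step m)
  have le: "t N K \<le> t N m" "t N m \<le> t N (Suc m)" using step by (auto intro: t_le)
  then have "f integrable_on {t N K..t N (Suc m)}"
    using step.prems by (intro integrable_on_subinterval[OF f]) auto
  then have "integral {t N K..t N m} f + integral {t N m..t N (Suc m)} f = integral {t N K..t N (Suc m)} f"
    using le by (intro Henstock_Kurzweil_Integration.integral_combine) auto
  then show ?case using step le by simp
qed auto

lemma integral_cells_last: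
  fixes f :: "real \<Rightarrow> real"
  assumes f: "f integrable_on {t N K..tstar \<sigma> (t N) n}" and "K < n" "n \<le> N"
  shows "(\<Sum>k=Suc K..n - 1. integral {t N (k - 1)..t N k} f) + integral {t N (n - 1)..tstar \<sigma> (t N) n} f
    = integral {t N K..tstar \<sigma> (t N) n} f"
proof -
  have le: "t N K \<le> t N (n - 1)" "t N (n - 1) \<le> tstar \<sigma> (t N) n"
    using assms tstar_bounds[of n N] by (auto intro: t_le)
  then have "(\<Sum>k=Suc K..n - 1. integral {t N (k - 1)..t N k} f) = integral {t N K..t N (n - 1)} f"
    using assms by (intro integral_cells[OF f]) auto
  then show ?thesis using Henstock_Kurzweil_Integration.integral_combine[OF le f] by simp
qed

text \<open>The power \<open>s\<^sup>\<beta>\<^sup>-\<^sup>1\<close>, frozen up to \<open>t\<^sub>K\<close>.  The value \<open>0\<close> at the initial node makes the comparison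
  principle applicable, and the jump to the frozen value is the source of the positive derivative.\<close>

definition cutoff :: "nat \<Rightarrow> nat \<Rightarrow> nat \<Rightarrow> real" where
  "cutoff N K n = (if n = 0 then 0 else t N (max K n) powr (\<beta> - 1))"

lemma cutoff_nonneg: "0 \<le> cutoff N K n" and cutoff_0 [simp]: "cutoff N K 0 = 0"
  by (auto simp: cutoff_def)

lemma cutoff_le: "1 \<le> n \<Longrightarrow> n \<le> N \<Longrightarrow> K \<le> N \<Longrightarrow> cutoff N K n \<le> t N n powr (\<beta> - 1)"
  using t_pos[of n N] t_le[of n "max K n" N] \<beta>_lt by (auto simp: cutoff_def intro!: powr_mono2')

lemma \<delta>_cutoff_before:
  assumes "1 \<le> n" "n \<le> K" "K \<le> N"
  shows "1 / t N n * ((t N n / t N K) powr (1 - \<beta>) / \<Gamma>\<beta>) \<le> \<delta> N (cutoff N K) n"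
proof -
  have tp: "0 < t N n" "0 < t N K" using assms t_pos by auto
  have "(t N n - t N 0) powr (- \<beta>) / \<Gamma>\<beta> * (cutoff N K n - cutoff N K 0) \<le> \<delta> N (cutoff N K) n"
  proof (rule \<delta>_lower_increasing)
    fix k assume k: "1 \<le> k" "k \<le> n"
    show "cutoff N K (k - 1) \<le> cutoff N K k"
      using k assms max_absorb1[of "k - 1" K] max_absorb1[of k K] by (auto simp: cutoff_def)
  qed (use assms in auto)
  moreover have "(t N n - t N 0) powr (- \<beta>) / \<Gamma>\<beta> * (cutoff N K n - cutoff N K 0) = 1 / t N n * ((t N n / t N K) powr (1 - \<beta>) / \<Gamma>\<beta>)"
    using assms tp t_0[of N] by (simp add: cutoff_def max_def powr_divide powr_diff powr_minus field_simps)
  ultimately show ?thesis by simp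
qed

lemma \<delta>_cutoff_split:
  assumes "1 \<le> K" "K < n" "n \<le> N"
  shows "\<delta> N (cutoff N K) n = t N K powr (\<beta> - 1) * g N n 1 + \<delta> N (\<lambda>k. if k \<le> K then 0 else t N k powr (\<beta> - 1) - t N K powr (\<beta> - 1)) n"
proof -
  define V where "V = (\<lambda>k. if k \<le> K then 0 else t N k powr (\<beta> - 1) - t N K powr (\<beta> - 1))"
  define W where "W = (\<lambda>k::nat. if k = 0 then 0 else t N K powr (\<beta> - 1))"
  have e: "cutoff N K k = W k + V k" for k using assms by (auto simp: cutoff_def max_def W_def V_def)
  have n: "1 \<le> n" using assms by auto
  have "\<delta> N (cutoff N K) n = \<delta> N W n + \<delta> N V n"
    unfolding \<delta>_eq[OF n assms(3)] by (simp add: e algebra_simps flip: sum.distrib)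
  moreover have "\<delta> N W n = t N K powr (\<beta> - 1) * g N n 1"
  proof -
    have "\<delta> N W n = (\<Sum>k=1..n. if k = 1 then g N n 1 * t N K powr (\<beta> - 1) else 0)"
      unfolding \<delta>_eq[OF n assms(3)] by (intro sum.cong) (auto simp: W_def)
    then show ?thesis using n by (simp add: sum.delta mult.commute)
  qed
  ultimately show ?thesis by (simp add: V_def)
qed

text \<open>Only the cell that contains the kink contributes an error that does not come from smooth interpolation.\<close>

lemma kink_cell:
  assumes K: "1 \<le> K" "K < n" "n \<le> N"
    and V: "V = (\<lambda>k. if k \<le> K then 0 else t N k powr (\<beta> - 1) - t N K powr (\<beta> - 1))"
  shows "- (Q\<^sup>2 * (2 * G) powr (\<beta> + 1) * (Q\<^sup>2) powr \<beta> * (1 / t N n * (real K powr (\<beta> - 1) * (real K / real n) powr (1 / 2))))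
    \<le> integral {t N (K - 1)..t N K} (\<lambda>s. (tstar \<sigma> (t N) n - s) powr (- \<beta>) * deriv (quad_interp (t N) V K) s)"
proof -
  define c a where "c = tstar \<sigma> (t N) n" and "a = t N K"
  have a: "0 < a" "0 < t N n" using K t_pos by (auto simp: a_def)
  have kn: "0 < real K" "0 < real n" "real K / real n \<le> 1" using K by auto
  have ts: "t N (K - 1) < t N K" "t N K < t N (K + 1)" "t N (K - 1) < t N (K + 1)" using K t_less by auto
  define s1 where "s1 = V (K + 1) / mstep (t N) (K + 1)"
  have mp: "0 < mstep (t N) (K + 1)" using ts by (simp add: mstep_def)
  have s1: "- (a powr (\<beta> - 2)) \<le> s1" "s1 \<le> 0"
  proof -
    have d: "((\<lambda>z. z powr (\<beta> - 1)) has_real_derivative (\<beta> - 1) * z powr (\<beta> - 2)) (at z)" if "0 < z" for z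
      using that by (auto intro!: derivative_eq_intros)
    obtain z where z: "t N K < z" "z < t N (K + 1)"
        "t N (K + 1) powr (\<beta> - 1) - t N K powr (\<beta> - 1) = (t N (K + 1) - t N K) * ((\<beta> - 1) * z powr (\<beta> - 2))"
      using MVT2[OF ts(2), of "\<lambda>z. z powr (\<beta> - 1)" "\<lambda>z. (\<beta> - 1) * z powr (\<beta> - 2)"] d a by (auto simp: a_def)
    have e: "s1 = (\<beta> - 1) * z powr (\<beta> - 2)" using z(3) ts by (simp add: s1_def V mstep_def)
    show "s1 \<le> 0" unfolding e using \<beta>_lt by (intro mult_nonpos_nonneg) auto
    have "z powr (\<beta> - 2) \<le> a powr (\<beta> - 2)" using z a \<beta>_lt by (intro powr_mono2') (auto simp: a_def)
    then have "(1 - \<beta>) * z powr (\<beta> - 2) \<le> 1 * a powr (\<beta> - 2)" using \<beta>_lt \<beta>_pos by (intro mult_mono) auto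
    then show "- (a powr (\<beta> - 2)) \<le> s1" unfolding e by (simp add: algebra_simps)
  qed
  define B where "B = \<Gamma>\<beta> * bcoef \<beta> \<sigma> (t N) (n - 1) (K - 1)"
  have dq: "deriv (quad_interp (t N) V K) s = 2 / (t N (K + 1) - t N (K - 1)) * (s - (t N (K - 1) + t N K) / 2) * s1" for s
    using deriv_quad_interp[of "t N" K V s] ts K by (simp add: V s1_def)
  have idx: "n - 1 + 1 = n" "K - 1 + 1 = K" "K - 1 + 2 = K + 1" using K by auto
  have I: "integral {t N (K - 1)..t N K} (\<lambda>s. (c - s) powr (- \<beta>) * deriv (quad_interp (t N) V K) s) = B * s1"
  proof -
    have "(\<lambda>s. (c - s) powr (- \<beta>) * deriv (quad_interp (t N) V K) s)
      = (\<lambda>s. (2 / (t N (K + 1) - t N (K - 1)) * s1) * ((c - s) powr (- \<beta>) * (s - (t N (K - 1) + t N K) / 2)))"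
      unfolding dq by (simp only: mult_ac)
    then show ?thesis
      unfolding B_def bcoef_def idx c_def[symmetric] using \<Gamma>\<beta>_pos by simp
  qed
  have "B \<le> mstep (t N) K ^ 2 * (c - a) powr (- \<beta> - 1)"
    using bcoef_upper[of K n N] K \<Gamma>\<beta>_pos by (simp add: B_def c_def a_def field_simps)
  also have "\<dots> \<le> (Q * (a / real K)) ^ 2 * ((2 * G) powr (\<beta> + 1) * real K powr (\<beta> + 1) * t N n powr (- \<beta> - 1))"
  proof (intro mult_mono power_mono)
    show "mstep (t N) K \<le> Q * (a / real K)" using step_upper[of K N] K by (simp add: a_def)
    have "real n \<le> real K * 2 * real (n - K)"
    proof -
      obtain d where d: "n = K + Suc d" using K less_iff_Suc_add by auto
      have "1 * (1 + real d) \<le> real K * (1 + real d)" using kn K by (intro mult_right_mono) auto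
      moreover have "real K * 1 \<le> real K * (1 + real d)" by (intro mult_left_mono) auto
      moreover have "0 \<le> real K * real d" by simp
      moreover have "real K * 2 * real (n - K) = 2 * real K + 2 * (real K * real d)"
        by (simp add: d algebra_simps)
      moreover have "real n = real K + 1 + real d" by (simp add: d)
      ultimately show ?thesis unfolding distrib_left mult_1_right by linarith
    qed
    then have "1 / (2 * real K) \<le> real (n - K) / real n" using kn by (simp add: field_simps)
    then have "t N n * (1 / (2 * real K)) \<le> t N n * (real (n - K) / real n)" using a by (intro mult_left_mono) auto
    also have "\<dots> \<le> G * (c - a)" unfolding c_def a_def using K by (intro tstar_gap) auto
    finally have "t N n / (2 * G * real K) \<le> c - a" using G_ge kn by (simp add: field_simps)
    then have "(c - a) powr (- \<beta> - 1) \<le> (t N n / (2 * G * real K)) powr (- \<beta> - 1)"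
      using a G_ge kn \<beta>_pos by (intro powr_mono2') auto
    also have "\<dots> = t N n powr (- \<beta> - 1) / (2 * G * real K) powr (- (\<beta> + 1))"
      using a G_ge kn by (simp add: powr_divide)
    also have "\<dots> = (2 * G) powr (\<beta> + 1) * real K powr (\<beta> + 1) * t N n powr (- \<beta> - 1)"
      unfolding powr_minus_divide using G_ge kn by (simp add: powr_mult)
    finally show "(c - a) powr (- \<beta> - 1) \<le> (2 * G) powr (\<beta> + 1) * real K powr (\<beta> + 1) * t N n powr (- \<beta> - 1)" .
  qed (use mstep_pos[of K N] K in auto)
  finally have Bu: "B \<le> (Q * (a / real K)) ^ 2 * ((2 * G) powr (\<beta> + 1) * real K powr (\<beta> + 1) * t N n powr (- \<beta> - 1))" .
  have B0: "0 \<le> B" using bcoef_nonneg[of "K - 1" n N] K \<Gamma>\<beta>_pos by (simp add: B_def)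
  have "B * (- s1) \<le> (Q * (a / real K)) ^ 2 * ((2 * G) powr (\<beta> + 1) * real K powr (\<beta> + 1) * t N n powr (- \<beta> - 1)) * a powr (\<beta> - 2)"
    using Bu B0 s1 by (intro mult_mono) auto
  also have "\<dots> = Q\<^sup>2 * (2 * G) powr (\<beta> + 1) * (a powr 2 * a powr (\<beta> - 2)) * (real K powr (- 2) * real K powr (\<beta> + 1)) * t N n powr (- \<beta> - 1)"
    using a kn by (simp add: power_mult_distrib power_divide powr_minus divide_inverse power_inverse)
  also have "a powr 2 * a powr (\<beta> - 2) = a powr \<beta>" by (simp only: powr_add[symmetric]) simp
  also have "real K powr (- 2) * real K powr (\<beta> + 1) = real K powr (\<beta> - 1)" by (simp only: powr_add[symmetric]) simp
  also have "Q\<^sup>2 * (2 * G) powr (\<beta> + 1) * a powr \<beta> * real K powr (\<beta> - 1) * t N n powr (- \<beta> - 1)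
    \<le> Q\<^sup>2 * (2 * G) powr (\<beta> + 1) * ((Q\<^sup>2) powr \<beta> * t N n powr \<beta> * (real K / real n) powr (1 / 2)) * real K powr (\<beta> - 1) * t N n powr (- \<beta> - 1)"
  proof (intro mult_right_mono mult_left_mono)
    have "a powr \<beta> \<le> (Q\<^sup>2 * t N n * (real K / real n) powr r) powr \<beta>"
      using t_ratio[of K N n] K a \<beta>_pos by (intro powr_mono2) (auto simp: a_def)
    also have "\<dots> = (Q\<^sup>2) powr \<beta> * t N n powr \<beta> * (real K / real n) powr (r * \<beta>)"
      using a Q_ge by (simp add: powr_mult powr_powr)
    also have "\<dots> \<le> (Q\<^sup>2) powr \<beta> * t N n powr \<beta> * (real K / real n) powr (1 / 2)"
    proof (intro mult_left_mono powr_mono')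
      have "1 * (1 / 2) \<le> r * \<beta>" using r_ge \<beta>_gt by (intro mult_mono) auto
      then show "1 / 2 \<le> r * \<beta>" by simp
    qed (use kn in auto)
    finally show "a powr \<beta> \<le> (Q\<^sup>2) powr \<beta> * t N n powr \<beta> * (real K / real n) powr (1 / 2)" .
  qed (use Q_ge in auto)
  also have "\<dots> = Q\<^sup>2 * (2 * G) powr (\<beta> + 1) * (Q\<^sup>2) powr \<beta> * ((t N n powr \<beta> * t N n powr (- \<beta> - 1)) * (real K powr (\<beta> - 1) * (real K / real n) powr (1 / 2)))"
    by (simp only: mult_ac)
  also have "t N n powr \<beta> * t N n powr (- \<beta> - 1) = 1 / t N n"
    using a by (simp only: powr_add[symmetric]) (simp add: powr_minus_divide)
  finally show ?thesis using I by (simp add: c_def)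
qed

text \<open>The derivative of the cut-off power itself is positive by \<open>cutoff_derivative_lower\<close> and yields the first term; the
  second one collects the discretisation errors, which are smaller by \<open>K\<^sup>\<beta>\<^sup>-\<^sup>1\<close>.  Their exponent \<open>1/2\<close> is admissible because of
  \<open>r \<beta> > 1/2\<close> and leaves them summable against the weights of the superposition.\<close>

lemma \<delta>_cutoff_after:
  obtains c1 C2 where "0 < c1" "0 < C2" "\<And>K n N. 1 \<le> K \<Longrightarrow> K < n \<Longrightarrow> n \<le> N \<Longrightarrow>
    1 / t N n * (c1 * (real K / real n) powr (r * \<beta>) - C2 * real K powr (\<beta> - 1) * (real K / real n) powr (1 / 2))
      \<le> \<delta> N (cutoff N K) n"
proof -
  have rb: "1 / 2 \<le> r * (\<beta> - 1 + 1)"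
    using mult_mono[of 1 r "1/2" \<beta>] r_ge \<beta>_gt by simp
  have mu: "- 1 \<le> \<beta> - 1" "\<beta> - 1 \<le> 1" and x: "1 / 2 \<le> 3 - \<beta>" using \<beta>_pos \<beta>_lt by auto
  obtain CT where CT: "0 < CT" "truncation_rate (\<beta> - 1) (1 / 2) CT"
    by (rule truncation_smooth[OF mu rb x])
  define A where "A = Q\<^sup>2 * (2 * G) powr (\<beta> + 1) * (Q\<^sup>2) powr \<beta>"
  have A: "0 < A" using Q_ge G_ge by (simp add: A_def)
  define c1 where "c1 = (1 - \<beta>) / ((Q\<^sup>2) powr \<beta> * \<Gamma>\<beta>)"
  have c1: "0 < c1" using \<beta>_lt Q_ge \<Gamma>\<beta>_pos by (simp add: c1_def)
  show thesis
  proof (rule that[OF c1])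
    show "0 < (A + CT * 6) / \<Gamma>\<beta>" using A CT(1) \<Gamma>\<beta>_pos by (intro divide_pos_pos add_pos_pos) auto
    fix K n N :: nat assume K: "1 \<le> K" "K < n" "n \<le> N"
    define c a where "c = tstar \<sigma> (t N) n" and "a = t N K"
    define R where "R = 1 / t N n * (real K powr (\<beta> - 1) * (real K / real n) powr (1 / 2))"
    define V where "V = (\<lambda>k. if k \<le> K then 0 else t N k powr (\<beta> - 1) - t N K powr (\<beta> - 1))"
    define v where "v s = s powr (\<beta> - 1) - a powr (\<beta> - 1)" for s
    define v1 where "v1 s = (\<beta> - 1) * s powr (\<beta> - 2)" for s
    define v2 where "v2 s = (\<beta> - 1) * ((\<beta> - 2) * s powr (\<beta> - 3))" for s
    define v3 where "v3 s = (\<beta> - 1) * ((\<beta> - 2) * ((\<beta> - 3) * s powr (\<beta> - 4)))" for s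
    have a: "0 < a" "0 < t N n" using K t_pos by (auto simp: a_def)
    have kn: "0 < real K" "0 < real n" "real K / real n \<le> 1" using K by auto
    have "t N K \<le> t N (n - 1)" using K by (intro t_le) auto
    then have ac: "a < c" using tstar_bounds(1)[of n N] K by (auto simp: a_def c_def)
    have cn: "0 < c" "c \<le> t N n" using tstar_bounds[of n N] K by (auto simp: c_def)
    have "\<bar>(\<Sum>k=Suc K..n - 1. integral {t N (k - 1)..t N k} (\<lambda>s. (c - s) powr (- \<beta>) * (v1 s - deriv (quad_interp (t N) V k) s)))
      + integral {t N (n - 1)..c} (\<lambda>s. (c - s) powr (- \<beta>) * (v1 s - deriv (lin_interp (t N) V n) s))\<bar>
     \<le> CT * 6 * t N n powr (\<beta> - 1 - \<beta>) * real n powr (- (1 / 2)) * real K powr (1 / 2 + \<beta> - 3)"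
      unfolding c_def
    proof (rule CT(2)[unfolded truncation_rate_def, THEN spec[of _ N], THEN spec[of _ n], THEN spec[of _ K],
        THEN spec[of _ 6], THEN spec[of _ v], THEN spec[of _ v1], THEN spec[of _ v2], THEN spec[of _ v3], THEN spec[of _ V], rule_format])
      fix z assume "z \<in> {t N K..t N n}"
      then have z: "0 < z" using a by (auto simp: a_def)
      show "(v has_real_derivative v1 z) (at z within {t N K..t N n})"
        "(v1 has_real_derivative v2 z) (at z within {t N K..t N n})"
        "(v2 has_real_derivative v3 z) (at z within {t N K..t N n})"
        unfolding v_def v1_def v2_def v3_def using z by (auto intro!: derivative_eq_intros)
      have "(1 - \<beta>) * ((2 - \<beta>) * ((3 - \<beta>) * z powr (\<beta> - 4))) \<le> 1 * (2 * (3 * z powr (\<beta> - 4)))"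
        using \<beta>_pos \<beta>_lt by (intro mult_mono) auto
      moreover have "\<bar>v3 z\<bar> = (1 - \<beta>) * ((2 - \<beta>) * ((3 - \<beta>) * z powr (\<beta> - 4)))"
        using \<beta>_pos \<beta>_lt by (simp add: v3_def abs_mult)
      ultimately show "\<bar>v3 z\<bar> \<le> 6 * z powr (\<beta> - 1 - 3)" by simp
    next
      fix k assume "k \<in> {K..n}"
      then show "V k = v (t N k)" by (auto simp: V_def v_def a_def)
    qed (use K in auto)
    also have "\<dots> \<le> CT * 6 * R"
    proof -
      have "t N n powr (\<beta> - 1 - \<beta>) = 1 / t N n" using a by (simp add: powr_minus_divide)
      moreover have "real n powr (- (1 / 2)) * real K powr (1 / 2 + \<beta> - 3) = real K powr (\<beta> - 3) * (real K / real n) powr (1 / 2)"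
        using kn powr_add[of "real K" "1/2" "\<beta> - 3"] by (simp add: powr_divide powr_minus field_simps)
      moreover have "real K powr (\<beta> - 3) \<le> real K powr (\<beta> - 1)" using K by (intro powr_mono) auto
      ultimately show ?thesis using CT(1) a by (auto simp: R_def mult.assoc intro!: mult_left_mono mult_right_mono divide_right_mono)
    qed
    finally have tr: "\<bar>(\<Sum>k=Suc K..n - 1. integral {t N (k - 1)..t N k} (\<lambda>s. (c - s) powr (- \<beta>) * (v1 s - deriv (quad_interp (t N) V k) s)))
      + integral {t N (n - 1)..c} (\<lambda>s. (c - s) powr (- \<beta>) * (v1 s - deriv (lin_interp (t N) V n) s))\<bar> \<le> CT * 6 * R" .
    have iv: "(\<lambda>s. (c - s) powr (- \<beta>) * v1 s) integrable_on {a..c}"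
      unfolding v1_def using kernel_power_integral[OF a(1) ac \<beta>_pos \<beta>_lt]
      by (auto simp: mult.left_commute[of _ "\<beta> - 1"] intro!: integrable_on_mult_right)
    have qi: "(\<lambda>s. (c - s) powr (- \<beta>) * deriv (quad_interp (t N) V k) s) integrable_on {t N (k - 1)..t N k}"
      if k: "k \<in> {Suc K..n - 1}" for k
    proof -
      have "t N k \<le> t N (n - 1)" using k K by (intro t_le) auto
      then have kc: "t N k < c" using tstar_bounds(1)[of n N] K by (auto simp: c_def)
      have "t N (k - 1) < t N k" "t N k < t N (k + 1)" using k K by (auto intro: t_less)
      then have "continuous_on {t N (k - 1)..t N k} (deriv (quad_interp (t N) V k))"
        by (subst continuous_on_cong[OF refl deriv_quad_interp]) (auto intro!: continuous_intros)
      then show ?thesis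
        by (intro integrable_continuous_interval continuous_on_mult kernel_continuous[OF kc])
    qed
    have li: "(\<lambda>s. (c - s) powr (- \<beta>) * deriv (lin_interp (t N) V n) s) integrable_on {t N (n - 1)..c}"
    proof -
      have ne: "t N (n - 1) \<noteq> t N n" "t N (n - 1) \<le> c"
        using K tstar_bounds[of n N] t_less[of "n - 1" n N] by (auto simp: c_def)
      show ?thesis
        unfolding deriv_lin_interp[of "t N" n, OF ne(1)]
        by (intro integrable_on_mult_left has_integral_integrable[OF integral_powr_end[OF ne(2) \<beta>_lt]])
    qed
    have ivk: "(\<lambda>s. (c - s) powr (- \<beta>) * v1 s) integrable_on {t N (k - 1)..t N k}" if k: "k \<in> {Suc K..n - 1}" for k
    proof (rule integrable_on_subinterval[OF iv])
      have "t N k \<le> t N (n - 1)" "t N K \<le> t N (k - 1)" using k K by (auto intro: t_le)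
      then show "{t N (k - 1)..t N k} \<subseteq> {a..c}" using tstar_bounds(1)[of n N] K by (auto simp: c_def a_def)
    qed
    have ivl: "(\<lambda>s. (c - s) powr (- \<beta>) * v1 s) integrable_on {t N (n - 1)..c}"
    proof (rule integrable_on_subinterval[OF iv])
      have "t N K \<le> t N (n - 1)" using K by (auto intro: t_le)
      then show "{t N (n - 1)..c} \<subseteq> {a..c}" by (auto simp: a_def)
    qed
    define S where "S = (\<Sum>k=Suc K..n - 1. integral {t N (k - 1)..t N k} (\<lambda>s. (c - s) powr (- \<beta>) * deriv (quad_interp (t N) V k) s))
       + integral {t N (n - 1)..c} (\<lambda>s. (c - s) powr (- \<beta>) * deriv (lin_interp (t N) V n) s)"
    have "(\<Sum>k=Suc K..n - 1. integral {t N (k - 1)..t N k} (\<lambda>s. (c - s) powr (- \<beta>) * (v1 s - deriv (quad_interp (t N) V k) s)))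
      + integral {t N (n - 1)..c} (\<lambda>s. (c - s) powr (- \<beta>) * (v1 s - deriv (lin_interp (t N) V n) s))
      = ((\<Sum>k=Suc K..n - 1. integral {t N (k - 1)..t N k} (\<lambda>s. (c - s) powr (- \<beta>) * v1 s))
      + integral {t N (n - 1)..c} (\<lambda>s. (c - s) powr (- \<beta>) * v1 s)) - S"
    proof -
      have "(\<Sum>k=Suc K..n - 1. integral {t N (k - 1)..t N k} (\<lambda>s. (c - s) powr (- \<beta>) * (v1 s - deriv (quad_interp (t N) V k) s)))
        = (\<Sum>k=Suc K..n - 1. integral {t N (k - 1)..t N k} (\<lambda>s. (c - s) powr (- \<beta>) * v1 s)
            - integral {t N (k - 1)..t N k} (\<lambda>s. (c - s) powr (- \<beta>) * deriv (quad_interp (t N) V k) s))"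
        unfolding right_diff_distrib
        by (intro sum.cong refl Henstock_Kurzweil_Integration.integral_diff ivk qi)
      moreover have "integral {t N (n - 1)..c} (\<lambda>s. (c - s) powr (- \<beta>) * (v1 s - deriv (lin_interp (t N) V n) s))
        = integral {t N (n - 1)..c} (\<lambda>s. (c - s) powr (- \<beta>) * v1 s)
          - integral {t N (n - 1)..c} (\<lambda>s. (c - s) powr (- \<beta>) * deriv (lin_interp (t N) V n) s)"
        unfolding right_diff_distrib by (intro Henstock_Kurzweil_Integration.integral_diff ivl li)
      ultimately show ?thesis unfolding S_def sum_subtractf by linarith
    qed
    also have "(\<Sum>k=Suc K..n - 1. integral {t N (k - 1)..t N k} (\<lambda>s. (c - s) powr (- \<beta>) * v1 s))
      + integral {t N (n - 1)..c} (\<lambda>s. (c - s) powr (- \<beta>) * v1 s) = integral {a..c} (\<lambda>s. (c - s) powr (- \<beta>) * v1 s)"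
      unfolding c_def a_def using iv K by (intro integral_cells_last) (auto simp: c_def a_def)
    finally have S: "integral {a..c} (\<lambda>s. (c - s) powr (- \<beta>) * v1 s) - CT * 6 * R \<le> S" using tr by simp
    have "\<Gamma>\<beta> * \<delta> N V n = (\<Sum>k=1..n - 1. integral {t N (k - 1)..t N k} (\<lambda>s. (c - s) powr (- \<beta>) * deriv (quad_interp (t N) V k) s))
       + integral {t N (n - 1)..c} (\<lambda>s. (c - s) powr (- \<beta>) * deriv (lin_interp (t N) V n) s)"
      unfolding alikhanov_def c_def using \<Gamma>\<beta>_pos by simp
    also have "(\<Sum>k=1..n - 1. integral {t N (k - 1)..t N k} (\<lambda>s. (c - s) powr (- \<beta>) * deriv (quad_interp (t N) V k) s))
      = (\<Sum>k=K..n - 1. integral {t N (k - 1)..t N k} (\<lambda>s. (c - s) powr (- \<beta>) * deriv (quad_interp (t N) V k) s))"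
    proof (rule sum.mono_neutral_right)
      show "\<forall>k\<in>{1..n - 1} - {K..n - 1}. integral {t N (k - 1)..t N k} (\<lambda>s. (c - s) powr (- \<beta>) * deriv (quad_interp (t N) V k) s) = 0"
      proof
        fix k assume k: "k \<in> {1..n - 1} - {K..n - 1}"
        then have "t N (k - 1) < t N k" "t N k < t N (k + 1)" using K by (auto intro: t_less)
        moreover have "V (k - 1) = 0" "V k = 0" "V (k + 1) = 0" using k K by (auto simp: V_def)
        ultimately show "integral {t N (k - 1)..t N k} (\<lambda>s. (c - s) powr (- \<beta>) * deriv (quad_interp (t N) V k) s) = 0"
          by (simp add: deriv_quad_interp)
      qed
    qed (use K in auto)
    also have "\<dots> = integral {t N (K - 1)..t N K} (\<lambda>s. (c - s) powr (- \<beta>) * deriv (quad_interp (t N) V K) s)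
       + (\<Sum>k=Suc K..n - 1. integral {t N (k - 1)..t N k} (\<lambda>s. (c - s) powr (- \<beta>) * deriv (quad_interp (t N) V k) s))"
      using K by (intro sum.atLeast_Suc_atMost) auto
    finally have dV: "\<Gamma>\<beta> * \<delta> N V n = integral {t N (K - 1)..t N K} (\<lambda>s. (c - s) powr (- \<beta>) * deriv (quad_interp (t N) V K) s) + S"
      by (simp add: S_def)
    have kink: "- (A * R) \<le> integral {t N (K - 1)..t N K} (\<lambda>s. (c - s) powr (- \<beta>) * deriv (quad_interp (t N) V K) s)"
      using kink_cell[OF K V_def] by (simp add: A_def R_def c_def)
    have "c powr (- \<beta>) / \<Gamma>\<beta> \<le> g N n 1" using g_lower[of 1 n N] K t_0[of N] by (simp add: c_def)
    then have "a powr (\<beta> - 1) * (c powr (- \<beta>) / \<Gamma>\<beta>) \<le> a powr (\<beta> - 1) * g N n 1" by (intro mult_left_mono) auto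
    from mult_left_mono[OF this, of \<Gamma>\<beta>]
    have g1: "a powr (\<beta> - 1) * c powr (- \<beta>) \<le> \<Gamma>\<beta> * (a powr (\<beta> - 1) * g N n 1)" using \<Gamma>\<beta>_pos by simp
    have iv1: "integral {a..c} (\<lambda>s. (c - s) powr (- \<beta>) * v1 s) = (\<beta> - 1) * integral {a..c} (\<lambda>s. (c - s) powr (- \<beta>) * s powr (\<beta> - 2))"
      unfolding v1_def by (simp add: mult.left_commute[of _ "\<beta> - 1"])
    have "\<Gamma>\<beta> * \<delta> N (cutoff N K) n = \<Gamma>\<beta> * (a powr (\<beta> - 1) * g N n 1) + \<Gamma>\<beta> * \<delta> N V n"
      using \<delta>_cutoff_split[OF K] by (simp add: V_def a_def distrib_left)
    then have lower: "(1 - \<beta>) * a powr \<beta> * c powr (- \<beta> - 1) - (A + CT * 6) * R \<le> \<Gamma>\<beta> * \<delta> N (cutoff N K) n"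
      using dV kink S iv1 g1 cutoff_derivative_lower[OF a(1) ac \<beta>_pos \<beta>_lt] by (simp add: algebra_simps)
    have "t N n powr \<beta> * (real K / real n) powr (r * \<beta>) \<le> (Q\<^sup>2) powr \<beta> * a powr \<beta>"
    proof -
      have e: "real n / real K = inverse (real K / real n)" by simp
      have "t N n \<le> Q\<^sup>2 * a * (real n / real K) powr r" unfolding a_def using K by (intro t_ratio) auto
      then have "t N n * (real K / real n) powr r \<le> Q\<^sup>2 * a"
        unfolding e using kn by (simp add: powr_divide powr_minus field_simps)
      then have "(t N n * (real K / real n) powr r) powr \<beta> \<le> (Q\<^sup>2 * a) powr \<beta>"
        using a \<beta>_pos by (intro powr_mono2) auto
      then show ?thesis using a Q_ge by (simp add: powr_mult powr_powr)
    qed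
    then have "t N n powr \<beta> * (real K / real n) powr (r * \<beta>) / (Q\<^sup>2) powr \<beta> \<le> a powr \<beta>"
      using Q_ge by (simp add: field_simps)
    then have "(1 - \<beta>) * (t N n powr \<beta> * (real K / real n) powr (r * \<beta>) / (Q\<^sup>2) powr \<beta>) * t N n powr (- \<beta> - 1)
       \<le> (1 - \<beta>) * a powr \<beta> * c powr (- \<beta> - 1)"
      using \<beta>_lt \<beta>_pos cn by (intro mult_mono mult_left_mono powr_mono2') auto
    moreover have "(1 - \<beta>) * (t N n powr \<beta> * (real K / real n) powr (r * \<beta>) / (Q\<^sup>2) powr \<beta>) * t N n powr (- \<beta> - 1)
       = \<Gamma>\<beta> * (1 / t N n * (c1 * (real K / real n) powr (r * \<beta>)))"
    proof -
      have "t N n powr \<beta> * t N n powr (- \<beta> - 1) = 1 / t N n"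
        using a by (simp only: powr_add[symmetric]) (simp add: powr_minus_divide)
      moreover have "p * (x * y / q) * z = p * (y / q) * (x * z)" for p x y q z :: real by simp
      ultimately have "(1 - \<beta>) * (t N n powr \<beta> * (real K / real n) powr (r * \<beta>) / (Q\<^sup>2) powr \<beta>) * t N n powr (- \<beta> - 1)
        = (1 - \<beta>) * ((real K / real n) powr (r * \<beta>) / (Q\<^sup>2) powr \<beta>) * (1 / t N n)"
        by metis
      also have "\<dots> = \<Gamma>\<beta> * (1 / t N n * (c1 * (real K / real n) powr (r * \<beta>)))"
        using \<Gamma>\<beta>_pos by (simp add: c1_def)
      finally show ?thesis .
    qed
    ultimately have "\<Gamma>\<beta> * (1 / t N n * (c1 * (real K / real n) powr (r * \<beta>))) - (A + CT * 6) * R \<le> \<Gamma>\<beta> * \<delta> N (cutoff N K) n"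
      using lower by linarith
    moreover have "\<Gamma>\<beta> * (1 / t N n * (c1 * (real K / real n) powr (r * \<beta>))) - (A + CT * 6) * R
      = \<Gamma>\<beta> * (1 / t N n * (c1 * (real K / real n) powr (r * \<beta>) - (A + CT * 6) / \<Gamma>\<beta> * real K powr (\<beta> - 1) * (real K / real n) powr (1 / 2)))"
      using \<Gamma>\<beta>_pos by (simp add: R_def right_diff_distrib)
    ultimately show "1 / t N n * (c1 * (real K / real n) powr (r * \<beta>) - (A + CT * 6) / \<Gamma>\<beta> * real K powr (\<beta> - 1) * (real K / real n) powr (1 / 2))
      \<le> \<delta> N (cutoff N K) n" by (metis \<Gamma>\<beta>_pos mult_le_cancel_left_pos)
  qed
qed

end

context quasi_graded_meshes
begin

lemma \<delta>_sum:
  assumes "1 \<le> n" "n \<le> N"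
  shows "\<delta> N (\<lambda>i. \<Sum>k\<in>A. w k * B k i) n = (\<Sum>k\<in>A. w k * \<delta> N (B k) n)"
proof -
  have "\<delta> N (\<lambda>i. \<Sum>k\<in>A. w k * B k i) n = (\<Sum>j=1..n. \<Sum>k\<in>A. w k * (g N n j * (B k j - B k (j - 1))))"
    unfolding \<delta>_eq[OF assms] by (intro sum.cong refl)
      (simp add: sum_distrib_left sum_subtractf right_diff_distrib mult_ac)
  also have "\<dots> = (\<Sum>k\<in>A. w k * \<delta> N (B k) n)"
    unfolding \<delta>_eq[OF assms] by (subst sum.swap) (simp add: sum_distrib_left)
  finally show ?thesis .
qed

lemma \<delta>_cutoff_early:
  assumes "1 \<le> n" "n \<le> K" "K \<le> n0" "K \<le> N"
  shows "(1 / t N n) * ((real n0 powr (- r) / Q\<^sup>2) powr (1 - \<beta>) / \<Gamma>\<beta>) \<le> \<delta> N (cutoff N K) n"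
proof -
  have tp: "0 < t N n" "0 < t N K" using assms t_pos by auto
  have "t N K \<le> Q\<^sup>2 * t N n * (real K / real n) powr r" using assms by (intro t_ratio) auto
  also have "\<dots> \<le> Q\<^sup>2 * t N n * real n0 powr r"
  proof (intro mult_left_mono powr_mono2)
    have "real K \<le> real n0 * real n" using assms mult_mono[of "real K" "real n0" 1 "real n"] by simp
    then show "real K / real n \<le> real n0" using assms by (simp add: field_simps)
  qed (use tp Q_ge r_ge in auto)
  finally have "real n0 powr (- r) / Q\<^sup>2 \<le> t N n / t N K"
    using tp Q_ge assms by (simp add: powr_minus field_simps)
  then have "(real n0 powr (- r) / Q\<^sup>2) powr (1 - \<beta>) \<le> (t N n / t N K) powr (1 - \<beta>)"
    using \<beta>_lt Q_ge by (intro powr_mono2) auto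
  then have "(1 / t N n) * ((real n0 powr (- r) / Q\<^sup>2) powr (1 - \<beta>) / \<Gamma>\<beta>) \<le> 1 / t N n * ((t N n / t N K) powr (1 - \<beta>) / \<Gamma>\<beta>)"
    using tp \<Gamma>\<beta>_pos by (intro mult_left_mono divide_right_mono) auto
  also have "\<dots> \<le> \<delta> N (cutoff N K) n" using assms by (intro \<delta>_cutoff_before) auto
  finally show ?thesis .
qed

lemma n0_exists:
  assumes "0 < (e::real)"
  obtains n0 :: nat where "1 \<le> n0" "real n0 powr (\<beta> - 1) \<le> e"
proof -
  have "((\<lambda>n. real n powr (\<beta> - 1)) \<longlongrightarrow> 0) sequentially"
    using \<beta>_lt by (intro tendsto_neg_powr filterlim_real_sequentially) auto
  then have "eventually (\<lambda>n. real n powr (\<beta> - 1) < e) sequentially"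
    using assms by (intro order_tendstoD(2)) auto
  then have "eventually (\<lambda>n. 1 \<le> n \<and> real n powr (\<beta> - 1) < e) sequentially"
    using eventually_ge_at_top[of 1] by eventually_elim auto
  then obtain n0 where "1 \<le> n0" "real n0 powr (\<beta> - 1) < e" by (auto simp: eventually_sequentially)
  then show thesis by (intro that) auto
qed

text \<open>Sources of the form \<open>t\<^sub>n\<^sup>-\<^sup>1 n\<^sup>-\<^sup>s\<close> are handled by superposing cut-off barriers with
  weights \<open>k\<^sup>-\<^sup>1\<^sup>-\<^sup>s\<close>, in analogy with the continuous resolvent, where a source \<open>\<rho>\<close> acts through its mass
  \<open>\<integral> \<rho>\<close>.  The barriers with cut-off index between \<open>n/2\<close> and \<open>n\<close> produce the source at \<open>t\<^sub>n\<close>; the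
  discretisation errors of all barriers that were cut off before \<open>t\<^sub>n\<close> sum up to the same order, with a constant that is small if
  the first cut-off index \<open>n0\<close> is large.  For \<open>n < 2 n0\<close> the barrier with index \<open>n0\<close> suffices.\<close>

lemma superposed_barrier:
  assumes s: "s \<le> 1 / 4"
  obtains c where "0 < c" "\<And>N m. 1 \<le> m \<Longrightarrow> m \<le> N \<Longrightarrow> \<exists>\<Phi>. \<Phi> 0 = 0 \<and> (\<forall>n. 0 \<le> \<Phi> n) \<and>
    (\<forall>n\<in>{1..m}. \<Phi> n \<le> t N n powr (\<beta> - 1) * (\<Sum>k=1..m. real k powr (- 1 - s)) \<and>
       c * (1 / t N n * real n powr (- s)) \<le> \<delta> N \<Phi> n)"
proof -
  obtain c1 C2 where c1: "0 < c1" and C2: "0 < C2" and after: "\<And>K n N. 1 \<le> K \<Longrightarrow> K < n \<Longrightarrow> n \<le> N \<Longrightarrow>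
    1 / t N n * (c1 * (real K / real n) powr (r * \<beta>) - C2 * real K powr (\<beta> - 1) * (real K / real n) powr (1 / 2))
      \<le> \<delta> N (cutoff N K) n" by (rule \<delta>_cutoff_after) blast
  define h where "h = c1 * (1 / 2) powr (r * \<beta>)"
  define \<kappa> where "\<kappa> = min 1 ((1 / 2) powr (- 1 - s))"
  define Cs where "Cs = 1 + 1 / (1 / 2 - s)"
  have hp: "0 < h" using c1 by (simp add: h_def)
  have kp: "0 < \<kappa>" "\<kappa> \<le> 1" by (auto simp: \<kappa>_def)
  have Cs: "1 \<le> Cs" using s by (simp add: Cs_def)
  \<comment> \<open>so small that the errors sum up to at most half of the main contribution \<open>h \<kappa> / 4\<close>\<close>
  define e0 where "e0 = h * \<kappa> / (8 * C2 * Cs)"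
  have e0: "0 < e0" using hp kp C2 Cs by (simp add: e0_def)
  have e1: "C2 * e0 * Cs = h * \<kappa> / 8" using C2 Cs by (simp add: e0_def)
  have "C2 * e0 * 1 \<le> C2 * e0 * Cs" using C2 e0 Cs by (intro mult_left_mono) auto
  also have "\<dots> \<le> h / 8" unfolding e1 using kp hp by (simp add: mult_left_le)
  finally have e2: "C2 * e0 \<le> h / 2" using hp by simp
  obtain n0 where n0: "1 \<le> n0" "real n0 powr (\<beta> - 1) \<le> e0" using n0_exists[OF e0] by blast
  have kb: "real k powr (\<beta> - 1) \<le> e0" if "n0 \<le> k" for k
  proof -
    have "real k powr (\<beta> - 1) \<le> real n0 powr (\<beta> - 1)" using that n0 \<beta>_lt by (intro powr_mono2') auto
    then show ?thesis using n0 by simp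
  qed
  define \<kappa>a where "\<kappa>a = (real n0 powr (- r) / Q\<^sup>2) powr (1 - \<beta>) / \<Gamma>\<beta>"
  have \<kappa>a: "0 < \<kappa>a" using n0 Q_ge \<Gamma>\<beta>_pos by (simp add: \<kappa>a_def)
  define w where "w k = real k powr (- 1 - s)" for k
  have wp: "0 \<le> w k" for k by (simp add: w_def)
  have wn0: "0 < w n0" using n0 by (simp add: w_def)
  define X where "X = (2 * real n0) powr \<bar>s\<bar>"
  have X: "0 < X" using n0 by (simp add: X_def)
  have ns: "real n powr (- s) \<le> X" if "1 \<le> n" "n \<le> 2 * n0" for n
  proof -
    have "real n powr (- s) \<le> real n powr \<bar>s\<bar>" using that by (intro powr_mono) auto
    also have "\<dots> \<le> X" unfolding X_def using that by (intro powr_mono2) auto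
    finally show ?thesis .
  qed
  define c where "c = min (min (\<kappa>a / X) (w n0 * \<kappa>a / X)) (min (w n0 * (h / 2) / X) (h * \<kappa> / 8))"
  have cp: "0 < c" using \<kappa>a X wn0 hp kp by (simp add: c_def)
  have cX: "c * X \<le> \<kappa>a" "c * X \<le> w n0 * \<kappa>a" "c * X \<le> w n0 * (h / 2)"
    using X by (auto simp: c_def min_def field_simps split: if_splits)
  have c8: "c \<le> h * \<kappa> / 8" unfolding c_def by (intro order_trans[OF min.cobounded2] min.cobounded2)
  have early: "c * (1 / t N n * real n powr (- s)) \<le> 1 / t N n * z"
    if "1 \<le> n" "n \<le> 2 * n0" "n \<le> N" "c * X \<le> z" for n N z
  proof -
    have "c * real n powr (- s) \<le> c * X" using ns that cp by (intro mult_left_mono) auto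
    then have "1 / t N n * (c * real n powr (- s)) \<le> 1 / t N n * z"
      using that t_pos[of n N] by (intro mult_left_mono) auto
    then show ?thesis by (simp add: mult_ac)
  qed
  show thesis
  proof (rule that[OF cp])
    fix N m :: nat assume m: "1 \<le> m" "m \<le> N"
    define Y where "Y = (\<Sum>k=1..m. w k)"
    show "\<exists>\<Phi>. \<Phi> 0 = 0 \<and> (\<forall>n. 0 \<le> \<Phi> n) \<and>
      (\<forall>n\<in>{1..m}. \<Phi> n \<le> t N n powr (\<beta> - 1) * (\<Sum>k=1..m. real k powr (- 1 - s)) \<and>
       c * (1 / t N n * real n powr (- s)) \<le> \<delta> N \<Phi> n)"
    proof (cases "m < n0")
      \<comment> \<open>boundedly many steps: one barrier that is constant up to \<open>t\<^sub>m\<close> suffices\<close>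
      case True
      have "w 1 \<le> Y" unfolding Y_def using m wp by (intro member_le_sum) auto
      then have Y1: "1 \<le> Y" by (simp add: w_def)
      have "cutoff N m n \<le> t N n powr (\<beta> - 1) * Y" if "n \<in> {1..m}" for n
      proof -
        have "cutoff N m n \<le> t N n powr (\<beta> - 1) * 1" using cutoff_le[of n N m] that m by simp
        also have "\<dots> \<le> t N n powr (\<beta> - 1) * Y" using Y1 by (intro mult_left_mono) auto
        finally show ?thesis .
      qed
      moreover have "c * (1 / t N n * real n powr (- s)) \<le> \<delta> N (cutoff N m) n" if n: "n \<in> {1..m}" for n
      proof -
        have "c * (1 / t N n * real n powr (- s)) \<le> 1 / t N n * \<kappa>a"
          using n m True cX by (intro early) auto
        also have "\<dots> \<le> \<delta> N (cutoff N m) n"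
          unfolding \<kappa>a_def using n m True by (intro \<delta>_cutoff_early) auto
        finally show ?thesis .
      qed
      ultimately show ?thesis using cutoff_nonneg by (intro exI[of _ "cutoff N m"]) (auto simp: Y_def w_def)
    next
      case False
      define \<Phi> where "\<Phi> n = (\<Sum>k=n0..m. w k * cutoff N k n)" for n
      have "\<Phi> n \<le> t N n powr (\<beta> - 1) * Y" if n: "n \<in> {1..m}" for n
      proof -
        have "\<Phi> n \<le> (\<Sum>k=n0..m. w k * t N n powr (\<beta> - 1))"
          unfolding \<Phi>_def using n m wp by (intro sum_mono mult_left_mono cutoff_le) auto
        also have "\<dots> \<le> (\<Sum>k=1..m. w k * t N n powr (\<beta> - 1))"
          using n0 wp by (intro sum_mono2) auto
        also have "\<dots> = t N n powr (\<beta> - 1) * Y" by (subst mult.commute) (simp add: Y_def sum_distrib_right)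
        finally show ?thesis .
      qed
      moreover have "c * (1 / t N n * real n powr (- s)) \<le> \<delta> N \<Phi> n" if n: "n \<in> {1..m}" for n
      proof -
        have n': "1 \<le> n" "n \<le> N" "n \<le> m" using n m by auto
        have tp: "0 < t N n" using t_pos n' by auto
        have d\<Phi>: "\<delta> N \<Phi> n = (\<Sum>k=n0..m. w k * \<delta> N (cutoff N k) n)"
          unfolding \<Phi>_def using n' by (intro \<delta>_sum) auto
        have late: "0 \<le> w k * \<delta> N (cutoff N k) n" if "k \<in> {n..m}" for k
        proof -
          have "0 \<le> 1 / t N n * ((t N n / t N k) powr (1 - \<beta>) / \<Gamma>\<beta>)" using tp \<Gamma>\<beta>_pos by simp
          also have "\<dots> \<le> \<delta> N (cutoff N k) n" using that n' m by (intro \<delta>_cutoff_before) auto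
          finally show ?thesis using wp by simp
        qed
        consider "n \<le> n0" | "n0 < n" "n < 2 * n0" | "2 * n0 \<le> n" by linarith
        then show ?thesis
        proof cases
          case 1
          have "c * (1 / t N n * real n powr (- s)) \<le> 1 / t N n * (w n0 * \<kappa>a)"
            using n' 1 cX by (intro early) auto
          also have "\<dots> = w n0 * (1 / t N n * \<kappa>a)" by simp
          also have "\<dots> \<le> w n0 * \<delta> N (cutoff N n0) n"
            unfolding \<kappa>a_def using n' 1 False m wp by (intro mult_left_mono \<delta>_cutoff_early) auto
          also have "\<dots> \<le> \<delta> N \<Phi> n"
            unfolding d\<Phi> using False late 1 by (intro member_le_sum) auto
          finally show ?thesis .
        next
          case 2
          have mid: "1 / t N n * (h / 2) \<le> \<delta> N (cutoff N k) n" if k: "k \<in> {n0..<n}" for k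
          proof -
            have q: "1 / 2 \<le> real k / real n" "real k / real n \<le> 1" using k 2 by (auto simp: field_simps)
            have "c1 * (1 / 2) powr (r * \<beta>) \<le> c1 * (real k / real n) powr (r * \<beta>)"
              using q c1 r_ge \<beta>_pos by (intro mult_left_mono powr_mono2) auto
            moreover have "C2 * real k powr (\<beta> - 1) * (real k / real n) powr (1 / 2) \<le> C2 * e0 * 1"
              using C2 kb[of k] k q e0 by (intro mult_mono mult_left_mono powr_le1) auto
            ultimately have "h / 2 \<le> c1 * (real k / real n) powr (r * \<beta>) - C2 * real k powr (\<beta> - 1) * (real k / real n) powr (1 / 2)"
              using e2 by (simp add: h_def)
            then have "1 / t N n * (h / 2) \<le> 1 / t N n * (c1 * (real k / real n) powr (r * \<beta>) - C2 * real k powr (\<beta> - 1) * (real k / real n) powr (1 / 2))"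
              using tp by (intro mult_left_mono) auto
            also have "\<dots> \<le> \<delta> N (cutoff N k) n" using k n0 n' by (intro after) auto
            finally show ?thesis .
          qed
          have midp: "0 \<le> w k * \<delta> N (cutoff N k) n" if k: "k \<in> {n0..m}" for k
          proof (cases "k < n")
            case True
            have "0 \<le> 1 / t N n * (h / 2)" using tp hp by simp
            also have "\<dots> \<le> \<delta> N (cutoff N k) n" using True k by (intro mid) auto
            finally show ?thesis using wp by simp
          qed (use late k in auto)
          have "c * (1 / t N n * real n powr (- s)) \<le> 1 / t N n * (w n0 * (h / 2))"
            using n' 2 cX by (intro early) auto
          also have "\<dots> = w n0 * (1 / t N n * (h / 2))" by simp
          also have "\<dots> \<le> w n0 * \<delta> N (cutoff N n0) n"
            using 2 wp by (intro mult_left_mono mid) auto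
          also have "\<dots> \<le> \<delta> N \<Phi> n"
            unfolding d\<Phi> using False midp by (intro member_le_sum) auto
          finally show ?thesis .
        next
          case 3
          have n2: "2 \<le> n" "0 < real n" using 3 n0 by auto
          \<comment> \<open>main part and error of the barrier with cut-off index \<open>k\<close>; for the main part only \<open>k \<ge> n / 2\<close> is used\<close>
          define A where "A k = w k * (c1 * (real k / real n) powr (r * \<beta>))" for k
          define B where "B k = w k * (C2 * real k powr (\<beta> - 1) * (real k / real n) powr (1 / 2))" for k
          have "1 / t N n * (\<Sum>k=n0..<n. A k - B k) = (\<Sum>k=n0..<n. w k * (1 / t N n * (c1 * (real k / real n) powr (r * \<beta>) - C2 * real k powr (\<beta> - 1) * (real k / real n) powr (1 / 2))))"
            unfolding sum_distrib_left by (intro sum.cong) (auto simp: A_def B_def algebra_simps)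
          also have "\<dots> \<le> (\<Sum>k=n0..<n. w k * \<delta> N (cutoff N k) n)"
            using n0 n' wp by (intro sum_mono mult_left_mono after) auto
          also have "\<dots> \<le> \<delta> N \<Phi> n"
            unfolding d\<Phi> using n' late by (intro sum_mono2) auto
          finally have low: "1 / t N n * (\<Sum>k=n0..<n. A k - B k) \<le> \<delta> N \<Phi> n" .
          have Ak: "h * \<kappa> * real n powr (- 1 - s) \<le> A k" if k: "k \<in> {n - n div 2..<n}" for k
          proof -
            have k2: "real n \<le> 2 * real k" using k by auto
            have q: "1 / 2 \<le> real k / real n" "real k / real n \<le> 1" using k2 k n2 by (auto simp: field_simps)
            have "\<kappa> * real n powr (- 1 - s) \<le> w k"
            proof (cases "- 1 - s \<le> 0")
              case True
              have "\<kappa> * real n powr (- 1 - s) \<le> 1 * real n powr (- 1 - s)" using kp by (intro mult_right_mono) auto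
              also have "\<dots> \<le> w k" unfolding w_def using True k k2 n2 by (auto intro!: powr_mono2')
              finally show ?thesis .
            next
              case False
              have "\<kappa> * real n powr (- 1 - s) \<le> (1 / 2) powr (- 1 - s) * real n powr (- 1 - s)"
                by (intro mult_right_mono) (auto simp: \<kappa>_def)
              also have "\<dots> = (1 / 2 * real n) powr (- 1 - s)" by (subst powr_mult) auto
              also have "\<dots> \<le> w k" unfolding w_def using False k2 by (intro powr_mono2) auto
              finally show ?thesis .
            qed
            moreover have "h \<le> c1 * (real k / real n) powr (r * \<beta>)"
              unfolding h_def using q c1 r_ge \<beta>_pos by (intro mult_left_mono powr_mono2) auto
            ultimately have "\<kappa> * real n powr (- 1 - s) * h \<le> A k"
              unfolding A_def using hp kp wp by (intro mult_mono) auto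
            then show ?thesis by (simp add: mult_ac)
          qed
          have "h * \<kappa> / 4 * real n powr (- s) = real n / 4 * (h * \<kappa> * real n powr (- 1 - s))"
            using n2 by (simp add: powr_diff powr_minus field_simps)
          also have "\<dots> \<le> real (n div 2) * (h * \<kappa> * real n powr (- 1 - s))"
            using n2 hp kp by (intro mult_right_mono) auto
          also have "\<dots> = (\<Sum>k=n - n div 2..<n. h * \<kappa> * real n powr (- 1 - s))" by simp
          also have "\<dots> \<le> (\<Sum>k=n - n div 2..<n. A k)" using Ak by (intro sum_mono) auto
          also have "\<dots> \<le> (\<Sum>k=n0..<n. A k)"
            using 3 c1 wp by (intro sum_mono2) (auto simp: A_def)
          finally have SA: "h * \<kappa> / 4 * real n powr (- s) \<le> (\<Sum>k=n0..<n. A k)" .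
          have "(\<Sum>k=n0..<n. B k) \<le> (\<Sum>k=n0..<n. C2 * e0 * real n powr (- (1 / 2)) * real k powr ((1 / 2 - s) - 1))"
          proof (rule sum_mono)
            fix k assume k: "k \<in> {n0..<n}"
            have "B k \<le> w k * (C2 * e0 * (real k / real n) powr (1 / 2))"
              unfolding B_def using kb[of k] k C2 wp by (intro mult_left_mono mult_right_mono) auto
            also have "\<dots> = C2 * e0 * real n powr (- (1 / 2)) * (real k powr (- 1 - s) * real k powr (1 / 2))"
              unfolding w_def powr_divide powr_minus_divide[of "real n"] by (simp add: powr_divide)
            also have "real k powr (- 1 - s) * real k powr (1 / 2) = real k powr ((1 / 2 - s) - 1)"
              by (simp only: powr_add[symmetric], rule arg_cong[where f = "\<lambda>x. real k powr x"]) simp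
            finally show "B k \<le> C2 * e0 * real n powr (- (1 / 2)) * real k powr ((1 / 2 - s) - 1)" .
          qed
          also have "\<dots> = C2 * e0 * real n powr (- (1 / 2)) * (\<Sum>k=n0..<n. real k powr ((1 / 2 - s) - 1))"
            by (simp add: sum_distrib_left)
          also have "\<dots> \<le> C2 * e0 * real n powr (- (1 / 2)) * (Cs * real n powr (1 / 2 - s))"
          proof (intro mult_left_mono)
            have "(\<Sum>k=n0..<n. real k powr ((1 / 2 - s) - 1)) \<le> (\<Sum>k=1..n. real k powr ((1 / 2 - s) - 1))"
              using n0 by (intro sum_mono2) auto
            also have "\<dots> \<le> Cs * real n powr (1 / 2 - s)"
              unfolding Cs_def using s by (intro sum_powr_upper) auto
            finally show "(\<Sum>k=n0..<n. real k powr ((1 / 2 - s) - 1)) \<le> Cs * real n powr (1 / 2 - s)" .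
          qed (use C2 e0 in auto)
          also have "\<dots> = (C2 * e0 * Cs) * (real n powr (- (1 / 2)) * real n powr (1 / 2 - s))" by (simp only: mult_ac)
          also have "real n powr (- (1 / 2)) * real n powr (1 / 2 - s) = real n powr (- s)"
            by (simp only: powr_add[symmetric]) simp
          finally have SB: "(\<Sum>k=n0..<n. B k) \<le> h * \<kappa> / 8 * real n powr (- s)" unfolding e1 .
          have "c * real n powr (- s) \<le> h * \<kappa> / 8 * real n powr (- s)" using c8 by (intro mult_right_mono) auto
          also have "\<dots> \<le> (\<Sum>k=n0..<n. A k - B k)" unfolding sum_subtractf using SA SB by simp
          finally have "1 / t N n * (c * real n powr (- s)) \<le> 1 / t N n * (\<Sum>k=n0..<n. A k - B k)"
            using tp by (intro mult_left_mono) auto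
          then show ?thesis using low by (simp add: mult_ac)
        qed
      qed
      ultimately show ?thesis using wp cutoff_nonneg
        by (intro exI[of _ \<Phi>]) (auto simp: Y_def w_def \<Phi>_def intro!: sum_nonneg)
    qed
  qed
qed

text \<open>Adding a multiple of the exponential barrier absorbs the Gronwall term; here \<open>\<beta> > 1/2\<close> enters, because
  then \<open>t\<^sub>n\<^sup>\<beta>\<^sup>-\<^sup>1\<close> is dominated by \<open>t\<^sub>n\<^sup>-\<^sup>\<beta>\<close>, which that barrier produces.\<close>

lemma stability_barrier:
  assumes s: "s \<le> 1 / 4" and lam: "0 \<le> lam"
  obtains C \<tau>0 where "0 < C" "0 < \<tau>0" "\<And>N m. 1 \<le> m \<Longrightarrow> m \<le> N \<Longrightarrow> max_step N (t N) \<le> \<tau>0 \<Longrightarrow>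
    \<exists>B. B 0 = 0 \<and> (\<forall>n. 0 \<le> B n) \<and>
      (\<forall>n\<in>{1..m}. lam * (B n + B (n - 1)) + 1 / t N n * real n powr (- s) \<le> \<delta> N B n) \<and>
      B m \<le> C * (t N m powr (\<beta> - 1) * (\<Sum>k=1..m. real k powr (- 1 - s)))"
proof -
  obtain c where c: "0 < c" and \<Phi>ex: "\<And>N m. 1 \<le> m \<Longrightarrow> m \<le> N \<Longrightarrow> \<exists>\<Phi>. \<Phi> 0 = 0 \<and> (\<forall>n. 0 \<le> \<Phi> n) \<and>
    (\<forall>n\<in>{1..m}. \<Phi> n \<le> t N n powr (\<beta> - 1) * (\<Sum>k=1..m. real k powr (- 1 - s)) \<and>
       c * (1 / t N n * real n powr (- s)) \<le> \<delta> N \<Phi> n)"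
    by (rule superposed_barrier[OF s]) blast
  have "0 \<le> 2 * lam" using lam by simp
  then obtain \<mu> \<tau>0 where \<mu>: "0 \<le> \<mu>" "0 < \<tau>0" and Fb: "\<And>N n. 1 \<le> n \<Longrightarrow> n \<le> N \<Longrightarrow> max_step N (t N) \<le> \<tau>0 \<Longrightarrow>
      2 * lam * exp (\<mu> * t N n) + t N n powr (- \<beta>) / (2 * \<Gamma>\<beta>) \<le> \<delta> N (\<lambda>k. if k = 0 then 0 else exp (\<mu> * t N k)) n"
    by (rule exp_barrier) blast
  define D0 where "D0 = lam / c * (1 + E powr (1 - \<beta>)) * T powr (2 * \<beta> - 1)"
  define D where "D = 2 * \<Gamma>\<beta> * D0"
  have D0: "0 \<le> D0" using lam c by (simp add: D0_def)
  then have D: "0 \<le> D" using \<Gamma>\<beta>_pos by (simp add: D_def)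
  define C where "C = 1 / c + D * exp (\<mu> * T) * T powr (1 - \<beta>)"
  have C: "0 < C" using c D by (simp add: C_def add_pos_nonneg)
  show thesis
  proof (rule that[OF C \<mu>(2)])
    fix N m :: nat assume m: "1 \<le> m" "m \<le> N" and ms: "max_step N (t N) \<le> \<tau>0"
    define Y where "Y = (\<Sum>k=1..m. real k powr (- 1 - s))"
    have Y: "0 \<le> Y" by (auto simp: Y_def intro!: sum_nonneg)
    obtain \<Phi> where \<Phi>: "\<Phi> 0 = 0" "\<And>n. 0 \<le> \<Phi> n" "\<And>n. n \<in> {1..m} \<Longrightarrow> \<Phi> n \<le> t N n powr (\<beta> - 1) * Y"
      "\<And>n. n \<in> {1..m} \<Longrightarrow> c * (1 / t N n * real n powr (- s)) \<le> \<delta> N \<Phi> n"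
      using \<Phi>ex[OF m] unfolding Y_def by blast
    define F where "F k = (if k = 0 then 0 else exp (\<mu> * t N k))" for k
    define B where "B k = 1 / c * \<Phi> k + D * Y * F k" for k
    have B0: "0 \<le> B n" for n using \<Phi>(2) c D Y by (simp add: B_def F_def)
    have ineq: "lam * (B n + B (n - 1)) + 1 / t N n * real n powr (- s) \<le> \<delta> N B n" if n: "n \<in> {1..m}" for n
    proof -
      have n': "1 \<le> n" "n \<le> N" using n m by auto
      have tp: "0 < t N n" using t_pos n' by auto
      have F1: "F (n - 1) \<le> F n" using n' \<mu> t_le[of "n - 1" n N] by (auto simp: F_def intro!: mult_left_mono)
      have "\<Phi> (n - 1) \<le> E powr (1 - \<beta>) * t N n powr (\<beta> - 1) * Y"
      proof (cases "n = 1")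
        case False
        then have n1: "0 < t N (n - 1)" "n - 1 \<in> {1..m}" using n n' t_pos by auto
        have "t N n / E \<le> t N (n - 1)" using t_Suc_le[of "n - 1" N] False n' E_ge by (simp add: field_simps)
        then have "t N (n - 1) powr (\<beta> - 1) \<le> (t N n / E) powr (\<beta> - 1)"
          using tp E_ge \<beta>_lt by (intro powr_mono2') auto
        also have "\<dots> = E powr (1 - \<beta>) * t N n powr (\<beta> - 1)"
          using tp E_ge powr_minus_divide[of E "\<beta> - 1"] by (simp add: powr_divide)
        finally have "t N (n - 1) powr (\<beta> - 1) * Y \<le> E powr (1 - \<beta>) * t N n powr (\<beta> - 1) * Y"
          using Y by (intro mult_right_mono)
        then show ?thesis using \<Phi>(3)[OF n1(2)] by simp
      qed (use \<Phi>(1) Y in auto)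
      then have "\<Phi> n + \<Phi> (n - 1) \<le> (1 + E powr (1 - \<beta>)) * t N n powr (\<beta> - 1) * Y"
        using \<Phi>(3)[OF n] by (simp add: algebra_simps)
      also have "\<dots> \<le> (1 + E powr (1 - \<beta>)) * (T powr (2 * \<beta> - 1) * t N n powr (- \<beta>)) * Y"
      proof (intro mult_right_mono mult_left_mono)
        have "t N n powr (\<beta> - 1) = t N n powr (2 * \<beta> - 1) * t N n powr (- \<beta>)"
          by (simp only: powr_add[symmetric]) simp
        also have "\<dots> \<le> T powr (2 * \<beta> - 1) * t N n powr (- \<beta>)"
          using t_le_T[of N n] n' tp \<beta>_gt by (intro mult_right_mono powr_mono2) auto
        finally show "t N n powr (\<beta> - 1) \<le> T powr (2 * \<beta> - 1) * t N n powr (- \<beta>)" .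
      qed (use Y in auto)
      finally have "lam / c * (\<Phi> n + \<Phi> (n - 1)) \<le> lam / c * ((1 + E powr (1 - \<beta>)) * (T powr (2 * \<beta> - 1) * t N n powr (- \<beta>)) * Y)"
        using lam c by (intro mult_left_mono) auto
      also have "\<dots> = D * Y * (t N n powr (- \<beta>) / (2 * \<Gamma>\<beta>))" using \<Gamma>\<beta>_pos by (simp add: D_def D0_def mult_ac)
      finally have a: "lam / c * (\<Phi> n + \<Phi> (n - 1)) \<le> D * Y * (t N n powr (- \<beta>) / (2 * \<Gamma>\<beta>))" .
      have "lam * (F n + F (n - 1)) \<le> 2 * lam * F n" using mult_left_mono[OF F1 lam] by (simp add: algebra_simps)
      then have b: "D * Y * (lam * (F n + F (n - 1))) \<le> D * Y * (2 * lam * F n)"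
        using D Y by (intro mult_left_mono) auto
      have "2 * lam * F n + t N n powr (- \<beta>) / (2 * \<Gamma>\<beta>) \<le> \<delta> N F n"
        using Fb[OF n' ms] n' unfolding F_def[abs_def] by simp
      then have "D * Y * (2 * lam * F n + t N n powr (- \<beta>) / (2 * \<Gamma>\<beta>)) \<le> D * Y * \<delta> N F n"
        using D Y by (intro mult_left_mono) auto
      then have cc: "D * Y * (2 * lam * F n) + D * Y * (t N n powr (- \<beta>) / (2 * \<Gamma>\<beta>)) \<le> D * Y * \<delta> N F n"
        by (simp only: distrib_left)
      have "1 / c * (c * (1 / t N n * real n powr (- s))) \<le> 1 / c * \<delta> N \<Phi> n"
        using \<Phi>(4)[OF n] c by (intro mult_left_mono) auto
      then have d: "1 / t N n * real n powr (- s) \<le> 1 / c * \<delta> N \<Phi> n" using c by simp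
      have "\<delta> N B n = 1 / c * \<delta> N \<Phi> n + D * Y * \<delta> N F n"
        unfolding \<delta>_eq[OF n'] sum_distrib_left sum.distrib[symmetric]
        by (intro sum.cong refl) (simp add: B_def algebra_simps)
      moreover have "lam * (B n + B (n - 1)) = lam / c * (\<Phi> n + \<Phi> (n - 1)) + D * Y * (lam * (F n + F (n - 1)))"
        by (simp add: B_def algebra_simps add_divide_distrib)
      ultimately show ?thesis using a b cc d by linarith
    qed
    have tm: "0 < t N m" "t N m \<le> T" using t_pos t_le_T m by auto
    have "t N m powr (1 - \<beta>) \<le> T powr (1 - \<beta>)" using tm \<beta>_lt by (intro powr_mono2) auto
    then have "t N m powr (1 - \<beta>) * t N m powr (\<beta> - 1) \<le> T powr (1 - \<beta>) * t N m powr (\<beta> - 1)" by (intro mult_right_mono) auto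
    then have one: "1 \<le> T powr (1 - \<beta>) * t N m powr (\<beta> - 1)" using tm by (simp flip: powr_add)
    have "F m \<le> exp (\<mu> * T)" using m \<mu> tm by (simp add: F_def mult_left_mono)
    also have "exp (\<mu> * T) \<le> exp (\<mu> * T) * (T powr (1 - \<beta>) * t N m powr (\<beta> - 1))"
      using mult_left_mono[OF one, of "exp (\<mu> * T)"] by simp
    finally have "D * Y * F m \<le> D * Y * (exp (\<mu> * T) * (T powr (1 - \<beta>) * t N m powr (\<beta> - 1)))"
      using D Y by (intro mult_left_mono) auto
    moreover have "1 / c * \<Phi> m \<le> 1 / c * (t N m powr (\<beta> - 1) * Y)" using \<Phi>(3)[of m] m c by (intro mult_left_mono) auto
    moreover have "C * (t N m powr (\<beta> - 1) * Y) = 1 / c * (t N m powr (\<beta> - 1) * Y) + D * Y * (exp (\<mu> * T) * (T powr (1 - \<beta>) * t N m powr (\<beta> - 1)))"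
      by (simp add: C_def algebra_simps)
    ultimately have "B m \<le> C * (t N m powr (\<beta> - 1) * Y)" unfolding B_def by linarith
    then show "\<exists>B. B 0 = 0 \<and> (\<forall>n. 0 \<le> B n) \<and>
      (\<forall>n\<in>{1..m}. lam * (B n + B (n - 1)) + 1 / t N n * real n powr (- s) \<le> \<delta> N B n) \<and>
      B m \<le> C * (t N m powr (\<beta> - 1) * (\<Sum>k=1..m. real k powr (- 1 - s)))"
      using B0 ineq \<Phi>(1) by (intro exI[of _ B]) (auto simp: B_def F_def Y_def)
  qed
qed


text \<open>Up to constants, the sum of the source \<open>t\<^sub>n\<^sup>-\<^sup>1 n\<^sup>-\<^sup>s\<close> over the steps \<open>\<tau>\<^sub>n \<simeq> t\<^sub>n / n\<close>.\<close>

definition mass :: "real \<Rightarrow> nat \<Rightarrow> real" where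
  "mass s m = (\<Sum>k=1..m. real k powr (- 1 - s))"

lemma mass_nonneg: "0 \<le> mass s m"
  by (auto simp: mass_def intro!: sum_nonneg)

text \<open>Stability for three simultaneous sources: the barriers add up, and the comparison principle applies
  to their sum.\<close>

lemma stability_estimate:
  assumes s: "s1 \<le> 1 / 4" "s2 \<le> 1 / 4" "s3 \<le> 1 / 4" and lam: "0 \<le> lam"
  obtains C \<tau>0 where "0 < C" "0 < \<tau>0" "\<And>N m W A1 A2 A3. 1 \<le> m \<Longrightarrow> m \<le> N \<Longrightarrow> max_step N (t N) \<le> \<tau>0 \<Longrightarrow>
    0 \<le> A1 \<Longrightarrow> 0 \<le> A2 \<Longrightarrow> 0 \<le> A3 \<Longrightarrow> W 0 = 0 \<Longrightarrow>
    (\<And>n. 1 \<le> n \<Longrightarrow> n \<le> m \<Longrightarrow> \<delta> N W n \<le> lam * (W n + W (n - 1)) +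
       1 / t N n * (A1 * real n powr (- s1) + A2 * real n powr (- s2) + A3 * real n powr (- s3))) \<Longrightarrow>
    W m \<le> C * (t N m powr (\<beta> - 1) * (A1 * mass s1 m + A2 * mass s2 m + A3 * mass s3 m))"
proof -
  obtain C1 \<tau>1 where 1: "0 < C1" "0 < \<tau>1" "\<And>N m. 1 \<le> m \<Longrightarrow> m \<le> N \<Longrightarrow> max_step N (t N) \<le> \<tau>1 \<Longrightarrow>
    \<exists>B. B 0 = 0 \<and> (\<forall>n. 0 \<le> B n) \<and>
      (\<forall>n\<in>{1..m}. lam * (B n + B (n - 1)) + 1 / t N n * real n powr (- s1) \<le> \<delta> N B n) \<and>
      B m \<le> C1 * (t N m powr (\<beta> - 1) * mass s1 m)"
    unfolding mass_def by (rule stability_barrier[OF s(1) lam]) blast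
  obtain C2 \<tau>2 where 2: "0 < C2" "0 < \<tau>2" "\<And>N m. 1 \<le> m \<Longrightarrow> m \<le> N \<Longrightarrow> max_step N (t N) \<le> \<tau>2 \<Longrightarrow>
    \<exists>B. B 0 = 0 \<and> (\<forall>n. 0 \<le> B n) \<and>
      (\<forall>n\<in>{1..m}. lam * (B n + B (n - 1)) + 1 / t N n * real n powr (- s2) \<le> \<delta> N B n) \<and>
      B m \<le> C2 * (t N m powr (\<beta> - 1) * mass s2 m)"
    unfolding mass_def by (rule stability_barrier[OF s(2) lam]) blast
  obtain C3 \<tau>3 where 3: "0 < C3" "0 < \<tau>3" "\<And>N m. 1 \<le> m \<Longrightarrow> m \<le> N \<Longrightarrow> max_step N (t N) \<le> \<tau>3 \<Longrightarrow>
    \<exists>B. B 0 = 0 \<and> (\<forall>n. 0 \<le> B n) \<and>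
      (\<forall>n\<in>{1..m}. lam * (B n + B (n - 1)) + 1 / t N n * real n powr (- s3) \<le> \<delta> N B n) \<and>
      B m \<le> C3 * (t N m powr (\<beta> - 1) * mass s3 m)"
    unfolding mass_def by (rule stability_barrier[OF s(3) lam]) blast
  define \<tau>4 where "\<tau>4 = (\<Gamma>\<beta> * (lam + 1)) powr (- 1 / \<beta>)"
  have \<tau>4: "0 < \<tau>4" using \<Gamma>\<beta>_pos lam by (simp add: \<tau>4_def)
  have \<tau>4e: "\<tau>4 powr (- \<beta>) / \<Gamma>\<beta> = lam + 1"
    using \<Gamma>\<beta>_pos lam \<beta>_pos by (simp add: \<tau>4_def powr_powr)
  define \<tau>0 where "\<tau>0 = min (min \<tau>1 \<tau>2) (min \<tau>3 \<tau>4)"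
  define C where "C = C1 + C2 + C3"
  show thesis
  proof (rule that[of C \<tau>0])
    show "0 < C" "0 < \<tau>0" using 1(1,2) 2(1,2) 3(1,2) \<tau>4 by (auto simp: C_def \<tau>0_def)
    fix N m :: nat and W :: "nat \<Rightarrow> real" and A1 A2 A3 :: real
    assume m: "1 \<le> m" "m \<le> N" and ms: "max_step N (t N) \<le> \<tau>0" and A: "0 \<le> A1" "0 \<le> A2" "0 \<le> A3"
      and W0: "W 0 = 0" and W: "\<And>n. 1 \<le> n \<Longrightarrow> n \<le> m \<Longrightarrow> \<delta> N W n \<le> lam * (W n + W (n - 1)) +
       1 / t N n * (A1 * real n powr (- s1) + A2 * real n powr (- s2) + A3 * real n powr (- s3))"
    have ms': "max_step N (t N) \<le> \<tau>1" "max_step N (t N) \<le> \<tau>2" "max_step N (t N) \<le> \<tau>3" "max_step N (t N) \<le> \<tau>4"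
      using ms by (auto simp: \<tau>0_def)
    obtain B1 where B1: "B1 0 = 0" "\<And>n. n \<in> {1..m} \<Longrightarrow> lam * (B1 n + B1 (n - 1)) + 1 / t N n * real n powr (- s1) \<le> \<delta> N B1 n"
      "B1 m \<le> C1 * (t N m powr (\<beta> - 1) * mass s1 m)" using 1(3)[OF m ms'(1)] by blast
    obtain B2 where B2: "B2 0 = 0" "\<And>n. n \<in> {1..m} \<Longrightarrow> lam * (B2 n + B2 (n - 1)) + 1 / t N n * real n powr (- s2) \<le> \<delta> N B2 n"
      "B2 m \<le> C2 * (t N m powr (\<beta> - 1) * mass s2 m)" using 2(3)[OF m ms'(2)] by blast
    obtain B3 where B3: "B3 0 = 0" "\<And>n. n \<in> {1..m} \<Longrightarrow> lam * (B3 n + B3 (n - 1)) + 1 / t N n * real n powr (- s3) \<le> \<delta> N B3 n"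
      "B3 m \<le> C3 * (t N m powr (\<beta> - 1) * mass s3 m)" using 3(3)[OF m ms'(3)] by blast
    define B where "B k = A1 * B1 k + A2 * B2 k + A3 * B3 k" for k
    have "W m \<le> B m"
    proof (rule comparison[OF m(2) lam])
      fix n assume n: "1 \<le> n" "n \<le> m"
      show "lam < g N n n" using g_diag_lower[OF \<tau>4 ms'(4), of n] n m \<tau>4e by simp
      have nN: "1 \<le> n" "n \<le> N" using n m by auto
      have "\<delta> N B n = A1 * \<delta> N B1 n + A2 * \<delta> N B2 n + A3 * \<delta> N B3 n"
        unfolding \<delta>_eq[OF nN] sum_distrib_left sum.distrib[symmetric]
        by (intro sum.cong refl) (simp add: B_def algebra_simps)
      moreover have "A1 * (lam * (B1 n + B1 (n - 1)) + 1 / t N n * real n powr (- s1)) \<le> A1 * \<delta> N B1 n"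
        using B1(2)[of n] n A by (intro mult_left_mono) auto
      moreover have "A2 * (lam * (B2 n + B2 (n - 1)) + 1 / t N n * real n powr (- s2)) \<le> A2 * \<delta> N B2 n"
        using B2(2)[of n] n A by (intro mult_left_mono) auto
      moreover have "A3 * (lam * (B3 n + B3 (n - 1)) + 1 / t N n * real n powr (- s3)) \<le> A3 * \<delta> N B3 n"
        using B3(2)[of n] n A by (intro mult_left_mono) auto
      moreover have "lam * (B n + B (n - 1)) + 1 / t N n * (A1 * real n powr (- s1) + A2 * real n powr (- s2) + A3 * real n powr (- s3))
        = A1 * (lam * (B1 n + B1 (n - 1)) + 1 / t N n * real n powr (- s1)) + A2 * (lam * (B2 n + B2 (n - 1)) + 1 / t N n * real n powr (- s2))
         + A3 * (lam * (B3 n + B3 (n - 1)) + 1 / t N n * real n powr (- s3))"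
        by (simp add: B_def algebra_simps add_divide_distrib)
      ultimately show "\<delta> N W n - lam * (W n + W (n - 1)) \<le> \<delta> N B n - lam * (B n + B (n - 1))"
        using W[OF n] by linarith
    qed (use W0 B1(1) B2(1) B3(1) m in \<open>auto simp: B_def\<close>)
    also have "B m \<le> A1 * (C * (t N m powr (\<beta> - 1) * mass s1 m)) + A2 * (C * (t N m powr (\<beta> - 1) * mass s2 m)) + A3 * (C * (t N m powr (\<beta> - 1) * mass s3 m))"
      unfolding B_def
    proof (intro add_mono mult_left_mono)
      have "C1 * (t N m powr (\<beta> - 1) * mass s1 m) \<le> C * (t N m powr (\<beta> - 1) * mass s1 m)"
        "C2 * (t N m powr (\<beta> - 1) * mass s2 m) \<le> C * (t N m powr (\<beta> - 1) * mass s2 m)"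
        "C3 * (t N m powr (\<beta> - 1) * mass s3 m) \<le> C * (t N m powr (\<beta> - 1) * mass s3 m)"
        using 1(1) 2(1) 3(1) mass_nonneg by (auto simp: C_def intro!: mult_right_mono)
      then show "B1 m \<le> C * (t N m powr (\<beta> - 1) * mass s1 m)" "B2 m \<le> C * (t N m powr (\<beta> - 1) * mass s2 m)"
        "B3 m \<le> C * (t N m powr (\<beta> - 1) * mass s3 m)" using B1(3) B2(3) B3(3) by linarith+
    qed (use A in auto)
    also have "\<dots> = C * (t N m powr (\<beta> - 1) * (A1 * mass s1 m + A2 * mass s2 m + A3 * mass s3 m))"
      by (simp add: algebra_simps)
    finally show "W m \<le> C * (t N m powr (\<beta> - 1) * (A1 * mass s1 m + A2 * mass s2 m + A3 * mass s3 m))" .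
  qed
qed

section \<open>Convergence rates in time\<close>

lemma mass_neg: "s < 0 \<Longrightarrow> mass s m \<le> (1 + 1 / (- s)) * real m powr (- s)"
proof -
  assume "s < 0"
  moreover have e: "- s - 1 = - 1 - s" by simp
  ultimately show ?thesis using sum_powr_upper[of "- s" m, unfolded e] unfolding mass_def by simp
qed

lemma mass_pos: "0 < s \<Longrightarrow> mass s m \<le> (\<Sum>k. real (Suc k) powr (- 1 - s))"
  using sum_powr_le_suminf[of "- 1 - s" m] by (simp add: mass_def)

lemma mass_0: "1 \<le> m \<Longrightarrow> mass 0 m \<le> 1 + ln (real m)"
proof (induction m rule: dec_induct)
  case (step m)
  have "ln (1 - 1 / real (Suc m)) \<le> - (1 / real (Suc m))"
    using ln_add_one_self_le_self2[of "- (1 / real (Suc m))"] step by simp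
  also have "1 - 1 / real (Suc m) = real m / real (Suc m)" by (simp add: field_simps)
  finally have "1 / real (Suc m) \<le> ln (real (Suc m)) - ln (real m)"
    using step by (simp add: ln_div)
  then show ?case using step by (simp add: mass_def powr_minus_divide)
qed (simp add: mass_def)

lemma index_powr_le:
  assumes "1 \<le> m" "m \<le> N" "0 \<le> e"
  shows "real m powr (r * e) \<le> Q powr e * (t N m / t N 1) powr e"
proof -
  have tp: "0 < t N 1" "0 < t N m" using t_pos assms by auto
  have "real m powr r \<le> Q * (t N m / t N 1)" using t_lower[of m N] assms tp by (simp add: field_simps)
  then have "(real m powr r) powr e \<le> (Q * (t N m / t N 1)) powr e" using assms by (intro powr_mono2) auto
  also have "\<dots> = Q powr e * (t N m / t N 1) powr e" by (rule powr_mult)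
  finally show ?thesis by (simp add: powr_powr)
qed

text \<open>The rate of the theorem, with \<open>H\<close> in the place of \<open>h\<^sup>2\<close>.\<close>

definition rate :: "real \<Rightarrow> real \<Rightarrow> real \<Rightarrow> real" where
  "rate \<tau>1 s H =
    (if r \<le> 2 / (\<beta> + 1) then \<tau>1 * s powr (\<beta> - 1) + H * s powr \<beta>
     else if r < 3 - \<beta> then \<tau>1 * s powr (\<beta> - 1) + \<tau>1 powr (2 / r) * s powr (2 * \<beta> - 2 / r) + H * s powr \<beta>
     else if r = 3 - \<beta> then (1 + ln (s / \<tau>1)) * \<tau>1 * s powr (\<beta> - 1)
        + \<tau>1 powr (2 / r) * s powr (2 * \<beta> - 2 / r) + H * s powr \<beta>
     else \<tau>1 powr ((3 - \<beta>) / r) * s powr (\<beta> - (3 - \<beta>) / r)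
        + \<tau>1 powr (2 / r) * s powr (2 * \<beta> - 2 / r) + H * s powr \<beta>)"

text \<open>The parts of the rate that stem from the truncation of the fractional derivative and from interpolation at the evaluation
  point.\<close>

definition rate1 :: "real \<Rightarrow> real \<Rightarrow> real" where
  "rate1 \<tau>1 s = (if r < 3 - \<beta> then \<tau>1 * s powr (\<beta> - 1) else if r = 3 - \<beta> then (1 + ln (s / \<tau>1)) * \<tau>1 * s powr (\<beta> - 1)
     else \<tau>1 powr ((3 - \<beta>) / r) * s powr (\<beta> - (3 - \<beta>) / r))"

definition rate2 :: "real \<Rightarrow> real \<Rightarrow> real" where
  "rate2 \<tau>1 s = (if r \<le> 2 / (\<beta> + 1) then \<tau>1 * s powr (\<beta> - 1) else \<tau>1 powr (2 / r) * s powr (2 * \<beta> - 2 / r))"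

lemma r_case: "r \<le> 2 / (\<beta> + 1) \<Longrightarrow> r < 3 - \<beta>"
proof -
  assume a: "r \<le> 2 / (\<beta> + 1)"
  have "\<beta> * \<beta> < 2 * \<beta> + 1" using mult_strict_right_mono[of \<beta> 1 \<beta>] \<beta>_lt \<beta>_pos by linarith
  then have "2 < (3 - \<beta>) * (\<beta> + 1)" by (simp add: algebra_simps)
  then have "2 / (\<beta> + 1) < 3 - \<beta>" using \<beta>_pos by (simp add: field_simps)
  then show ?thesis using a by simp
qed

lemma rate_parts:
  assumes "0 < \<tau>1" "\<tau>1 \<le> s" "0 \<le> H"
  shows "0 \<le> rate1 \<tau>1 s" "0 \<le> rate2 \<tau>1 s" "rate1 \<tau>1 s + rate2 \<tau>1 s + H * s powr \<beta> \<le> 2 * rate \<tau>1 s H"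
proof -
  have l: "0 \<le> ln (s / \<tau>1)" using assms by simp
  then show a: "0 \<le> rate1 \<tau>1 s" "0 \<le> rate2 \<tau>1 s" using assms by (auto simp: rate1_def rate2_def)
  have H: "0 \<le> H * s powr \<beta>" using assms by simp
  show "rate1 \<tau>1 s + rate2 \<tau>1 s + H * s powr \<beta> \<le> 2 * rate \<tau>1 s H"
  proof (cases "r \<le> 2 / (\<beta> + 1)")
    case True
    then show ?thesis using r_case H by (simp add: rate1_def rate2_def rate_def)
  next
    case False
    then have "rate \<tau>1 s H = rate1 \<tau>1 s + rate2 \<tau>1 s + H * s powr \<beta>"
      by (simp add: rate1_def rate2_def rate_def)
    then show ?thesis using a H by linarith
  qed
qed

text \<open>The exponent of the truncation error after division by \<open>\<tau>\<^sub>1 / t\<^sub>n \<simeq> n\<^sup>-\<^sup>r\<close>.  The cap \<open>1/4\<close> is the one of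
  \<open>superposed_barrier\<close>; it only concerns positive exponents, whose sums converge anyway.\<close>

definition "s_trunc = min (min (r * \<beta>) (3 - \<beta> - r)) (1 / 4)"

text \<open>The interpolation error \<open>t\<^sub>n\<^sup>\<beta> n\<^sup>-\<^sup>2\<close> after division by \<open>\<tau>\<^sub>1\<^sup>1\<^sup>+\<^sup>\<beta> / t\<^sub>n\<close> grows like \<open>n\<close> to the power
  \<open>r (1 + \<beta>) - 2\<close>.  In the first case this power need not be positive and is replaced by the larger \<open>r \<beta>\<close>: then the sum is always of the
  order of its upper limit, and the loss disappears behind \<open>\<tau>\<^sub>1 t\<^sub>n\<^sup>\<beta>\<^sup>-\<^sup>1\<close>.\<close>

definition "s_interp = (if r \<le> 2 / (\<beta> + 1) then - (r * \<beta>) else 2 - r * (1 + \<beta>))"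

text \<open>The three regimes of \<open>r\<close> are those of a convergent, a logarithmic and a divergent sum.\<close>

lemma mass_trunc:
  obtains C where "0 < C" "\<And>N m. 1 \<le> m \<Longrightarrow> m \<le> N \<Longrightarrow> t N m powr (\<beta> - 1) * (t N 1 * mass s_trunc m) \<le> C * rate1 (t N 1) (t N m)"
proof -
  have rb: "0 < r * \<beta>" using r_ge \<beta>_pos by auto
  consider "r < 3 - \<beta>" | "r = 3 - \<beta>" | "3 - \<beta> < r" by linarith
  then show thesis
  proof cases
    case 1
    define S where "S = (\<Sum>k. real (Suc k) powr (- 1 - s_trunc))"
    have s: "0 < s_trunc" using 1 rb by (simp add: s_trunc_def)
    show thesis
    proof (rule that[of "\<bar>S\<bar> + 1"])
      fix N m assume m: "1 \<le> m" "m \<le> (N::nat)"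
      have "mass s_trunc m \<le> \<bar>S\<bar> + 1" using mass_pos[OF s, of m] by (simp add: S_def)
      then have "t N m powr (\<beta> - 1) * (t N 1 * mass s_trunc m) \<le> t N m powr (\<beta> - 1) * (t N 1 * (\<bar>S\<bar> + 1))"
        using t_pos[of 1 N] m by (intro mult_left_mono) auto
      then show "t N m powr (\<beta> - 1) * (t N 1 * mass s_trunc m) \<le> (\<bar>S\<bar> + 1) * rate1 (t N 1) (t N m)"
        using 1 by (simp add: rate1_def mult_ac)
    qed auto
  next
    case 2
    have "3 - \<beta> - r = 0" using 2 by simp
    then have s: "s_trunc = 0" unfolding s_trunc_def using rb by simp
    have lQ: "0 \<le> ln Q" using Q_ge by simp
    show thesis
    proof (rule that[of "1 + ln Q"])
      show "0 < 1 + ln Q" using lQ by linarith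
      fix N m assume m: "1 \<le> m" "m \<le> (N::nat)"
      have tp: "0 < t N 1" "t N 1 \<le> t N m" using t_pos t_le m by auto
      define l where "l = ln (t N m / t N 1)"
      have l: "0 \<le> l" using tp by (simp add: l_def)
      have "real m powr 1 \<le> real m powr r" using r_ge m by (intro powr_mono) auto
      then have "t N 1 * real m \<le> t N 1 * real m powr r" using tp by (intro mult_left_mono) auto
      then have "t N 1 * real m \<le> Q * t N m" using t_lower[of m N] m by linarith
      then have "real m \<le> Q * (t N m / t N 1)" using tp by (simp add: field_simps)
      then have "ln (real m) \<le> ln (Q * (t N m / t N 1))" using m tp Q_ge by (subst ln_le_cancel_iff) auto
      also have "\<dots> = ln Q + l" unfolding l_def using tp Q_ge by (subst ln_mult) auto
      finally have "mass s_trunc m \<le> 1 + ln Q + l" using mass_0[OF m(1)] s by simp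
      also have "\<dots> \<le> (1 + ln Q) * (1 + l)" using l lQ by (simp add: algebra_simps)
      finally have "t N m powr (\<beta> - 1) * (t N 1 * mass s_trunc m) \<le> t N m powr (\<beta> - 1) * (t N 1 * ((1 + ln Q) * (1 + l)))"
        using tp by (intro mult_left_mono) auto
      then show "t N m powr (\<beta> - 1) * (t N 1 * mass s_trunc m) \<le> (1 + ln Q) * rate1 (t N 1) (t N m)"
      proof -
        have nl: "\<not> r < 3 - \<beta>" using 2 by simp
        have e: "rate1 (t N 1) (t N m) = (1 + l) * t N 1 * t N m powr (\<beta> - 1)"
          unfolding rate1_def l_def if_not_P[OF nl] if_P[OF 2] ..
        then show ?thesis
          using \<open>t N m powr (\<beta> - 1) * (t N 1 * mass s_trunc m) \<le> t N m powr (\<beta> - 1) * (t N 1 * ((1 + ln Q) * (1 + l)))\<close>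
          unfolding e by (simp only: mult_ac)
      qed
    qed
  next
    case 3
    have s: "s_trunc = 3 - \<beta> - r" using 3 rb by (auto simp: s_trunc_def min_def)
    define e where "e = 1 - (3 - \<beta>) / r"
    have e: "0 \<le> e" "- s_trunc = r * e" using 3 r_ge by (auto simp: e_def s field_simps)
    define K where "K = (1 + 1 / (- s_trunc)) * Q powr e"
    show thesis
    proof (rule that[of K])
      have "0 < 1 / (- s_trunc)" using 3 by (simp add: s)
      then show K: "0 < K" unfolding K_def using Q_ge by (intro mult_pos_pos add_pos_pos) auto
      fix N m assume m: "1 \<le> m" "m \<le> (N::nat)"
      have tp: "0 < t N 1" "0 < t N m" using t_pos m by auto
      have "mass s_trunc m \<le> (1 + 1 / (- s_trunc)) * real m powr (- s_trunc)"
        using 3 by (intro mass_neg) (simp add: s)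
      also have "\<dots> \<le> (1 + 1 / (- s_trunc)) * (Q powr e * (t N m / t N 1) powr e)"
        unfolding e(2) using m e 3 by (intro mult_left_mono index_powr_le) (auto simp flip: e(2) simp: s)
      finally have "t N m powr (\<beta> - 1) * (t N 1 * mass s_trunc m) \<le> t N m powr (\<beta> - 1) * (t N 1 * (K * (t N m / t N 1) powr e))"
        using tp by (intro mult_left_mono) (auto simp: K_def)
      also have "\<dots> = K * ((t N m powr (\<beta> - 1) * t N m powr e) * (t N 1 powr 1 * t N 1 powr (- e)))"
        using tp by (simp add: powr_divide powr_minus field_simps)
      also have "\<dots> = K * rate1 (t N 1) (t N m)"
        unfolding powr_add[symmetric] using 3 by (simp add: rate1_def e_def mult.commute)
      finally show "t N m powr (\<beta> - 1) * (t N 1 * mass s_trunc m) \<le> K * rate1 (t N 1) (t N m)" .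
    qed
  qed
qed

lemma mass_interp:
  obtains C where "0 < C" "\<And>N m. 1 \<le> m \<Longrightarrow> m \<le> N \<Longrightarrow>
    t N m powr (\<beta> - 1) * (t N 1 powr (1 + \<beta>) * mass s_interp m) \<le> C * rate2 (t N 1) (t N m)"
proof -
  define e where "e = - s_interp / r"
  have neg: "s_interp < 0" and e: "0 \<le> e" "- s_interp = r * e"
  proof -
    show neg: "s_interp < 0" using r_ge \<beta>_pos by (auto simp: s_interp_def field_simps)
    then show "0 \<le> e" "- s_interp = r * e" using r_ge by (auto simp: e_def divide_le_0_iff)
  qed
  define K where "K = (1 + 1 / (- s_interp)) * Q powr e"
  have "0 < 1 / (- s_interp)" using neg by simp
  then have K: "0 < K" unfolding K_def using Q_ge by (intro mult_pos_pos add_pos_pos) auto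
  have main: "t N m powr (\<beta> - 1) * (t N 1 powr (1 + \<beta>) * mass s_interp m) \<le> K * (t N 1 powr (1 + \<beta> - e) * t N m powr (\<beta> - 1 + e))"
    if m: "1 \<le> m" "m \<le> N" for N m
  proof -
    have tp: "0 < t N 1" "0 < t N m" using t_pos m by auto
    have "mass s_interp m \<le> (1 + 1 / (- s_interp)) * real m powr (- s_interp)" using neg by (intro mass_neg)
    also have "\<dots> \<le> (1 + 1 / (- s_interp)) * (Q powr e * (t N m / t N 1) powr e)"
      unfolding e(2) using m e neg by (intro mult_left_mono index_powr_le) (auto simp flip: e(2))
    finally have "t N m powr (\<beta> - 1) * (t N 1 powr (1 + \<beta>) * mass s_interp m) \<le> t N m powr (\<beta> - 1) * (t N 1 powr (1 + \<beta>) * (K * (t N m / t N 1) powr e))"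
      by (intro mult_left_mono) (auto simp: K_def)
    also have "\<dots> = K * ((t N 1 powr (1 + \<beta>) * t N 1 powr (- e)) * (t N m powr (\<beta> - 1) * t N m powr e))"
      using tp by (simp add: powr_divide powr_minus field_simps)
    finally show ?thesis unfolding powr_add[symmetric] by simp
  qed
  show thesis
  proof (cases "r \<le> 2 / (\<beta> + 1)")
    case True
    then have eb: "e = \<beta>" using r_ge by (simp add: e_def s_interp_def)
    show thesis
    proof (rule that[of "K * T powr \<beta>"])
      show "0 < K * T powr \<beta>" using K T_pos by simp
      fix N m assume m: "1 \<le> m" "m \<le> (N::nat)"
      have tp: "0 < t N 1" "0 < t N m" "t N m \<le> T" using t_pos t_le_T m by auto
      have "t N 1 powr (1 + \<beta> - e) * t N m powr (\<beta> - 1 + e) = t N m powr \<beta> * (t N 1 * t N m powr (\<beta> - 1))"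
      proof -
        have "t N 1 powr (1 + \<beta> - e) = t N 1" "\<beta> - 1 + e = \<beta> + (\<beta> - 1)" using tp by (simp_all add: eb)
        then show ?thesis by (simp only: powr_add mult_ac)
      qed
      also have "\<dots> \<le> T powr \<beta> * (t N 1 * t N m powr (\<beta> - 1))"
        using tp \<beta>_pos by (intro mult_right_mono powr_mono2) auto
      finally have "K * (t N 1 powr (1 + \<beta> - e) * t N m powr (\<beta> - 1 + e)) \<le> K * (T powr \<beta> * (t N 1 * t N m powr (\<beta> - 1)))"
        using K by (intro mult_left_mono) auto
      also have "\<dots> = K * T powr \<beta> * rate2 (t N 1) (t N m)" using True by (simp add: rate2_def)
      finally show "t N m powr (\<beta> - 1) * (t N 1 powr (1 + \<beta>) * mass s_interp m) \<le> K * T powr \<beta> * rate2 (t N 1) (t N m)"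
        using main[OF m] by linarith
    qed
  next
    case False
    have eb: "e = 1 + \<beta> - 2 / r" using False r_ge by (simp add: e_def s_interp_def field_simps)
    show thesis
      by (rule that[OF K]) (use main False in \<open>simp add: eb rate2_def\<close>)
  qed
qed

text \<open>The time-discrete part of the error analysis in one statement: a sequence whose discrete fractional derivative is
  controlled by itself and the consistency errors obeys the asserted rate.\<close>

lemma gronwall_rate:
  assumes lam: "0 \<le> lam"
  obtains C \<tau>0 where "0 < C" "0 < \<tau>0" "\<And>N m W A H. 1 \<le> m \<Longrightarrow> m \<le> N \<Longrightarrow> max_step N (t N) \<le> \<tau>0 \<Longrightarrow>
    0 \<le> A \<Longrightarrow> 0 \<le> H \<Longrightarrow> W 0 = 0 \<Longrightarrow>
    (\<And>n. 1 \<le> n \<Longrightarrow> n \<le> m \<Longrightarrow> \<delta> N W n \<le> lam * (W n + W (n - 1)) +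
       A * (real n powr (- min (r * (\<beta> + 1)) (3 - \<beta>)) + t N n powr \<beta> * real n powr (- 2) + H)) \<Longrightarrow>
    W m \<le> C * (A * rate (t N 1) (t N m) H)"
proof -
  have s: "s_trunc \<le> 1 / 4" "s_interp \<le> 1 / 4" "- r \<le> 1 / 4"
  proof -
    show "s_trunc \<le> 1 / 4" unfolding s_trunc_def by (rule min.cobounded2)
    have "2 - r * (1 + \<beta>) \<le> 0" if "2 / (\<beta> + 1) < r" using that \<beta>_pos by (simp add: field_simps)
    moreover have "0 \<le> r * \<beta>" using r_ge \<beta>_pos by simp
    ultimately show "s_interp \<le> 1 / 4" by (cases "r \<le> 2 / (\<beta> + 1)") (auto simp: s_interp_def)
    show "- r \<le> 1 / 4" using r_ge by simp
  qed
  obtain C \<tau>0 where C: "0 < C" "0 < \<tau>0" and st: "\<And>N m W A1 A2 A3. 1 \<le> m \<Longrightarrow> m \<le> N \<Longrightarrow> max_step N (t N) \<le> \<tau>0 \<Longrightarrow>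
    0 \<le> A1 \<Longrightarrow> 0 \<le> A2 \<Longrightarrow> 0 \<le> A3 \<Longrightarrow> W 0 = 0 \<Longrightarrow>
    (\<And>n. 1 \<le> n \<Longrightarrow> n \<le> m \<Longrightarrow> \<delta> N W n \<le> lam * (W n + W (n - 1)) +
       1 / t N n * (A1 * real n powr (- s_trunc) + A2 * real n powr (- s_interp) + A3 * real n powr (- (- r)))) \<Longrightarrow>
    W m \<le> C * (t N m powr (\<beta> - 1) * (A1 * mass s_trunc m + A2 * mass s_interp m + A3 * mass (- r) m))"
    by (rule stability_estimate[OF s lam]) blast
  obtain C1 where C1: "0 < C1" "\<And>N m. 1 \<le> m \<Longrightarrow> m \<le> N \<Longrightarrow> t N m powr (\<beta> - 1) * (t N 1 * mass s_trunc m) \<le> C1 * rate1 (t N 1) (t N m)"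
    by (rule mass_trunc) blast
  obtain C2 where C2: "0 < C2" "\<And>N m. 1 \<le> m \<Longrightarrow> m \<le> N \<Longrightarrow>
    t N m powr (\<beta> - 1) * (t N 1 powr (1 + \<beta>) * mass s_interp m) \<le> C2 * rate2 (t N 1) (t N m)"
    by (rule mass_interp) blast
  define C3 where "C3 = (1 + 1 / r) * Q"
  have C3: "0 < C3" using r_ge Q_ge by (simp add: C3_def add_pos_pos)
  define K where "K = Q powr (1 + \<beta>)"
  have K: "Q \<le> K" "1 \<le> K"
  proof -
    show "Q \<le> K" using powr_mono[of 1 "1 + \<beta>" Q] Q_ge \<beta>_pos by (simp add: K_def)
    then show "1 \<le> K" using Q_ge by simp
  qed
  define Cm where "Cm = C1 + C2 + C3"
  show thesis
  proof (rule that[of "C * (2 * K * Cm)" \<tau>0])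
    show "0 < C * (2 * K * Cm)" using C C1(1) C2(1) C3 K by (simp add: Cm_def)
    show "0 < \<tau>0" by fact
    fix N m :: nat and W :: "nat \<Rightarrow> real" and A H :: real
    assume m: "1 \<le> m" "m \<le> N" and ms: "max_step N (t N) \<le> \<tau>0" and A: "0 \<le> A" and H: "0 \<le> H" and W0: "W 0 = 0"
      and W: "\<And>n. 1 \<le> n \<Longrightarrow> n \<le> m \<Longrightarrow> \<delta> N W n \<le> lam * (W n + W (n - 1)) +
       A * (real n powr (- min (r * (\<beta> + 1)) (3 - \<beta>)) + t N n powr \<beta> * real n powr (- 2) + H)"
    have t1: "0 < t N 1" using t_pos m by auto
    define A1 A2 A3 where "A1 = A * K * t N 1" and "A2 = A * K * t N 1 powr (1 + \<beta>)" and "A3 = A * K * (H * t N 1)"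
    have "W m \<le> C * (t N m powr (\<beta> - 1) * (A1 * mass s_trunc m + A2 * mass s_interp m + A3 * mass (- r) m))"
    proof (rule st[OF m ms])
      show "0 \<le> A1" "0 \<le> A2" "0 \<le> A3" using A K t1 H by (auto simp: A1_def A2_def A3_def)
      show "W 0 = 0" by fact
      fix n assume n: "1 \<le> n" "n \<le> m"
      have tp: "0 < t N n" using t_pos n m by auto
      define \<rho> where "\<rho> = t N 1 * real n powr r / t N n"
      have \<rho>0: "0 < \<rho>" using t1 tp n by (simp add: \<rho>_def)
      have up: "t N n \<le> Q * (t N 1 * real n powr r)" using t_upper[of n N] n m by auto
      then have q1: "1 \<le> Q * \<rho>" using tp by (simp add: \<rho>_def field_simps)
      have kr: "1 \<le> K * \<rho>" using q1 mult_right_mono[OF K(1), of \<rho>] \<rho>0 by linarith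
      have tr: "real n powr (- min (r * (\<beta> + 1)) (3 - \<beta>)) \<le> K * (t N 1 / t N n * real n powr (- s_trunc))"
      proof -
        have "real n powr (- min (r * (\<beta> + 1)) (3 - \<beta>)) \<le> real n powr (- r - s_trunc)"
          using n by (intro powr_mono) (auto simp: s_trunc_def min_def algebra_simps)
        also have "\<dots> \<le> K * \<rho> * real n powr (- r - s_trunc)" using mult_right_mono[OF kr, of "real n powr (- r - s_trunc)"] by simp
        also have "\<dots> = K * (t N 1 / t N n * (real n powr r * real n powr (- r - s_trunc)))" by (simp add: \<rho>_def)
        also have "real n powr r * real n powr (- r - s_trunc) = real n powr (- s_trunc)"
          by (simp only: powr_add[symmetric]) simp
        finally show ?thesis .
      qed
      have ti: "t N n powr \<beta> * real n powr (- 2) \<le> K * (t N 1 powr (1 + \<beta>) / t N n * real n powr (- s_interp))"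
      proof -
        have "t N n powr (1 + \<beta>) \<le> (Q * (t N 1 * real n powr r)) powr (1 + \<beta>)"
          using up tp \<beta>_pos by (intro powr_mono2) auto
        also have "\<dots> = K * (t N 1 powr (1 + \<beta>) * real n powr (r * (1 + \<beta>)))"
          using t1 Q_ge by (simp add: K_def powr_mult powr_powr)
        finally have "t N n powr (1 + \<beta>) / t N n * real n powr (- 2) \<le> K * (t N 1 powr (1 + \<beta>) * real n powr (r * (1 + \<beta>))) / t N n * real n powr (- 2)"
          using tp by (intro mult_right_mono divide_right_mono) auto
        also have "\<dots> = K * (t N 1 powr (1 + \<beta>) / t N n * (real n powr (r * (1 + \<beta>)) * real n powr (- 2)))" by simp
        also have "real n powr (r * (1 + \<beta>)) * real n powr (- 2) = real n powr (r * (1 + \<beta>) - 2)"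
          by (simp only: powr_add[symmetric]) simp
        also have "K * (t N 1 powr (1 + \<beta>) / t N n * real n powr (r * (1 + \<beta>) - 2)) \<le> K * (t N 1 powr (1 + \<beta>) / t N n * real n powr (- s_interp))"
        proof (intro mult_left_mono powr_mono)
          have "2 / (\<beta> + 1) \<le> 2" using \<beta>_pos by (simp add: field_simps)
          then show "r * (1 + \<beta>) - 2 \<le> - s_interp" by (auto simp: s_interp_def algebra_simps)
        qed (use n K tp in auto)
        finally show ?thesis using tp by (simp add: powr_add)
      qed
      have th: "H \<le> K * (H * t N 1 / t N n * real n powr (- (- r)))"
        using mult_left_mono[OF kr H] by (simp add: \<rho>_def mult_ac)
      have "A * (real n powr (- min (r * (\<beta> + 1)) (3 - \<beta>)) + t N n powr \<beta> * real n powr (- 2) + H)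
        \<le> A * (K * (t N 1 / t N n * real n powr (- s_trunc)) + K * (t N 1 powr (1 + \<beta>) / t N n * real n powr (- s_interp)) + K * (H * t N 1 / t N n * real n powr (- (- r))))"
        using A tr ti th by (intro mult_left_mono add_mono) auto
      also have "\<dots> = 1 / t N n * (A1 * real n powr (- s_trunc) + A2 * real n powr (- s_interp) + A3 * real n powr (- (- r)))"
        by (simp add: A1_def A2_def A3_def algebra_simps add_divide_distrib)
      finally show "\<delta> N W n \<le> lam * (W n + W (n - 1)) +
         1 / t N n * (A1 * real n powr (- s_trunc) + A2 * real n powr (- s_interp) + A3 * real n powr (- (- r)))"
        using W[OF n] by linarith
    qed
    also have "t N m powr (\<beta> - 1) * (A1 * mass s_trunc m + A2 * mass s_interp m + A3 * mass (- r) m)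
      = A * K * (t N m powr (\<beta> - 1) * (t N 1 * mass s_trunc m) + t N m powr (\<beta> - 1) * (t N 1 powr (1 + \<beta>) * mass s_interp m)
         + H * (t N m powr (\<beta> - 1) * (t N 1 * mass (- r) m)))"
      by (simp add: A1_def A2_def A3_def algebra_simps)
    also have "C * \<dots> \<le> C * (A * K * (Cm * rate1 (t N 1) (t N m) + Cm * rate2 (t N 1) (t N m) + H * (Cm * t N m powr \<beta>)))"
    proof -
      have tp: "0 < t N m" "t N 1 \<le> t N m" using t_pos t_le m by auto
      have "mass (- r) m \<le> (1 + 1 / r) * real m powr r" using mass_neg[of "- r" m] r_ge by simp
      then have "t N 1 * mass (- r) m \<le> t N 1 * ((1 + 1 / r) * real m powr r)" using t1 by (intro mult_left_mono) auto
      also have "\<dots> = (1 + 1 / r) * (t N 1 * real m powr r)" by simp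
      also have "\<dots> \<le> (1 + 1 / r) * (Q * t N m)" using t_lower[of m N] m r_ge by (intro mult_left_mono) auto
      finally have "t N m powr (\<beta> - 1) * (t N 1 * mass (- r) m) \<le> t N m powr (\<beta> - 1) * (C3 * t N m)"
        unfolding C3_def by (intro mult_left_mono) (simp_all add: mult.assoc)
      also have "\<dots> = C3 * t N m powr \<beta>" using tp by (simp add: powr_diff)
      also have "\<dots> \<le> Cm * t N m powr \<beta>" using C1(1) C2(1) by (intro mult_right_mono) (auto simp: Cm_def)
      finally have c: "t N m powr (\<beta> - 1) * (t N 1 * mass (- r) m) \<le> Cm * t N m powr \<beta>" .
      have "C1 * rate1 (t N 1) (t N m) \<le> Cm * rate1 (t N 1) (t N m)"
        using rate_parts(1)[OF t1 tp(2) H] C2(1) C3 by (intro mult_right_mono) (auto simp: Cm_def)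
      moreover have "C2 * rate2 (t N 1) (t N m) \<le> Cm * rate2 (t N 1) (t N m)"
        using rate_parts(2)[OF t1 tp(2) H] C1(1) C3 by (intro mult_right_mono) (auto simp: Cm_def)
      ultimately show ?thesis
        using C1(2)[OF m] C2(2)[OF m] c C A K H by (intro mult_left_mono add_mono) auto
    qed
    also have "\<dots> = C * K * Cm * (A * (rate1 (t N 1) (t N m) + rate2 (t N 1) (t N m) + H * t N m powr \<beta>))"
      by (simp add: algebra_simps)
    also have "\<dots> \<le> C * K * Cm * (A * (2 * rate (t N 1) (t N m) H))"
      using rate_parts(3)[OF t1 t_le[OF m] H] A C K C1(1) C2(1) C3
      by (intro mult_left_mono) (auto simp: Cm_def)
    also have "\<dots> = C * (2 * K * Cm) * (A * rate (t N 1) (t N m) H)" by simp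
    finally show "W m \<le> C * (2 * K * Cm) * (A * rate (t N 1) (t N m) H)" using C by simp
  qed
qed

end

section \<open>Consistency for weakly singular functions\<close>

lemma has_integral_Beta_scaled:
  fixes a b c :: real
  assumes "0 < a" "0 < b" "0 < c"
  shows "((\<lambda>s. (c - s) powr (b - 1) * s powr (a - 1)) has_integral c powr (a + b - 1) * Beta a b) {0..c}"
proof -
  have im: "(\<lambda>x. x / (1 / c)) ` {0..1} = {0..c}"
  proof (intro equalityI subsetI)
    fix x assume "x \<in> {0..c}"
    then show "x \<in> (\<lambda>x. x / (1 / c)) ` {0..1}" using assms by (intro image_eqI[of _ _ "x / c"]) auto
  qed (use assms in \<open>auto simp: mult_left_le\<close>)
  have "((\<lambda>x. (1 / c * x) powr (a - 1) * (1 - 1 / c * x) powr (b - 1)) has_integral c * Beta a b) {0..c}"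
    using has_integral_stretch_real[OF has_integral_Beta_real[OF assms(1,2)], of "1 / c"] assms unfolding im by simp
  from has_integral_mult_right[OF this, of "c powr (a + b - 2)"]
  have "((\<lambda>x. c powr (a + b - 2) * ((1 / c * x) powr (a - 1) * (1 - 1 / c * x) powr (b - 1))) has_integral c powr (a + b - 2) * (c * Beta a b)) {0..c}" .
  moreover have "c powr (a + b - 2) * (c * Beta a b) = c powr (a + b - 1) * Beta a b"
    using assms powr_add[of c 1 "a + b - 2"] by simp
  moreover have "c powr (a + b - 2) * ((1 / c * x) powr (a - 1) * (1 - 1 / c * x) powr (b - 1)) = (c - x) powr (b - 1) * x powr (a - 1)"
    if "x \<in> {0..c}" for x
  proof -
    have "1 - 1 / c * x = (c - x) / c" using assms by (simp add: field_simps)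
    moreover have "c powr (a + b - 2) = c powr (a - 1) * c powr (b - 1)" by (simp flip: powr_add add: algebra_simps)
    ultimately show ?thesis using that assms by (simp add: powr_divide)
  qed
  ultimately show ?thesis by (metis (no_types, lifting) has_integral_eq)
qed

text \<open>The integrand is dominated by that of a Beta integral, which is singular at both ends.\<close>

lemma singular_product_integrable:
  fixes a b c M :: real
  assumes "0 < a" "0 < b" "0 < c" and f: "continuous_on {0<..<c} f"
    and le: "\<And>s. s \<in> {0<..<c} \<Longrightarrow> \<bar>f s\<bar> \<le> M * s powr (a - 1)"
  shows "(\<lambda>s. (c - s) powr (b - 1) * f s) absolutely_integrable_on {0..c}"
    and "\<bar>integral {0..c} (\<lambda>s. (c - s) powr (b - 1) * f s)\<bar> \<le> M * (c powr (a + b - 1) * Beta a b)"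
proof -
  have h: "((\<lambda>s. M * ((c - s) powr (b - 1) * s powr (a - 1))) has_integral M * (c powr (a + b - 1) * Beta a b)) {0<..<c}"
    using has_integral_mult_right[OF has_integral_Beta_scaled[OF assms(1-3)]] by (simp add: has_integral_Icc_iff_Ioo)
  have bd: "\<bar>(c - s) powr (b - 1) * f s\<bar> \<le> M * ((c - s) powr (b - 1) * s powr (a - 1))" if "s \<in> {0<..<c}" for s
    using mult_left_mono[OF le[OF that], of "(c - s) powr (b - 1)"] by (simp add: abs_mult mult_ac)
  have meas: "(\<lambda>s. (c - s) powr (b - 1) * f s) \<in> borel_measurable (lebesgue_on {0<..<c})"
    using f by (intro continuous_imp_measurable_on_sets_lebesgue continuous_intros) auto
  have i: "(\<lambda>s. (c - s) powr (b - 1) * f s) integrable_on {0<..<c}"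
    by (rule measurable_bounded_by_integrable_imp_integrable_real[OF meas _ bd]) (use h in auto)
  have "(\<lambda>s. (c - s) powr (b - 1) * f s) absolutely_integrable_on {0<..<c}"
    by (rule absolutely_integrable_integrable_bound[OF _ i has_integral_integrable[OF h]]) (use bd in auto)
  then show "(\<lambda>s. (c - s) powr (b - 1) * f s) absolutely_integrable_on {0..c}"
    by (simp add: absolutely_integrable_on_def integrable_on_Icc_iff_Ioo)
  have "norm (integral {0<..<c} (\<lambda>s. (c - s) powr (b - 1) * f s)) \<le> integral {0<..<c} (\<lambda>s. M * ((c - s) powr (b - 1) * s powr (a - 1)))"
    using i h bd by (intro integral_norm_bound_integral) auto
  then show "\<bar>integral {0..c} (\<lambda>s. (c - s) powr (b - 1) * f s)\<bar> \<le> M * (c powr (a + b - 1) * Beta a b)"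
    unfolding integral_unique[OF h] unfolding integral_open_interval_real[symmetric] by simp
qed

context quasi_graded_meshes
begin

text \<open>The regularity class of the solution components: derivatives with respect to time up to order three, with the singularity of
  \<open>s\<^sup>\<beta>\<close> at \<open>0\<close>.\<close>

definition weak_reg :: "real \<Rightarrow> (real \<Rightarrow> real) \<Rightarrow> (real \<Rightarrow> real) \<Rightarrow> (real \<Rightarrow> real) \<Rightarrow> (real \<Rightarrow> real) \<Rightarrow> bool" where
  "weak_reg M v v1 v2 v3 \<longleftrightarrow> continuous_on {0..T} v \<and>
     (\<forall>s\<in>{0<..T}. (v has_real_derivative v1 s) (at s within {0..T}) \<and>
        (v1 has_real_derivative v2 s) (at s within {0..T}) \<and> (v2 has_real_derivative v3 s) (at s within {0..T}) \<and>
        \<bar>v1 s\<bar> \<le> M * s powr (\<beta> - 1) \<and> \<bar>v2 s\<bar> \<le> M * s powr (\<beta> - 2) \<and> \<bar>v3 s\<bar> \<le> M * s powr (\<beta> - 3))"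

text \<open>The fractional derivative of order \<open>\<beta>\<close> of a function with derivative \<open>v1\<close>.  The derivative is the argument, so that the
  integral is linear in it without any differentiability question.\<close>

definition frac_deriv :: "(real \<Rightarrow> real) \<Rightarrow> real \<Rightarrow> real" where
  "frac_deriv v1 c = 1 / \<Gamma>\<beta> * integral {0..c} (\<lambda>s. (c - s) powr (- \<beta>) * v1 s)"

context
  fixes M v v1 v2 v3 assumes reg: "weak_reg M v v1 v2 v3"
begin

lemma weak_regD:
  assumes "s \<in> {0<..T}"
  shows "(v has_real_derivative v1 s) (at s within {0..T})" "(v1 has_real_derivative v2 s) (at s within {0..T})"
    "(v2 has_real_derivative v3 s) (at s within {0..T})" "\<bar>v1 s\<bar> \<le> M * s powr (\<beta> - 1)" "\<bar>v2 s\<bar> \<le> M * s powr (\<beta> - 2)"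
    "\<bar>v3 s\<bar> \<le> M * s powr (\<beta> - 3)"
  using reg assms unfolding weak_reg_def by blast+

lemma weak_reg_nonneg: "0 \<le> M"
proof -
  have "0 \<le> \<bar>v1 T\<bar>" by simp
  also have "\<bar>v1 T\<bar> \<le> M * T powr (\<beta> - 1)" using weak_regD(4)[of T] T_pos by simp
  finally show ?thesis using T_pos by (simp add: zero_le_mult_iff)
qed

lemma weak_reg_continuous: "continuous_on {0<..T} v1"
proof -
  have "(v1 has_real_derivative v2 s) (at s within {0<..T})" if "s \<in> {0<..T}" for s
    by (rule DERIV_subset[OF weak_regD(2)[OF that]]) auto
  then show ?thesis by (rule DERIV_continuous_on)
qed

lemma weak_reg_has_integral:
  assumes "0 \<le> a" "a \<le> b" "b \<le> T"
  shows "(v1 has_integral v b - v a) {a..b}"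
proof (rule fundamental_theorem_of_calculus_interior)
  have "continuous_on {0..T} v" using reg unfolding weak_reg_def by blast
  then show "continuous_on {a..b} v" using assms by (auto intro: continuous_on_subset)
  fix s assume s: "s \<in> {a<..<b}"
  then have "(v has_real_derivative v1 s) (at s within {0..T})" using assms by (intro weak_regD) auto
  moreover have "at s within {0..T} = at s" using s assms by (intro at_within_interior) auto
  ultimately show "(v has_vector_derivative v1 s) (at s)" by (simp add: has_real_derivative_iff_has_vector_derivative)
qed (use assms in auto)

lemma weak_reg_increment:
  assumes "0 \<le> b" "b \<le> T"
  shows "\<bar>v b - v 0\<bar> \<le> M * b powr \<beta> / \<beta>"
proof -
  have h: "((\<lambda>s. M * s powr (\<beta> - 1)) has_integral M * (b powr (\<beta> - 1 + 1) / (\<beta> - 1 + 1))) {0..b}"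
    using assms \<beta>_pos by (intro has_integral_mult_right has_integral_powr_from_0) auto
  have h1: "(v1 has_integral v b - v 0) {0<..<b}"
    using weak_reg_has_integral[of 0 b] assms by (simp add: has_integral_Icc_iff_Ioo)
  have "norm (integral {0<..<b} v1) \<le> integral {0<..<b} (\<lambda>s. M * s powr (\<beta> - 1))"
    using h h1 weak_regD(4) assms by (intro integral_norm_bound_integral) (auto simp: has_integral_Icc_iff_Ioo)
  then show ?thesis
    using integral_unique[OF h1] integral_unique[OF h[unfolded has_integral_Icc_iff_Ioo]] by simp
qed

lemma weak_reg_kernel:
  assumes "0 < c" "c \<le> T"
  shows "(\<lambda>s. (c - s) powr (- \<beta>) * v1 s) integrable_on {0..c}"
    and "\<bar>integral {0..c} (\<lambda>s. (c - s) powr (- \<beta>) * v1 s)\<bar> \<le> M * Beta \<beta> (1 - \<beta>)"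
proof -
  have f: "continuous_on {0<..<c} v1" using weak_reg_continuous assms by (auto intro: continuous_on_subset)
  have le: "\<bar>v1 s\<bar> \<le> M * s powr (\<beta> - 1)" if "s \<in> {0<..<c}" for s using weak_regD(4)[of s] that assms by auto
  have b: "0 < 1 - \<beta>" using \<beta>_lt by simp
  note sp = singular_product_integrable[OF \<beta>_pos b assms(1) f le]
  show "(\<lambda>s. (c - s) powr (- \<beta>) * v1 s) integrable_on {0..c}"
    using set_lebesgue_integral_eq_integral(1)[OF sp(1)] by simp
  show "\<bar>integral {0..c} (\<lambda>s. (c - s) powr (- \<beta>) * v1 s)\<bar> \<le> M * Beta \<beta> (1 - \<beta>)"
    using sp(2) assms by simp
qed

lemma weak_reg_on:
  assumes "0 < a" "b \<le> T" "z \<in> {a..b}"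
  shows "(v has_real_derivative v1 z) (at z within {a..b})" "(v1 has_real_derivative v2 z) (at z within {a..b})"
    "(v2 has_real_derivative v3 z) (at z within {a..b})" "\<bar>v1 z\<bar> \<le> M * z powr (\<beta> - 1)" "\<bar>v2 z\<bar> \<le> M * z powr (\<beta> - 2)"
    "\<bar>v3 z\<bar> \<le> M * z powr (\<beta> - 3)"
proof -
  have z: "z \<in> {0<..T}" and sub: "{a..b} \<subseteq> {0..T}" using assms by auto
  show "(v has_real_derivative v1 z) (at z within {a..b})" "(v1 has_real_derivative v2 z) (at z within {a..b})"
    "(v2 has_real_derivative v3 z) (at z within {a..b})"
    using weak_regD(1-3)[OF z] sub by (blast intro: DERIV_subset)+
  show "\<bar>v1 z\<bar> \<le> M * z powr (\<beta> - 1)" "\<bar>v2 z\<bar> \<le> M * z powr (\<beta> - 2)" "\<bar>v3 z\<bar> \<le> M * z powr (\<beta> - 3)"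
    using weak_regD(4-6)[OF z] .
qed

lemma first_step_error:
  assumes N: "1 \<le> N"
  shows "\<bar>\<delta> N (\<lambda>k. v (t N k)) 1 - frac_deriv v1 (tstar \<sigma> (t N) 1)\<bar> \<le> (1 / (Gamma (2 - \<beta>) * \<beta>) + Beta \<beta> (1 - \<beta>) / \<Gamma>\<beta>) * M"
proof -
  have t1: "0 < t N 1" "t N 1 \<le> T" using t_pos t_le_T N by auto
  have G2: "0 < Gamma (2 - \<beta>)" using \<beta>_lt by (intro Gamma_real_pos) auto
  have "\<delta> N (\<lambda>k. v (t N k)) 1 = acoef \<beta> \<sigma> (t N) 0 0 / t N 1 * (v (t N 1) - v 0)"
    using \<delta>_eq[of 1 N] N by (simp add: gcoef_def mstep_def t_0)
  also have "acoef \<beta> \<sigma> (t N) 0 0 = \<sigma> powr (1 - \<beta>) / Gamma (2 - \<beta>) * t N 1 powr (1 - \<beta>)"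
    using N by (simp add: acoef_def mstep_def t_0)
  also have "\<dots> / t N 1 = \<sigma> powr (1 - \<beta>) / Gamma (2 - \<beta>) * t N 1 powr (- \<beta>)"
    using t1 by (simp add: powr_diff powr_minus field_simps)
  finally have "\<bar>\<delta> N (\<lambda>k. v (t N k)) 1\<bar> = \<sigma> powr (1 - \<beta>) / Gamma (2 - \<beta>) * t N 1 powr (- \<beta>) * \<bar>v (t N 1) - v 0\<bar>"
    using G2 by (simp add: abs_mult)
  also have "\<dots> \<le> 1 / Gamma (2 - \<beta>) * t N 1 powr (- \<beta>) * (M * t N 1 powr \<beta> / \<beta>)"
    using G2 \<sigma>_bounds \<beta>_lt t1 weak_reg_increment[of "t N 1"]
    by (intro mult_mono divide_right_mono powr_le1) auto
  also have "\<dots> = 1 / (Gamma (2 - \<beta>) * \<beta>) * M" using t1 by (simp add: powr_minus field_simps)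
  finally have a: "\<bar>\<delta> N (\<lambda>k. v (t N k)) 1\<bar> \<le> 1 / (Gamma (2 - \<beta>) * \<beta>) * M" .
  have "\<bar>frac_deriv v1 (tstar \<sigma> (t N) 1)\<bar> = \<bar>integral {0..tstar \<sigma> (t N) 1} (\<lambda>s. (tstar \<sigma> (t N) 1 - s) powr (- \<beta>) * v1 s)\<bar> / \<Gamma>\<beta>"
    using \<Gamma>\<beta>_pos by (simp add: frac_deriv_def abs_mult)
  also have "\<dots> \<le> M * Beta \<beta> (1 - \<beta>) / \<Gamma>\<beta>"
    using tstar_bounds[of 1 N] N \<Gamma>\<beta>_pos by (intro divide_right_mono weak_reg_kernel) auto
  finally have "\<bar>frac_deriv v1 (tstar \<sigma> (t N) 1)\<bar> \<le> Beta \<beta> (1 - \<beta>) / \<Gamma>\<beta> * M" by (simp add: mult.commute)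
  then show ?thesis using a by (simp add: distrib_right)
qed

text \<open>The first cell, where \<open>v\<close> is only Hoelder continuous: the interpolation error is of the size of \<open>v\<close> itself, but the kernel varies little
  because the evaluation point is far away.\<close>

lemma initial_cell_error:
  assumes n: "2 \<le> n" "n \<le> N"
  shows "(\<lambda>s. (tstar \<sigma> (t N) n - s) powr (- \<beta>) * deriv (quad_interp (t N) (\<lambda>k. v (t N k)) 1) s) integrable_on {0..t N 1}"
    and "\<bar>integral {0..t N 1} (\<lambda>s. (tstar \<sigma> (t N) n - s) powr (- \<beta>) * (v1 s - deriv (quad_interp (t N) (\<lambda>k. v (t N k)) 1) s))\<bar>
      \<le> 4 * (2 * G) powr (\<beta> + 1) * Q powr (\<beta> + 1) * M * real n powr (- (r * (\<beta> + 1)))"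
proof -
  define c where "c = tstar \<sigma> (t N) n"
  have N: "1 \<le> N" using n by auto
  have tt: "0 < t N 1" "t N 1 < t N 2" "t N 2 \<le> T" "t N 1 \<le> T" "0 < t N n" "t N 0 = 0"
    using t_pos t_less t_le_T t_0 n N by auto
  have "t N 1 \<le> t N (n - 1)" using n by (intro t_le) auto
  then have tc: "t N 1 < c" "c \<le> T" using tstar_bounds[of n N] n by (auto simp: c_def)
  define D1 where "D1 = (v (t N 1) - v 0) / t N 1"
  define D2 where "D2 = (v (t N 2) - v (t N 1)) / (t N 2 - t N 1)"
  define q where "q s = D1 + 2 / t N 2 * (s - (0 + t N 1) / 2) * (D2 - D1)" for s
  have dq: "deriv (quad_interp (t N) (\<lambda>k. v (t N k)) 1) s = q s" for s
    using deriv_quad_interp[of "t N" 1 "\<lambda>k. v (t N k)" s] tt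
    by (simp add: q_def D1_def D2_def mstep_def numeral_2_eq_2)
  have qc: "continuous_on {0..t N 1} q" unfolding q_def using tt by (intro continuous_intros) auto
  have iq: "(\<lambda>s. (c - s) powr (- \<beta>) * q s) integrable_on {0..t N 1}"
    by (intro integrable_continuous_interval continuous_on_mult kernel_continuous[OF tc(1)] qc)
  then show "(\<lambda>s. (tstar \<sigma> (t N) n - s) powr (- \<beta>) * deriv (quad_interp (t N) (\<lambda>k. v (t N k)) 1) s) integrable_on {0..t N 1}"
    by (simp only: dq c_def)
  define K where "K = M * t N 1 powr (\<beta> - 1) / \<beta>"
  have D1: "\<bar>D1\<bar> \<le> K"
  proof -
    have "\<bar>D1\<bar> = \<bar>v (t N 1) - v 0\<bar> / t N 1" using tt by (simp add: D1_def)
    also have "\<dots> \<le> (M * t N 1 powr \<beta> / \<beta>) / t N 1"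
      using tt by (intro divide_right_mono weak_reg_increment) auto
    also have "\<dots> = K" using tt by (simp add: K_def powr_diff)
    finally show ?thesis .
  qed
  have D2: "\<bar>D2\<bar> \<le> K"
  proof -
    obtain z where z: "z \<in> {t N 1<..<t N 2}" "v (t N 2) - v (t N 1) = v1 z * (t N 2 - t N 1)"
    proof -
      have "(v has_derivative (\<lambda>h. v1 z * h)) (at z within {t N 1..t N 2})" if "t N 1 \<le> z" "z \<le> t N 2" for z
        using weak_reg_on(1)[of "t N 1" "t N 2" z] tt that by (simp add: has_field_derivative_def)
      then show thesis using mvt_simple[OF tt(2), of v "\<lambda>z h. v1 z * h"] that by blast
    qed
    have "\<bar>D2\<bar> = \<bar>v1 z\<bar>" using z tt by (simp add: D2_def)
    also have "\<dots> \<le> M * z powr (\<beta> - 1)" using weak_reg_on(4)[of "t N 1" "t N 2" z] z tt by auto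
    also have "\<dots> \<le> M * t N 1 powr (\<beta> - 1)"
      using z tt weak_reg_nonneg \<beta>_lt by (intro mult_left_mono powr_mono2') auto
    also have "\<dots> \<le> K" unfolding K_def
      using mult_left_mono[of 1 "1 / \<beta>" "M * t N 1 powr (\<beta> - 1)"] \<beta>_pos \<beta>_lt weak_reg_nonneg by simp
    finally show ?thesis .
  qed
  have bd: "\<bar>v1 s - q s\<bar> \<le> M * s powr (\<beta> - 1) + 3 * K" if s: "s \<in> {0<..<t N 1}" for s
  proof -
    have w: "\<bar>2 / t N 2 * (s - (0 + t N 1) / 2)\<bar> \<le> 1" using s tt by (auto simp: abs_le_iff field_simps)
    have "\<bar>2 / t N 2 * (s - (0 + t N 1) / 2) * (D2 - D1)\<bar> \<le> 1 * \<bar>D2 - D1\<bar>"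
      unfolding abs_mult[of _ "D2 - D1"] using w by (intro mult_right_mono) auto
    also have "\<dots> \<le> K + K" using abs_triangle_ineq4[of D2 D1] D1 D2 by simp
    finally have "\<bar>q s\<bar> \<le> K + (K + K)" unfolding q_def by (intro order_trans[OF abs_triangle_ineq] add_mono D1)
    moreover have "\<bar>v1 s\<bar> \<le> M * s powr (\<beta> - 1)" using weak_reg_on(4)[of s T s] s tt by auto
    ultimately show ?thesis using abs_triangle_ineq4[of "v1 s" "q s"] by simp
  qed
  have h1: "(v1 has_integral v (t N 1) - v 0) {0..t N 1}" using tt by (intro weak_reg_has_integral) auto
  have h2: "(q has_integral (v (t N 1) - v 0)) {0..t N 1}"
  proof -
    have "(q has_integral (t N 1 - 0) *\<^sub>R D1 + 2 / t N 2 * 0 * (D2 - D1)) {0..t N 1}"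
      unfolding q_def using has_integral_const_real[of D1 0 "t N 1"] tt
      by (intro has_integral_add has_integral_mult_right has_integral_mult_left has_integral_centered) auto
    then show ?thesis using tt by (simp add: D1_def)
  qed
  have iv: "(\<lambda>s. (c - s) powr (- \<beta>) * v1 s) integrable_on {0..t N 1}"
    using weak_reg_kernel(1)[of c] tc tt by (rule_tac integrable_on_subinterval) auto
  have "\<bar>integral {0..t N 1} (\<lambda>s. (c - s) powr (- \<beta>) * (v1 s - q s))\<bar>
     \<le> \<beta> * (t N 1 - 0) * (c - t N 1) powr (- \<beta> - 1) * (M * (t N 1 powr (\<beta> - 1 + 1) / (\<beta> - 1 + 1)) + (t N 1 - 0) *\<^sub>R (3 * K))"
  proof (rule kernel_oscillation)
    show "((\<lambda>s. M * s powr (\<beta> - 1) + 3 * K) has_integral M * (t N 1 powr (\<beta> - 1 + 1) / (\<beta> - 1 + 1)) + (t N 1 - 0) *\<^sub>R (3 * K)) {0..t N 1}"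
      using has_integral_const_real[of "3 * K" 0 "t N 1"] tt \<beta>_pos
      by (intro has_integral_add has_integral_mult_right has_integral_powr_from_0) auto
    show "(\<lambda>s. (c - s) powr (- \<beta>) * (v1 s - q s)) integrable_on {0..t N 1}"
      unfolding right_diff_distrib by (intro integrable_diff iv iq)
    show "((\<lambda>s. v1 s - q s) has_integral 0) {0..t N 1}" using has_integral_diff[OF h1 h2] by simp
  qed (use tt tc \<beta>_pos bd in auto)
  also have "\<dots> = 4 * M * t N 1 powr (\<beta> + 1) * (c - t N 1) powr (- \<beta> - 1)"
    using tt \<beta>_pos by (simp add: K_def powr_diff powr_add field_simps)
  also have "\<dots> \<le> 4 * M * t N 1 powr (\<beta> + 1) * ((2 * G) powr (\<beta> + 1) * t N n powr (- \<beta> - 1))"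
  proof (intro mult_left_mono)
    have "t N n * (real (n - 1) / real n) \<le> G * (c - t N 1)" unfolding c_def using n by (intro tstar_gap) auto
    moreover have "t N n * (1 / 2) \<le> t N n * (real (n - 1) / real n)" using n tt by (intro mult_left_mono) (auto simp: field_simps)
    ultimately have "t N n / (2 * G) \<le> c - t N 1" using G_ge by (simp add: field_simps)
    then have "(c - t N 1) powr (- \<beta> - 1) \<le> (t N n / (2 * G)) powr (- \<beta> - 1)"
      using tt G_ge \<beta>_pos by (intro powr_mono2') auto
    also have "\<dots> = (2 * G) powr (\<beta> + 1) * t N n powr (- \<beta> - 1)"
      using tt G_ge powr_minus_divide[of "2 * G" "\<beta> + 1"] by (simp add: powr_divide)
    finally show "(c - t N 1) powr (- \<beta> - 1) \<le> (2 * G) powr (\<beta> + 1) * t N n powr (- \<beta> - 1)" .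
  qed (use weak_reg_nonneg in auto)
  also have "\<dots> = 4 * M * (2 * G) powr (\<beta> + 1) * (t N 1 / t N n) powr (\<beta> + 1)"
    using tt powr_minus_divide[of "t N n" "\<beta> + 1"] by (simp add: powr_divide)
  also have "\<dots> \<le> 4 * M * (2 * G) powr (\<beta> + 1) * (Q powr (\<beta> + 1) * real n powr (- (r * (\<beta> + 1))))"
  proof (intro mult_left_mono)
    have "t N 1 / t N n \<le> Q * real n powr (- r)"
      using t_lower[of n N] n tt by (simp add: powr_minus field_simps)
    then have "(t N 1 / t N n) powr (\<beta> + 1) \<le> (Q * real n powr (- r)) powr (\<beta> + 1)"
      using tt \<beta>_pos by (intro powr_mono2) auto
    also have "\<dots> = Q powr (\<beta> + 1) * real n powr (- (r * (\<beta> + 1)))" using Q_ge by (simp add: powr_mult powr_powr)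
    finally show "(t N 1 / t N n) powr (\<beta> + 1) \<le> Q powr (\<beta> + 1) * real n powr (- (r * (\<beta> + 1)))" .
  qed (use weak_reg_nonneg in auto)
  finally show "\<bar>integral {0..t N 1} (\<lambda>s. (tstar \<sigma> (t N) n - s) powr (- \<beta>) * (v1 s - deriv (quad_interp (t N) (\<lambda>k. v (t N k)) 1) s))\<bar>
      \<le> 4 * (2 * G) powr (\<beta> + 1) * Q powr (\<beta> + 1) * M * real n powr (- (r * (\<beta> + 1)))"
    unfolding dq c_def[symmetric] by (simp only: mult_ac)
qed

text \<open>The evaluation point is the weighted mean of the two nodes, so linear functions are reproduced.  On the first cell, where \<open>v2\<close>
  is not bounded, the error has the size of the increments of \<open>v\<close>.\<close>

lemma interpolation_error:
  assumes n: "1 \<le> n" "n \<le> N"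
  shows "\<bar>v (tstar \<sigma> (t N) n) - vstar \<sigma> (\<lambda>k. v (t N k)) n\<bar> \<le> (2 / \<beta> + E powr (3 - \<beta>) * Q\<^sup>2) * (M * (t N n powr \<beta> * real n powr (- 2)))"
proof -
  define c where "c = tstar \<sigma> (t N) n"
  have N: "1 \<le> N" using n by auto
  have cb: "t N (n - 1) < c" "c < t N n" "c - t N (n - 1) = \<sigma> * mstep (t N) n" "0 < c" "c \<le> T"
    and ce: "c = \<sigma> * t N n + (1 - \<sigma>) * t N (n - 1)"
    using tstar_bounds[of n N] n by (auto simp: c_def)
  have tn: "0 < t N n" "t N n \<le> T" using t_pos t_le_T n N by auto
  have M0: "0 \<le> M" by (rule weak_reg_nonneg)
  define X where "X = M * (t N n powr \<beta> * real n powr (- 2))"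
  have X: "0 \<le> X" using M0 by (simp add: X_def)
  show ?thesis
  proof (cases "n = 1")
    case True
    have "\<bar>v c - v 0\<bar> \<le> M * c powr \<beta> / \<beta>" using cb by (intro weak_reg_increment) auto
    also have "\<dots> \<le> M * t N 1 powr \<beta> / \<beta>"
      using cb True \<beta>_pos M0 by (intro divide_right_mono mult_left_mono powr_mono2) auto
    finally have a: "\<bar>v c - v 0\<bar> \<le> M * t N 1 powr \<beta> / \<beta>" .
    have b: "\<bar>v (t N 1) - v 0\<bar> \<le> M * t N 1 powr \<beta> / \<beta>" using tn True by (intro weak_reg_increment) auto
    have "\<bar>\<sigma> * (v (t N 1) - v 0)\<bar> \<le> 1 * \<bar>v (t N 1) - v 0\<bar>" unfolding abs_mult using \<sigma>_bounds by (intro mult_right_mono) auto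
    moreover have "v c - vstar \<sigma> (\<lambda>k. v (t N k)) n = (v c - v 0) - \<sigma> * (v (t N 1) - v 0)"
      using True N by (simp add: vstar_def t_0 algebra_simps)
    ultimately have "\<bar>v c - vstar \<sigma> (\<lambda>k. v (t N k)) n\<bar> \<le> M * t N 1 powr \<beta> / \<beta> + M * t N 1 powr \<beta> / \<beta>"
      using b by (simp only:, intro order_trans[OF abs_triangle_ineq4] add_mono a) simp
    also have "\<dots> = 2 / \<beta> * X" using True by (simp add: X_def field_simps)
    also have "\<dots> \<le> (2 / \<beta> + E powr (3 - \<beta>) * Q\<^sup>2) * X" using X by (intro mult_right_mono) auto
    finally show ?thesis by (simp add: c_def X_def)
  next
    case False
    define a b where "a = t N (n - 1)" and "b = t N n"
    have ab: "0 < a" "a < c" "c < b" "b \<le> T" using t_pos[of "n - 1" N] n False cb tn by (auto simp: a_def b_def)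
    define M2 where "M2 = M * a powr (\<beta> - 2)"
    have M2: "0 \<le> M2" using M0 by (simp add: M2_def)
    have v2: "\<bar>v2 z\<bar> \<le> M2" if "z \<in> {a..b}" for z
    proof -
      have "\<bar>v2 z\<bar> \<le> M * z powr (\<beta> - 2)" using that ab by (intro weak_reg_on) auto
      also have "\<dots> \<le> M2" unfolding M2_def using that ab M0 \<beta>_lt by (intro mult_left_mono powr_mono2') auto
      finally show ?thesis .
    qed
    have e1: "\<bar>v1 z - v1 c\<bar> \<le> M2 * \<bar>z - c\<bar> ^ Suc 0" if "z \<in> {a..b}" for z
      by (rule deriv_bound_power[where f' = v2 and a = a and b = b])
        (use ab that M2 v2 weak_reg_on(2)[of a b] in \<open>auto intro!: derivative_eq_intros\<close>)
    have e0: "\<bar>v z - v c - v1 c * (z - c)\<bar> \<le> M2 * \<bar>z - c\<bar> ^ Suc (Suc 0)" if "z \<in> {a..b}" for z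
      by (rule deriv_bound_power[where f' = "\<lambda>z. v1 z - v1 c" and a = a and b = b])
        (use ab that M2 e1 weak_reg_on(1)[of a b] in \<open>auto intro!: derivative_eq_intros\<close>)
    define Ra Rb where "Ra = v a - v c - v1 c * (a - c)" and "Rb = v b - v c - v1 c * (b - c)"
    have R: "\<bar>Rz\<bar> \<le> M2 * (b - a)\<^sup>2" if "Rz = v z - v c - v1 c * (z - c)" "z \<in> {a..b}" for Rz z
    proof -
      have "\<bar>Rz\<bar> \<le> M2 * \<bar>z - c\<bar>\<^sup>2" using e0[OF that(2)] that(1) by (simp add: numeral_2_eq_2)
      also have "\<dots> \<le> M2 * (b - a)\<^sup>2" using that ab M2 by (intro mult_left_mono power_mono) auto
      finally show ?thesis .
    qed
    have "\<sigma> * (b - c) + (1 - \<sigma>) * (a - c) = 0" using ce by (simp add: a_def b_def algebra_simps)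
    moreover have "v c - vstar \<sigma> (\<lambda>k. v (t N k)) n = - (\<sigma> * Rb + (1 - \<sigma>) * Ra) - v1 c * (\<sigma> * (b - c) + (1 - \<sigma>) * (a - c))"
      by (simp add: vstar_def Ra_def Rb_def a_def b_def algebra_simps)
    ultimately have "\<bar>v c - vstar \<sigma> (\<lambda>k. v (t N k)) n\<bar> = \<bar>\<sigma> * Rb + (1 - \<sigma>) * Ra\<bar>" by simp
    also have "\<dots> \<le> \<sigma> * (M2 * (b - a)\<^sup>2) + (1 - \<sigma>) * (M2 * (b - a)\<^sup>2)"
    proof (rule order_trans[OF abs_triangle_ineq], intro add_mono)
      show "\<bar>\<sigma> * Rb\<bar> \<le> \<sigma> * (M2 * (b - a)\<^sup>2)" "\<bar>(1 - \<sigma>) * Ra\<bar> \<le> (1 - \<sigma>) * (M2 * (b - a)\<^sup>2)"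
        using \<sigma>_bounds R[OF Rb_def] R[OF Ra_def] ab by (auto simp: abs_mult intro!: mult_left_mono)
    qed
    also have "\<dots> = M2 * (b - a)\<^sup>2" by (simp add: algebra_simps)
    also have "\<dots> \<le> (M * (E powr (2 - \<beta>) * b powr (\<beta> - 2))) * (Q * (b / real n))\<^sup>2"
    proof (intro mult_mono power_mono)
      have "b / E \<le> a" using t_Suc_le[of "n - 1" N] n False E_ge by (simp add: a_def b_def field_simps)
      then have "a powr (\<beta> - 2) \<le> (b / E) powr (\<beta> - 2)" using ab E_ge \<beta>_lt by (intro powr_mono2') auto
      also have "\<dots> = E powr (2 - \<beta>) * b powr (\<beta> - 2)"
        using ab E_ge powr_minus_divide[of E "\<beta> - 2"] by (simp add: powr_divide)
      finally show "M2 \<le> M * (E powr (2 - \<beta>) * b powr (\<beta> - 2))" unfolding M2_def using M0 by (intro mult_left_mono)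
      show "b - a \<le> Q * (b / real n)" using step_upper[of n N] n by (simp add: a_def b_def mstep_def)
    qed (use ab M0 in auto)
    also have "\<dots> = E powr (2 - \<beta>) * Q\<^sup>2 * (M * ((b powr (\<beta> - 2) * b powr 2) * real n powr (- 2)))"
      using ab n by (simp add: power_mult_distrib power_divide powr_minus divide_inverse power_inverse)
    also have "b powr (\<beta> - 2) * b powr 2 = b powr \<beta>" by (simp only: powr_add[symmetric]) simp
    also have "E powr (2 - \<beta>) * Q\<^sup>2 * (M * (b powr \<beta> * real n powr (- 2))) = E powr (2 - \<beta>) * Q\<^sup>2 * X" by (simp add: X_def b_def)
    also have "\<dots> \<le> (2 / \<beta> + E powr (3 - \<beta>) * Q\<^sup>2) * X"
    proof (intro mult_right_mono X)
      have "E powr (2 - \<beta>) * Q\<^sup>2 \<le> E powr (3 - \<beta>) * Q\<^sup>2" using E_ge by (intro mult_right_mono powr_mono) auto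
      then show "E powr (2 - \<beta>) * Q\<^sup>2 \<le> 2 / \<beta> + E powr (3 - \<beta>) * Q\<^sup>2" using \<beta>_pos by (simp add: add_increasing)
    qed
    finally show ?thesis by (simp add: c_def X_def)
  qed
qed

end

text \<open>The initial cell contributes \<open>n\<close> to the power \<open>- r (\<beta> + 1)\<close>, the smooth part \<open>- (3 - \<beta>)\<close>; for \<open>n = 1\<close> both
  derivatives are merely bounded.\<close>

lemma truncation_weak:
  obtains C where "0 < C" "\<And>N n M v v1 v2 v3. weak_reg M v v1 v2 v3 \<Longrightarrow> 1 \<le> n \<Longrightarrow> n \<le> N \<Longrightarrow>
    \<bar>\<delta> N (\<lambda>k. v (t N k)) n - frac_deriv v1 (tstar \<sigma> (t N) n)\<bar> \<le> C * (M * real n powr (- min (r * (\<beta> + 1)) (3 - \<beta>)))"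
proof -
  define x where "x = min (r * (\<beta> + 1)) (3 - \<beta>)"
  have mu: "- 1 \<le> \<beta>" "\<beta> \<le> 1" and x: "x \<le> r * (\<beta> + 1)" "x \<le> 3 - \<beta>" using \<beta>_pos \<beta>_lt by (auto simp: x_def)
  obtain CT where CT: "0 < CT" "truncation_rate \<beta> x CT" by (rule truncation_smooth[OF mu x])
  define C1 where "C1 = 1 / (Gamma (2 - \<beta>) * \<beta>) + Beta \<beta> (1 - \<beta>) / \<Gamma>\<beta>"
  define C2 where "C2 = 4 * (2 * G) powr (\<beta> + 1) * Q powr (\<beta> + 1)"
  have C2: "0 < C2" using G_ge Q_ge by (simp add: C2_def)
  define C where "C = \<bar>C1\<bar> + (C2 + CT) / \<Gamma>\<beta>"
  have Cp: "0 < (C2 + CT) / \<Gamma>\<beta>" using C2 CT \<Gamma>\<beta>_pos by simp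
  show thesis
  proof (rule that[of C])
    show "0 < C" using Cp by (simp add: C_def)
    fix N n M v v1 v2 v3 assume reg: "weak_reg M v v1 v2 v3" and n: "1 \<le> n" "n \<le> (N::nat)"
    have M0: "0 \<le> M" by (rule weak_reg_nonneg[OF reg])
    define Y where "Y = M * real n powr (- x)"
    have Y: "0 \<le> Y" using M0 by (simp add: Y_def)
    have "\<bar>\<delta> N (\<lambda>k. v (t N k)) n - frac_deriv v1 (tstar \<sigma> (t N) n)\<bar> \<le> C * Y"
    proof (cases "n = 1")
      case True
      have "\<bar>\<delta> N (\<lambda>k. v (t N k)) n - frac_deriv v1 (tstar \<sigma> (t N) n)\<bar> \<le> C1 * M"
        using first_step_error[OF reg, of N] n True by (simp add: C1_def)
      also have "\<dots> \<le> C * M" using Cp by (intro mult_right_mono M0) (simp add: C_def)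
      also have "\<dots> = C * Y" using True by (simp add: Y_def)
      finally show ?thesis .
    next
      case False
      then have n2: "2 \<le> n" and N: "1 \<le> N" using n by auto
      define c where "c = tstar \<sigma> (t N) n"
      define V where "V k = v (t N k)" for k
      have tt: "0 < t N 1" "t N n \<le> T" "t N 0 = 0" using t_pos t_le_T t_0 n N by auto
      have cb: "t N (n - 1) < c" "0 < c" "c \<le> T" using tstar_bounds[of n N] n by (auto simp: c_def)
      have iv: "(\<lambda>s. (c - s) powr (- \<beta>) * v1 s) integrable_on {t N 0..c}"
        using weak_reg_kernel(1)[OF reg cb(2,3)] tt by simp
      have kc: "t N k < c" if "k \<le> n - 1" for k
      proof -
        have "t N k \<le> t N (n - 1)" using that n by (intro t_le) auto
        then show ?thesis using cb by simp
      qed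
      have ivk: "(\<lambda>s. (c - s) powr (- \<beta>) * v1 s) integrable_on {t N (k - 1)..t N k}" if k: "k \<in> {1..n - 1}" for k
        using kc[of k] k t_nonneg[of "k - 1" N] n tt by (intro integrable_on_subinterval[OF iv]) auto
      have ivl: "(\<lambda>s. (c - s) powr (- \<beta>) * v1 s) integrable_on {t N (n - 1)..c}"
        using t_nonneg[of "n - 1" N] n tt by (intro integrable_on_subinterval[OF iv]) auto
      have qi: "(\<lambda>s. (c - s) powr (- \<beta>) * deriv (quad_interp (t N) V k) s) integrable_on {t N (k - 1)..t N k}"
        if k: "k \<in> {1..n - 1}" for k
      proof -
        have "t N (k - 1) < t N k" "t N k < t N (k + 1)" using k n by (auto intro: t_less)
        then have "continuous_on {t N (k - 1)..t N k} (deriv (quad_interp (t N) V k))"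
          by (subst continuous_on_cong[OF refl deriv_quad_interp]) (auto intro!: continuous_intros)
        then show ?thesis using kc[of k] k by (intro integrable_continuous_interval continuous_on_mult kernel_continuous) auto
      qed
      have li: "(\<lambda>s. (c - s) powr (- \<beta>) * deriv (lin_interp (t N) V n) s) integrable_on {t N (n - 1)..c}"
      proof -
        have ne: "t N (n - 1) \<noteq> t N n" "t N (n - 1) \<le> c" using n cb t_less[of "n - 1" n N] by auto
        show ?thesis
          unfolding deriv_lin_interp[of "t N" n, OF ne(1)]
          by (intro integrable_on_mult_left has_integral_integrable[OF integral_powr_end[OF ne(2) \<beta>_lt]])
      qed
      define e where "e k = integral {t N (k - 1)..t N k} (\<lambda>s. (c - s) powr (- \<beta>) * (v1 s - deriv (quad_interp (t N) V k) s))" for k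
      define el where "el = integral {t N (n - 1)..c} (\<lambda>s. (c - s) powr (- \<beta>) * (v1 s - deriv (lin_interp (t N) V n) s))"
      have "(\<Sum>k=1..n - 1. e k) = (\<Sum>k=1..n - 1. integral {t N (k - 1)..t N k} (\<lambda>s. (c - s) powr (- \<beta>) * v1 s)
            - integral {t N (k - 1)..t N k} (\<lambda>s. (c - s) powr (- \<beta>) * deriv (quad_interp (t N) V k) s))"
        unfolding e_def right_diff_distrib by (intro sum.cong refl Henstock_Kurzweil_Integration.integral_diff ivk qi)
      moreover have "el = integral {t N (n - 1)..c} (\<lambda>s. (c - s) powr (- \<beta>) * v1 s)
          - integral {t N (n - 1)..c} (\<lambda>s. (c - s) powr (- \<beta>) * deriv (lin_interp (t N) V n) s)"
        unfolding el_def right_diff_distrib by (intro Henstock_Kurzweil_Integration.integral_diff ivl li)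
      moreover have "(\<Sum>k=1..n - 1. integral {t N (k - 1)..t N k} (\<lambda>s. (c - s) powr (- \<beta>) * v1 s))
         + integral {t N (n - 1)..c} (\<lambda>s. (c - s) powr (- \<beta>) * v1 s) = integral {0..c} (\<lambda>s. (c - s) powr (- \<beta>) * v1 s)"
        using integral_cells_last[of "\<lambda>s. (c - s) powr (- \<beta>) * v1 s" N 0 n] iv n tt by (simp add: c_def)
      ultimately have "(\<Sum>k=1..n - 1. e k) + el = \<Gamma>\<beta> * (frac_deriv v1 c - \<delta> N V n)"
      proof -
        assume 1: "(\<Sum>k=1..n - 1. e k) = (\<Sum>k=1..n - 1. integral {t N (k - 1)..t N k} (\<lambda>s. (c - s) powr (- \<beta>) * v1 s)
            - integral {t N (k - 1)..t N k} (\<lambda>s. (c - s) powr (- \<beta>) * deriv (quad_interp (t N) V k) s))"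
          and 2: "el = integral {t N (n - 1)..c} (\<lambda>s. (c - s) powr (- \<beta>) * v1 s)
          - integral {t N (n - 1)..c} (\<lambda>s. (c - s) powr (- \<beta>) * deriv (lin_interp (t N) V n) s)"
          and 3: "(\<Sum>k=1..n - 1. integral {t N (k - 1)..t N k} (\<lambda>s. (c - s) powr (- \<beta>) * v1 s))
         + integral {t N (n - 1)..c} (\<lambda>s. (c - s) powr (- \<beta>) * v1 s) = integral {0..c} (\<lambda>s. (c - s) powr (- \<beta>) * v1 s)"
        have "\<Gamma>\<beta> * frac_deriv v1 c = integral {0..c} (\<lambda>s. (c - s) powr (- \<beta>) * v1 s)"
          using \<Gamma>\<beta>_pos by (simp add: frac_deriv_def)
        moreover have "\<Gamma>\<beta> * \<delta> N V n = (\<Sum>k=1..n - 1. integral {t N (k - 1)..t N k} (\<lambda>s. (c - s) powr (- \<beta>) * deriv (quad_interp (t N) V k) s))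
          + integral {t N (n - 1)..c} (\<lambda>s. (c - s) powr (- \<beta>) * deriv (lin_interp (t N) V n) s)"
          using \<Gamma>\<beta>_pos by (simp add: alikhanov_def c_def)
        ultimately show ?thesis using 1 2 3 unfolding sum_subtractf right_diff_distrib by linarith
      qed
      moreover have "(\<Sum>k=1..n - 1. e k) = e 1 + (\<Sum>k=Suc 1..n - 1. e k)" using n2 by (intro sum.atLeast_Suc_atMost) auto
      ultimately have eq: "\<Gamma>\<beta> * (\<delta> N V n - frac_deriv v1 c) = - (e 1 + ((\<Sum>k=Suc 1..n - 1. e k) + el))"
        by (simp add: algebra_simps)
      have "\<bar>e 1\<bar> \<le> C2 * M * real n powr (- (r * (\<beta> + 1)))"
        using initial_cell_error(2)[OF reg n2 n(2)] tt unfolding e_def V_def[abs_def] c_def by (simp add: C2_def)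
      also have "\<dots> \<le> C2 * M * real n powr (- x)"
        using C2 M0 n x by (intro mult_left_mono powr_mono) auto
      finally have e1: "\<bar>e 1\<bar> \<le> C2 * Y" by (simp add: Y_def mult.assoc)
      have "\<bar>(\<Sum>k=Suc 1..n - 1. e k) + el\<bar> \<le> CT * M * t N n powr (\<beta> - \<beta>) * real n powr (- x) * real 1 powr (x + \<beta> - 3)"
        unfolding e_def el_def c_def
      proof (rule CT(2)[unfolded truncation_rate_def, THEN spec[of _ N], THEN spec[of _ n], THEN spec[of _ 1],
        THEN spec[of _ M], THEN spec[of _ v], THEN spec[of _ v1], THEN spec[of _ v2], THEN spec[of _ v3], THEN spec[of _ V], rule_format])
        fix z assume z: "z \<in> {t N 1..t N n}"
        show "(v has_real_derivative v1 z) (at z within {t N 1..t N n})" "(v1 has_real_derivative v2 z) (at z within {t N 1..t N n})"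
          "(v2 has_real_derivative v3 z) (at z within {t N 1..t N n})" "\<bar>v3 z\<bar> \<le> M * z powr (\<beta> - 3)"
          using weak_reg_on[OF reg tt(1,2) z] by auto
      qed (use n2 n M0 in \<open>auto simp: V_def\<close>)
      also have "\<dots> = CT * Y" using t_pos[of n N] n by (simp add: Y_def)
      finally have e2: "\<bar>(\<Sum>k=Suc 1..n - 1. e k) + el\<bar> \<le> CT * Y" .
      have "\<bar>\<Gamma>\<beta> * (\<delta> N V n - frac_deriv v1 c)\<bar> \<le> (C2 + CT) * Y"
        unfolding eq abs_minus_cancel distrib_right by (intro order_trans[OF abs_triangle_ineq] add_mono e1 e2)
      then have "\<Gamma>\<beta> * \<bar>\<delta> N V n - frac_deriv v1 c\<bar> \<le> (C2 + CT) * Y"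
        using \<Gamma>\<beta>_pos by (simp only: abs_mult abs_of_pos)
      then have "\<bar>\<delta> N V n - frac_deriv v1 c\<bar> \<le> (C2 + CT) / \<Gamma>\<beta> * Y"
        using \<Gamma>\<beta>_pos by (simp add: pos_le_divide_eq mult.commute)
      also have "\<dots> \<le> C * Y" using Y by (intro mult_right_mono) (auto simp: C_def)
      finally show ?thesis by (simp only: V_def[abs_def] c_def)
    qed
    then show "\<bar>\<delta> N (\<lambda>k. v (t N k)) n - frac_deriv v1 (tstar \<sigma> (t N) n)\<bar> \<le> C * (M * real n powr (- min (r * (\<beta> + 1)) (3 - \<beta>)))"
      by (simp add: Y_def x_def)
  qed
qed

end

section \<open>The semigroup property of the Caputo derivative\<close>

lemma has_integral_Beta_between:
  fixes a b c z :: real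
  assumes "0 < a" "0 < b" "z < c"
  shows "((\<lambda>s. (c - s) powr (b - 1) * (s - z) powr (a - 1)) has_integral (c - z) powr (a + b - 1) * Beta a b) {z..c}"
proof -
  have "((\<lambda>x. (c - (x + z)) powr (b - 1) * (x + z - z) powr (a - 1)) has_integral (c - z) powr (a + b - 1) * Beta a b) {0..c - z}"
    using has_integral_Beta_scaled[of a b "c - z"] assms by (simp add: algebra_simps)
  then show ?thesis
    using has_integral_shift_Icc_real[of "\<lambda>s. (c - s) powr (b - 1) * (s - z) powr (a - 1)" z _ 0 "c - z"]
    by (simp add: o_def add.commute)
qed

lemma integrable_lborel_of_absolutely:
  fixes f :: "real \<Rightarrow> real"
  assumes "f absolutely_integrable_on S" and m: "(\<lambda>x. indicator S x * f x) \<in> borel_measurable borel"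
  shows "integrable lborel (\<lambda>x. indicator S x * f x)" "(\<integral>x. indicator S x * f x \<partial>lborel) = integral S f"
proof -
  have "integrable lebesgue (\<lambda>x. indicator S x * f x)" using assms(1) by (simp add: set_integrable_def)
  then show i: "integrable lborel (\<lambda>x. indicator S x * f x)"
    using m by (subst (asm) integrable_completion) auto
  then have "set_integrable lborel S f" by (simp add: set_integrable_def)
  from set_borel_integral_eq_integral(2)[OF this] show "(\<integral>x. indicator S x * f x \<partial>lborel) = integral S f"
    by (simp add: set_lebesgue_integral_def)
qed

text \<open>Fractional integrals compose: Fubini's theorem, and the inner integral of the two kernels is a Beta
  integral.\<close>

lemma fractional_integral_compose:
  fixes a b c m M :: real
  assumes "0 < a" "0 < b" "0 < m" "0 < c" and f: "continuous_on {0<..<c} f"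
    and le: "\<And>s. s \<in> {0<..<c} \<Longrightarrow> \<bar>f s\<bar> \<le> M * s powr (m - 1)"
  shows "(\<lambda>s. (c - s) powr (a - 1) * integral {0..s} (\<lambda>z. (s - z) powr (b - 1) * f z)) integrable_on {0<..<c}"
    and "integral {0<..<c} (\<lambda>s. (c - s) powr (a - 1) * integral {0..s} (\<lambda>z. (s - z) powr (b - 1) * f z))
      = Beta a b * integral {0..c} (\<lambda>z. (c - z) powr (a + b - 1) * f z)"
proof -
  define F where "F z = indicator {0<..<c} z * f z" for z
  define k where "k z s = (if z < s \<and> s < c then (c - s) powr (a - 1) * (s - z) powr (b - 1) else 0)" for z s
  have Fm[measurable]: "F \<in> borel_measurable borel"
    using borel_measurable_continuous_on_indicator[OF _ f] by (simp add: F_def[abs_def])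
  have km[measurable]: "(\<lambda>p. k (fst p) (snd p)) \<in> borel_measurable (lborel \<Otimes>\<^sub>M lborel)"
    unfolding k_def by measurable
  have k_nonneg: "0 \<le> k z s" for z s by (simp add: k_def)
  have ki: "integrable lborel (k z)" "(\<integral>s. k z s \<partial>lborel) = (c - z) powr (a + b - 1) * Beta b a" if "z < c" for z
  proof -
    have h: "((\<lambda>s. (c - s) powr (a - 1) * (s - z) powr (b - 1)) has_integral (c - z) powr (b + a - 1) * Beta b a) {z<..<c}"
      using has_integral_Beta_between[of b a z c] assms that by (simp add: has_integral_Icc_iff_Ioo)
    have e: "k z = (\<lambda>s. indicator {z<..<c} s * ((c - s) powr (a - 1) * (s - z) powr (b - 1)))"
      by (auto simp: k_def fun_eq_iff indicator_def)
    have ab: "(\<lambda>s. (c - s) powr (a - 1) * (s - z) powr (b - 1)) absolutely_integrable_on {z<..<c}"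
      using h by (intro nonnegative_absolutely_integrable_1) (auto simp: integrable_on_def)
    have ms: "(\<lambda>s. indicator {z<..<c} s * ((c - s) powr (a - 1) * (s - z) powr (b - 1))) \<in> borel_measurable borel"
      by measurable
    show "integrable lborel (k z)" unfolding e by (rule integrable_lborel_of_absolutely(1)[OF ab ms])
    show "(\<integral>s. k z s \<partial>lborel) = (c - z) powr (a + b - 1) * Beta b a"
      unfolding e integrable_lborel_of_absolutely(2)[OF ab ms] integral_unique[OF h] by (simp add: add.commute)
  qed
  have Fz: "F z = 0" if "\<not> z < c" for z using that by (simp add: F_def)
  have ab: "(\<lambda>z. (c - z) powr (a + b - 1) * f z) absolutely_integrable_on {0<..<c}"
    using singular_product_integrable(1)[of m "a + b" c f M] assms
    by (auto simp: absolutely_integrable_on_def integrable_on_Icc_iff_Ioo)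
  have mz: "(\<lambda>z. indicator {0<..<c} z * ((c - z) powr (a + b - 1) * f z)) \<in> borel_measurable borel"
  proof -
    have "(\<lambda>z. (c - z) powr (a + b - 1) * F z) \<in> borel_measurable borel" by measurable
    then show ?thesis by (simp add: F_def mult_ac)
  qed
  note Iz = integrable_lborel_of_absolutely[OF ab mz]
  have hm: "case_prod (\<lambda>z s. F z * k z s) \<in> borel_measurable (lborel \<Otimes>\<^sub>M lborel)"
    using km by (simp add: case_prod_beta')
  have "integrable (lborel \<Otimes>\<^sub>M lborel) (case_prod (\<lambda>z s. F z * k z s))"
  proof (rule lborel_pair.Fubini_integrable[OF hm])
    have e: "(\<integral>s. norm (case (z, s) of (z, s) \<Rightarrow> F z * k z s) \<partial>lborel) = \<bar>indicator {0<..<c} z * ((c - z) powr (a + b - 1) * f z)\<bar> * Beta b a" for z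
    proof (cases "z < c")
      case True
      have "(\<integral>s. norm (case (z, s) of (z, s) \<Rightarrow> F z * k z s) \<partial>lborel) = \<bar>F z\<bar> * ((c - z) powr (a + b - 1) * Beta b a)"
        using ki(2)[OF True] k_nonneg by (simp add: abs_mult)
      then show ?thesis by (simp add: F_def abs_mult mult_ac)
    qed (simp add: Fz)
    show "integrable lborel (\<lambda>z. \<integral>s. norm (case (z, s) of (z, s) \<Rightarrow> F z * k z s) \<partial>lborel)"
      unfolding e by (intro integrable_mult_left integrable_abs Iz)
    show "AE z in lborel. integrable lborel (\<lambda>s. case (z, s) of (z, s) \<Rightarrow> F z * k z s)"
    proof (rule AE_I2)
      fix z show "integrable lborel (\<lambda>s. case (z, s) of (z, s) \<Rightarrow> F z * k z s)"
        by (cases "z < c") (auto simp: Fz ki)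
    qed
  qed
  note Fub = lborel_pair.Fubini_integral[OF this] lborel_pair.integrable_snd[OF this]
  have inner: "(\<integral>z. F z * k z s \<partial>lborel) = indicator {0<..<c} s * ((c - s) powr (a - 1) * integral {0..s} (\<lambda>z. (s - z) powr (b - 1) * f z))" for s
  proof (cases "s \<in> {0<..<c}")
    case True
    have cs: "continuous_on {0<..<s} f" using True by (intro continuous_on_subset[OF f]) auto
    have abs: "(\<lambda>z. (s - z) powr (b - 1) * f z) absolutely_integrable_on {0<..<s}"
      using singular_product_integrable(1)[of m b s f M] assms cs True le
      by (auto simp: absolutely_integrable_on_def integrable_on_Icc_iff_Ioo)
    have e: "indicator {0<..<s} z * ((s - z) powr (b - 1) * f z) = indicator {..<s} z * ((s - z) powr (b - 1) * F z)" for z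
      using True by (auto simp: F_def indicator_def)
    have ms: "(\<lambda>z. indicator {0<..<s} z * ((s - z) powr (b - 1) * f z)) \<in> borel_measurable borel"
      unfolding e by measurable
    have "(\<integral>z. F z * k z s \<partial>lborel) = (\<integral>z. (c - s) powr (a - 1) * (indicator {0<..<s} z * ((s - z) powr (b - 1) * f z)) \<partial>lborel)"
      using True by (intro Bochner_Integration.integral_cong) (auto simp: F_def k_def indicator_def)
    also have "\<dots> = (c - s) powr (a - 1) * integral {0<..<s} (\<lambda>z. (s - z) powr (b - 1) * f z)"
      using integrable_lborel_of_absolutely(2)[OF abs ms] by simp
    finally show ?thesis using True by (simp add: integral_open_interval_real)
  next
    case False
    then have e: "(\<lambda>z. F z * k z s) = (\<lambda>z. 0)" by (auto simp: fun_eq_iff F_def k_def indicator_def)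
    show ?thesis unfolding e using False by simp
  qed
  have "set_integrable lborel {0<..<c} (\<lambda>s. (c - s) powr (a - 1) * integral {0..s} (\<lambda>z. (s - z) powr (b - 1) * f z))"
    using Fub(2) unfolding inner by (simp add: set_integrable_def)
  note S = set_borel_integral_eq_integral[OF this]
  show "(\<lambda>s. (c - s) powr (a - 1) * integral {0..s} (\<lambda>z. (s - z) powr (b - 1) * f z)) integrable_on {0<..<c}"
    by (rule S(1))
  have "integral {0<..<c} (\<lambda>s. (c - s) powr (a - 1) * integral {0..s} (\<lambda>z. (s - z) powr (b - 1) * f z))
    = (\<integral>s. (\<integral>z. F z * k z s \<partial>lborel) \<partial>lborel)"
    using S(2) unfolding inner by (simp add: set_lebesgue_integral_def)
  also have "\<dots> = (\<integral>z. (\<integral>s. F z * k z s \<partial>lborel) \<partial>lborel)" by (rule Fub(1))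
  also have "\<dots> = (\<integral>z. Beta b a * (indicator {0<..<c} z * ((c - z) powr (a + b - 1) * f z)) \<partial>lborel)"
  proof (intro Bochner_Integration.integral_cong refl)
    fix z
    show "(\<integral>s. F z * k z s \<partial>lborel) = Beta b a * (indicator {0<..<c} z * ((c - z) powr (a + b - 1) * f z))"
      by (cases "z < c") (simp_all add: ki Fz F_def)
  qed
  also have "\<dots> = Beta b a * integral {0<..<c} (\<lambda>z. (c - z) powr (a + b - 1) * f z)"
    using Iz(2) by simp
  finally show "integral {0<..<c} (\<lambda>s. (c - s) powr (a - 1) * integral {0..s} (\<lambda>z. (s - z) powr (b - 1) * f z))
      = Beta a b * integral {0..c} (\<lambda>z. (c - z) powr (a + b - 1) * f z)"
    by (simp add: integral_open_interval_real Beta_commute)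
qed

text \<open>Two functions with the same indefinite integrals cannot be told apart by a kernel that is monotone
  away from \<open>c\<close>: this is the second mean value theorem.  It spares the question whether they agree pointwise.\<close>

lemma kernel_integral_zero:
  fixes c \<beta> :: real and d :: "real \<Rightarrow> real"
  assumes "0 < c" "0 \<le> \<beta>" and d: "d integrable_on {0..c}" and z: "\<And>s. s \<in> {0..c} \<Longrightarrow> integral {0..s} d = 0"
    and i: "(\<lambda>s. (c - s) powr (- \<beta>) * d s) integrable_on {0..c}"
  shows "integral {0..c} (\<lambda>s. (c - s) powr (- \<beta>) * d s) = 0"
proof -
  have zero: "integral {0..s} (\<lambda>s. (c - s) powr (- \<beta>) * d s) = 0" if s: "s \<in> {0..<c}" for s
  proof -
    have ds: "d integrable_on {0..s}" using s by (intro integrable_on_subinterval[OF d]) auto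
    obtain e where e: "e \<in> {0..s}"
      "((\<lambda>x. (c - x) powr (- \<beta>) * d x) has_integral (c - 0) powr (- \<beta>) * integral {0..e} d + (c - s) powr (- \<beta>) * integral {e..s} d) {0..s}"
      by (rule second_mean_value_theorem_full[OF ds, of "\<lambda>x. (c - x) powr (- \<beta>)"])
        (use s assms(2) in \<open>auto intro!: kernel_mono\<close>)
    have "integral {0..e} d + integral {e..s} d = integral {0..s} d"
      using e ds by (intro Henstock_Kurzweil_Integration.integral_combine) auto
    then have "integral {0..e} d = 0" "integral {e..s} d = 0" using z[of e] z[of s] e s by auto
    then show ?thesis using integral_unique[OF e(2)] by simp
  qed
  define I where "I s = integral {0..s} (\<lambda>s. (c - s) powr (- \<beta>) * d s)" for s
  have "continuous_on {0..c} I" unfolding I_def using i by (rule indefinite_integral_continuous_1)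
  then have "(I \<longlongrightarrow> I c) (at c within {0..c})" using assms(1) by (auto simp: continuous_on_def)
  moreover have "at c within {0..c} = at_left c" using assms(1) by (rule at_within_Icc_at_left)
  ultimately have t1: "(I \<longlongrightarrow> I c) (at_left c)" by simp
  have "eventually (\<lambda>s. I s = 0) (at_left c)"
    using eventually_at_left_real[OF assms(1)] by eventually_elim (use zero in \<open>auto simp: I_def\<close>)
  then have "(I \<longlongrightarrow> 0) (at_left c)" using tendsto_eventually by blast
  then have "I c = 0" using t1 tendsto_unique by (metis trivial_limit_at_left_real)
  then show ?thesis by (simp add: I_def)
qed

text \<open>Both sides are fractional integrals of \<open>u2\<close>.  By the composition rule the fractional integral \<open>J\<close> of \<open>u2\<close> of order \<open>1 - \<beta>\<close> has the
  indefinite integral \<open>p\<close>, up to a constant factor, because \<open>u1\<close> is the integral of \<open>u2\<close> from \<open>0\<close>.  Hence \<open>p1\<close> may be replaced by \<open>J\<close>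
  under the kernel, and a second composition adds the orders.\<close>

lemma caputo_twice:
  fixes T \<beta> M M' :: real and u1 u2 p p1 :: "real \<Rightarrow> real"
  assumes T: "0 < T" and \<beta>: "1 / 2 < \<beta>" "\<beta> < 1"
    and u1: "\<And>s. s \<in> {0..T} \<Longrightarrow> (u2 has_integral u1 s) {0..s}"
    and u2c: "continuous_on {0<..T} u2" and u2: "\<And>s. s \<in> {0<..T} \<Longrightarrow> \<bar>u2 s\<bar> \<le> M * s powr (2 * \<beta> - 2)"
    and p: "\<And>s. s \<in> {0<..T} \<Longrightarrow> p s = 1 / Gamma (1 - \<beta>) * integral {0..s} (\<lambda>z. (s - z) powr (- \<beta>) * u1 z)"
    and pp: "\<And>s. s \<in> {0<..T} \<Longrightarrow> (p1 has_integral p s) {0..s}"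
    and p1c: "continuous_on {0<..T} p1" and p1: "\<And>s. s \<in> {0<..T} \<Longrightarrow> \<bar>p1 s\<bar> \<le> M' * s powr (\<beta> - 1)"
    and c: "c \<in> {0<..T}"
  shows "1 / Gamma (1 - \<beta>) * integral {0..c} (\<lambda>s. (c - s) powr (- \<beta>) * p1 s)
    = 1 / Gamma (2 - 2 * \<beta>) * integral {0..c} (\<lambda>s. (c - s) powr (1 - 2 * \<beta>) * u2 s)"
proof -
  have G: "0 < Gamma (1 - \<beta>)" "0 < Gamma (2 - 2 * \<beta>)" using \<beta> by (auto intro!: Gamma_real_pos)
  have b1: "0 < 1 - \<beta>" and m: "0 < 2 * \<beta> - 1" using \<beta> by auto
  have u2': "\<bar>u2 s\<bar> \<le> M * s powr ((2 * \<beta> - 1) - 1)" if "s \<in> {0<..T}" for s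
    using u2[OF that] by simp
  define J where "J s = integral {0..s} (\<lambda>z. (s - z) powr (- \<beta>) * u2 z)" for s
  have cs: "continuous_on {0<..<s} u2" if "s \<in> {0<..T}" for s using that by (intro continuous_on_subset[OF u2c]) auto
  have u2s: "\<bar>u2 z\<bar> \<le> M * z powr ((2 * \<beta> - 1) - 1)" if "s \<in> {0<..T}" "z \<in> {0<..<s}" for s z using u2'[of z] that by auto
  \<comment> \<open>order of integration \<open>1\<close> outside, \<open>1 - \<beta>\<close> inside\<close>
  have A: "J integrable_on {0<..<s}" "integral {0<..<s} J = Beta 1 (1 - \<beta>) * integral {0..s} (\<lambda>z. (s - z) powr (1 - \<beta>) * u2 z)"
    if s: "s \<in> {0<..T}" for s
  proof -
    have s0: "0 < s" using s by simp
    note fc = fractional_integral_compose[OF zero_less_one b1 m s0 cs[OF s] u2s[OF s]]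
    have e: "(s - x) powr (1 - 1) * integral {0..x} (\<lambda>z. (x - z) powr (1 - \<beta> - 1) * u2 z) = J x" if "x \<in> {0<..<s}" for x
      using that by (simp add: J_def)
    show "J integrable_on {0<..<s}" using fc(1) e by (rule integrable_eq)
    have "integral {0<..<s} J = integral {0<..<s} (\<lambda>x. (s - x) powr (1 - 1) * integral {0..x} (\<lambda>z. (x - z) powr (1 - \<beta> - 1) * u2 z))"
      by (intro integral_cong) (simp only: e)
    also note fc(2)
    finally show "integral {0<..<s} J = Beta 1 (1 - \<beta>) * integral {0..s} (\<lambda>z. (s - z) powr (1 - \<beta>) * u2 z)"
      by simp
  qed
  \<comment> \<open>and the other way round\<close>
  have B: "integral {0..s} (\<lambda>z. (s - z) powr (- \<beta>) * u1 z) = Beta (1 - \<beta>) 1 * integral {0..s} (\<lambda>z. (s - z) powr (1 - \<beta>) * u2 z)"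
    if s: "s \<in> {0<..T}" for s
  proof -
    have s0: "0 < s" using s by simp
    note fc = fractional_integral_compose[OF b1 zero_less_one m s0 cs[OF s] u2s[OF s]]
    have "integral {0..x} (\<lambda>z. (x - z) powr (1 - 1) * u2 z) = u1 x" if "x \<in> {0<..<s}" for x
    proof -
      have "integral {0..x} (\<lambda>z. (x - z) powr (1 - 1) * u2 z) = integral {0<..<x} u2"
        unfolding integral_open_interval_real by (intro integral_cong) auto
      also have "\<dots> = u1 x" using u1[of x] that s by (simp add: has_integral_Icc_iff_Ioo integral_unique)
      finally show ?thesis .
    qed
    then have "integral {0<..<s} (\<lambda>x. (s - x) powr (1 - \<beta> - 1) * integral {0..x} (\<lambda>z. (x - z) powr (1 - 1) * u2 z))
      = integral {0<..<s} (\<lambda>x. (s - x) powr (- \<beta>) * u1 x)"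
      by (intro integral_cong) simp
    then show ?thesis using fc(2) by (simp add: integral_open_interval_real)
  qed
  define d where "d s = p1 s - J s / Gamma (1 - \<beta>)" for s
  have hJ: "(J has_integral Beta 1 (1 - \<beta>) * integral {0..s} (\<lambda>z. (s - z) powr (1 - \<beta>) * u2 z)) {0..s}" if "s \<in> {0<..T}" for s
    using A[OF that] by (metis has_integral_Icc_iff_Ioo integrable_integral)
  have hd: "(d has_integral 0) {0..s}" if s: "s \<in> {0<..T}" for s
  proof -
    have "(d has_integral p s - (Beta 1 (1 - \<beta>) * integral {0..s} (\<lambda>z. (s - z) powr (1 - \<beta>) * u2 z)) / Gamma (1 - \<beta>)) {0..s}"
      unfolding d_def by (intro has_integral_diff has_integral_divide pp hJ s)
    then show ?thesis unfolding p[OF s] B[OF s] by (simp add: Beta_commute)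
  qed
  have c0: "0 < c" using c by simp
  have i1: "(\<lambda>s. (c - s) powr (- \<beta>) * p1 s) integrable_on {0..c}"
  proof -
    have "(\<lambda>s. (c - s) powr (1 - \<beta> - 1) * p1 s) absolutely_integrable_on {0..c}"
      using \<beta> c p1 by (intro singular_product_integrable(1)[of \<beta> _ _ _ M']) (auto intro: continuous_on_subset[OF p1c])
    then show ?thesis by (simp add: set_lebesgue_integral_eq_integral(1))
  qed
  note fc = fractional_integral_compose[OF b1 b1 m c0 cs[OF c] u2s[OF c]]
  have e: "(c - x) powr (1 - \<beta> - 1) * integral {0..x} (\<lambda>z. (x - z) powr (1 - \<beta> - 1) * u2 z) = (c - x) powr (- \<beta>) * J x" for x
    by (simp add: J_def)
  have i2: "(\<lambda>s. (c - s) powr (- \<beta>) * J s) integrable_on {0..c}"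
    and v2: "integral {0..c} (\<lambda>s. (c - s) powr (- \<beta>) * J s) = Beta (1 - \<beta>) (1 - \<beta>) * integral {0..c} (\<lambda>z. (c - z) powr (1 - 2 * \<beta>) * u2 z)"
  proof -
    show "(\<lambda>s. (c - s) powr (- \<beta>) * J s) integrable_on {0..c}" using fc(1) unfolding e integrable_on_Icc_iff_Ioo .
    have "1 - \<beta> + (1 - \<beta>) - 1 = 1 - 2 * \<beta>" by simp
    then show "integral {0..c} (\<lambda>s. (c - s) powr (- \<beta>) * J s) = Beta (1 - \<beta>) (1 - \<beta>) * integral {0..c} (\<lambda>z. (c - z) powr (1 - 2 * \<beta>) * u2 z)"
      using fc(2) unfolding e by (simp add: integral_open_interval_real)
  qed
  have "integral {0..c} (\<lambda>s. (c - s) powr (- \<beta>) * d s) = 0"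
  proof (rule kernel_integral_zero[OF c0])
    show "d integrable_on {0..c}" using hd[OF c] by auto
    fix s assume s: "s \<in> {0..c}"
    show "integral {0..s} d = 0" using hd[of s] s c by (cases "s = 0") (auto simp: integral_unique)
  next
    have "(\<lambda>s. (c - s) powr (- \<beta>) * d s) = (\<lambda>s. (c - s) powr (- \<beta>) * p1 s - ((c - s) powr (- \<beta>) * J s) / Gamma (1 - \<beta>))"
      by (simp add: d_def right_diff_distrib)
    then show "(\<lambda>s. (c - s) powr (- \<beta>) * d s) integrable_on {0..c}" using i1 i2 by (auto intro!: integrable_diff integrable_on_divide)
  qed (use \<beta> in auto)
  moreover have "integral {0..c} (\<lambda>s. (c - s) powr (- \<beta>) * d s)
    = integral {0..c} (\<lambda>s. (c - s) powr (- \<beta>) * p1 s) - integral {0..c} (\<lambda>s. (c - s) powr (- \<beta>) * J s) / Gamma (1 - \<beta>)"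
  proof -
    have "((\<lambda>s. (c - s) powr (- \<beta>) * p1 s - ((c - s) powr (- \<beta>) * J s) / Gamma (1 - \<beta>)) has_integral
      integral {0..c} (\<lambda>s. (c - s) powr (- \<beta>) * p1 s) - integral {0..c} (\<lambda>s. (c - s) powr (- \<beta>) * J s) / Gamma (1 - \<beta>)) {0..c}"
      by (intro has_integral_diff has_integral_divide integrable_integral i1 i2)
    then show ?thesis by (simp add: d_def right_diff_distrib integral_unique)
  qed
  ultimately have "integral {0..c} (\<lambda>s. (c - s) powr (- \<beta>) * p1 s)
    = Beta (1 - \<beta>) (1 - \<beta>) * integral {0..c} (\<lambda>z. (c - z) powr (1 - 2 * \<beta>) * u2 z) / Gamma (1 - \<beta>)"
    by (simp add: v2)
  moreover have "Beta (1 - \<beta>) (1 - \<beta>) = Gamma (1 - \<beta>) * Gamma (1 - \<beta>) / Gamma (2 - 2 * \<beta>)"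
    by (simp add: Beta_def)
  ultimately show ?thesis using G by (simp add: field_simps)
qed

section \<open>Derivatives on closed intervals and difference quotients\<close>

lemma nderiv_has_derivative:
  "nderiv k S f differentiable (at s within S) \<Longrightarrow> (nderiv k S f has_real_derivative nderiv (Suc k) S f s) (at s within S)"
  by (simp add: vector_derivative_works has_real_derivative_iff_has_vector_derivative)

lemma diff_upto_has_derivative:
  "diff_upto k S f \<Longrightarrow> i < k \<Longrightarrow> s \<in> S \<Longrightarrow> (nderiv i S f has_real_derivative nderiv (Suc i) S f s) (at s within S)"
  by (rule nderiv_has_derivative) (auto simp: diff_upto_def)

lemma nderiv_1_unique:
  fixes f :: "real \<Rightarrow> real"
  assumes "a < b" "s \<in> {a..b}" "(f has_real_derivative D) (at s within {a..b})"
  shows "nderiv 1 {a..b} f s = D"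
  using vector_derivative_within_closed_interval[of a b s f D] assms
  by (simp add: has_real_derivative_iff_has_vector_derivative)

lemma nderiv_Suc_unique:
  assumes "a < b" "s \<in> {a..b}" "(nderiv k {a..b} f has_real_derivative D) (at s within {a..b})"
  shows "nderiv (Suc k) {a..b} f s = D"
  using nderiv_1_unique[OF assms] by simp

lemma first_difference_bound:
  fixes f :: "real \<Rightarrow> real"
  assumes d: "diff_upto 1 {0..L} f" and le: "\<And>z. z \<in> {0..L} \<Longrightarrow> \<bar>nderiv 1 {0..L} f z\<bar> \<le> B"
    and x: "x \<in> {0..L}" "s \<in> {0..L}"
  shows "\<bar>f s - f x\<bar> \<le> B * \<bar>s - x\<bar>"
proof -
  have f': "(f has_real_derivative nderiv 1 {0..L} f z) (at z within {0..L})" if "z \<in> {0..L}" for z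
    using diff_upto_has_derivative[OF d, of 0 z] that by simp
  have B: "0 \<le> B" using le[OF x(1)] by linarith
  have "\<bar>f s - f x\<bar> \<le> B * \<bar>s - x\<bar> ^ Suc 0"
    by (rule deriv_bound_power[where f' = "nderiv 1 {0..L} f" and a = 0 and b = L])
      (use x le B in \<open>auto intro!: derivative_eq_intros f' simp del: nderiv.simps\<close>)
  then show ?thesis by simp
qed

lemma taylor_remainder_2:
  fixes f :: "real \<Rightarrow> real"
  assumes d: "diff_upto 2 {0..L} f" and le: "\<And>z. z \<in> {0..L} \<Longrightarrow> \<bar>nderiv 2 {0..L} f z\<bar> \<le> B"
    and x: "x \<in> {0..L}" "s \<in> {0..L}"
  shows "\<bar>f s - f x - nderiv 1 {0..L} f x * (s - x)\<bar> \<le> B * \<bar>s - x\<bar> ^ 2"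
proof -
  have f0: "(f has_real_derivative nderiv 1 {0..L} f z) (at z within {0..L})" if "z \<in> {0..L}" for z
    using diff_upto_has_derivative[OF d, of 0 z] that by simp
  have f1: "(nderiv 1 {0..L} f has_real_derivative nderiv 2 {0..L} f z) (at z within {0..L})" if "z \<in> {0..L}" for z
    using diff_upto_has_derivative[OF d, of 1 z] that by (simp add: numeral_2_eq_2)
  have B: "0 \<le> B" using le[OF x(1)] by linarith
  have k: "((\<lambda>z. c) has_real_derivative 0) (at z within {0..L})" for c z by simp
  have l1: "((\<lambda>z. c * (z - x)) has_real_derivative c) (at z within {0..L})" for c z
    by (auto intro!: derivative_eq_intros)
  have e1: "\<bar>nderiv 1 {0..L} f z - nderiv 1 {0..L} f x\<bar> \<le> B * \<bar>z - x\<bar> ^ Suc 0" if z: "z \<in> {0..L}" for z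
  proof (rule deriv_bound_power[OF _ x(1) z _ B])
    fix z assume z: "z \<in> {0..L}"
    show "((\<lambda>z. nderiv 1 {0..L} f z - nderiv 1 {0..L} f x) has_real_derivative nderiv 2 {0..L} f z) (at z within {0..L})"
      by (rule DERIV_cong[OF DERIV_diff[OF f1[OF z] k]]) simp
    show "\<bar>nderiv 2 {0..L} f z\<bar> \<le> B * \<bar>z - x\<bar> ^ 0" using le[OF z] by (simp only: power_0 mult_1_right)
  qed simp
  have "\<bar>f s - f x - nderiv 1 {0..L} f x * (s - x)\<bar> \<le> B * \<bar>s - x\<bar> ^ Suc (Suc 0)"
  proof (rule deriv_bound_power[OF _ x _ B])
    fix z assume z: "z \<in> {0..L}"
    show "((\<lambda>z. f z - f x - nderiv 1 {0..L} f x * (z - x)) has_real_derivative nderiv 1 {0..L} f z - nderiv 1 {0..L} f x) (at z within {0..L})"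
      by (rule DERIV_cong[OF DERIV_diff[OF DERIV_diff[OF f0[OF z] k] l1]]) simp
    show "\<bar>nderiv 1 {0..L} f z - nderiv 1 {0..L} f x\<bar> \<le> B * \<bar>z - x\<bar> ^ Suc 0" by (rule e1[OF z])
  qed simp
  then show ?thesis by (simp add: numeral_2_eq_2 del: nderiv.simps)
qed

lemma second_difference_bound:
  fixes f :: "real \<Rightarrow> real"
  assumes d: "diff_upto 2 {0..L} f" and le: "\<And>z. z \<in> {0..L} \<Longrightarrow> \<bar>nderiv 2 {0..L} f z\<bar> \<le> B"
    and x: "x - h \<in> {0..L}" "x + h \<in> {0..L}"
  shows "\<bar>f (x + h) - 2 * f x + f (x - h)\<bar> \<le> 2 * B * h\<^sup>2"
proof -
  have xx: "x \<in> {0..L}" using x by auto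
  have a: "\<bar>f (x + h) - f x - nderiv 1 {0..L} f x * h\<bar> \<le> B * h\<^sup>2"
    using taylor_remainder_2[OF d le xx x(2)] by simp
  have b: "\<bar>f (x - h) - f x - nderiv 1 {0..L} f x * (- h)\<bar> \<le> B * h\<^sup>2"
    using taylor_remainder_2[OF d le xx x(1)] by simp
  have "f (x + h) - 2 * f x + f (x - h) = (f (x + h) - f x - nderiv 1 {0..L} f x * h) + (f (x - h) - f x - nderiv 1 {0..L} f x * (- h))"
    by simp
  also have "\<bar>\<dots>\<bar> \<le> B * h\<^sup>2 + B * h\<^sup>2" by (intro order_trans[OF abs_triangle_ineq] add_mono a b)
  finally show ?thesis by simp
qed

text \<open>The five-point stencil has second order: odd terms of the Taylor expansion cancel.\<close>

lemma second_difference_consistency: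
  fixes f :: "real \<Rightarrow> real"
  assumes d: "diff_upto 4 {0..L} f" and le: "\<And>z. z \<in> {0..L} \<Longrightarrow> \<bar>nderiv 4 {0..L} f z\<bar> \<le> B"
    and x: "x - h \<in> {0..L}" "x + h \<in> {0..L}" and h: "h \<noteq> 0"
  shows "\<bar>(f (x + h) - 2 * f x + f (x - h)) / h\<^sup>2 - nderiv 2 {0..L} f x\<bar> \<le> 2 * B * h\<^sup>2"
proof -
  have xx: "x \<in> {0..L}" using x by auto
  define D where "D k = nderiv k {0..L} f" for k
  have D0: "D 0 = f" by (simp add: D_def)
  have fk: "(D k has_real_derivative D (Suc k) z) (at z within {0..L})" if "z \<in> {0..L}" "k < 4" for z k
    unfolding D_def using d that by (intro nderiv_has_derivative) (auto simp: diff_upto_def)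
  have B: "0 \<le> B" using le[OF xx] by linarith
  have leD: "\<bar>D 4 z\<bar> \<le> B" if "z \<in> {0..L}" for z using le[OF that] by (simp only: D_def)
  have n: "Suc 0 = 1" "Suc 1 = 2" "Suc 2 = 3" "Suc 3 = 4" by auto
  have k: "((\<lambda>z. c) has_real_derivative 0) (at z within {0..L})" for c z by simp
  have l1: "((\<lambda>z. c * (z - x)) has_real_derivative c) (at z within {0..L})" for c z
    by (auto intro!: derivative_eq_intros)
  have l2: "((\<lambda>z. c * (z - x)\<^sup>2 / 2) has_real_derivative c * (z - x)) (at z within {0..L})" for c z
    by (auto intro!: derivative_eq_intros)
  have l3: "((\<lambda>z. c * (z - x) ^ 3 / 6) has_real_derivative c * (z - x)\<^sup>2 / 2) (at z within {0..L})" for c z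
    by (auto intro!: derivative_eq_intros)
  note f0 = fk[of _ 0, unfolded n] and f1 = fk[of _ 1, unfolded n] and f2 = fk[of _ 2, unfolded n] and f3 = fk[of _ 3, unfolded n]
  have e3: "\<bar>D 3 z - D 3 x\<bar> \<le> B * \<bar>z - x\<bar> ^ Suc 0" if z: "z \<in> {0..L}" for z
  proof (rule deriv_bound_power[OF _ xx z _ B])
    fix z assume z: "z \<in> {0..L}"
    show "((\<lambda>z. D 3 z - D 3 x) has_real_derivative D 4 z) (at z within {0..L})"
      by (rule DERIV_cong[OF DERIV_diff[OF f3[OF z] k]]) simp_all
    show "\<bar>D 4 z\<bar> \<le> B * \<bar>z - x\<bar> ^ 0" using leD[OF z] by simp
  qed simp
  have e2: "\<bar>D 2 z - D 2 x - D 3 x * (z - x)\<bar> \<le> B * \<bar>z - x\<bar> ^ Suc (Suc 0)" if z: "z \<in> {0..L}" for z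
  proof (rule deriv_bound_power[OF _ xx z _ B])
    fix z assume z: "z \<in> {0..L}"
    show "((\<lambda>z. D 2 z - D 2 x - D 3 x * (z - x)) has_real_derivative D 3 z - D 3 x) (at z within {0..L})"
      by (rule DERIV_cong[OF DERIV_diff[OF DERIV_diff[OF f2[OF z] k] l1]]) simp_all
    show "\<bar>D 3 z - D 3 x\<bar> \<le> B * \<bar>z - x\<bar> ^ Suc 0" by (rule e3[OF z])
  qed simp
  have e1: "\<bar>D 1 z - D 1 x - D 2 x * (z - x) - D 3 x * (z - x)\<^sup>2 / 2\<bar> \<le> B * \<bar>z - x\<bar> ^ Suc (Suc (Suc 0))" if z: "z \<in> {0..L}" for z
  proof (rule deriv_bound_power[OF _ xx z _ B])
    fix z assume z: "z \<in> {0..L}"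
    show "((\<lambda>z. D 1 z - D 1 x - D 2 x * (z - x) - D 3 x * (z - x)\<^sup>2 / 2) has_real_derivative D 2 z - D 2 x - D 3 x * (z - x)) (at z within {0..L})"
      by (rule DERIV_cong[OF DERIV_diff[OF DERIV_diff[OF DERIV_diff[OF f1[OF z] k] l1] l2]]) simp_all
    show "\<bar>D 2 z - D 2 x - D 3 x * (z - x)\<bar> \<le> B * \<bar>z - x\<bar> ^ Suc (Suc 0)" by (rule e2[OF z])
  qed simp
  have e0: "\<bar>D 0 z - D 0 x - D 1 x * (z - x) - D 2 x * (z - x)\<^sup>2 / 2 - D 3 x * (z - x) ^ 3 / 6\<bar> \<le> B * \<bar>z - x\<bar> ^ Suc (Suc (Suc (Suc 0)))"
    if z: "z \<in> {0..L}" for z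
  proof (rule deriv_bound_power[OF _ xx z _ B])
    fix z assume z: "z \<in> {0..L}"
    show "((\<lambda>z. D 0 z - D 0 x - D 1 x * (z - x) - D 2 x * (z - x)\<^sup>2 / 2 - D 3 x * (z - x) ^ 3 / 6) has_real_derivative
        D 1 z - D 1 x - D 2 x * (z - x) - D 3 x * (z - x)\<^sup>2 / 2) (at z within {0..L})"
      by (rule DERIV_cong[OF DERIV_diff[OF DERIV_diff[OF DERIV_diff[OF DERIV_diff[OF f0[OF z] k] l1] l2] l3]]) simp_all
    show "\<bar>D 1 z - D 1 x - D 2 x * (z - x) - D 3 x * (z - x)\<^sup>2 / 2\<bar> \<le> B * \<bar>z - x\<bar> ^ Suc (Suc (Suc 0))" by (rule e1[OF z])
  qed simp
  have p: "\<bar>f (x + h) - f x - D 1 x * h - D 2 x * h\<^sup>2 / 2 - D 3 x * h ^ 3 / 6\<bar> \<le> B * h ^ 4"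
    using e0[OF x(2)] by (simp add: D0 eval_nat_numeral)
  have m: "\<bar>f (x - h) - f x - D 1 x * (- h) - D 2 x * (- h)\<^sup>2 / 2 - D 3 x * (- h) ^ 3 / 6\<bar> \<le> B * h ^ 4"
    using e0[OF x(1)] by (simp add: D0 eval_nat_numeral)
  have "f (x + h) - 2 * f x + f (x - h) - D 2 x * h\<^sup>2 = (f (x + h) - f x - D 1 x * h - D 2 x * h\<^sup>2 / 2 - D 3 x * h ^ 3 / 6)
    + (f (x - h) - f x - D 1 x * (- h) - D 2 x * (- h)\<^sup>2 / 2 - D 3 x * (- h) ^ 3 / 6)" by simp
  also have "\<bar>\<dots>\<bar> \<le> B * h ^ 4 + B * h ^ 4" by (intro order_trans[OF abs_triangle_ineq] add_mono p m)
  finally have "\<bar>f (x + h) - 2 * f x + f (x - h) - D 2 x * h\<^sup>2\<bar> / h\<^sup>2 \<le> (B * h ^ 4 + B * h ^ 4) / h\<^sup>2"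
    by (intro divide_right_mono) auto
  moreover have "(B * h ^ 4 + B * h ^ 4) / h\<^sup>2 = 2 * B * h\<^sup>2" using h by (simp add: eval_nat_numeral)
  moreover have "\<bar>f (x + h) - 2 * f x + f (x - h) - D 2 x * h\<^sup>2\<bar> / h\<^sup>2 = \<bar>(f (x + h) - 2 * f x + f (x - h)) / h\<^sup>2 - D 2 x\<bar>"
  proof -
    have "(f (x + h) - 2 * f x + f (x - h)) / h\<^sup>2 - D 2 x = (f (x + h) - 2 * f x + f (x - h) - D 2 x * h\<^sup>2) / h\<^sup>2"
      using h by (simp add: diff_divide_distrib)
    then show ?thesis by (simp add: abs_divide)
  qed
  ultimately show ?thesis by (simp only: D_def)
qed

text \<open>The Caputo derivative only sees the derivatives at interior points.\<close>

lemma caputo_eq_low: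
  assumes "0 < \<delta>" "\<delta> < 1" "0 < c" and d: "\<And>s. s \<in> {0<..<c} \<Longrightarrow> (v has_real_derivative v1 s) (at s)"
  shows "caputo \<delta> v c = 1 / Gamma (1 - \<delta>) * integral {0..c} (\<lambda>s. (c - s) powr (- \<delta>) * v1 s)"
proof -
  have "nderiv 1 {0..c} v s = v1 s" if "s \<in> {0<..<c}" for s
    using that d[OF that] by (intro nderiv_1_unique) (auto intro: DERIV_subset)
  then have "integral {0<..<c} (\<lambda>s. (c - s) powr (- \<delta>) * nderiv 1 {0..c} v s) = integral {0<..<c} (\<lambda>s. (c - s) powr (- \<delta>) * v1 s)"
    by (intro integral_cong) (simp del: nderiv.simps)
  then show ?thesis using assms by (simp add: caputo_def integral_open_interval_real del: nderiv.simps)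
qed

lemma caputo_eq_high:
  assumes "1 < \<delta>" "\<delta> < 2" "0 < c" and d: "\<And>s. s \<in> {0<..<c} \<Longrightarrow> (v has_real_derivative v1 s) (at s)"
    and d1: "\<And>s. s \<in> {0<..<c} \<Longrightarrow> (v1 has_real_derivative v2 s) (at s)"
  shows "caputo \<delta> v c = 1 / Gamma (2 - \<delta>) * integral {0..c} (\<lambda>s. (c - s) powr (1 - \<delta>) * v2 s)"
proof -
  have e1: "nderiv 1 {0..c} v s = v1 s" if "s \<in> {0<..<c}" for s
    using that d[OF that] by (intro nderiv_1_unique) (auto intro: DERIV_subset)
  have "nderiv (Suc 1) {0..c} v s = v2 s" if s: "s \<in> {0<..<c}" for s
  proof (rule nderiv_Suc_unique)
    have "(nderiv 1 {0..c} v has_real_derivative v2 s) (at s)"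
      using has_field_derivative_transform_within_open[OF d1[OF s] open_greaterThanLessThan s] e1 by metis
    then show "(nderiv 1 {0..c} v has_real_derivative v2 s) (at s within {0..c})" by (rule DERIV_subset) auto
  qed (use s in auto)
  then have "integral {0<..<c} (\<lambda>s. (c - s) powr (1 - \<delta>) * nderiv 2 {0..c} v s) = integral {0<..<c} (\<lambda>s. (c - s) powr (1 - \<delta>) * v2 s)"
    by (intro integral_cong) (simp del: nderiv.simps add: numeral_2_eq_2)
  then show ?thesis using assms by (simp add: caputo_def integral_open_interval_real del: nderiv.simps)
qed

lemma dxy_le_sum:
  assumes "j1 + j2 \<le> (2::nat)"
  shows "\<bar>dxy L j1 j2 v x y\<bar> \<le> (\<Sum>(j1, j2)\<in>{(j1, j2). j1 + j2 \<le> 2}. \<bar>dxy L j1 j2 v x y\<bar>)"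
proof -
  have "{(j1, j2). j1 + j2 \<le> (2::nat)} \<subseteq> {..2} \<times> {..2}" by auto
  then have fin: "finite {(j1, j2). j1 + j2 \<le> (2::nat)}" by (rule finite_subset) auto
  show ?thesis
    using member_le_sum[of "(j1, j2)" "{(j1, j2). j1 + j2 \<le> (2::nat)}" "\<lambda>(j1, j2). \<bar>dxy L j1 j2 v x y\<bar>"] fin assms
    by auto
qed

section \<open>Regularity of the solution\<close>

context quasi_graded_meshes
begin

text \<open>Large enough for both parts of \<open>1 + s\<^sup>\<gamma>\<^sup>-\<^sup>l\<close> to be bounded by \<open>s\<^sup>\<beta>\<^sup>-\<^sup>l\<close> on \<open>(0, T]\<close>, \<open>l = 1, 2, 3\<close>.\<close>

definition reg_const :: "real \<Rightarrow> real \<Rightarrow> real" where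
  "reg_const Creg \<gamma> = \<bar>Creg\<bar> * (T powr (1 - \<beta>) + T powr (2 - \<beta>) + T powr (3 - \<beta>) + T powr (\<gamma> - \<beta>))"

lemma reg_const_nonneg: "0 \<le> reg_const Creg \<gamma>" by (simp add: reg_const_def)

lemma reg_const_bound:
  assumes "\<beta> \<le> \<gamma>" "s \<in> {0<..T}" "l \<in> {1, 2, 3}"
  shows "Creg * (1 + s powr (\<gamma> - real l)) \<le> reg_const Creg \<gamma> * s powr (\<beta> - real l)"
proof -
  have "1 = s powr (real l - \<beta>) * s powr (\<beta> - real l)" using assms by (simp flip: powr_add)
  also have "\<dots> \<le> T powr (real l - \<beta>) * s powr (\<beta> - real l)"
    using assms \<beta>_lt by (intro mult_right_mono powr_mono2) auto
  also have "\<dots> \<le> (T powr (1 - \<beta>) + T powr (2 - \<beta>) + T powr (3 - \<beta>)) * s powr (\<beta> - real l)"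
    using assms by (intro mult_right_mono) auto
  finally have a: "1 \<le> (T powr (1 - \<beta>) + T powr (2 - \<beta>) + T powr (3 - \<beta>)) * s powr (\<beta> - real l)" .
  have "s powr (\<gamma> - real l) = s powr (\<gamma> - \<beta>) * s powr (\<beta> - real l)" by (simp flip: powr_add)
  also have "\<dots> \<le> T powr (\<gamma> - \<beta>) * s powr (\<beta> - real l)" using assms by (intro mult_right_mono powr_mono2) auto
  finally have "1 + s powr (\<gamma> - real l) \<le> (T powr (1 - \<beta>) + T powr (2 - \<beta>) + T powr (3 - \<beta>) + T powr (\<gamma> - \<beta>)) * s powr (\<beta> - real l)"
    using a by (simp add: distrib_right)
  then have "\<bar>Creg\<bar> * (1 + s powr (\<gamma> - real l)) \<le> reg_const Creg \<gamma> * s powr (\<beta> - real l)"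
    unfolding reg_const_def mult.assoc by (intro mult_left_mono) auto
  moreover have "Creg * (1 + s powr (\<gamma> - real l)) \<le> \<bar>Creg\<bar> * (1 + s powr (\<gamma> - real l))"
    by (intro mult_right_mono) auto
  ultimately show ?thesis by linarith
qed

context
  fixes L Creg \<gamma> :: real and w :: "real \<Rightarrow> real \<Rightarrow> real \<Rightarrow> real"
  assumes ws: "weakly_singular L T Creg \<gamma> w" and \<gamma>: "\<beta> \<le> \<gamma>"
    and wcont: "\<forall>x\<in>{0..L}. \<forall>y\<in>{0..L}. continuous_on {0..T} (w x y)"
begin

lemma wc: "x \<in> {0..L} \<Longrightarrow> y \<in> {0..L} \<Longrightarrow> continuous_on {0..T} (w x y)"
  using wcont by blast

abbreviation "D l x y \<equiv> nderiv l {0..T} (w x y)"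

lemma ws_deriv:
  assumes "x \<in> {0..L}" "y \<in> {0..L}" "s \<in> {0<..T}"
  shows "(w x y has_real_derivative D 1 x y s) (at s within {0..T})"
    "(D 1 x y has_real_derivative D 2 x y s) (at s within {0..T})"
    "(D 2 x y has_real_derivative D 3 x y s) (at s within {0..T})"
proof -
  have d: "D l x y differentiable (at s within {0..T})" if "l < 3" for l
    using ws assms that unfolding weakly_singular_def by blast
  have n: "Suc 0 = 1" "Suc 1 = 2" "Suc 2 = 3" by auto
  show "(w x y has_real_derivative D 1 x y s) (at s within {0..T})"
    using nderiv_has_derivative[OF d[of 0]] unfolding n by simp
  show "(D 1 x y has_real_derivative D 2 x y s) (at s within {0..T})"
    using nderiv_has_derivative[OF d[of 1]] unfolding n by simp
  show "(D 2 x y has_real_derivative D 3 x y s) (at s within {0..T})"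
    using nderiv_has_derivative[OF d[of 2]] unfolding n by simp
qed

lemma ws_dxy:
  assumes "x \<in> {0..L}" "y \<in> {0..L}" "s \<in> {0<..T}" "l \<in> {1, 2, 3}" "j1 + j2 \<le> 2"
  shows "\<bar>dxy L j1 j2 (\<lambda>x y. D l x y s) x y\<bar> \<le> reg_const Creg \<gamma> * s powr (\<beta> - real l)"
proof -
  have "\<bar>dxy L j1 j2 (\<lambda>x y. D l x y s) x y\<bar> \<le> (\<Sum>(j1, j2)\<in>{(j1, j2). j1 + j2 \<le> 2}. \<bar>dxy L j1 j2 (\<lambda>x y. D l x y s) x y\<bar>)"
    using assms(5) by (rule dxy_le_sum)
  also have "\<dots> \<le> Creg * (1 + s powr (\<gamma> - real l))"
  proof -
    have "l \<le> 3" using assms by auto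
    then show ?thesis using ws assms unfolding weakly_singular_def by blast
  qed
  also have "\<dots> \<le> reg_const Creg \<gamma> * s powr (\<beta> - real l)" using \<gamma> assms by (intro reg_const_bound)
  finally show ?thesis .
qed

lemma ws_space_diff:
  assumes "s \<in> {0<..T}" "l \<in> {1, 2, 3}" "x \<in> {0..L}"
  shows "diff_upto 2 {0..L} (\<lambda>\<xi>. D l \<xi> x s)" "diff_upto 2 {0..L} (\<lambda>\<xi>. D l x \<xi> s)"
proof -
  have "l \<le> 3" using assms by auto
  then have "space_diff L 2 (\<lambda>x y. D l x y s)" using ws assms unfolding weakly_singular_def by blast
  note sd = this[unfolded space_diff_def]
  show "diff_upto 2 {0..L} (\<lambda>\<xi>. D l x \<xi> s)" using sd assms by blast
  have "diff_upto (2 - 0) {0..L} (\<lambda>\<xi>. nderiv 0 {0..L} (\<lambda>y. D l \<xi> y s) x)" using sd assms by blast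
  then show "diff_upto 2 {0..L} (\<lambda>\<xi>. D l \<xi> x s)" by simp
qed

lemma diff_upto_mono: "diff_upto k S f \<Longrightarrow> j \<le> k \<Longrightarrow> diff_upto j S f"
  by (auto simp: diff_upto_def)

lemma ws_weak_reg:
  assumes "x \<in> {0..L}" "y \<in> {0..L}"
  shows "weak_reg (reg_const Creg \<gamma>) (w x y) (D 1 x y) (D 2 x y) (D 3 x y)"
proof -
  have b: "\<bar>D l x y s\<bar> \<le> reg_const Creg \<gamma> * s powr (\<beta> - real l)" if "s \<in> {0<..T}" "l \<in> {1, 2, 3}" for s l
    using ws_dxy[OF assms that, of 0 0] unfolding dxy_def by simp
  show ?thesis
    unfolding weak_reg_def using wc[OF assms] ws_deriv[OF assms] b[of _ 1] b[of _ 2] b[of _ 3] by simp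
qed

lemma ws_weak_reg_diff:
  assumes xy: "x \<in> {0..L}" "y \<in> {0..L}" "x' \<in> {0..L}" "y' \<in> {0..L}"
    and b: "\<And>s l. s \<in> {0<..T} \<Longrightarrow> l \<in> {1, 2, 3} \<Longrightarrow> \<bar>D l x y s - D l x' y' s\<bar> \<le> A * s powr (\<beta> - real l)"
  shows "weak_reg A (\<lambda>s. w x y s - w x' y' s) (\<lambda>s. D 1 x y s - D 1 x' y' s)
    (\<lambda>s. D 2 x y s - D 2 x' y' s) (\<lambda>s. D 3 x y s - D 3 x' y' s)"
proof -
  have r: "real 1 = 1" "real 2 = 2" "real 3 = 3" "1 \<in> {1, 2, 3::nat}" "2 \<in> {1, 2, 3::nat}" "3 \<in> {1, 2, 3::nat}" by auto
  show ?thesis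
    unfolding weak_reg_def
  proof (intro conjI ballI)
    show "continuous_on {0..T} (\<lambda>s. w x y s - w x' y' s)" by (intro continuous_on_diff wc xy)
  next
    fix s assume s: "s \<in> {0<..T}"
    show "((\<lambda>s. w x y s - w x' y' s) has_real_derivative D 1 x y s - D 1 x' y' s) (at s within {0..T})"
      "((\<lambda>s. D 1 x y s - D 1 x' y' s) has_real_derivative D 2 x y s - D 2 x' y' s) (at s within {0..T})"
      "((\<lambda>s. D 2 x y s - D 2 x' y' s) has_real_derivative D 3 x y s - D 3 x' y' s) (at s within {0..T})"
      by (rule DERIV_diff; rule ws_deriv; rule xy s)+
    show "\<bar>D 1 x y s - D 1 x' y' s\<bar> \<le> A * s powr (\<beta> - 1)" by (rule b[OF s r(4), unfolded r])
    show "\<bar>D 2 x y s - D 2 x' y' s\<bar> \<le> A * s powr (\<beta> - 2)" by (rule b[OF s r(5), unfolded r])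
    show "\<bar>D 3 x y s - D 3 x' y' s\<bar> \<le> A * s powr (\<beta> - 3)" by (rule b[OF s r(6), unfolded r])
  qed
qed

text \<open>The bounds on the first space derivatives give the differences of neighbouring nodes the factor \<open>\<bar>x - x'\<bar>\<close>.\<close>

lemma ws_weak_reg_dx:
  assumes "x \<in> {0..L}" "x' \<in> {0..L}" "y \<in> {0..L}"
  shows "weak_reg (reg_const Creg \<gamma> * \<bar>x - x'\<bar>) (\<lambda>s. w x y s - w x' y s) (\<lambda>s. D 1 x y s - D 1 x' y s)
    (\<lambda>s. D 2 x y s - D 2 x' y s) (\<lambda>s. D 3 x y s - D 3 x' y s)"
proof (rule ws_weak_reg_diff)
  fix s l assume s: "s \<in> {0<..T}" "l \<in> {1, 2, 3::nat}"
  have "\<bar>D l x y s - D l x' y s\<bar> \<le> (reg_const Creg \<gamma> * s powr (\<beta> - real l)) * \<bar>x - x'\<bar>"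
  proof (rule first_difference_bound[where f = "\<lambda>\<xi>. D l \<xi> y s"])
    show "diff_upto 1 {0..L} (\<lambda>\<xi>. D l \<xi> y s)" using ws_space_diff(1)[OF s assms(3)] by (rule diff_upto_mono) simp
    fix z assume "z \<in> {0..L}"
    then show "\<bar>nderiv 1 {0..L} (\<lambda>\<xi>. D l \<xi> y s) z\<bar> \<le> reg_const Creg \<gamma> * s powr (\<beta> - real l)"
      using ws_dxy[OF _ assms(3) s, of z 1 0] unfolding dxy_def by simp
  qed (use assms in auto)
  then show "\<bar>D l x y s - D l x' y s\<bar> \<le> reg_const Creg \<gamma> * \<bar>x - x'\<bar> * s powr (\<beta> - real l)" by (simp add: mult_ac)
qed (use assms in auto)

lemma ws_weak_reg_dy:
  assumes "x \<in> {0..L}" "x' \<in> {0..L}" "y \<in> {0..L}"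
  shows "weak_reg (reg_const Creg \<gamma> * \<bar>x - x'\<bar>) (\<lambda>s. w y x s - w y x' s) (\<lambda>s. D 1 y x s - D 1 y x' s)
    (\<lambda>s. D 2 y x s - D 2 y x' s) (\<lambda>s. D 3 y x s - D 3 y x' s)"
proof (rule ws_weak_reg_diff)
  fix s l assume s: "s \<in> {0<..T}" "l \<in> {1, 2, 3::nat}"
  have "\<bar>D l y x s - D l y x' s\<bar> \<le> (reg_const Creg \<gamma> * s powr (\<beta> - real l)) * \<bar>x - x'\<bar>"
  proof (rule first_difference_bound[where f = "\<lambda>\<xi>. D l y \<xi> s"])
    show "diff_upto 1 {0..L} (\<lambda>\<xi>. D l y \<xi> s)" using ws_space_diff(2)[OF s assms(3)] by (rule diff_upto_mono) simp
    fix z assume "z \<in> {0..L}"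
    then show "\<bar>nderiv 1 {0..L} (\<lambda>\<xi>. D l y \<xi> s) z\<bar> \<le> reg_const Creg \<gamma> * s powr (\<beta> - real l)"
      using ws_dxy[OF assms(3) _ s, of z 0 1] unfolding dxy_def by simp
  qed (use assms in auto)
  then show "\<bar>D l y x s - D l y x' s\<bar> \<le> reg_const Creg \<gamma> * \<bar>x - x'\<bar> * s powr (\<beta> - real l)" by (simp add: mult_ac)
qed (use assms in auto)

text \<open>Likewise the second space derivatives give the five-point stencil the factor \<open>h\<^sup>2\<close>.\<close>

lemma ws_weak_reg_laplacian:
  assumes x: "x - h \<in> {0..L}" "x + h \<in> {0..L}" and y: "y - h \<in> {0..L}" "y + h \<in> {0..L}"
  shows "weak_reg (4 * reg_const Creg \<gamma> * h\<^sup>2)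
    (\<lambda>s. (w (x + h) y s - 2 * w x y s + w (x - h) y s) + (w x (y + h) s - 2 * w x y s + w x (y - h) s))
    (\<lambda>s. (D 1 (x + h) y s - 2 * D 1 x y s + D 1 (x - h) y s) + (D 1 x (y + h) s - 2 * D 1 x y s + D 1 x (y - h) s))
    (\<lambda>s. (D 2 (x + h) y s - 2 * D 2 x y s + D 2 (x - h) y s) + (D 2 x (y + h) s - 2 * D 2 x y s + D 2 x (y - h) s))
    (\<lambda>s. (D 3 (x + h) y s - 2 * D 3 x y s + D 3 (x - h) y s) + (D 3 x (y + h) s - 2 * D 3 x y s + D 3 x (y - h) s))"
proof -
  have xy: "x \<in> {0..L}" "y \<in> {0..L}" using x y by auto
  have b: "\<bar>(D l (x + h) y s - 2 * D l x y s + D l (x - h) y s) + (D l x (y + h) s - 2 * D l x y s + D l x (y - h) s)\<bar>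
    \<le> 4 * reg_const Creg \<gamma> * h\<^sup>2 * s powr (\<beta> - real l)" if s: "s \<in> {0<..T}" "l \<in> {1, 2, 3}" for s l
  proof -
    define B where "B = reg_const Creg \<gamma> * s powr (\<beta> - real l)"
    have b1: "\<bar>D l (x + h) y s - 2 * D l x y s + D l (x - h) y s\<bar> \<le> 2 * B * h\<^sup>2"
    proof (rule second_difference_bound[where f = "\<lambda>\<xi>. D l \<xi> y s", OF ws_space_diff(1)[OF s xy(2)] _ x])
      fix z assume "z \<in> {0..L}"
      then show "\<bar>nderiv 2 {0..L} (\<lambda>\<xi>. D l \<xi> y s) z\<bar> \<le> B"
        using ws_dxy[OF _ xy(2) s, of z 2 0] unfolding dxy_def B_def by (simp add: nderiv.simps(1) del: nderiv.simps(2))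
    qed
    have b2: "\<bar>D l x (y + h) s - 2 * D l x y s + D l x (y - h) s\<bar> \<le> 2 * B * h\<^sup>2"
    proof (rule second_difference_bound[where f = "\<lambda>\<xi>. D l x \<xi> s", OF ws_space_diff(2)[OF s xy(1)] _ y])
      fix z assume "z \<in> {0..L}"
      then show "\<bar>nderiv 2 {0..L} (\<lambda>\<xi>. D l x \<xi> s) z\<bar> \<le> B"
        using ws_dxy[OF xy(1) _ s, of z 0 2] unfolding dxy_def B_def by (simp add: nderiv.simps(1) del: nderiv.simps(2))
    qed
    have "\<bar>(D l (x + h) y s - 2 * D l x y s + D l (x - h) y s) + (D l x (y + h) s - 2 * D l x y s + D l x (y - h) s)\<bar> \<le> 2 * B * h\<^sup>2 + 2 * B * h\<^sup>2"
      by (intro order_trans[OF abs_triangle_ineq] add_mono b1 b2)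
    then show ?thesis by (simp add: B_def mult_ac)
  qed
  have st: "((\<lambda>s. (a s - 2 * b s + c s) + (d s - 2 * b s + e s)) has_real_derivative (a' - 2 * b' + c') + (d' - 2 * b' + e')) (at z within S)"
    if "(a has_real_derivative a') (at z within S)" "(b has_real_derivative b') (at z within S)" "(c has_real_derivative c') (at z within S)"
      "(d has_real_derivative d') (at z within S)" "(e has_real_derivative e') (at z within S)" for a b c d e a' b' c' d' e' z S
    using that by (intro DERIV_add DERIV_diff DERIV_cmult)
  show ?thesis
    unfolding weak_reg_def
  proof (intro conjI ballI)
    show "continuous_on {0..T} (\<lambda>s. (w (x + h) y s - 2 * w x y s + w (x - h) y s) + (w x (y + h) s - 2 * w x y s + w x (y - h) s))"
      using x y xy by (intro continuous_intros wc)
  next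
    fix s assume s: "s \<in> {0<..T}"
    show "((\<lambda>s. (w (x + h) y s - 2 * w x y s + w (x - h) y s) + (w x (y + h) s - 2 * w x y s + w x (y - h) s)) has_real_derivative
      (D 1 (x + h) y s - 2 * D 1 x y s + D 1 (x - h) y s) + (D 1 x (y + h) s - 2 * D 1 x y s + D 1 x (y - h) s)) (at s within {0..T})"
      by (rule st; rule ws_deriv; rule x y xy s)
    show "((\<lambda>s. (D 1 (x + h) y s - 2 * D 1 x y s + D 1 (x - h) y s) + (D 1 x (y + h) s - 2 * D 1 x y s + D 1 x (y - h) s)) has_real_derivative
      (D 2 (x + h) y s - 2 * D 2 x y s + D 2 (x - h) y s) + (D 2 x (y + h) s - 2 * D 2 x y s + D 2 x (y - h) s)) (at s within {0..T})"
      by (rule st; rule ws_deriv; rule x y xy s)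
    show "((\<lambda>s. (D 2 (x + h) y s - 2 * D 2 x y s + D 2 (x - h) y s) + (D 2 x (y + h) s - 2 * D 2 x y s + D 2 x (y - h) s)) has_real_derivative
      (D 3 (x + h) y s - 2 * D 3 x y s + D 3 (x - h) y s) + (D 3 x (y + h) s - 2 * D 3 x y s + D 3 x (y - h) s)) (at s within {0..T})"
      by (rule st; rule ws_deriv; rule x y xy s)
    have r: "real 1 = 1" "real 2 = 2" "real 3 = 3" "1 \<in> {1, 2, 3::nat}" "2 \<in> {1, 2, 3::nat}" "3 \<in> {1, 2, 3::nat}" by auto
    show "\<bar>(D 1 (x + h) y s - 2 * D 1 x y s + D 1 (x - h) y s) + (D 1 x (y + h) s - 2 * D 1 x y s + D 1 x (y - h) s)\<bar>
      \<le> 4 * reg_const Creg \<gamma> * h\<^sup>2 * s powr (\<beta> - 1)" by (rule b[OF s r(4), unfolded r])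
    show "\<bar>(D 2 (x + h) y s - 2 * D 2 x y s + D 2 (x - h) y s) + (D 2 x (y + h) s - 2 * D 2 x y s + D 2 x (y - h) s)\<bar>
      \<le> 4 * reg_const Creg \<gamma> * h\<^sup>2 * s powr (\<beta> - 2)" by (rule b[OF s r(5), unfolded r])
    show "\<bar>(D 3 (x + h) y s - 2 * D 3 x y s + D 3 (x - h) y s) + (D 3 x (y + h) s - 2 * D 3 x y s + D 3 x (y - h) s)\<bar>
      \<le> 4 * reg_const Creg \<gamma> * h\<^sup>2 * s powr (\<beta> - 3)" by (rule b[OF s r(6), unfolded r])
  qed
qed

end

end

section \<open>Energy estimate\<close>

lemma L2_set_cauchy: "(\<Sum>x\<in>A. f x * h x) \<le> L2_set f A * L2_set h A"
proof -
  have "(\<Sum>x\<in>A. f x * h x) \<le> (\<Sum>x\<in>A. \<bar>f x\<bar> * \<bar>h x\<bar>)"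
    by (intro sum_mono) (simp flip: abs_mult)
  also have "\<dots> \<le> L2_set f A * L2_set h A" by (rule L2_set_mult_ineq)
  finally show ?thesis .
qed

lemma L2_set_square: "(L2_set f A)\<^sup>2 = (\<Sum>x\<in>A. (f x)\<^sup>2)"
  by (simp add: L2_set_def sum_nonneg)

context quasi_graded_meshes
begin

text \<open>The norm version of the energy inequality.  The only cross term whose sign is not fixed by the monotonicity of the
  coefficients is that of \<open>e n\<close> and \<open>e (n - 1)\<close>; its coefficient
  is \<open>\<sigma> g\<^sub>n\<^sub>,\<^sub>n\<^sub>-\<^sub>1 - (2 \<sigma> - 1) g\<^sub>n\<^sub>,\<^sub>n < 0\<close> by (P2).\<close>

lemma energy_inequality:
  fixes e :: "nat \<Rightarrow> 'i \<Rightarrow> real"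
  assumes P2: "P2 \<beta> \<sigma> N (t N)" and n: "1 \<le> n" "n \<le> N" and e0: "\<And>x. x \<in> I \<Longrightarrow> e 0 x = 0"
  shows "L2_set (\<lambda>x. vstar \<sigma> (\<lambda>k. e k x) n) I \<le> \<sigma> * L2_set (e n) I + (1 - \<sigma>) * L2_set (e (n - 1)) I"
    and "(\<sigma> * L2_set (e n) I + (1 - \<sigma>) * L2_set (e (n - 1)) I) * \<delta> N (\<lambda>k. L2_set (e k) I) n
      \<le> (\<Sum>x\<in>I. \<delta> N (\<lambda>k. e k x) n * vstar \<sigma> (\<lambda>k. e k x) n)"
proof -
  define W where "W k = L2_set (e k) I" for k
  define es where "es x = vstar \<sigma> (\<lambda>k. e k x) n" for x
  define S where "S = \<sigma> * W n + (1 - \<sigma>) * W (n - 1)"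
  define c where "c k = g N n (Suc k) - g N n k" for k
  have W: "0 \<le> W k" for k by (simp add: W_def)
  have S: "0 \<le> S" using W \<sigma>_bounds by (simp add: S_def)
  have es: "es = (\<lambda>x. \<sigma> * e n x + (1 - \<sigma>) * e (n - 1) x)" by (simp add: es_def vstar_def fun_eq_iff)
  have "L2_set es I \<le> L2_set (\<lambda>x. \<sigma> * e n x) I + L2_set (\<lambda>x. (1 - \<sigma>) * e (n - 1) x) I"
    unfolding es by (rule L2_set_triangle_ineq)
  also have "\<dots> = S" using \<sigma>_bounds by (simp add: S_def W_def L2_set_right_distrib)
  finally have esS: "L2_set es I \<le> S" .
  then show "L2_set (\<lambda>x. vstar \<sigma> (\<lambda>k. e k x) n) I \<le> \<sigma> * L2_set (e n) I + (1 - \<sigma>) * L2_set (e (n - 1)) I"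
    by (simp only: es_def[abs_def] S_def W_def)
  have W0: "W 0 = 0" using e0 by (simp add: W_def L2_set_0')
  have dW: "\<delta> N W n = g N n n * W n - (\<Sum>k=1..<n. c k * W k)"
    using \<delta>_eq_parts[OF n, of W] W0 by (simp add: c_def)
  have de: "\<delta> N (\<lambda>k. e k x) n = g N n n * e n x - (\<Sum>k=1..<n. c k * e k x)" if "x \<in> I" for x
    using \<delta>_eq_parts[OF n, of "\<lambda>k. e k x"] e0[OF that] by (simp add: c_def)
  have "S * \<delta> N W n \<le> (\<Sum>x\<in>I. \<delta> N (\<lambda>k. e k x) n * es x)"
  proof (cases "n = 1")
    case True
    have "(\<Sum>x\<in>I. \<delta> N (\<lambda>k. e k x) n * es x) = (\<Sum>x\<in>I. g N n n * \<sigma> * (e n x)\<^sup>2)"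
    proof (intro sum.cong refl)
      fix x assume x: "x \<in> I"
      show "\<delta> N (\<lambda>k. e k x) n * es x = g N n n * \<sigma> * (e n x)\<^sup>2"
        unfolding de[OF x] es using True e0[OF x] by (simp add: power2_eq_square)
    qed
    also have "\<dots> = g N n n * \<sigma> * (W n)\<^sup>2" by (simp add: W_def L2_set_square sum_distrib_left)
    also have "\<dots> = S * \<delta> N W n"
    proof -
      have "S = \<sigma> * W n" using True W0 by (simp add: S_def)
      moreover have "\<delta> N W n = g N n n * W n" unfolding dW using True by simp
      ultimately show ?thesis by (simp add: power2_eq_square)
    qed
    finally show ?thesis by simp
  next
    case False
    then have n2: "2 \<le> n" using n by auto
    define gn where "gn = g N n n"
    define d where "d = c (n - 1)"
    have split: "(\<Sum>k=1..<n. F k) = (\<Sum>k=1..<n - 1. F k) + F (n - 1)" for F :: "nat \<Rightarrow> real"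
    proof -
      have "{1..<n} = insert (n - 1) {1..<n - 1}" using n2 by auto
      then show ?thesis by simp
    qed
    define X where "X = (\<Sum>x\<in>I. e n x * e (n - 1) x)"
    have Xle: "X \<le> W n * W (n - 1)" unfolding X_def W_def by (rule L2_set_cauchy)
    have coef: "gn * (1 - \<sigma>) - d * \<sigma> \<le> 0"
    proof -
      have "\<sigma> * g N n (n - 1) < (2 * \<sigma> - 1) * gn" using P2 n2 n by (simp add: P2_def gn_def)
      moreover have "d = gn - g N n (n - 1)" using n2 by (simp add: d_def c_def gn_def)
      moreover have "gn * (1 - \<sigma>) - (gn - g N n (n - 1)) * \<sigma> = \<sigma> * g N n (n - 1) - (2 * \<sigma> - 1) * gn"
        by (simp add: algebra_simps)
      ultimately show ?thesis by simp
    qed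
    have "(\<Sum>x\<in>I. (gn * e n x - d * e (n - 1) x) * es x)
      = (\<Sum>x\<in>I. gn * \<sigma> * (e n x)\<^sup>2 - d * (1 - \<sigma>) * (e (n - 1) x)\<^sup>2 + (gn * (1 - \<sigma>) - d * \<sigma>) * (e n x * e (n - 1) x))"
      by (intro sum.cong refl) (simp add: es algebra_simps power2_eq_square)
    also have "\<dots> = gn * \<sigma> * (W n)\<^sup>2 - d * (1 - \<sigma>) * (W (n - 1))\<^sup>2 + (gn * (1 - \<sigma>) - d * \<sigma>) * X"
      by (simp add: sum.distrib sum_subtractf W_def L2_set_square X_def flip: sum_distrib_left)
    also have "\<dots> \<ge> gn * \<sigma> * (W n)\<^sup>2 - d * (1 - \<sigma>) * (W (n - 1))\<^sup>2 + (gn * (1 - \<sigma>) - d * \<sigma>) * (W n * W (n - 1))"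
      using mult_left_mono_neg[OF Xle coef] by simp
    also have "gn * \<sigma> * (W n)\<^sup>2 - d * (1 - \<sigma>) * (W (n - 1))\<^sup>2 + (gn * (1 - \<sigma>) - d * \<sigma>) * (W n * W (n - 1))
      = (gn * W n - d * W (n - 1)) * S" by (simp add: S_def algebra_simps power2_eq_square)
    finally have A: "(gn * W n - d * W (n - 1)) * S \<le> (\<Sum>x\<in>I. (gn * e n x - d * e (n - 1) x) * es x)" by simp
    have B: "(\<Sum>x\<in>I. (\<Sum>k=1..<n - 1. c k * e k x) * es x) \<le> (\<Sum>k=1..<n - 1. c k * W k) * S"
    proof -
      have "(\<Sum>x\<in>I. (\<Sum>k=1..<n - 1. c k * e k x) * es x) = (\<Sum>k=1..<n - 1. c k * (\<Sum>x\<in>I. e k x * es x))"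
        by (simp add: sum_distrib_left sum_distrib_right mult.assoc) (rule sum.swap)
      also have "\<dots> \<le> (\<Sum>k=1..<n - 1. c k * (W k * S))"
      proof (intro sum_mono mult_left_mono)
        fix k assume k: "k \<in> {1..<n - 1}"
        have "(\<Sum>x\<in>I. e k x * es x) \<le> W k * L2_set es I" unfolding W_def by (rule L2_set_cauchy)
        also have "\<dots> \<le> W k * S" using esS W by (intro mult_left_mono)
        finally show "(\<Sum>x\<in>I. e k x * es x) \<le> W k * S" .
        have "k < n" using k by auto
        then show "0 \<le> c k" using g_mono[of k n N] k n by (simp add: c_def)
      qed
      finally show ?thesis by (simp add: sum_distrib_right mult.assoc)
    qed
    have "S * \<delta> N W n = (gn * W n - d * W (n - 1)) * S - (\<Sum>k=1..<n - 1. c k * W k) * S"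
      unfolding dW split[of "\<lambda>k. c k * W k"] by (simp add: gn_def d_def algebra_simps)
    also have "\<dots> \<le> (\<Sum>x\<in>I. (gn * e n x - d * e (n - 1) x) * es x) - (\<Sum>x\<in>I. (\<Sum>k=1..<n - 1. c k * e k x) * es x)"
      using A B by simp
    also have "\<dots> = (\<Sum>x\<in>I. \<delta> N (\<lambda>k. e k x) n * es x)"
      unfolding sum_subtractf[symmetric]
    proof (intro sum.cong refl)
      fix x assume x: "x \<in> I"
      show "(gn * e n x - d * e (n - 1) x) * es x - (\<Sum>k=1..<n - 1. c k * e k x) * es x = \<delta> N (\<lambda>k. e k x) n * es x"
        unfolding de[OF x] split[of "\<lambda>k. c k * e k x"] by (simp add: gn_def d_def algebra_simps)
    qed
    finally show ?thesis .
  qed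
  then show "(\<sigma> * L2_set (e n) I + (1 - \<sigma>) * L2_set (e (n - 1)) I) * \<delta> N (\<lambda>k. L2_set (e k) I) n
      \<le> (\<Sum>x\<in>I. \<delta> N (\<lambda>k. e k x) n * vstar \<sigma> (\<lambda>k. e k x) n)"
    by (simp add: S_def W_def[abs_def] es_def)
qed

text \<open>The common factor of \<open>energy_inequality\<close> is divided out.  Where it vanishes, so does the norm of \<open>e n\<close>, and then \<open>\<delta>\<close> of the
  norm is not positive by (P1).\<close>

lemma energy_estimate:
  fixes e :: "nat \<Rightarrow> 'i \<Rightarrow> real"
  assumes P2: "P2 \<beta> \<sigma> N (t N)" and n: "1 \<le> n" "n \<le> N" and e0: "\<And>x. x \<in> I \<Longrightarrow> e 0 x = 0"
    and le: "(\<Sum>x\<in>I. \<delta> N (\<lambda>k. e k x) n * vstar \<sigma> (\<lambda>k. e k x) n) \<le> R * L2_set (\<lambda>x. vstar \<sigma> (\<lambda>k. e k x) n) I"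
    and R: "0 \<le> R"
  shows "\<delta> N (\<lambda>k. L2_set (e k) I) n \<le> R"
proof -
  define W where "W k = L2_set (e k) I" for k
  define S where "S = \<sigma> * W n + (1 - \<sigma>) * W (n - 1)"
  have W: "0 \<le> W k" for k by (simp add: W_def)
  have "S * \<delta> N W n \<le> R * L2_set (\<lambda>x. vstar \<sigma> (\<lambda>k. e k x) n) I"
    using energy_inequality(2)[where e = e and I = I and n = n, OF P2 n e0] le by (simp add: S_def W_def[abs_def])
  also have "\<dots> \<le> R * S"
    using energy_inequality(1)[where e = e and I = I and n = n, OF P2 n e0] R by (intro mult_left_mono) (auto simp: S_def W_def)
  finally have SR: "S * \<delta> N W n \<le> S * R" by (simp add: mult.commute)
  show ?thesis
  proof (cases "0 < S")
    case True
    then show ?thesis using SR by (simp add: W_def[abs_def])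
  next
    case False
    have "0 \<le> \<sigma> * W n" "0 \<le> (1 - \<sigma>) * W (n - 1)" using W \<sigma>_bounds by auto
    then have "\<sigma> * W n = 0" using False unfolding S_def by linarith
    then have Wn: "W n = 0" using \<sigma>_bounds by simp
    have W0: "W 0 = 0" using e0 by (simp add: W_def L2_set_0')
    have "0 \<le> (\<Sum>k=1..<n. (g N n (Suc k) - g N n k) * W k)"
      using g_mono[of _ n N] n W by (intro sum_nonneg mult_nonneg_nonneg) (auto intro: less_imp_le)
    then have "\<delta> N W n \<le> 0" using \<delta>_eq_parts[OF n, of W] Wn W0 by simp
    then show ?thesis using R by (simp add: W_def[abs_def])
  qed
qed

end

section \<open>Grid functions\<close>

text \<open>The pair of \<open>P\<close> and \<open>\<nabla>\<^sub>h U\<close> as one vector, scaled so that its Euclidean norm is the energy norm: component \<open>0\<close> carries \<open>P\<close>,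
  components \<open>1\<close> and \<open>2\<close> the differences in the two directions.\<close>

definition grid_index :: "nat \<Rightarrow> (nat \<times> nat \<times> nat) set" where
  "grid_index M = {0} \<times> {1..M - 1} \<times> {1..M - 1} \<union> {1} \<times> {1..M} \<times> {1..M - 1} \<union> {2} \<times> {1..M - 1} \<times> {1..M}"

definition grid_vec :: "real \<Rightarrow> real \<Rightarrow> (nat \<Rightarrow> nat \<Rightarrow> real) \<Rightarrow> (nat \<Rightarrow> nat \<Rightarrow> real) \<Rightarrow> nat \<times> nat \<times> nat \<Rightarrow> real" where
  "grid_vec h \<nu> P U = (\<lambda>(c, i, j). if c = 0 then h * P i j else if c = 1 then sqrt \<nu> * (U i j - U (i - 1) j)
     else sqrt \<nu> * (U i j - U i (j - 1)))"

lemma sum_grid_index: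
  fixes f :: "nat \<times> nat \<times> nat \<Rightarrow> real"
  shows "(\<Sum>x\<in>grid_index M. f x) = (\<Sum>i=1..M - 1. \<Sum>j=1..M - 1. f (0, i, j)) + (\<Sum>i=1..M. \<Sum>j=1..M - 1. f (1, i, j))
    + (\<Sum>i=1..M - 1. \<Sum>j=1..M. f (2, i, j))"
proof -
  have c: "(\<Sum>x\<in>{c} \<times> A \<times> B. f x) = (\<Sum>i\<in>A. \<Sum>j\<in>B. f (c, i, j))" for c A B
    by (simp add: sum.cartesian_product' )
  show ?thesis
    unfolding grid_index_def by (subst sum.union_disjoint, simp, simp, force)+ (simp only: c)
qed

lemma card_grid_index: "real (card (grid_index M)) \<le> 3 * (real M)\<^sup>2"
proof -
  have "real (card (grid_index M)) = (\<Sum>x\<in>grid_index M. 1)" by simp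
  also have "\<dots> = real (M - 1) * real (M - 1) + real M * real (M - 1) + real (M - 1) * real M"
    unfolding sum_grid_index by (cases M) (simp_all add: algebra_simps)
  also have "\<dots> \<le> real M * real M + real M * real M + real M * real M"
    by (intro add_mono mult_mono) auto
  finally show ?thesis by (simp add: power2_eq_square)
qed

lemma grid_vec_norm:
  assumes "0 < h" "0 < \<nu>"
  shows "grid_norm h M P + grid_grad_norm h M U \<le> (1 + 1 / sqrt \<nu>) * L2_set (grid_vec h \<nu> P U) (grid_index M)"
    and "grid_grad_norm h M U \<le> 1 / sqrt \<nu> * L2_set (grid_vec h \<nu> P U) (grid_index M)"
proof -
  define A where "A = (\<Sum>i=1..M - 1. \<Sum>j=1..M - 1. (h * P i j)\<^sup>2)"
  define B where "B = (\<Sum>i=1..M. \<Sum>j=1..M - 1. (U i j - U (i - 1) j)\<^sup>2) + (\<Sum>i=1..M - 1. \<Sum>j=1..M. (U i j - U i (j - 1))\<^sup>2)"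
  define Z where "Z = L2_set (grid_vec h \<nu> P U) (grid_index M)"
  have AB: "0 \<le> A" "0 \<le> B" by (auto simp: A_def B_def intro!: sum_nonneg add_nonneg_nonneg)
  have n: "grid_norm h M P = sqrt A"
    by (simp add: grid_norm_def grid_inner_def A_def sum_distrib_left power_mult_distrib power2_eq_square mult_ac)
  have gr: "grid_grad_norm h M U = sqrt B"
  proof -
    have "h\<^sup>2 * (x / h)\<^sup>2 = x\<^sup>2" for x using assms by (simp add: power_divide)
    then show ?thesis by (simp add: grid_grad_norm_def B_def sum_distrib_left)
  qed
  have Z: "Z = sqrt (A + \<nu> * B)"
    using assms by (simp add: Z_def L2_set_def sum_grid_index grid_vec_def A_def B_def power_mult_distrib sum_distrib_left distrib_left)
  have "sqrt A \<le> Z" unfolding Z using AB assms by (intro real_sqrt_le_mono) simp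
  moreover have "sqrt \<nu> * sqrt B \<le> Z" unfolding Z real_sqrt_mult[symmetric] using AB by (intro real_sqrt_le_mono) simp
  then have b: "sqrt B \<le> 1 / sqrt \<nu> * Z" using assms by (simp add: field_simps)
  ultimately show "grid_norm h M P + grid_grad_norm h M U \<le> (1 + 1 / sqrt \<nu>) * L2_set (grid_vec h \<nu> P U) (grid_index M)"
    unfolding n gr Z_def[symmetric] by (simp add: distrib_right)
  show "grid_grad_norm h M U \<le> 1 / sqrt \<nu> * L2_set (grid_vec h \<nu> P U) (grid_index M)"
    using b unfolding gr Z_def[symmetric] .
qed

lemma summation_by_parts_1d:
  fixes U V :: "nat \<Rightarrow> real"
  assumes "V 0 = 0" "V M = 0"
  shows "(\<Sum>i=1..M - 1. (U (i + 1) - 2 * U i + U (i - 1)) * V i) = - (\<Sum>i=1..M. (U i - U (i - 1)) * (V i - V (i - 1)))"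
proof (cases M)
  case (Suc m)
  have "(\<Sum>i=1..m. (U (i + 1) - 2 * U i + U (i - 1)) * V i) + (\<Sum>i=1..m. (U i - U (i - 1)) * (V i - V (i - 1)))
    = (U (Suc m) - U m) * V m - (U 1 - U 0) * V 0"
    by (induction m) (auto simp: algebra_simps)
  then show ?thesis using assms Suc by (simp add: algebra_simps)
qed simp

lemma grid_summation_by_parts:
  assumes h: "h \<noteq> 0" and V: "\<And>i j. i \<le> M \<Longrightarrow> j \<le> M \<Longrightarrow> i \<in> {0, M} \<or> j \<in> {0, M} \<Longrightarrow> V i j = 0"
  shows "(\<Sum>i=1..M - 1. \<Sum>j=1..M - 1. h\<^sup>2 * laplacian_h h U i j * V i j)
    = - ((\<Sum>i=1..M. \<Sum>j=1..M - 1. (U i j - U (i - 1) j) * (V i j - V (i - 1) j))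
       + (\<Sum>i=1..M - 1. \<Sum>j=1..M. (U i j - U i (j - 1)) * (V i j - V i (j - 1))))"
proof -
  have "(\<Sum>i=1..M - 1. \<Sum>j=1..M - 1. h\<^sup>2 * laplacian_h h U i j * V i j)
    = (\<Sum>i=1..M - 1. \<Sum>j=1..M - 1. (U (i + 1) j - 2 * U i j + U (i - 1) j) * V i j)
    + (\<Sum>i=1..M - 1. \<Sum>j=1..M - 1. (U i (j + 1) - 2 * U i j + U i (j - 1)) * V i j)"
    unfolding sum.distrib[symmetric]
    using h by (intro sum.cong refl) (simp add: laplacian_h_def field_simps)
  also have "(\<Sum>i=1..M - 1. \<Sum>j=1..M - 1. (U (i + 1) j - 2 * U i j + U (i - 1) j) * V i j)
    = (\<Sum>j=1..M - 1. \<Sum>i=1..M - 1. (U (i + 1) j - 2 * U i j + U (i - 1) j) * V i j)" by (rule sum.swap)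
  also have "\<dots> = (\<Sum>j=1..M - 1. - (\<Sum>i=1..M. (U i j - U (i - 1) j) * (V i j - V (i - 1) j)))"
    using V by (intro sum.cong refl summation_by_parts_1d) auto
  also have "\<dots> = - (\<Sum>i=1..M. \<Sum>j=1..M - 1. (U i j - U (i - 1) j) * (V i j - V (i - 1) j))"
    unfolding sum_negf by (subst sum.swap) simp
  also have "(\<Sum>i=1..M - 1. \<Sum>j=1..M - 1. (U i (j + 1) - 2 * U i j + U i (j - 1)) * V i j)
    = (\<Sum>i=1..M - 1. - (\<Sum>j=1..M. (U i j - U i (j - 1)) * (V i j - V i (j - 1))))"
    using V by (intro sum.cong refl summation_by_parts_1d) auto
  finally show ?thesis by (simp add: sum_negf)
qed

text \<open>The first order system is skew: the discrete Laplacian in the first equation cancels against the gradient of the second, and only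
  the right-hand sides \<open>q\<close> and \<open>\<rho>\<close> remain.\<close>

lemma energy_identity:
  assumes h: "0 < h" and \<nu>: "0 < \<nu>"
    and V: "\<And>i j. i \<le> M \<Longrightarrow> j \<le> M \<Longrightarrow> i \<in> {0, M} \<or> j \<in> {0, M} \<Longrightarrow> ps i j = 0"
    and dp: "\<And>i j. i \<in> {1..M - 1} \<Longrightarrow> j \<in> {1..M - 1} \<Longrightarrow> dp i j = \<nu> * laplacian_h h us i j + q i j"
    and du: "\<And>i j. i \<le> M \<Longrightarrow> j \<le> M \<Longrightarrow> du i j = ps i j + \<rho> i j"
  shows "(\<Sum>x\<in>grid_index M. grid_vec h \<nu> dp du x * grid_vec h \<nu> ps us x) = (\<Sum>x\<in>grid_index M. grid_vec h \<nu> q \<rho> x * grid_vec h \<nu> ps us x)"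
proof -
  have s: "sqrt \<nu> * (sqrt \<nu> * x) = \<nu> * x" for x
    using \<nu> by (simp flip: mult.assoc)
  have 0: "(\<Sum>i=1..M - 1. \<Sum>j=1..M - 1. grid_vec h \<nu> dp du (0, i, j) * grid_vec h \<nu> ps us (0, i, j))
    = \<nu> * (\<Sum>i=1..M - 1. \<Sum>j=1..M - 1. h\<^sup>2 * laplacian_h h us i j * ps i j)
      + (\<Sum>i=1..M - 1. \<Sum>j=1..M - 1. grid_vec h \<nu> q \<rho> (0, i, j) * grid_vec h \<nu> ps us (0, i, j))"
    unfolding sum_distrib_left sum.distrib[symmetric]
    by (intro sum.cong refl) (simp add: grid_vec_def dp algebra_simps power2_eq_square)
  have 1: "(\<Sum>i=1..M. \<Sum>j=1..M - 1. grid_vec h \<nu> dp du (1, i, j) * grid_vec h \<nu> ps us (1, i, j))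
    = \<nu> * (\<Sum>i=1..M. \<Sum>j=1..M - 1. (us i j - us (i - 1) j) * (ps i j - ps (i - 1) j))
      + (\<Sum>i=1..M. \<Sum>j=1..M - 1. grid_vec h \<nu> q \<rho> (1, i, j) * grid_vec h \<nu> ps us (1, i, j))"
    unfolding sum_distrib_left sum.distrib[symmetric]
  proof (intro sum.cong refl)
    fix i j assume ij: "i \<in> {1..M}" "j \<in> {1..M - 1}"
    then have "du i j = ps i j + \<rho> i j" "du (i - 1) j = ps (i - 1) j + \<rho> (i - 1) j" by (auto intro!: du)
    then show "grid_vec h \<nu> dp du (1, i, j) * grid_vec h \<nu> ps us (1, i, j)
      = \<nu> * ((us i j - us (i - 1) j) * (ps i j - ps (i - 1) j)) + grid_vec h \<nu> q \<rho> (1, i, j) * grid_vec h \<nu> ps us (1, i, j)"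
      by (simp add: grid_vec_def s algebra_simps)
  qed
  have 2: "(\<Sum>i=1..M - 1. \<Sum>j=1..M. grid_vec h \<nu> dp du (2, i, j) * grid_vec h \<nu> ps us (2, i, j))
    = \<nu> * (\<Sum>i=1..M - 1. \<Sum>j=1..M. (us i j - us i (j - 1)) * (ps i j - ps i (j - 1)))
      + (\<Sum>i=1..M - 1. \<Sum>j=1..M. grid_vec h \<nu> q \<rho> (2, i, j) * grid_vec h \<nu> ps us (2, i, j))"
    unfolding sum_distrib_left sum.distrib[symmetric]
  proof (intro sum.cong refl)
    fix i j assume ij: "i \<in> {1..M - 1}" "j \<in> {1..M}"
    then have "du i j = ps i j + \<rho> i j" "du i (j - 1) = ps i (j - 1) + \<rho> i (j - 1)" by (auto intro!: du)
    then show "grid_vec h \<nu> dp du (2, i, j) * grid_vec h \<nu> ps us (2, i, j)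
      = \<nu> * ((us i j - us i (j - 1)) * (ps i j - ps i (j - 1))) + grid_vec h \<nu> q \<rho> (2, i, j) * grid_vec h \<nu> ps us (2, i, j)"
      by (simp add: grid_vec_def s algebra_simps)
  qed
  have h0: "h \<noteq> 0" using h by simp
  have cancel: "\<nu> * A + a + (\<nu> * B + b) + (\<nu> * C + c) = a + b + c" if "A = - (B + C)" for A B C a b c
    unfolding that by (simp add: algebra_simps)
  note sbp = grid_summation_by_parts[of h M ps us, OF h0 V]
  show ?thesis
    unfolding sum_grid_index 0 1 2 by (rule cancel[OF sbp])
qed

text \<open>Telescoping along grid lines from the boundary, and the Cauchy-Schwarz inequality.\<close>

lemma grid_poincare:
  assumes h: "h = L / real M" "0 < L" "1 \<le> M"
    and U: "\<And>j. j \<le> M \<Longrightarrow> U 0 j = 0"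
  shows "grid_norm h M U \<le> L * grid_grad_norm h M U"
proof -
  define S where "S j = (\<Sum>k=1..M. (U k j - U (k - 1) j)\<^sup>2)" for j
  have S: "0 \<le> S j" for j by (simp add: S_def sum_nonneg)
  have pt: "(U i j)\<^sup>2 \<le> real M * S j" if "i \<le> M" "j \<le> M" for i j
  proof -
    have "U i j = (\<Sum>k=1..i. U k j - U (k - 1) j)"
      using sum_telescope''[of 0 i "\<lambda>k. U k j"] U[OF that(2)] by simp
    then have "(U i j)\<^sup>2 \<le> (\<Sum>k=1..i. (U k j - U (k - 1) j)\<^sup>2) * real i"
      using sum_squared_le_sum_of_squares[of "\<lambda>k. U k j - U (k - 1) j" "{1..i}"] by simp
    also have "\<dots> \<le> S j * real M"
      unfolding S_def using that by (intro mult_mono sum_mono2) (auto intro: sum_nonneg)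
    finally show ?thesis by (simp add: mult.commute)
  qed
  have hp: "0 < h" using h by simp
  have "grid_inner h M U U = h\<^sup>2 * (\<Sum>i=1..M - 1. \<Sum>j=1..M - 1. (U i j)\<^sup>2)"
    by (simp add: grid_inner_def power2_eq_square)
  also have "\<dots> \<le> h\<^sup>2 * (\<Sum>i=1..M - 1. \<Sum>j=1..M - 1. real M * S j)"
    using pt by (intro mult_left_mono sum_mono) auto
  also have "\<dots> = h\<^sup>2 * (real (M - 1) * (real M * (\<Sum>j=1..M - 1. S j)))" by (simp add: sum_distrib_left)
  also have "\<dots> \<le> h\<^sup>2 * (real M * (real M * (\<Sum>j=1..M - 1. S j)))"
    using S by (intro mult_left_mono mult_right_mono) (auto intro!: sum_nonneg mult_nonneg_nonneg)
  also have "\<dots> = L\<^sup>2 * (\<Sum>j=1..M - 1. S j)" using h by (simp add: power2_eq_square)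
  also have "(\<Sum>j=1..M - 1. S j) = (\<Sum>i=1..M. \<Sum>j=1..M - 1. (U i j - U (i - 1) j)\<^sup>2)"
    unfolding S_def by (rule sum.swap)
  also have "L\<^sup>2 * \<dots> \<le> L\<^sup>2 * (h\<^sup>2 * (\<Sum>i=1..M. \<Sum>j=1..M - 1. ((U i j - U (i - 1) j) / h)\<^sup>2) +
           h\<^sup>2 * (\<Sum>i=1..M - 1. \<Sum>j=1..M. ((U i j - U i (j - 1)) / h)\<^sup>2))"
  proof (intro mult_left_mono)
    have "h\<^sup>2 * (x / h)\<^sup>2 = x\<^sup>2" for x using hp by (simp add: power_divide)
    then have "h\<^sup>2 * (\<Sum>i=1..M. \<Sum>j=1..M - 1. ((U i j - U (i - 1) j) / h)\<^sup>2) = (\<Sum>i=1..M. \<Sum>j=1..M - 1. (U i j - U (i - 1) j)\<^sup>2)"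
      by (simp add: sum_distrib_left)
    moreover have "0 \<le> h\<^sup>2 * (\<Sum>i=1..M - 1. \<Sum>j=1..M. ((U i j - U i (j - 1)) / h)\<^sup>2)"
      by (intro mult_nonneg_nonneg sum_nonneg) auto
    ultimately show "(\<Sum>i=1..M. \<Sum>j=1..M - 1. (U i j - U (i - 1) j)\<^sup>2) \<le> h\<^sup>2 * (\<Sum>i=1..M. \<Sum>j=1..M - 1. ((U i j - U (i - 1) j) / h)\<^sup>2) +
           h\<^sup>2 * (\<Sum>i=1..M - 1. \<Sum>j=1..M. ((U i j - U i (j - 1)) / h)\<^sup>2)" by linarith
  qed auto
  finally have "sqrt (grid_inner h M U U) \<le> sqrt (L\<^sup>2 * (h\<^sup>2 * (\<Sum>i=1..M. \<Sum>j=1..M - 1. ((U i j - U (i - 1) j) / h)\<^sup>2) +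
           h\<^sup>2 * (\<Sum>i=1..M - 1. \<Sum>j=1..M. ((U i j - U i (j - 1)) / h)\<^sup>2)))" by (rule real_sqrt_le_mono)
  then show ?thesis using h(2) by (simp add: grid_norm_def grid_grad_norm_def real_sqrt_mult)
qed

text \<open>The vector has at most \<open>3 M\<^sup>2\<close> components of size \<open>h B\<close>, and \<open>M h = L\<close>.\<close>

lemma grid_vec_sup_bound:
  assumes h: "h = L / real M" "0 < L" "1 \<le> M" and \<nu>: "0 < \<nu>" and B: "0 \<le> B"
    and q: "\<And>i j. i \<in> {1..M - 1} \<Longrightarrow> j \<in> {1..M - 1} \<Longrightarrow> \<bar>q i j\<bar> \<le> B"
    and \<rho>1: "\<And>i j. i \<in> {1..M} \<Longrightarrow> j \<le> M \<Longrightarrow> \<bar>\<rho> i j - \<rho> (i - 1) j\<bar> \<le> h * B"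
    and \<rho>2: "\<And>i j. i \<le> M \<Longrightarrow> j \<in> {1..M} \<Longrightarrow> \<bar>\<rho> i j - \<rho> i (j - 1)\<bar> \<le> h * B"
  shows "L2_set (grid_vec h \<nu> q \<rho>) (grid_index M) \<le> 2 * L * (1 + sqrt \<nu>) * B"
proof -
  have hp: "0 < h" using h by simp
  define Z where "Z = h * (1 + sqrt \<nu>) * B"
  have Z: "0 \<le> Z" using hp \<nu> B by (simp add: Z_def)
  have "\<bar>grid_vec h \<nu> q \<rho> x\<bar> \<le> Z" if x: "x \<in> grid_index M" for x
  proof -
    obtain c i j where cij: "x = (c, i, j)" by (cases x)
    consider "c = 0" "i \<in> {1..M - 1}" "j \<in> {1..M - 1}" | "c = 1" "i \<in> {1..M}" "j \<in> {1..M - 1}" | "c = 2" "i \<in> {1..M - 1}" "j \<in> {1..M}"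
      using x by (auto simp: grid_index_def cij)
    then show ?thesis
    proof cases
      case 1
      have "\<bar>grid_vec h \<nu> q \<rho> x\<bar> \<le> h * B" using 1 q[of i j] hp by (simp add: grid_vec_def cij abs_mult)
      also have "\<dots> \<le> Z" unfolding Z_def using hp \<nu> B by (simp add: distrib_left distrib_right)
      finally show ?thesis .
    next
      case 2
      have "\<bar>grid_vec h \<nu> q \<rho> x\<bar> \<le> sqrt \<nu> * (h * B)" using 2 \<rho>1[of i j] \<nu> by (auto simp: grid_vec_def cij abs_mult intro!: mult_left_mono)
      also have "\<dots> \<le> Z" unfolding Z_def using hp \<nu> B by (simp add: distrib_left distrib_right mult_ac)
      finally show ?thesis .
    next
      case 3
      have "\<bar>grid_vec h \<nu> q \<rho> x\<bar> \<le> sqrt \<nu> * (h * B)" using 3 \<rho>2[of i j] \<nu> by (auto simp: grid_vec_def cij abs_mult intro!: mult_left_mono)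
      also have "\<dots> \<le> Z" unfolding Z_def using hp \<nu> B by (simp add: distrib_left distrib_right mult_ac)
      finally show ?thesis .
    qed
  qed
  then have "(\<Sum>x\<in>grid_index M. (grid_vec h \<nu> q \<rho> x)\<^sup>2) \<le> (\<Sum>x\<in>grid_index M. Z\<^sup>2)"
    using Z by (intro sum_mono) (simp add: abs_le_square_iff[symmetric])
  also have "\<dots> = real (card (grid_index M)) * Z\<^sup>2" by simp
  also have "\<dots> \<le> (2 * real M)\<^sup>2 * Z\<^sup>2"
    using card_grid_index[of M] by (intro mult_right_mono) (auto simp: power_mult_distrib intro: order_trans)
  also have "\<dots> = (2 * L * (1 + sqrt \<nu>) * B)\<^sup>2" using h by (simp add: Z_def power_mult_distrib power_divide)
  finally show ?thesis
    unfolding L2_set_def using h \<nu> B by (intro real_le_lsqrt) (auto intro: sum_nonneg)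
qed

section \<open>The linearised nonlinearity\<close>

lemma sin_taylor:
  fixes a b :: real
  shows "\<bar>sin a - sin b\<bar> \<le> \<bar>a - b\<bar>" "\<bar>cos a - cos b\<bar> \<le> \<bar>a - b\<bar>" "\<bar>sin a - sin b - cos b * (a - b)\<bar> \<le> (a - b)\<^sup>2"
proof -
  have m: "a \<in> {min a b..max a b}" "b \<in> {min a b..max a b}" by auto
  have s: "\<bar>sin z - sin b\<bar> \<le> 1 * \<bar>z - b\<bar> ^ Suc 0" and c: "\<bar>cos z - cos b\<bar> \<le> 1 * \<bar>z - b\<bar> ^ Suc 0" if z: "z \<in> {min a b..max a b}" for z
  proof -
    show "\<bar>sin z - sin b\<bar> \<le> 1 * \<bar>z - b\<bar> ^ Suc 0"
      by (rule deriv_bound_power[OF _ m(2) z, where f' = cos]) (auto intro!: derivative_eq_intros)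
    show "\<bar>cos z - cos b\<bar> \<le> 1 * \<bar>z - b\<bar> ^ Suc 0"
      by (rule deriv_bound_power[OF _ m(2) z, where f' = "\<lambda>x. - sin x"]) (auto intro!: derivative_eq_intros)
  qed
  show "\<bar>sin a - sin b\<bar> \<le> \<bar>a - b\<bar>" "\<bar>cos a - cos b\<bar> \<le> \<bar>a - b\<bar>" using s[OF m(1)] c[OF m(1)] by auto
  have "\<bar>sin a - sin b - cos b * (a - b)\<bar> \<le> 1 * \<bar>a - b\<bar> ^ Suc (Suc 0)"
  proof (rule deriv_bound_power[OF _ m(2) m(1), where f' = "\<lambda>z. cos z - cos b"])
    fix z assume "z \<in> {min a b..max a b}"
    then show "\<bar>cos z - cos b\<bar> \<le> 1 * \<bar>z - b\<bar> ^ Suc 0" by (rule c)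
  qed (auto intro!: derivative_eq_intros)
  then show "\<bar>sin a - sin b - cos b * (a - b)\<bar> \<le> (a - b)\<^sup>2" by (simp flip: power2_eq_square)
qed

lemma F_lin_eq: "F_lin \<kappa> \<sigma> U n = \<kappa>\<^sup>2 * sin (U (n - 1)) + \<sigma> * (\<kappa>\<^sup>2 * cos (U (n - 1))) * (U n - U (n - 1))"
proof -
  have "((\<lambda>u. \<kappa>\<^sup>2 * sin u) has_real_derivative \<kappa>\<^sup>2 * cos x) (at x)" for x
    by (auto intro!: derivative_eq_intros)
  then have "deriv (sgf \<kappa>) x = \<kappa>\<^sup>2 * cos x" for x
    unfolding sgf_def[abs_def] by (rule DERIV_imp_deriv)
  then show ?thesis by (simp add: F_lin_def sgf_def)
qed

text \<open>The two linearisations have different slopes, which multiply the increment of one of the sequences; it is taken to be that of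
  \<open>a\<close>, the exact solution, for which a bound \<open>K\<close> is at hand.\<close>

lemma F_lin_lipschitz:
  assumes \<sigma>: "0 \<le> \<sigma>" "\<sigma> \<le> 1" and K: "\<bar>a n - a (n - 1)\<bar> \<le> K"
  shows "\<bar>F_lin \<kappa> \<sigma> a n - F_lin \<kappa> \<sigma> b n\<bar> \<le> \<kappa>\<^sup>2 * (2 + K) * (\<bar>a n - b n\<bar> + \<bar>a (n - 1) - b (n - 1)\<bar>)"
proof -
  define x y where "x = a n - b n" and "y = a (n - 1) - b (n - 1)"
  define z where "z = sin (a (n - 1)) - sin (b (n - 1)) + \<sigma> * (cos (b (n - 1)) * (x - y)) + \<sigma> * ((cos (a (n - 1)) - cos (b (n - 1))) * (a n - a (n - 1)))"
  have e: "F_lin \<kappa> \<sigma> a n - F_lin \<kappa> \<sigma> b n = \<kappa>\<^sup>2 * z"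
    by (simp add: F_lin_eq z_def x_def y_def algebra_simps)
  have 1: "\<bar>sin (a (n - 1)) - sin (b (n - 1))\<bar> \<le> \<bar>y\<bar>" unfolding y_def by (rule sin_taylor)
  have "\<bar>\<sigma>\<bar> * (\<bar>cos (b (n - 1))\<bar> * \<bar>x - y\<bar>) \<le> 1 * (1 * (\<bar>x\<bar> + \<bar>y\<bar>))"
    using \<sigma> abs_cos_le_one by (intro mult_mono abs_triangle_ineq4) auto
  then have 2: "\<bar>\<sigma> * (cos (b (n - 1)) * (x - y))\<bar> \<le> \<bar>x\<bar> + \<bar>y\<bar>" by (simp add: abs_mult)
  have "\<bar>\<sigma>\<bar> * (\<bar>cos (a (n - 1)) - cos (b (n - 1))\<bar> * \<bar>a n - a (n - 1)\<bar>) \<le> 1 * (\<bar>y\<bar> * K)"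
    using \<sigma> K unfolding y_def by (intro mult_mono sin_taylor) auto
  then have 3: "\<bar>\<sigma> * ((cos (a (n - 1)) - cos (b (n - 1))) * (a n - a (n - 1)))\<bar> \<le> \<bar>y\<bar> * K" by (simp add: abs_mult)
  have K0: "0 \<le> K" using K by linarith
  have "\<bar>z\<bar> \<le> \<bar>y\<bar> + (\<bar>x\<bar> + \<bar>y\<bar>) + \<bar>y\<bar> * K"
    unfolding z_def by (intro order_trans[OF abs_triangle_ineq] add_mono 1 2 3)
  also have "\<dots> \<le> (2 + K) * (\<bar>x\<bar> + \<bar>y\<bar>)" using K0 by (simp add: algebra_simps)
  finally have "\<bar>\<kappa>\<^sup>2 * z\<bar> \<le> \<kappa>\<^sup>2 * ((2 + K) * (\<bar>x\<bar> + \<bar>y\<bar>))" unfolding abs_mult by (intro mult_mono) auto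
  then show ?thesis unfolding e by (simp add: x_def y_def mult.assoc)
qed

text \<open>The linearisation at \<open>a (n - 1)\<close> has a quadratic remainder at \<open>w\<close>; its evaluation at the weighted mean instead of \<open>w\<close> adds the
  second term.\<close>

lemma F_lin_consistency:
  "\<bar>F_lin \<kappa> \<sigma> a n - sgf \<kappa> w\<bar> \<le> \<kappa>\<^sup>2 * ((w - a (n - 1))\<^sup>2 + \<bar>w - vstar \<sigma> a n\<bar>)"
proof -
  define z where "z = (sin w - sin (a (n - 1)) - cos (a (n - 1)) * (w - a (n - 1))) + cos (a (n - 1)) * (w - vstar \<sigma> a n)"
  have e: "F_lin \<kappa> \<sigma> a n - sgf \<kappa> w = - (\<kappa>\<^sup>2 * z)"
    by (simp add: F_lin_eq sgf_def z_def vstar_def algebra_simps)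
  have 1: "\<bar>sin w - sin (a (n - 1)) - cos (a (n - 1)) * (w - a (n - 1))\<bar> \<le> (w - a (n - 1))\<^sup>2" by (rule sin_taylor)
  have 2: "\<bar>cos (a (n - 1)) * (w - vstar \<sigma> a n)\<bar> \<le> \<bar>w - vstar \<sigma> a n\<bar>"
    unfolding abs_mult using abs_cos_le_one by (intro mult_left_le_one_le) auto
  have "\<bar>z\<bar> \<le> (w - a (n - 1))\<^sup>2 + \<bar>w - vstar \<sigma> a n\<bar>"
    unfolding z_def by (intro order_trans[OF abs_triangle_ineq] add_mono 1 2)
  then have "\<bar>\<kappa>\<^sup>2 * z\<bar> \<le> \<kappa>\<^sup>2 * ((w - a (n - 1))\<^sup>2 + \<bar>w - vstar \<sigma> a n\<bar>)" unfolding abs_mult by (intro mult_mono) auto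
  then show ?thesis unfolding e by simp
qed

section \<open>Consistency of the scheme\<close>

lemma continuous_on_cylinder_bounded:
  fixes f :: "real \<Rightarrow> real \<Rightarrow> real \<Rightarrow> real"
  assumes c: "continuous_on ({0..L} \<times> {0..L} \<times> {0..T}) (\<lambda>(x, y, s). f x y s)"
  obtains B where "0 \<le> B" "\<And>x y s. x \<in> {0..L} \<Longrightarrow> y \<in> {0..L} \<Longrightarrow> s \<in> {0..T} \<Longrightarrow> \<bar>f x y s\<bar> \<le> B"
proof -
  have "compact ((\<lambda>(x, y, s). f x y s) ` ({0..L} \<times> {0..L} \<times> {0..T}))"
    by (intro compact_continuous_image[OF c] compact_Times compact_Icc)
  then obtain B where B: "\<And>z. z \<in> (\<lambda>(x, y, s). f x y s) ` ({0..L} \<times> {0..L} \<times> {0..T}) \<Longrightarrow> norm z \<le> B"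
    using compact_imp_bounded bounded_iff by metis
  show thesis
  proof (rule that[of "\<bar>B\<bar>"])
    fix x y s assume "x \<in> {0..L}" "y \<in> {0..L}" "s \<in> {0..T}"
    then have "norm (f x y s) \<le> B" by (intro B image_eqI[of _ _ "(x, y, s)"]) auto
    then show "\<bar>f x y s\<bar> \<le> \<bar>B\<bar>" by simp
  qed simp
qed

lemma C_space_time_bounded:
  assumes "C_space_time L T m k v" "j1 + j2 \<le> m"
  obtains B where "0 \<le> B" "\<And>x y s. x \<in> {0..L} \<Longrightarrow> y \<in> {0..L} \<Longrightarrow> s \<in> {0..T} \<Longrightarrow> \<bar>dxy L j1 j2 (\<lambda>x y. v x y s) x y\<bar> \<le> B"
proof -
  have "continuous_on ({0..L} \<times> {0..L} \<times> {0..T}) (\<lambda>(x, y, s). dxy L j1 j2 (\<lambda>x y. v x y s) x y)"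
    using assms unfolding C_space_time_def by blast
  then show thesis by (rule continuous_on_cylinder_bounded) (rule that)
qed

lemma C_space_time_bounded_time:
  assumes "C_space_time L T m k v" "l \<le> k"
  obtains B where "0 \<le> B" "\<And>x y s. x \<in> {0..L} \<Longrightarrow> y \<in> {0..L} \<Longrightarrow> s \<in> {0..T} \<Longrightarrow> \<bar>nderiv l {0..T} (v x y) s\<bar> \<le> B"
proof -
  have "continuous_on ({0..L} \<times> {0..L} \<times> {0..T}) (\<lambda>(x, y, s). nderiv l {0..T} (v x y) s)"
    using assms unfolding C_space_time_def by blast
  then show thesis by (rule continuous_on_cylinder_bounded) (rule that)
qed

lemma C_space_time_continuous_time:
  assumes "C_space_time L T m k v" "l \<le> k" "x \<in> {0..L}" "y \<in> {0..L}"
  shows "continuous_on {0..T} (nderiv l {0..T} (v x y))"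
proof -
  have c: "continuous_on ({0..L} \<times> {0..L} \<times> {0..T}) (\<lambda>(x, y, s). nderiv l {0..T} (v x y) s)"
    using assms unfolding C_space_time_def by blast
  have "continuous_on {0..T} (\<lambda>s. (x, y, s))" by (intro continuous_intros)
  then have "continuous_on {0..T} (\<lambda>s. (\<lambda>(x, y, s). nderiv l {0..T} (v x y) s) (x, y, s))"
    by (rule continuous_on_compose2[OF c]) (use assms in auto)
  then show ?thesis by simp
qed

lemma nderiv_2_add:
  fixes a b :: "real \<Rightarrow> real"
  assumes L: "0 < L" and a: "diff_upto 2 {0..L} a" and b: "diff_upto 2 {0..L} b" and x: "x \<in> {0..L}"
  shows "nderiv 2 {0..L} (\<lambda>z. a z + c * b z) x = nderiv 2 {0..L} a x + c * nderiv 2 {0..L} b x"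
proof -
  have 1: "nderiv 1 {0..L} (\<lambda>z. a z + c * b z) z = nderiv 1 {0..L} a z + c * nderiv 1 {0..L} b z" if z: "z \<in> {0..L}" for z
  proof (rule nderiv_1_unique[OF L z])
    show "((\<lambda>z. a z + c * b z) has_real_derivative nderiv 1 {0..L} a z + c * nderiv 1 {0..L} b z) (at z within {0..L})"
      using diff_upto_has_derivative[OF a, of 0 z] diff_upto_has_derivative[OF b, of 0 z] z
      by (intro DERIV_add DERIV_cmult) auto
  qed
  have "nderiv (Suc 1) {0..L} (\<lambda>z. a z + c * b z) x = nderiv (Suc 1) {0..L} a x + c * nderiv (Suc 1) {0..L} b x"
  proof (rule nderiv_Suc_unique[OF L x])
    have "((\<lambda>z. nderiv 1 {0..L} a z + c * nderiv 1 {0..L} b z) has_real_derivative nderiv (Suc 1) {0..L} a x + c * nderiv (Suc 1) {0..L} b x) (at x within {0..L})"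
      using diff_upto_has_derivative[OF a, of 1 x] diff_upto_has_derivative[OF b, of 1 x] x
      by (intro DERIV_add DERIV_cmult) auto
    then show "(nderiv 1 {0..L} (\<lambda>z. a z + c * b z) has_real_derivative nderiv (Suc 1) {0..L} a x + c * nderiv (Suc 1) {0..L} b x) (at x within {0..L})"
      by (rule has_field_derivative_transform_within[of _ _ _ _ 1]) (use x 1 in \<open>auto simp del: nderiv.simps\<close>)
  qed
  then show ?thesis by (simp only: numeral_2_eq_2 One_nat_def)
qed

lemma space_diff_D:
  assumes "space_diff L m v" "y \<in> {0..L}"
  shows "diff_upto m {0..L} (v y)" "diff_upto m {0..L} (\<lambda>\<xi>. v \<xi> y)"
proof -
  show "diff_upto m {0..L} (v y)" using assms unfolding space_diff_def by blast
  have "diff_upto (m - 0) {0..L} (\<lambda>\<xi>. nderiv 0 {0..L} (v \<xi>) y)" using assms unfolding space_diff_def by blast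
  then show "diff_upto m {0..L} (\<lambda>\<xi>. v \<xi> y)" by simp
qed

lemma laplacian_add:
  assumes L: "0 < L" and a: "space_diff L m a" "2 \<le> m" and b: "space_diff L m' b" "2 \<le> m'" and xy: "x \<in> {0..L}" "y \<in> {0..L}"
  shows "laplacian L (\<lambda>x y. a x y + c * b x y) x y = laplacian L a x y + c * laplacian L b x y"
proof -
  have d: "diff_upto 2 {0..L} f" if "diff_upto k {0..L} f" "2 \<le> k" for k f using that by (auto simp: diff_upto_def)
  have "nderiv 2 {0..L} (\<lambda>\<xi>. a \<xi> y + c * b \<xi> y) x = nderiv 2 {0..L} (\<lambda>\<xi>. a \<xi> y) x + c * nderiv 2 {0..L} (\<lambda>\<xi>. b \<xi> y) x"
    by (intro nderiv_2_add L xy d[OF space_diff_D(2)[OF a(1) xy(2)] a(2)] d[OF space_diff_D(2)[OF b(1) xy(2)] b(2)])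
  moreover have "nderiv 2 {0..L} (\<lambda>\<xi>. a x \<xi> + c * b x \<xi>) y = nderiv 2 {0..L} (a x) y + c * nderiv 2 {0..L} (b x) y"
    by (intro nderiv_2_add L xy d[OF space_diff_D(1)[OF a(1) xy(1)] a(2)] d[OF space_diff_D(1)[OF b(1) xy(1)] b(2)])
  ultimately show ?thesis
    unfolding laplacian_def dxy_def nderiv.simps(1) by (simp only: distrib_left)
qed

locale sine_gordon = quasi_graded_meshes \<beta> \<sigma> r T Q t for \<beta> \<sigma> r T Q :: real and t :: "nat \<Rightarrow> nat \<Rightarrow> real" +
  fixes L \<nu> \<kappa> \<alpha> Creg :: real and \<psi> \<phi> :: "real \<Rightarrow> real \<Rightarrow> real" and u ubar p :: "real \<Rightarrow> real \<Rightarrow> real \<Rightarrow> real"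
  assumes L_pos: "0 < L" and \<nu>_pos: "0 < \<nu>" and \<alpha>_eq: "\<alpha> = 2 * \<beta>"
    and \<phi>_C: "C_space L 2 \<phi>"
    and \<phi>_bd: "\<And>x y. x \<in> {0..L} \<Longrightarrow> y \<in> {0..L} \<Longrightarrow> x \<in> {0, L} \<or> y \<in> {0, L} \<Longrightarrow> \<phi> x y = 0"
    and sol: "sine_gordon_solution L T \<alpha> \<nu> \<kappa> \<psi> \<phi> u"
    and ubar_eq: "ubar = (\<lambda>x y s. u x y s - s * \<phi> x y)"
    and p_eq: "p = (\<lambda>x y s. caputo \<beta> (ubar x y) s)"
    and ubar_C: "C_space_time L T 4 1 ubar" and p_C: "C_space_time L T 2 0 p"
    and ubar_ws: "weakly_singular L T Creg \<alpha> ubar" and p_ws: "weakly_singular L T Creg \<beta> p"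
    and P2: "\<And>N. 1 \<le> N \<Longrightarrow> P2 \<beta> \<sigma> N (t N)"
begin

abbreviation "U k x y \<equiv> nderiv k {0..T} (ubar x y)"
abbreviation "V k x y \<equiv> nderiv k {0..T} (p x y)"

definition "MU = reg_const Creg \<alpha>"
definition "MP = reg_const Creg \<beta>"

lemma MU_nonneg: "0 \<le> MU" and MP_nonneg: "0 \<le> MP"
  by (simp_all add: MU_def MP_def reg_const_nonneg)

lemma \<beta>_le_\<alpha>: "\<beta> \<le> \<alpha>" using \<beta>_pos by (simp add: \<alpha>_eq)

lemma ubar_cont: "\<forall>x\<in>{0..L}. \<forall>y\<in>{0..L}. continuous_on {0..T} (ubar x y)"
  using C_space_time_continuous_time[OF ubar_C, of 0] by simp

lemma p_cont: "\<forall>x\<in>{0..L}. \<forall>y\<in>{0..L}. continuous_on {0..T} (p x y)"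
  using C_space_time_continuous_time[OF p_C, of 0] by simp

lemmas U_deriv = ws_deriv[OF ubar_ws \<beta>_le_\<alpha> ubar_cont]
lemmas U_reg = ws_weak_reg[OF ubar_ws \<beta>_le_\<alpha> ubar_cont, folded MU_def]
lemmas V_reg = ws_weak_reg[OF p_ws order_refl p_cont, folded MP_def]
lemmas U_reg_dx = ws_weak_reg_dx[OF ubar_ws \<beta>_le_\<alpha> ubar_cont, folded MU_def]
lemmas V_reg_dx = ws_weak_reg_dx[OF p_ws order_refl p_cont, folded MP_def]
lemmas U_reg_dy = ws_weak_reg_dy[OF ubar_ws \<beta>_le_\<alpha> ubar_cont, folded MU_def]
lemmas V_reg_dy = ws_weak_reg_dy[OF p_ws order_refl p_cont, folded MP_def]
lemmas U_reg_laplacian = ws_weak_reg_laplacian[OF ubar_ws \<beta>_le_\<alpha> ubar_cont, folded MU_def]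

lemma U_deriv_interior:
  assumes "x \<in> {0..L}" "y \<in> {0..L}" "s \<in> {0<..<T}"
  shows "(ubar x y has_real_derivative U 1 x y s) (at s)" "(U 1 x y has_real_derivative U 2 x y s) (at s)"
proof -
  have "at s within {0..T} = at s" using assms by (intro at_within_interior) auto
  then show "(ubar x y has_real_derivative U 1 x y s) (at s)" "(U 1 x y has_real_derivative U 2 x y s) (at s)"
    using U_deriv(1,2)[of x y s] assms by auto
qed

lemma ubar_boundary:
  assumes "x \<in> {0..L}" "y \<in> {0..L}" "x \<in> {0, L} \<or> y \<in> {0, L}" "s \<in> {0..T}"
  shows "ubar x y s = 0"
proof -
  have "\<forall>x\<in>{0..L}. \<forall>y\<in>{0..L}. \<forall>t\<in>{0..T}. x \<in> {0, L} \<or> y \<in> {0, L} \<longrightarrow> u x y t = 0"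
    using sol unfolding sine_gordon_solution_def by blast
  then have "u x y s = 0" using assms by blast
  then show ?thesis using \<phi>_bd[OF assms(1-3)] by (simp add: ubar_eq)
qed

lemma p_0: "p x y 0 = 0"
  by (simp add: p_eq caputo_def)

lemma p_boundary:
  assumes "x \<in> {0..L}" "y \<in> {0..L}" "x \<in> {0, L} \<or> y \<in> {0, L}" "s \<in> {0..T}"
  shows "p x y s = 0"
proof (cases "s = 0")
  case False
  have "(ubar x y has_real_derivative 0) (at z)" if z: "z \<in> {0<..<s}" for z
  proof (rule has_field_derivative_transform_within_open[of "\<lambda>_. 0"])
    fix z' assume "z' \<in> {0<..<s}"
    then show "0 = ubar x y z'" using ubar_boundary[OF assms(1-3), of z'] assms(4) by auto
  qed (use z in auto)
  then have "caputo \<beta> (ubar x y) s = 1 / Gamma (1 - \<beta>) * integral {0..s} (\<lambda>z. (s - z) powr (- \<beta>) * 0)"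
    using False assms \<beta>_pos \<beta>_lt by (intro caputo_eq_low) auto
  then show ?thesis by (simp add: p_eq)
qed (simp add: p_0)

lemma frac_deriv_U:
  assumes "x \<in> {0..L}" "y \<in> {0..L}" "c \<in> {0<..T}"
  shows "frac_deriv (U 1 x y) c = p x y c"
proof -
  have "caputo \<beta> (ubar x y) c = 1 / Gamma (1 - \<beta>) * integral {0..c} (\<lambda>s. (c - s) powr (- \<beta>) * U 1 x y s)"
    using assms \<beta>_pos \<beta>_lt by (intro caputo_eq_low U_deriv_interior) auto
  then show ?thesis by (simp only: frac_deriv_def p_eq)
qed

text \<open>The derivative of order \<open>\<alpha> > 1\<close> does not change when the linear function \<open>s \<phi>\<close> is subtracted, and after the subtraction the
  initial velocity vanishes, as \<open>caputo_twice\<close> requires.\<close>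

lemma frac_deriv_V:
  assumes x: "x \<in> {0<..<L}" and y: "y \<in> {0<..<L}" and c: "c \<in> {0<..T}"
  shows "frac_deriv (V 1 x y) c = caputo \<alpha> (u x y) c"
proof -
  have xy: "x \<in> {0..L}" "y \<in> {0..L}" using x y by auto
  define M where "M = \<bar>Creg\<bar> * (T powr (2 - \<alpha>) + 1)"
  have U2: "\<bar>U 2 x y s\<bar> \<le> M * s powr (2 * \<beta> - 2)" if s: "s \<in> {0<..T}" for s
  proof -
    have "\<bar>U 2 x y s\<bar> = \<bar>dxy L 0 0 (\<lambda>x y. U 2 x y s) x y\<bar>" by (simp add: dxy_def)
    also have "\<dots> \<le> (\<Sum>(j1, j2)\<in>{(j1, j2). j1 + j2 \<le> 2}. \<bar>dxy L j1 j2 (\<lambda>x y. U 2 x y s) x y\<bar>)" by (rule dxy_le_sum) simp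
    also have "\<dots> \<le> Creg * (1 + s powr (\<alpha> - real 2))"
    proof -
      have "(2::nat) \<le> 3" by simp
      then show ?thesis using ubar_ws xy s unfolding weakly_singular_def by blast
    qed
    also have "\<dots> \<le> \<bar>Creg\<bar> * (1 + s powr (\<alpha> - 2))" by (simp add: mult_right_mono)
    also have "\<dots> \<le> \<bar>Creg\<bar> * ((T powr (2 - \<alpha>) + 1) * s powr (\<alpha> - 2))"
    proof (intro mult_left_mono)
      have "1 = s powr (2 - \<alpha>) * s powr (\<alpha> - 2)" using s by (simp flip: powr_add)
      also have "\<dots> \<le> T powr (2 - \<alpha>) * s powr (\<alpha> - 2)" using s \<beta>_lt by (intro mult_right_mono powr_mono2) (auto simp: \<alpha>_eq)
      finally show "1 + s powr (\<alpha> - 2) \<le> (T powr (2 - \<alpha>) + 1) * s powr (\<alpha> - 2)" by (simp add: distrib_right)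
    qed simp
    finally show ?thesis by (simp add: M_def \<alpha>_eq mult.assoc)
  qed
  have U2c: "continuous_on {0<..T} (U 2 x y)"
  proof (rule DERIV_continuous_on)
    fix s assume s: "s \<in> {0<..T}"
    show "(U 2 x y has_real_derivative U 3 x y s) (at s within {0<..T})"
      by (rule DERIV_subset[OF U_deriv(3)[OF xy s]]) auto
  qed
  have U10: "U 1 x y 0 = 0"
  proof (rule nderiv_1_unique)
    have "(u x y has_real_derivative \<phi> x y) (at 0 within {0..T})" using sol x y unfolding sine_gordon_solution_def by blast
    then have "((\<lambda>s. u x y s - s * \<phi> x y) has_real_derivative \<phi> x y - 1 * \<phi> x y) (at 0 within {0..T})"
      by (intro DERIV_diff DERIV_cmult_right DERIV_ident)
    then show "(ubar x y has_real_derivative 0) (at 0 within {0..T})" by (simp add: ubar_eq)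
  qed (use T_pos in auto)
  have U1: "(U 2 x y has_integral U 1 x y s) {0..s}" if s: "s \<in> {0..T}" for s
  proof -
    have "(U 2 x y has_integral U 1 x y s - U 1 x y 0) {0..s}"
    proof (rule fundamental_theorem_of_calculus_interior)
      show "continuous_on {0..s} (U 1 x y)"
        using C_space_time_continuous_time[OF ubar_C, of 1 x y] xy s by (auto intro: continuous_on_subset simp del: nderiv.simps)
      fix z assume "z \<in> {0<..<s}"
      then show "(U 1 x y has_vector_derivative U 2 x y z) (at z)"
        using U_deriv_interior(2)[OF xy, of z] s by (simp add: has_real_derivative_iff_has_vector_derivative del: nderiv.simps)
    qed (use s in auto)
    then show ?thesis by (simp only: U10 diff_zero)
  qed
  have "frac_deriv (V 1 x y) c = 1 / Gamma (2 - 2 * \<beta>) * integral {0..c} (\<lambda>s. (c - s) powr (1 - 2 * \<beta>) * U 2 x y s)"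
    unfolding frac_deriv_def
  proof (rule caputo_twice[OF T_pos \<beta>_gt \<beta>_lt U1 U2c U2 _ _ _ _ c])
    fix s assume s: "s \<in> {0<..T}"
    show "p x y s = 1 / \<Gamma>\<beta> * integral {0..s} (\<lambda>z. (s - z) powr (- \<beta>) * U 1 x y z)"
      using frac_deriv_U[OF xy s] by (simp only: frac_deriv_def)
    show "(V 1 x y has_integral p x y s) {0..s}"
      using weak_reg_has_integral[OF V_reg[OF xy], of 0 s] s by (simp add: p_0 del: nderiv.simps)
    show "\<bar>V 1 x y s\<bar> \<le> MP * s powr (\<beta> - 1)" by (rule weak_regD(4)[OF V_reg[OF xy] s])
  qed (assumption | rule weak_reg_continuous[OF V_reg[OF xy]])+
  also have "\<dots> = 1 / Gamma (2 - \<alpha>) * integral {0..c} (\<lambda>s. (c - s) powr (1 - \<alpha>) * U 2 x y s)" by (simp only: \<alpha>_eq)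
  also have "\<dots> = caputo \<alpha> (u x y) c"
  proof (rule caputo_eq_high[symmetric])
    fix s assume s: "s \<in> {0<..<c}"
    then have sT: "s \<in> {0<..<T}" using c by auto
    have "((\<lambda>s. ubar x y s + s * \<phi> x y) has_real_derivative U 1 x y s + 1 * \<phi> x y) (at s)"
      by (intro DERIV_add U_deriv_interior xy sT DERIV_cmult_right DERIV_ident)
    then show "(u x y has_real_derivative U 1 x y s + \<phi> x y) (at s)" by (simp add: ubar_eq del: nderiv.simps)
    have "((\<lambda>s. U 1 x y s + \<phi> x y) has_real_derivative U 2 x y s + 0) (at s)"
      by (intro DERIV_add U_deriv_interior xy sT DERIV_const)
    then show "((\<lambda>s. U 1 x y s + \<phi> x y) has_real_derivative U 2 x y s) (at s)" by (simp only: add_0_right)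
  qed (use \<beta>_gt \<beta>_lt c in \<open>auto simp: \<alpha>_eq\<close>)
  finally show ?thesis .
qed

text \<open>The equation at an evaluation point, in the form in which the scheme discretises it.\<close>

lemma equation:
  assumes x: "x \<in> {0<..<L}" and y: "y \<in> {0<..<L}" and c: "c \<in> {0<..T}"
  shows "frac_deriv (V 1 x y) c - \<nu> * laplacian L (\<lambda>x y. ubar x y c) x y + sgf \<kappa> (u x y c) = \<nu> * c * laplacian L \<phi> x y"
proof -
  have "caputo \<alpha> (u x y) c - \<nu> * laplacian L (\<lambda>x y. u x y c) x y + sgf \<kappa> (u x y c) = 0"
    using sol x y c unfolding sine_gordon_solution_def by blast
  moreover have "laplacian L (\<lambda>x y. ubar x y c + c * \<phi> x y) x y = laplacian L (\<lambda>x y. ubar x y c) x y + c * laplacian L \<phi> x y"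
  proof (rule laplacian_add[OF L_pos])
    show "space_diff L 4 (\<lambda>x y. ubar x y c)" using ubar_C c unfolding C_space_time_def by auto
    show "space_diff L 2 \<phi>" using \<phi>_C unfolding C_space_def by blast
  qed (use x y in auto)
  moreover have "(\<lambda>x y. u x y c) = (\<lambda>x y. ubar x y c + c * \<phi> x y)" by (simp add: ubar_eq)
  ultimately show ?thesis using frac_deriv_V[OF x y c] by (simp add: distrib_left)
qed

end

context quasi_graded_meshes
begin

lemma \<delta>_linear:
  assumes "1 \<le> n" "n \<le> N"
  shows "\<delta> N (\<lambda>k. v k - w k) n = \<delta> N v n - \<delta> N w n" "\<delta> N (\<lambda>k. c * v k) n = c * \<delta> N v n" "\<delta> N (\<lambda>k. 0) n = 0"
  unfolding \<delta>_eq[OF assms] sum_subtractf[symmetric] sum_distrib_left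
  by (simp_all add: algebra_simps cong: sum.cong)

lemma \<delta>_cong:
  assumes "1 \<le> n" "n \<le> N" "\<And>k. k \<le> n \<Longrightarrow> v k = w k"
  shows "\<delta> N v n = \<delta> N w n"
  unfolding \<delta>_eq[OF assms(1,2)] by (intro sum.cong) (auto simp: assms(3))

lemma frac_deriv_diff:
  assumes "weak_reg M v v1 v2 v3" "weak_reg M' w w1 w2 w3" "0 < c" "c \<le> T"
  shows "frac_deriv (\<lambda>s. v1 s - w1 s) c = frac_deriv v1 c - frac_deriv w1 c"
proof -
  have "integral {0..c} (\<lambda>s. (c - s) powr (- \<beta>) * (v1 s - w1 s))
    = integral {0..c} (\<lambda>s. (c - s) powr (- \<beta>) * v1 s) - integral {0..c} (\<lambda>s. (c - s) powr (- \<beta>) * w1 s)"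
    unfolding right_diff_distrib
    by (rule integral_diff) (rule weak_reg_kernel(1)[OF assms(1,3,4)], rule weak_reg_kernel(1)[OF assms(2,3,4)])
  then show ?thesis by (simp add: frac_deriv_def right_diff_distrib)
qed

text \<open>The size of the temporal residuals: the first part comes from the fractional derivative, the second from interpolation at the
  evaluation point.\<close>

definition "time_error N n = real n powr (- min (r * (\<beta> + 1)) (3 - \<beta>)) + t N n powr \<beta> * real n powr (- 2)"

lemma time_error_ge: "real n powr (- min (r * (\<beta> + 1)) (3 - \<beta>)) \<le> time_error N n" "t N n powr \<beta> * real n powr (- 2) \<le> time_error N n"
  "0 \<le> time_error N n"
  by (simp_all add: time_error_def)

end

definition stencil :: "real \<Rightarrow> (real \<Rightarrow> real \<Rightarrow> real \<Rightarrow> real) \<Rightarrow> real \<Rightarrow> real \<Rightarrow> real \<Rightarrow> real" where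
  "stencil h w x y s = (w (x + h) y s - 2 * w x y s + w (x - h) y s) + (w x (y + h) s - 2 * w x y s + w x (y - h) s)"

lemma laplacian_h_stencil:
  assumes "1 \<le> i" "1 \<le> j" "h \<noteq> 0"
  shows "laplacian_h h (\<lambda>i j. vstar \<sigma> (\<lambda>m. w (real i * h) (real j * h) (s m)) n) i j
    = 1 / h\<^sup>2 * vstar \<sigma> (\<lambda>m. stencil h w (real i * h) (real j * h) (s m)) n"
proof -
  have "real (i + 1) * h = real i * h + h" "real (j + 1) * h = real j * h + h"
    "real (i - 1) * h = real i * h - h" "real (j - 1) * h = real j * h - h"
    using assms by (auto simp: algebra_simps of_nat_diff)
  then show ?thesis
    unfolding laplacian_h_def stencil_def vstar_def by (simp only:) (simp add: algebra_simps add_divide_distrib diff_divide_distrib)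
qed

lemma laplacian_h_diff:
  "laplacian_h h (\<lambda>i j. vstar \<sigma> (\<lambda>m. a m i j - b m i j) n) i j
    = laplacian_h h (\<lambda>i j. vstar \<sigma> (\<lambda>m. a m i j) n) i j - laplacian_h h (\<lambda>i j. vstar \<sigma> (\<lambda>m. b m i j) n) i j"
  by (simp add: laplacian_h_def vstar_def algebra_simps diff_divide_distrib add_divide_distrib)

lemma grid_norm_eq_L2_set: "0 < h \<Longrightarrow> grid_norm h M A = L2_set (grid_vec h \<nu> A (\<lambda>i j. 0)) (grid_index M)"
  by (simp add: L2_set_def sum_grid_index grid_vec_def grid_norm_def grid_inner_def power_mult_distrib power2_eq_square sum_distrib_left mult_ac)

lemma grid_norm_le_sum:
  assumes h: "0 < h" and K: "0 \<le> K"
    and le: "\<And>i j. i \<in> {1..M - 1} \<Longrightarrow> j \<in> {1..M - 1} \<Longrightarrow> \<bar>A i j\<bar> \<le> K * (\<bar>B i j\<bar> + \<bar>C i j\<bar>)"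
  shows "grid_norm h M A \<le> K * (grid_norm h M B + grid_norm h M C)"
proof -
  define J where "J = {1..M - 1} \<times> {1..M - 1}"
  have n: "grid_norm h M F = L2_set (\<lambda>(i, j). h * \<bar>F i j\<bar>) J" for F
    by (simp add: J_def grid_norm_def grid_inner_def L2_set_def sum.cartesian_product' power_mult_distrib power2_eq_square sum_distrib_left mult_ac)
  have "L2_set (\<lambda>(i, j). h * \<bar>A i j\<bar>) J \<le> L2_set (\<lambda>x. K * (case x of (i, j) \<Rightarrow> h * \<bar>B i j\<bar>) + K * (case x of (i, j) \<Rightarrow> h * \<bar>C i j\<bar>)) J"
  proof (rule L2_set_mono)
    fix x assume x: "x \<in> J"
    obtain i j where ij: "x = (i, j)" by (cases x)
    have "h * \<bar>A i j\<bar> \<le> h * (K * (\<bar>B i j\<bar> + \<bar>C i j\<bar>))" using le[of i j] x h unfolding J_def ij by (intro mult_left_mono) auto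
    then show "(case x of (i, j) \<Rightarrow> h * \<bar>A i j\<bar>) \<le> K * (case x of (i, j) \<Rightarrow> h * \<bar>B i j\<bar>) + K * (case x of (i, j) \<Rightarrow> h * \<bar>C i j\<bar>)"
      unfolding ij by (simp add: algebra_simps)
    show "0 \<le> (case x of (i, j) \<Rightarrow> h * \<bar>A i j\<bar>)" unfolding ij using h by simp
  qed
  also have "\<dots> \<le> L2_set (\<lambda>x. K * (case x of (i, j) \<Rightarrow> h * \<bar>B i j\<bar>)) J + L2_set (\<lambda>x. K * (case x of (i, j) \<Rightarrow> h * \<bar>C i j\<bar>)) J"
    by (rule L2_set_triangle_ineq)
  also have "\<dots> = K * (L2_set (\<lambda>(i, j). h * \<bar>B i j\<bar>) J + L2_set (\<lambda>(i, j). h * \<bar>C i j\<bar>) J)"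
    by (simp only: L2_set_right_distrib[OF K] distrib_left)
  finally show ?thesis unfolding n .
qed

context sine_gordon
begin

lemma u_eq: "u x y s = ubar x y s + s * \<phi> x y" by (simp add: ubar_eq)

lemma u_lipschitz:
  obtains K where "0 \<le> K" "\<And>x y s s'. x \<in> {0..L} \<Longrightarrow> y \<in> {0..L} \<Longrightarrow> s \<in> {0..T} \<Longrightarrow> s' \<in> {0..T} \<Longrightarrow>
    \<bar>u x y s - u x y s'\<bar> \<le> K * \<bar>s - s'\<bar>"
proof -
  obtain B where B: "0 \<le> B" "\<And>x y s. x \<in> {0..L} \<Longrightarrow> y \<in> {0..L} \<Longrightarrow> s \<in> {0..T} \<Longrightarrow> \<bar>nderiv 1 {0..T} (ubar x y) s\<bar> \<le> B"
    using C_space_time_bounded_time[OF ubar_C order_refl] by metis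
  have "continuous_on ({0..L} \<times> {0..L}) (\<lambda>(x, y). dxy L 0 0 \<phi> x y)"
    using \<phi>_C zero_le[of "2::nat"] unfolding C_space_def by (metis add_0)
  then have c: "continuous_on ({0..L} \<times> {0..L}) (\<lambda>(x, y). \<phi> x y)" by (simp add: dxy_def)
  have "compact ((\<lambda>(x, y). \<phi> x y) ` ({0..L} \<times> {0..L}))"
    by (intro compact_continuous_image[OF c] compact_Times compact_Icc)
  then obtain F where F: "\<And>z. z \<in> (\<lambda>(x, y). \<phi> x y) ` ({0..L} \<times> {0..L}) \<Longrightarrow> norm z \<le> F"
    using compact_imp_bounded bounded_iff by metis
  have F: "\<bar>\<phi> x y\<bar> \<le> \<bar>F\<bar>" if "x \<in> {0..L}" "y \<in> {0..L}" for x y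
  proof -
    have "norm (\<phi> x y) \<le> F" using that by (intro F image_eqI[of _ _ "(x, y)"]) auto
    then show ?thesis by simp
  qed
  show thesis
  proof (rule that[of "B + \<bar>F\<bar>"])
    fix x y s s' assume a: "x \<in> {0..L}" "y \<in> {0..L}" "s \<in> {0..T}" "s' \<in> {0..T}"
    have d: "diff_upto 1 {0..T} (ubar x y)" using ubar_C a unfolding C_space_time_def by blast
    have 1: "\<bar>ubar x y s - ubar x y s'\<bar> \<le> B * \<bar>s - s'\<bar>"
      using d B(2)[OF a(1,2)] a(4,3) by (rule first_difference_bound)
    have 2: "\<bar>(s - s') * \<phi> x y\<bar> \<le> \<bar>F\<bar> * \<bar>s - s'\<bar>"
      using F[OF a(1,2)] unfolding abs_mult by (subst mult.commute) (intro mult_right_mono, auto)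
    have "u x y s - u x y s' = (ubar x y s - ubar x y s') + (s - s') * \<phi> x y" by (simp add: u_eq algebra_simps)
    then show "\<bar>u x y s - u x y s'\<bar> \<le> (B + \<bar>F\<bar>) * \<bar>s - s'\<bar>" using 1 2 by (simp add: distrib_right)
  qed (use B in auto)
qed

lemma stencil_consistency:
  obtains C where "0 \<le> C" "\<And>x y h s. x - h \<in> {0..L} \<Longrightarrow> x + h \<in> {0..L} \<Longrightarrow> y - h \<in> {0..L} \<Longrightarrow> y + h \<in> {0..L} \<Longrightarrow> h \<noteq> 0 \<Longrightarrow>
    s \<in> {0..T} \<Longrightarrow> \<bar>1 / h\<^sup>2 * stencil h ubar x y s - laplacian L (\<lambda>x y. ubar x y s) x y\<bar> \<le> C * h\<^sup>2"
proof -
  obtain B1 where B1: "0 \<le> B1" "\<And>x y s. x \<in> {0..L} \<Longrightarrow> y \<in> {0..L} \<Longrightarrow> s \<in> {0..T} \<Longrightarrow> \<bar>dxy L 4 0 (\<lambda>x y. ubar x y s) x y\<bar> \<le> B1"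
    using C_space_time_bounded[OF ubar_C, of 4 0] by auto
  obtain B2 where B2: "0 \<le> B2" "\<And>x y s. x \<in> {0..L} \<Longrightarrow> y \<in> {0..L} \<Longrightarrow> s \<in> {0..T} \<Longrightarrow> \<bar>dxy L 0 4 (\<lambda>x y. ubar x y s) x y\<bar> \<le> B2"
    using C_space_time_bounded[OF ubar_C, of 0 4] by auto
  show thesis
  proof (rule that[of "2 * B1 + 2 * B2"])
    fix x y h s assume x: "x - h \<in> {0..L}" "x + h \<in> {0..L}" and y: "y - h \<in> {0..L}" "y + h \<in> {0..L}" and h: "h \<noteq> 0" and s: "s \<in> {0..T}"
    have xy: "x \<in> {0..L}" "y \<in> {0..L}" using x y by auto
    have sd: "space_diff L 4 (\<lambda>x y. ubar x y s)" using ubar_C s unfolding C_space_time_def by blast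
    have 1: "\<bar>(ubar (x + h) y s - 2 * ubar x y s + ubar (x - h) y s) / h\<^sup>2 - nderiv 2 {0..L} (\<lambda>\<xi>. ubar \<xi> y s) x\<bar> \<le> 2 * B1 * h\<^sup>2"
    proof (rule second_difference_consistency[OF space_diff_D(2)[OF sd xy(2)] _ x h])
      fix z assume "z \<in> {0..L}"
      then show "\<bar>nderiv 4 {0..L} (\<lambda>\<xi>. ubar \<xi> y s) z\<bar> \<le> B1" using B1(2)[OF _ xy(2) s, of z] by (simp only: dxy_def nderiv.simps(1))
    qed
    have 2: "\<bar>(ubar x (y + h) s - 2 * ubar x y s + ubar x (y - h) s) / h\<^sup>2 - nderiv 2 {0..L} (\<lambda>\<xi>. ubar x \<xi> s) y\<bar> \<le> 2 * B2 * h\<^sup>2"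
    proof (rule second_difference_consistency[OF space_diff_D(1)[OF sd xy(1)] _ y h])
      fix z assume "z \<in> {0..L}"
      then show "\<bar>nderiv 4 {0..L} (\<lambda>\<xi>. ubar x \<xi> s) z\<bar> \<le> B2" using B2(2)[OF xy(1) _ s, of z] by (simp only: dxy_def nderiv.simps(1))
    qed
    have "1 / h\<^sup>2 * stencil h ubar x y s - laplacian L (\<lambda>x y. ubar x y s) x y
      = ((ubar (x + h) y s - 2 * ubar x y s + ubar (x - h) y s) / h\<^sup>2 - nderiv 2 {0..L} (\<lambda>\<xi>. ubar \<xi> y s) x)
      + ((ubar x (y + h) s - 2 * ubar x y s + ubar x (y - h) s) / h\<^sup>2 - nderiv 2 {0..L} (\<lambda>\<xi>. ubar x \<xi> s) y)"
      unfolding laplacian_def dxy_def nderiv.simps(1) stencil_def by (simp only: times_divide_eq_left mult_1_left add_divide_distrib)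
    also have "\<bar>\<dots>\<bar> \<le> 2 * B1 * h\<^sup>2 + 2 * B2 * h\<^sup>2" by (intro order_trans[OF abs_triangle_ineq] add_mono 1 2)
    finally show "\<bar>1 / h\<^sup>2 * stencil h ubar x y s - laplacian L (\<lambda>x y. ubar x y s) x y\<bar> \<le> (2 * B1 + 2 * B2) * h\<^sup>2" by (simp only: distrib_right)
  qed (use B1 B2 in auto)
qed

text \<open>The residuals of the exact solution in the two equations of the scheme.\<close>

definition "res_u N n x y = \<delta> N (\<lambda>k. ubar x y (t N k)) n - vstar \<sigma> (\<lambda>k. p x y (t N k)) n"

definition "res_p h N n x y = \<delta> N (\<lambda>k. p x y (t N k)) n - \<nu> * (1 / h\<^sup>2 * vstar \<sigma> (\<lambda>k. stencil h ubar x y (t N k)) n)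
  + F_lin \<kappa> \<sigma> (\<lambda>k. u x y (t N k)) n - \<nu> * tstar \<sigma> (t N) n * laplacian L \<phi> x y"

text \<open>The energy norm sees the gradient of the residual of the second equation, so that its differences are estimated.\<close>

lemma res_u_difference:
  obtains C where "0 < C" "\<And>N n x x' y. 1 \<le> n \<Longrightarrow> n \<le> N \<Longrightarrow> x \<in> {0..L} \<Longrightarrow> x' \<in> {0..L} \<Longrightarrow> y \<in> {0..L} \<Longrightarrow>
    \<bar>res_u N n x y - res_u N n x' y\<bar> \<le> \<bar>x - x'\<bar> * (C * time_error N n)"
    "\<And>N n x x' y. 1 \<le> n \<Longrightarrow> n \<le> N \<Longrightarrow> x \<in> {0..L} \<Longrightarrow> x' \<in> {0..L} \<Longrightarrow> y \<in> {0..L} \<Longrightarrow>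
    \<bar>res_u N n y x - res_u N n y x'\<bar> \<le> \<bar>x - x'\<bar> * (C * time_error N n)"
proof -
  obtain CT where CT: "0 < CT" "\<And>N n M v v1 v2 v3. weak_reg M v v1 v2 v3 \<Longrightarrow> 1 \<le> n \<Longrightarrow> n \<le> N \<Longrightarrow>
    \<bar>\<delta> N (\<lambda>k. v (t N k)) n - frac_deriv v1 (tstar \<sigma> (t N) n)\<bar> \<le> CT * (M * real n powr (- min (r * (\<beta> + 1)) (3 - \<beta>)))"
    by (rule truncation_weak) blast
  define CI where "CI = 2 / \<beta> + E powr (3 - \<beta>) * Q\<^sup>2"
  have CI: "0 \<le> CI" using \<beta>_pos by (simp add: CI_def)
  have main: "\<bar>res_u N n x y - res_u N n x' y'\<bar> \<le> d * ((CT * MU + CI * MP + 1) * time_error N n)"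
    if n: "1 \<le> n" "n \<le> N" and xy: "x \<in> {0..L}" "y \<in> {0..L}" "x' \<in> {0..L}" "y' \<in> {0..L}" and d: "0 \<le> d"
      and wu: "weak_reg (MU * d) (\<lambda>s. ubar x y s - ubar x' y' s) (\<lambda>s. U 1 x y s - U 1 x' y' s) v2 v3"
      and wp: "weak_reg (MP * d) (\<lambda>s. p x y s - p x' y' s) w1 w2 w3" for N n x y x' y' d v2 v3 w1 w2 w3
  proof -
    define c where "c = tstar \<sigma> (t N) n"
    have c: "0 < c" "c \<le> T" using tstar_bounds[OF n] by (auto simp: c_def)
    have "frac_deriv (\<lambda>s. U 1 x y s - U 1 x' y' s) c = p x y c - p x' y' c"
      using frac_deriv_diff[OF U_reg[OF xy(1,2)] U_reg[OF xy(3,4)] c] frac_deriv_U[OF xy(1,2)] frac_deriv_U[OF xy(3,4)] c by simp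
    then have 1: "\<bar>\<delta> N (\<lambda>k. ubar x y (t N k) - ubar x' y' (t N k)) n - (p x y c - p x' y' c)\<bar>
      \<le> CT * (MU * d * real n powr (- min (r * (\<beta> + 1)) (3 - \<beta>)))"
      using CT(2)[OF wu n] by (simp only: c_def)
    also have "\<dots> \<le> CT * (MU * d * time_error N n)"
      using CT(1) MU_nonneg d by (intro mult_left_mono time_error_ge) auto
    finally have 1: "\<bar>\<delta> N (\<lambda>k. ubar x y (t N k) - ubar x' y' (t N k)) n - (p x y c - p x' y' c)\<bar> \<le> CT * (MU * d * time_error N n)" .
    have "\<bar>(p x y c - p x' y' c) - vstar \<sigma> (\<lambda>k. p x y (t N k) - p x' y' (t N k)) n\<bar> \<le> CI * (MP * d * (t N n powr \<beta> * real n powr (- 2)))"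
      using interpolation_error[OF wp n] by (simp only: c_def CI_def)
    also have "\<dots> \<le> CI * (MP * d * time_error N n)"
      using CI MP_nonneg d by (intro mult_left_mono time_error_ge) auto
    finally have 2: "\<bar>(p x y c - p x' y' c) - vstar \<sigma> (\<lambda>k. p x y (t N k) - p x' y' (t N k)) n\<bar> \<le> CI * (MP * d * time_error N n)" .
    have "res_u N n x y - res_u N n x' y' = (\<delta> N (\<lambda>k. ubar x y (t N k) - ubar x' y' (t N k)) n - (p x y c - p x' y' c))
      + ((p x y c - p x' y' c) - vstar \<sigma> (\<lambda>k. p x y (t N k) - p x' y' (t N k)) n)"
      by (simp add: res_u_def \<delta>_linear(1)[OF n] vstar_def algebra_simps)
    also have "\<bar>\<dots>\<bar> \<le> CT * (MU * d * time_error N n) + CI * (MP * d * time_error N n)"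
      by (intro order_trans[OF abs_triangle_ineq] add_mono 1 2)
    also have "\<dots> \<le> d * ((CT * MU + CI * MP + 1) * time_error N n)"
      using mult_nonneg_nonneg[OF d time_error_ge(3)[of N n]] by (simp add: algebra_simps)
    finally show ?thesis .
  qed
  show thesis
  proof (rule that[of "CT * MU + CI * MP + 1"])
    show "0 < CT * MU + CI * MP + 1" using CT(1) CI MU_nonneg MP_nonneg by (intro add_nonneg_pos add_nonneg_nonneg mult_nonneg_nonneg) auto
    fix N n :: nat and x x' y :: real assume a: "1 \<le> n" "n \<le> N" "x \<in> {0..L}" "x' \<in> {0..L}" "y \<in> {0..L}"
    show "\<bar>res_u N n x y - res_u N n x' y\<bar> \<le> \<bar>x - x'\<bar> * ((CT * MU + CI * MP + 1) * time_error N n)"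
      by (rule main[OF a(1,2,3,5,4,5) _ U_reg_dx[OF a(3-5)] V_reg_dx[OF a(3-5)]]) simp
    show "\<bar>res_u N n y x - res_u N n y x'\<bar> \<le> \<bar>x - x'\<bar> * ((CT * MU + CI * MP + 1) * time_error N n)"
      by (rule main[OF a(1,2,5,3,5,4) _ U_reg_dy[OF a(3-5)] V_reg_dy[OF a(3-5)]]) simp
  qed
qed

lemma step_squared_le:
  assumes n: "1 \<le> n" "n \<le> N"
  shows "(mstep (t N) n)\<^sup>2 \<le> Q\<^sup>2 * T powr (2 - \<beta>) * (t N n powr \<beta> * real n powr (- 2))"
proof -
  have tn: "0 < t N n" "t N n \<le> T" using t_pos t_le_T n by auto
  have "(mstep (t N) n)\<^sup>2 \<le> (Q * (t N n / real n))\<^sup>2"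
    using step_upper[OF n] mstep_pos[OF n] by (intro power_mono) auto
  also have "\<dots> = Q\<^sup>2 * (t N n powr 2 * real n powr (- 2))"
    using tn n by (simp add: power_mult_distrib power_divide powr_minus divide_inverse power_inverse)
  also have "t N n powr 2 = t N n powr (2 - \<beta>) * t N n powr \<beta>" by (simp flip: powr_add)
  also have "Q\<^sup>2 * (t N n powr (2 - \<beta>) * t N n powr \<beta> * real n powr (- 2)) = Q\<^sup>2 * t N n powr (2 - \<beta>) * (t N n powr \<beta> * real n powr (- 2))" by simp
  also have "\<dots> \<le> Q\<^sup>2 * T powr (2 - \<beta>) * (t N n powr \<beta> * real n powr (- 2))"
    using tn \<beta>_lt by (intro mult_right_mono mult_left_mono powr_mono2) auto
  finally show ?thesis .
qed

lemma res_p_bound: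
  obtains C where "0 < C" "\<And>N n h x y. 1 \<le> n \<Longrightarrow> n \<le> N \<Longrightarrow> x \<in> {0<..<L} \<Longrightarrow> y \<in> {0<..<L} \<Longrightarrow> h \<noteq> 0 \<Longrightarrow>
    x - h \<in> {0..L} \<Longrightarrow> x + h \<in> {0..L} \<Longrightarrow> y - h \<in> {0..L} \<Longrightarrow> y + h \<in> {0..L} \<Longrightarrow>
    \<bar>res_p h N n x y\<bar> \<le> C * (time_error N n + h\<^sup>2)"
proof -
  obtain CT where CT: "0 < CT" "\<And>N n M v v1 v2 v3. weak_reg M v v1 v2 v3 \<Longrightarrow> 1 \<le> n \<Longrightarrow> n \<le> N \<Longrightarrow>
    \<bar>\<delta> N (\<lambda>k. v (t N k)) n - frac_deriv v1 (tstar \<sigma> (t N) n)\<bar> \<le> CT * (M * real n powr (- min (r * (\<beta> + 1)) (3 - \<beta>)))"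
    by (rule truncation_weak) blast
  define CI where "CI = 2 / \<beta> + E powr (3 - \<beta>) * Q\<^sup>2"
  have CI: "0 \<le> CI" using \<beta>_pos by (simp add: CI_def)
  obtain CS where CS: "0 \<le> CS" "\<And>x y h s. x - h \<in> {0..L} \<Longrightarrow> x + h \<in> {0..L} \<Longrightarrow> y - h \<in> {0..L} \<Longrightarrow> y + h \<in> {0..L} \<Longrightarrow> h \<noteq> 0 \<Longrightarrow>
    s \<in> {0..T} \<Longrightarrow> \<bar>1 / h\<^sup>2 * stencil h ubar x y s - laplacian L (\<lambda>x y. ubar x y s) x y\<bar> \<le> CS * h\<^sup>2"
    by (rule stencil_consistency) blast
  obtain K where K: "0 \<le> K" "\<And>x y s s'. x \<in> {0..L} \<Longrightarrow> y \<in> {0..L} \<Longrightarrow> s \<in> {0..T} \<Longrightarrow> s' \<in> {0..T} \<Longrightarrow>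
    \<bar>u x y s - u x y s'\<bar> \<le> K * \<bar>s - s'\<bar>" by (rule u_lipschitz) blast
  define C where "C = CT * MP + \<nu> * CS + \<nu> * (CI * (4 * MU)) + \<kappa>\<^sup>2 * (K\<^sup>2 * (Q\<^sup>2 * T powr (2 - \<beta>)) + CI * MU) + 1"
  show thesis
  proof (rule that[of C])
    show "0 < C" unfolding C_def using CT(1) CI CS(1) MU_nonneg MP_nonneg \<nu>_pos
      by (intro add_nonneg_pos add_nonneg_nonneg mult_nonneg_nonneg) auto
    fix N n :: nat and h x y :: real assume n: "1 \<le> n" "n \<le> N" and xi: "x \<in> {0<..<L}" and yi: "y \<in> {0<..<L}" and h: "h \<noteq> 0"
      and x: "x - h \<in> {0..L}" "x + h \<in> {0..L}" and y: "y - h \<in> {0..L}" "y + h \<in> {0..L}"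
    have xy: "x \<in> {0..L}" "y \<in> {0..L}" using xi yi by auto
    define c where "c = tstar \<sigma> (t N) n"
    define e where "e = time_error N n"
    have e: "0 \<le> e" "t N n powr \<beta> * real n powr (- 2) \<le> e" "real n powr (- min (r * (\<beta> + 1)) (3 - \<beta>)) \<le> e"
      using time_error_ge by (auto simp: e_def)
    have c: "0 < c" "c \<le> T" and cI: "c \<in> {0<..T}" "c \<in> {0..T}" using tstar_bounds[OF n] by (auto simp: c_def)
    have "\<bar>\<delta> N (\<lambda>k. p x y (t N k)) n - frac_deriv (V 1 x y) c\<bar> \<le> CT * (MP * real n powr (- min (r * (\<beta> + 1)) (3 - \<beta>)))"
      using CT(2)[OF V_reg[OF xy] n] by (simp only: c_def)
    also have "\<dots> \<le> CT * (MP * e)" using CT(1) MP_nonneg e by (intro mult_left_mono) auto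
    finally have 1: "\<bar>\<delta> N (\<lambda>k. p x y (t N k)) n - frac_deriv (V 1 x y) c\<bar> \<le> CT * (MP * e)" .
    have "\<nu> * \<bar>1 / h\<^sup>2 * stencil h ubar x y c - laplacian L (\<lambda>x y. ubar x y c) x y\<bar> \<le> \<nu> * (CS * h\<^sup>2)"
      using CS(2)[OF x y h cI(2)] \<nu>_pos by (intro mult_left_mono) auto
    then have 2: "\<bar>\<nu> * (1 / h\<^sup>2 * stencil h ubar x y c - laplacian L (\<lambda>x y. ubar x y c) x y)\<bar> \<le> \<nu> * (CS * h\<^sup>2)"
      using \<nu>_pos by (simp add: abs_mult)
    have "\<bar>stencil h ubar x y c - vstar \<sigma> (\<lambda>k. stencil h ubar x y (t N k)) n\<bar> \<le> CI * (4 * MU * h\<^sup>2 * (t N n powr \<beta> * real n powr (- 2)))"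
      using interpolation_error[OF U_reg_laplacian[OF x y] n] by (simp only: c_def CI_def stencil_def)
    also have "\<dots> \<le> CI * (4 * MU * h\<^sup>2 * e)" using CI MU_nonneg e by (intro mult_left_mono) auto
    finally have "\<nu> * (1 / h\<^sup>2 * \<bar>stencil h ubar x y c - vstar \<sigma> (\<lambda>k. stencil h ubar x y (t N k)) n\<bar>) \<le> \<nu> * (1 / h\<^sup>2 * (CI * (4 * MU * h\<^sup>2 * e)))"
      using \<nu>_pos by (intro mult_left_mono) auto
    also have "\<dots> = \<nu> * (CI * (4 * MU)) * e" using h by simp
    finally have 3: "\<bar>\<nu> * (1 / h\<^sup>2 * (stencil h ubar x y c - vstar \<sigma> (\<lambda>k. stencil h ubar x y (t N k)) n))\<bar> \<le> \<nu> * (CI * (4 * MU)) * e"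
      using \<nu>_pos by (simp add: abs_mult)
    have 4: "\<bar>F_lin \<kappa> \<sigma> (\<lambda>k. u x y (t N k)) n - sgf \<kappa> (u x y c)\<bar> \<le> \<kappa>\<^sup>2 * (K\<^sup>2 * (Q\<^sup>2 * T powr (2 - \<beta>)) + CI * MU) * e"
    proof -
      have cs: "0 \<le> c - t N (n - 1)" using tstar_bounds(1)[OF n] by (simp add: c_def)
      have cs': "c - t N (n - 1) \<le> mstep (t N) n" using tstar_bounds(2)[OF n] unfolding c_def mstep_def by linarith
      have tI: "t N (n - 1) \<in> {0..T}" using t_nonneg[of "n - 1" N] t_le_T[of N "n - 1"] n by auto
      have "\<bar>u x y c - u x y (t N (n - 1))\<bar> \<le> K * \<bar>c - t N (n - 1)\<bar>" by (rule K(2)[OF xy cI(2) tI])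
      also have "\<dots> \<le> K * mstep (t N) n" using cs cs' K(1) by (intro mult_left_mono) auto
      finally have "\<bar>u x y c - u x y (t N (n - 1))\<bar>\<^sup>2 \<le> (K * mstep (t N) n)\<^sup>2" by (intro power_mono) auto
      also have "\<dots> \<le> K\<^sup>2 * (Q\<^sup>2 * T powr (2 - \<beta>) * e)"
        unfolding power_mult_distrib using e(2) by (intro mult_left_mono order_trans[OF step_squared_le[OF n]]) auto
      finally have a: "(u x y c - u x y (t N (n - 1)))\<^sup>2 \<le> K\<^sup>2 * (Q\<^sup>2 * T powr (2 - \<beta>) * e)" by simp
      have "u x y c - vstar \<sigma> (\<lambda>k. u x y (t N k)) n = ubar x y c - vstar \<sigma> (\<lambda>k. ubar x y (t N k)) n"
        unfolding u_eq vstar_def c_def tstar_bounds(4)[OF n] by (simp add: algebra_simps)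
      then have "\<bar>u x y c - vstar \<sigma> (\<lambda>k. u x y (t N k)) n\<bar> \<le> CI * (MU * (t N n powr \<beta> * real n powr (- 2)))"
        using interpolation_error[OF U_reg[OF xy] n] by (simp only: c_def CI_def)
      also have "\<dots> \<le> CI * (MU * e)" using CI MU_nonneg e by (intro mult_left_mono) auto
      finally have b: "\<bar>u x y c - vstar \<sigma> (\<lambda>k. u x y (t N k)) n\<bar> \<le> CI * (MU * e)" .
      have "\<bar>F_lin \<kappa> \<sigma> (\<lambda>k. u x y (t N k)) n - sgf \<kappa> (u x y c)\<bar>
        \<le> \<kappa>\<^sup>2 * ((u x y c - u x y (t N (n - 1)))\<^sup>2 + \<bar>u x y c - vstar \<sigma> (\<lambda>k. u x y (t N k)) n\<bar>)" by (rule F_lin_consistency)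
      also have "\<dots> \<le> \<kappa>\<^sup>2 * (K\<^sup>2 * (Q\<^sup>2 * T powr (2 - \<beta>) * e) + CI * (MU * e))" by (intro mult_left_mono add_mono a b) simp
      finally show ?thesis by (simp add: algebra_simps)
    qed
    define S where "S = stencil h ubar x y c"
    define Sv where "Sv = vstar \<sigma> (\<lambda>k. stencil h ubar x y (t N k)) n"
    have "frac_deriv (V 1 x y) c - \<nu> * laplacian L (\<lambda>x y. ubar x y c) x y + sgf \<kappa> (u x y c) = \<nu> * c * laplacian L \<phi> x y"
      by (rule equation[OF xi yi cI(1)])
    then have eq: "res_p h N n x y = (\<delta> N (\<lambda>k. p x y (t N k)) n - frac_deriv (V 1 x y) c)
      - \<nu> * (1 / h\<^sup>2 * S - laplacian L (\<lambda>x y. ubar x y c) x y) + \<nu> * (1 / h\<^sup>2 * (S - Sv)) + (F_lin \<kappa> \<sigma> (\<lambda>k. u x y (t N k)) n - sgf \<kappa> (u x y c))"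
      unfolding res_p_def Sv_def[symmetric] c_def[symmetric] right_diff_distrib by linarith
    have tri: "\<bar>a - b + c + d\<bar> \<le> A + B + C' + D" if "\<bar>a\<bar> \<le> A" "\<bar>b\<bar> \<le> B" "\<bar>c\<bar> \<le> C'" "\<bar>d\<bar> \<le> D" for a b c d A B C' D :: real
      using that by linarith
    have "\<bar>res_p h N n x y\<bar> \<le> CT * (MP * e) + \<nu> * (CS * h\<^sup>2) + \<nu> * (CI * (4 * MU)) * e + \<kappa>\<^sup>2 * (K\<^sup>2 * (Q\<^sup>2 * T powr (2 - \<beta>)) + CI * MU) * e"
      unfolding eq by (rule tri[OF 1 2[folded S_def] 3[folded S_def Sv_def] 4])
    also have "\<dots> = (CT * MP + \<nu> * (CI * (4 * MU)) + \<kappa>\<^sup>2 * (K\<^sup>2 * (Q\<^sup>2 * T powr (2 - \<beta>)) + CI * MU)) * e + \<nu> * CS * h\<^sup>2"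
      by (simp only: distrib_right mult.assoc)
    also have "\<dots> \<le> C * e + C * h\<^sup>2"
    proof (intro add_mono mult_right_mono)
      show "CT * MP + \<nu> * (CI * (4 * MU)) + \<kappa>\<^sup>2 * (K\<^sup>2 * (Q\<^sup>2 * T powr (2 - \<beta>)) + CI * MU) \<le> C"
        using \<nu>_pos CS(1) by (simp add: C_def)
      have "0 \<le> CT * MP" "0 \<le> \<nu> * (CI * (4 * MU))" "0 \<le> \<kappa>\<^sup>2 * (K\<^sup>2 * (Q\<^sup>2 * T powr (2 - \<beta>)) + CI * MU)"
        using CT(1) CI MU_nonneg MP_nonneg \<nu>_pos by auto
      then show "\<nu> * CS \<le> C" unfolding C_def by linarith
    qed (use e in auto)
    finally show "\<bar>res_p h N n x y\<bar> \<le> C * (time_error N n + h\<^sup>2)" by (simp add: e_def distrib_left)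
  qed
qed

end

section \<open>The error estimate\<close>

context sine_gordon
begin

lemma grid_vec_\<delta>:
  assumes n: "1 \<le> n" "n \<le> N"
  shows "\<delta> N (\<lambda>k. grid_vec h \<nu> (a k) (b k) x) n = grid_vec h \<nu> (\<lambda>i j. \<delta> N (\<lambda>k. a k i j) n) (\<lambda>i j. \<delta> N (\<lambda>k. b k i j) n) x"
proof -
  obtain c i j where "x = (c, i, j)" by (cases x)
  then show ?thesis by (simp add: grid_vec_def \<delta>_linear[OF n])
qed

lemma grid_vec_vstar:
  "vstar \<sigma> (\<lambda>k. grid_vec h \<nu> (a k) (b k) x) n = grid_vec h \<nu> (\<lambda>i j. vstar \<sigma> (\<lambda>k. a k i j) n) (\<lambda>i j. vstar \<sigma> (\<lambda>k. b k i j) n) x"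
proof -
  obtain c i j where "x = (c, i, j)" by (cases x)
  then show ?thesis by (simp add: grid_vec_def vstar_def algebra_simps)
qed

text \<open>The errors solve the scheme with \<open>res_p\<close> and \<open>res_u\<close> as sources, and vanish initially and on the boundary; the energy estimate
  turns this into the hypothesis of \<open>gronwall_rate\<close> for the energy norm.\<close>

theorem error_estimate:
  obtains C \<tau>0 where "0 < C" "0 < \<tau>0" "\<And>N M P Ub m. 1 \<le> M \<Longrightarrow> 1 \<le> m \<Longrightarrow> m \<le> N \<Longrightarrow> max_step N (t N) \<le> \<tau>0 \<Longrightarrow>
    scheme_solution L \<beta> \<sigma> \<nu> \<kappa> \<psi> \<phi> N (t N) M P Ub \<Longrightarrow>
    grid_norm (L / real M) M (\<lambda>i j. p (real i * (L / real M)) (real j * (L / real M)) (t N m) - P m i j)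
      + grid_grad_norm (L / real M) M (\<lambda>i j. ubar (real i * (L / real M)) (real j * (L / real M)) (t N m) - Ub m i j)
    \<le> C * rate (t N 1) (t N m) ((L / real M)\<^sup>2)"
proof -
  obtain CU where CU: "0 < CU" "\<And>N n x x' y. 1 \<le> n \<Longrightarrow> n \<le> N \<Longrightarrow> x \<in> {0..L} \<Longrightarrow> x' \<in> {0..L} \<Longrightarrow> y \<in> {0..L} \<Longrightarrow>
      \<bar>res_u N n x y - res_u N n x' y\<bar> \<le> \<bar>x - x'\<bar> * (CU * time_error N n)"
    "\<And>N n x x' y. 1 \<le> n \<Longrightarrow> n \<le> N \<Longrightarrow> x \<in> {0..L} \<Longrightarrow> x' \<in> {0..L} \<Longrightarrow> y \<in> {0..L} \<Longrightarrow>
      \<bar>res_u N n y x - res_u N n y x'\<bar> \<le> \<bar>x - x'\<bar> * (CU * time_error N n)"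
    by (rule res_u_difference) blast
  obtain CP where CP: "0 < CP" "\<And>N n h x y. 1 \<le> n \<Longrightarrow> n \<le> N \<Longrightarrow> x \<in> {0<..<L} \<Longrightarrow> y \<in> {0<..<L} \<Longrightarrow> h \<noteq> 0 \<Longrightarrow>
    x - h \<in> {0..L} \<Longrightarrow> x + h \<in> {0..L} \<Longrightarrow> y - h \<in> {0..L} \<Longrightarrow> y + h \<in> {0..L} \<Longrightarrow>
    \<bar>res_p h N n x y\<bar> \<le> CP * (time_error N n + h\<^sup>2)"
    by (rule res_p_bound) blast
  obtain K where K: "0 \<le> K" "\<And>x y s s'. x \<in> {0..L} \<Longrightarrow> y \<in> {0..L} \<Longrightarrow> s \<in> {0..T} \<Longrightarrow> s' \<in> {0..T} \<Longrightarrow>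
    \<bar>u x y s - u x y s'\<bar> \<le> K * \<bar>s - s'\<bar>" by (rule u_lipschitz) blast
  define KF where "KF = \<kappa>\<^sup>2 * (2 + K * T)"
  have KF: "0 \<le> KF" using K T_pos by (simp add: KF_def)
  define lam where "lam = KF * (L / sqrt \<nu>)"
  have lam: "0 \<le> lam" using KF L_pos \<nu>_pos by (simp add: lam_def)
  define A where "A = 2 * L * (1 + sqrt \<nu>) * (CU + CP)"
  have A: "0 < A" unfolding A_def using L_pos \<nu>_pos CU(1) CP(1) by (intro mult_pos_pos add_pos_pos) auto
  obtain CG \<tau>0 where G: "0 < CG" "0 < \<tau>0" "\<And>N m W A H. 1 \<le> m \<Longrightarrow> m \<le> N \<Longrightarrow> max_step N (t N) \<le> \<tau>0 \<Longrightarrow>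
    0 \<le> A \<Longrightarrow> 0 \<le> H \<Longrightarrow> W 0 = 0 \<Longrightarrow>
    (\<And>n. 1 \<le> n \<Longrightarrow> n \<le> m \<Longrightarrow> \<delta> N W n \<le> lam * (W n + W (n - 1)) +
       A * (real n powr (- min (r * (\<beta> + 1)) (3 - \<beta>)) + t N n powr \<beta> * real n powr (- 2) + H)) \<Longrightarrow>
    W m \<le> CG * (A * rate (t N 1) (t N m) H)"
    by (rule gronwall_rate[OF lam]) blast
  show thesis
  proof (rule that[of "(1 + 1 / sqrt \<nu>) * (CG * A)" \<tau>0])
    show "0 < (1 + 1 / sqrt \<nu>) * (CG * A)" using G(1) A \<nu>_pos by (intro mult_pos_pos add_pos_pos) auto
    show "0 < \<tau>0" by (rule G(2))
    fix N M P Ub m assume M: "1 \<le> M" and m: "1 \<le> m" "m \<le> N" and \<tau>: "max_step N (t N) \<le> \<tau>0"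
      and sch: "scheme_solution L \<beta> \<sigma> \<nu> \<kappa> \<psi> \<phi> N (t N) M P Ub"
    define h where "h = L / real M"
    have h: "0 < h" "h \<noteq> 0" using L_pos M by (auto simp: h_def)
    have N1: "1 \<le> N" using m by auto
    define X where "X i = real i * h" for i :: nat
    have X: "X i \<in> {0..L}" if "i \<le> M" for i
    proof -
      have "real i * L \<le> L * real M" using that L_pos by (simp add: mult.commute)
      then show ?thesis using that M L_pos by (simp add: X_def h_def field_simps)
    qed
    have XS: "X i - X (i - 1) = h" if "1 \<le> i" for i using that by (simp add: X_def of_nat_diff algebra_simps)
    have Xh: "X i - h \<in> {0..L}" "X i + h \<in> {0..L}" "X i \<in> {0<..<L}" if i: "i \<in> {1..M - 1}" for i
    proof -
      have "X i - h = X (i - 1)" "X i + h = X (Suc i)" using i by (auto simp: X_def of_nat_diff algebra_simps)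
      then show 1: "X i - h \<in> {0..L}" "X i + h \<in> {0..L}" using X[of "i - 1"] X[of "Suc i"] i by auto
      show "X i \<in> {0<..<L}" using 1 h by auto
    qed
    have X0: "X 0 = 0" and XM: "X M = L" using M by (auto simp: X_def h_def)
    have Xb: "X i \<in> {0, L} \<or> X j \<in> {0, L}" if "i \<in> {0, M} \<or> j \<in> {0, M}" for i j using that X0 XM by auto
    define Uh where "Uh n i j = Ub n i j + t N n * \<phi> (X i) (X j)" for n i j
    have s1: "\<delta> N (\<lambda>k. P k i j) n - \<nu> * laplacian_h h (\<lambda>i j. vstar \<sigma> (\<lambda>k. Ub k i j) n) i j + F_lin \<kappa> \<sigma> (\<lambda>k. Uh k i j) n
        = \<nu> * tstar \<sigma> (t N) n * laplacian L \<phi> (X i) (X j)"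
      and s2: "\<delta> N (\<lambda>k. Ub k i j) n = vstar \<sigma> (\<lambda>k. P k i j) n"
      if "n \<in> {1..N}" "i \<in> {1..M - 1}" "j \<in> {1..M - 1}" for n i j
      using sch that unfolding scheme_solution_def Let_def h_def[symmetric] Uh_def X_def by blast+
    have s0: "Ub 0 i j = \<psi> (X i) (X j)" "P 0 i j = 0" if "i \<in> {1..M - 1}" "j \<in> {1..M - 1}" for i j
      using sch that unfolding scheme_solution_def Let_def h_def[symmetric] X_def by blast+
    have sb: "Ub n i j = 0" "P n i j = 0" if "n \<le> N" "i \<le> M" "j \<le> M" "i \<in> {0, M} \<or> j \<in> {0, M}" for n i j
      using sch that unfolding scheme_solution_def Let_def by blast+
    define pt where "pt k i j = p (X i) (X j) (t N k) - P k i j" for k i j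
    define ut where "ut k i j = ubar (X i) (X j) (t N k) - Ub k i j" for k i j
    have tI: "t N k \<in> {0..T}" if "k \<le> N" for k using t_nonneg[OF that N1] t_le_T[OF N1 that] by auto
    have node: "i \<in> {1..M - 1} \<and> j \<in> {1..M - 1} \<or> (i \<in> {0, M} \<or> j \<in> {0, M})" if "i \<le> M" "j \<le> M" for i j
      using that by auto
    have eb: "ubar (X i) (X j) (t N k) = 0" "p (X i) (X j) (t N k) = 0" "ut k i j = 0" "pt k i j = 0"
      if "k \<le> N" "i \<le> M" "j \<le> M" "i \<in> {0, M} \<or> j \<in> {0, M}" for k i j
    proof -
      show "ubar (X i) (X j) (t N k) = 0" using that by (intro ubar_boundary X Xb tI)
      then show "ut k i j = 0" using sb that by (simp add: ut_def)
      show "p (X i) (X j) (t N k) = 0" using that by (intro p_boundary X Xb tI)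
      then show "pt k i j = 0" using sb that by (simp add: pt_def)
    qed
    have e0: "ut 0 i j = 0" "pt 0 i j = 0" if ij: "i \<le> M" "j \<le> M" for i j
    proof -
      have "ut 0 i j = 0 \<and> pt 0 i j = 0"
      proof (cases "i \<in> {1..M - 1} \<and> j \<in> {1..M - 1}")
        case True
        have "\<forall>x\<in>{0<..<L}. \<forall>y\<in>{0<..<L}. u x y 0 = \<psi> x y" using sol unfolding sine_gordon_solution_def by (elim conjE)
        then have "u (X i) (X j) 0 = \<psi> (X i) (X j)" using True Xh(3) by simp
        then show ?thesis using s0 True t_0[OF N1] by (simp add: ut_def pt_def p_0 ubar_eq)
      next
        case False
        then show ?thesis using eb(3,4)[of 0 i j] node[OF ij] ij by auto
      qed
      then show "ut 0 i j = 0" "pt 0 i j = 0" by auto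
    qed
    define I where "I = grid_index M"
    define e where "e k = grid_vec h \<nu> (pt k) (ut k)" for k
    define W where "W k = L2_set (e k) I" for k
    have e00: "e 0 x = 0" if "x \<in> I" for x
    proof -
      obtain c i j where x: "x = (c, i, j)" by (cases x)
      have "i \<le> M" "j \<le> M" using that unfolding I_def grid_index_def x by auto
      then show ?thesis by (simp add: e_def grid_vec_def x e0)
    qed
    have W0: "W 0 = 0" using e00 by (simp add: W_def L2_set_0')
    have step: "\<delta> N W n \<le> lam * (W n + W (n - 1)) +
       A * (real n powr (- min (r * (\<beta> + 1)) (3 - \<beta>)) + t N n powr \<beta> * real n powr (- 2) + h\<^sup>2)" if n: "1 \<le> n" "n \<le> m" for n
    proof -
      have nN: "1 \<le> n" "n \<le> N" "n - 1 \<le> N" using n m by auto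
      define dp where "dp i j = \<delta> N (\<lambda>k. pt k i j) n" for i j
      define du where "du i j = \<delta> N (\<lambda>k. ut k i j) n" for i j
      define ps where "ps i j = vstar \<sigma> (\<lambda>k. pt k i j) n" for i j
      define us where "us i j = vstar \<sigma> (\<lambda>k. ut k i j) n" for i j
      define dF where "dF i j = F_lin \<kappa> \<sigma> (\<lambda>k. Uh k i j) n - F_lin \<kappa> \<sigma> (\<lambda>k. u (X i) (X j) (t N k)) n" for i j
      define rp where "rp i j = res_p h N n (X i) (X j)" for i j
      define ru where "ru i j = res_u N n (X i) (X j)" for i j
      have dpe: "dp i j = \<nu> * laplacian_h h us i j + (rp i j + dF i j)" if ij: "i \<in> {1..M - 1}" "j \<in> {1..M - 1}" for i j
      proof -
        have l: "laplacian_h h us i j = 1 / h\<^sup>2 * vstar \<sigma> (\<lambda>k. stencil h ubar (X i) (X j) (t N k)) n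
          - laplacian_h h (\<lambda>i j. vstar \<sigma> (\<lambda>k. Ub k i j) n) i j"
          unfolding us_def[abs_def] ut_def laplacian_h_diff using ij h unfolding X_def by (subst laplacian_h_stencil) auto
        show ?thesis
          using s1[of n i j] ij nN unfolding dp_def pt_def \<delta>_linear(1)[OF nN(1,2)] l rp_def dF_def res_p_def right_diff_distrib by auto
      qed
      have due: "du i j = ps i j + ru i j" if ij: "i \<le> M" "j \<le> M" for i j
      proof (cases "i \<in> {1..M - 1} \<and> j \<in> {1..M - 1}")
        case True
        then show ?thesis using s2[of n i j] nN
          by (simp add: du_def ut_def ps_def pt_def \<delta>_linear(1)[OF nN(1,2)] ru_def res_u_def vstar_def algebra_simps)
      next
        case False
        then have b: "i \<in> {0, M} \<or> j \<in> {0, M}" using node[OF ij] by blast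
        have z: "\<delta> N v n = 0" if "\<And>k. k \<le> N \<Longrightarrow> v k = 0" for v
          using \<delta>_cong[OF nN(1,2), of v "\<lambda>k. 0"] \<delta>_linear(3)[OF nN(1,2)] that nN by auto
        have "du i j = 0" unfolding du_def by (rule z) (rule eb(3)[OF _ ij b])
        moreover have "\<delta> N (\<lambda>k. ubar (X i) (X j) (t N k)) n = 0" by (rule z) (rule eb(1)[OF _ ij b])
        ultimately show ?thesis using eb[OF nN(2) ij b] eb[OF nN(3) ij b] by (simp add: ps_def ru_def res_u_def vstar_def)
      qed
      have psb: "ps i j = 0" if "i \<le> M" "j \<le> M" "i \<in> {0, M} \<or> j \<in> {0, M}" for i j
        using eb(4)[OF nN(2) that] eb(4)[OF nN(3) that] by (simp add: ps_def vstar_def)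
      define B where "B = (CU + CP) * (time_error N n + h\<^sup>2)"
      have te: "0 \<le> time_error N n" by (rule time_error_ge)
      have B: "0 \<le> B" "CU * time_error N n \<le> B" "CP * (time_error N n + h\<^sup>2) \<le> B"
      proof -
        have "CU * time_error N n \<le> (CU + CP) * (time_error N n + h\<^sup>2)" using te CU(1) CP(1) by (intro mult_mono) auto
        moreover have "CP * (time_error N n + h\<^sup>2) \<le> (CU + CP) * (time_error N n + h\<^sup>2)" using te CU(1) by (intro mult_right_mono) auto
        moreover have "0 \<le> CU * time_error N n" using te CU(1) by simp
        ultimately show "0 \<le> B" "CU * time_error N n \<le> B" "CP * (time_error N n + h\<^sup>2) \<le> B" by (auto simp: B_def)
      qed
      have res: "L2_set (grid_vec h \<nu> rp ru) I \<le> 2 * L * (1 + sqrt \<nu>) * B"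
        unfolding I_def
      proof (rule grid_vec_sup_bound[OF h_def L_pos M \<nu>_pos B(1)])
        fix i j assume ij: "i \<in> {1..M - 1}" "j \<in> {1..M - 1}"
        show "\<bar>rp i j\<bar> \<le> B" unfolding rp_def
          using CP(2)[OF nN(1,2) Xh(3)[OF ij(1)] Xh(3)[OF ij(2)] h(2) Xh(1,2)[OF ij(1)] Xh(1,2)[OF ij(2)]] B(3) by linarith
      next
        fix i j assume ij: "i \<in> {1..M}" "j \<le> M"
        have "\<bar>ru i j - ru (i - 1) j\<bar> \<le> \<bar>X i - X (i - 1)\<bar> * (CU * time_error N n)"
          unfolding ru_def using ij by (intro CU(2) nN X) auto
        also have "\<dots> \<le> h * B" using XS[of i] ij h B(2) by simp
        finally show "\<bar>ru i j - ru (i - 1) j\<bar> \<le> h * B" .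
      next
        fix i j assume ij: "i \<le> M" "j \<in> {1..M}"
        have "\<bar>ru i j - ru i (j - 1)\<bar> \<le> \<bar>X j - X (j - 1)\<bar> * (CU * time_error N n)"
          unfolding ru_def using ij by (intro CU(3) nN X) auto
        also have "\<dots> \<le> h * B" using XS[of j] ij h B(2) by simp
        finally show "\<bar>ru i j - ru i (j - 1)\<bar> \<le> h * B" .
      qed
      have gp: "grid_norm h M (ut k) \<le> L / sqrt \<nu> * W k" if k: "k \<le> N" for k
      proof -
        have "grid_norm h M (ut k) \<le> L * grid_grad_norm h M (ut k)"
          using eb(3)[OF k] by (intro grid_poincare[OF h_def L_pos M]) auto
        also have "\<dots> \<le> L * (1 / sqrt \<nu> * W k)"
          using grid_vec_norm(2)[OF h(1) \<nu>_pos, of M "ut k" "pt k"] L_pos unfolding W_def e_def I_def by (intro mult_left_mono) auto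
        finally show ?thesis by simp
      qed
      have nl: "L2_set (grid_vec h \<nu> dF (\<lambda>i j. 0)) I \<le> lam * (W n + W (n - 1))"
      proof -
        have "L2_set (grid_vec h \<nu> dF (\<lambda>i j. 0)) I = grid_norm h M dF" unfolding I_def by (rule grid_norm_eq_L2_set[OF h(1), symmetric])
        also have "\<dots> \<le> KF * (grid_norm h M (ut n) + grid_norm h M (ut (n - 1)))"
        proof (rule grid_norm_le_sum[OF h(1) KF])
          fix i j assume ij: "i \<in> {1..M - 1}" "j \<in> {1..M - 1}"
          then have Xij: "X i \<in> {0..L}" "X j \<in> {0..L}" using X by auto
          define a where "a k = u (X i) (X j) (t N k)" for k
          have "\<bar>a n - a (n - 1)\<bar> \<le> K * \<bar>t N n - t N (n - 1)\<bar>" unfolding a_def by (rule K(2)[OF Xij tI[OF nN(2)] tI[OF nN(3)]])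
          also have "\<dots> \<le> K * T" using tI[OF nN(2)] tI[OF nN(3)] K(1) by (intro mult_left_mono) auto
          finally have aK: "\<bar>a n - a (n - 1)\<bar> \<le> K * T" .
          have au: "a k - Uh k i j = ut k i j" for k by (simp add: a_def Uh_def ut_def u_eq)
          have "\<bar>F_lin \<kappa> \<sigma> a n - F_lin \<kappa> \<sigma> (\<lambda>k. Uh k i j) n\<bar> \<le> KF * (\<bar>ut n i j\<bar> + \<bar>ut (n - 1) i j\<bar>)"
            using F_lin_lipschitz[of \<sigma> a n "K * T" \<kappa> "\<lambda>k. Uh k i j"] aK \<sigma>_bounds unfolding au KF_def by simp
          then show "\<bar>dF i j\<bar> \<le> KF * (\<bar>ut n i j\<bar> + \<bar>ut (n - 1) i j\<bar>)" by (simp add: dF_def a_def[abs_def] abs_minus_commute)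
        qed
        also have "\<dots> \<le> KF * (L / sqrt \<nu> * W n + L / sqrt \<nu> * W (n - 1))"
          using KF by (intro mult_left_mono add_mono gp nN)
        also have "\<dots> = lam * (W n + W (n - 1))" by (simp add: lam_def algebra_simps)
        finally show ?thesis .
      qed
      define R where "R = 2 * L * (1 + sqrt \<nu>) * B + lam * (W n + W (n - 1))"
      have "(\<Sum>x\<in>I. \<delta> N (\<lambda>k. e k x) n * vstar \<sigma> (\<lambda>k. e k x) n) = (\<Sum>x\<in>I. grid_vec h \<nu> dp du x * grid_vec h \<nu> ps us x)"
        by (simp add: e_def grid_vec_\<delta>[OF nN(1,2)] grid_vec_vstar dp_def[abs_def] du_def[abs_def] ps_def[abs_def] us_def[abs_def])
      also have "\<dots> = (\<Sum>x\<in>I. grid_vec h \<nu> (\<lambda>i j. rp i j + dF i j) ru x * grid_vec h \<nu> ps us x)"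
        unfolding I_def by (rule energy_identity[OF h(1) \<nu>_pos psb dpe due])
      also have "\<dots> \<le> L2_set (grid_vec h \<nu> (\<lambda>i j. rp i j + dF i j) ru) I * L2_set (grid_vec h \<nu> ps us) I" by (rule L2_set_cauchy)
      also have "\<dots> \<le> R * L2_set (grid_vec h \<nu> ps us) I"
      proof (rule mult_right_mono)
        have "grid_vec h \<nu> (\<lambda>i j. rp i j + dF i j) ru = (\<lambda>x. grid_vec h \<nu> rp ru x + grid_vec h \<nu> dF (\<lambda>i j. 0) x)"
          by (auto simp: grid_vec_def fun_eq_iff distrib_left)
        then have "L2_set (grid_vec h \<nu> (\<lambda>i j. rp i j + dF i j) ru) I \<le> L2_set (grid_vec h \<nu> rp ru) I + L2_set (grid_vec h \<nu> dF (\<lambda>i j. 0)) I"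
          using L2_set_triangle_ineq[of "grid_vec h \<nu> rp ru" "grid_vec h \<nu> dF (\<lambda>i j. 0)" I] by simp
        then show "L2_set (grid_vec h \<nu> (\<lambda>i j. rp i j + dF i j) ru) I \<le> R" using res nl by (simp add: R_def)
      qed simp
      also have "grid_vec h \<nu> ps us = (\<lambda>x. vstar \<sigma> (\<lambda>k. e k x) n)"
        by (simp add: e_def grid_vec_vstar ps_def[abs_def] us_def[abs_def])
      finally have en: "(\<Sum>x\<in>I. \<delta> N (\<lambda>k. e k x) n * vstar \<sigma> (\<lambda>k. e k x) n) \<le> R * L2_set (\<lambda>x. vstar \<sigma> (\<lambda>k. e k x) n) I" .
      have R0: "0 \<le> R" unfolding R_def using B(1) lam L_pos \<nu>_pos by (auto simp: W_def intro!: add_nonneg_nonneg mult_nonneg_nonneg)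
      have "\<delta> N W n \<le> R"
        using energy_estimate[OF P2[OF N1] nN(1,2) e00 en R0] by (simp only: W_def[abs_def])
      also have "R = lam * (W n + W (n - 1)) + A * (real n powr (- min (r * (\<beta> + 1)) (3 - \<beta>)) + t N n powr \<beta> * real n powr (- 2) + h\<^sup>2)"
        unfolding R_def B_def A_def time_error_def by (simp only: mult.assoc)
      finally show ?thesis .
    qed
    have "W m \<le> CG * (A * rate (t N 1) (t N m) (h\<^sup>2))"
      by (rule G(3)[OF m \<tau> _ _ W0 step]) (use A in auto)
    then have "(1 + 1 / sqrt \<nu>) * W m \<le> (1 + 1 / sqrt \<nu>) * (CG * (A * rate (t N 1) (t N m) (h\<^sup>2)))"
      using \<nu>_pos by (intro mult_left_mono) auto
    then have "grid_norm h M (pt m) + grid_grad_norm h M (ut m) \<le> (1 + 1 / sqrt \<nu>) * (CG * A) * rate (t N 1) (t N m) (h\<^sup>2)"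
      using grid_vec_norm(1)[OF h(1) \<nu>_pos, of M "pt m" "ut m"] unfolding W_def e_def I_def mult.assoc by linarith
    then show "grid_norm (L / real M) M (\<lambda>i j. p (real i * (L / real M)) (real j * (L / real M)) (t N m) - P m i j)
      + grid_grad_norm (L / real M) M (\<lambda>i j. ubar (real i * (L / real M)) (real j * (L / real M)) (t N m) - Ub m i j)
      \<le> (1 + 1 / sqrt \<nu>) * (CG * A) * rate (t N 1) (t N m) ((L / real M)\<^sup>2)"
      unfolding h_def[symmetric] pt_def[abs_def] ut_def[abs_def] X_def .
  qed
qed

end

text \<open>The condition on the steps says \<open>\<tau>\<^sub>n \<simeq> t\<^sub>n / n\<close>, because \<open>\<tau>\<^sub>1\<^sup>1\<^sup>/\<^sup>r \<simeq> t\<^sub>n\<^sup>1\<^sup>/\<^sup>r / n\<close>.\<close>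

lemma quasi_graded_bounds:
  fixes r :: real
  assumes r: "1 \<le> r" and mesh: "\<forall>N\<ge>1. is_mesh T N (t N)" and qg: "quasi_graded r t"
  obtains Q where "1 \<le> Q" "\<And>N n. 1 \<le> n \<Longrightarrow> n \<le> N \<Longrightarrow> t N n \<le> Q * (t N 1 * real n powr r)"
    "\<And>N n. 1 \<le> n \<Longrightarrow> n \<le> N \<Longrightarrow> t N 1 * real n powr r \<le> Q * t N n"
    "\<And>N n. 1 \<le> n \<Longrightarrow> n \<le> N \<Longrightarrow> mstep (t N) n \<le> Q * (t N n / real n)"
    "\<And>N n. 1 \<le> n \<Longrightarrow> n \<le> N \<Longrightarrow> t N n / real n \<le> Q * mstep (t N) n"
proof -
  have m: "mesh_equiv t (\<lambda>N n. mstep (t N) 1 * real n powr r)"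
    "mesh_equiv (\<lambda>N. mstep (t N)) (\<lambda>N n. mstep (t N) 1 powr (1 / r) * t N n powr (1 - 1 / r))"
    using qg unfolding quasi_graded_def by (simp_all only:)
  obtain c1 C1 where a: "0 < c1" "0 < C1" "\<forall>N\<ge>1. \<forall>n\<in>{1..N}.
      c1 \<le> t N n / (mstep (t N) 1 * real n powr r) \<and> t N n / (mstep (t N) 1 * real n powr r) \<le> C1"
    using m(1) unfolding mesh_equiv_def by metis
  obtain c2 C2 where b: "0 < c2" "0 < C2" "\<forall>N\<ge>1. \<forall>n\<in>{1..N}.
      c2 \<le> mstep (t N) n / (mstep (t N) 1 powr (1 / r) * t N n powr (1 - 1 / r)) \<and>
      mstep (t N) n / (mstep (t N) 1 powr (1 / r) * t N n powr (1 - 1 / r)) \<le> C2"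
    using m(2) unfolding mesh_equiv_def by metis
  define q1 where "q1 = C1 + 1 / c1 + 1"
  define q where "q = (C2 + 1 / c2 + 1) * q1"
  have q1: "1 \<le> q1" "C1 \<le> q1" "1 / c1 \<le> q1" using a(1,2) by (auto simp: q1_def)
  have q2: "1 \<le> C2 + 1 / c2 + 1" using b(1,2) by auto
  have q: "1 \<le> q" "q1 \<le> q" "C2 * q1 \<le> q" "1 / c2 * q1 \<le> q"
  proof -
    show "q1 \<le> q" unfolding q_def using mult_right_mono[OF q2, of q1] q1 by simp
    then show "1 \<le> q" using q1 by simp
    show "C2 * q1 \<le> q" "1 / c2 * q1 \<le> q" unfolding q_def using b(1,2) q1 by (intro mult_right_mono; simp)+
  qed
  have T: "mstep (t N) 1 = t N 1" "0 < t N 1" "0 < t N n"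
    "t N n \<le> q1 * (t N 1 * real n powr r)" "t N 1 * real n powr r \<le> q1 * t N n"
    "mstep (t N) n \<le> q * (t N n / real n)" "t N n / real n \<le> q * mstep (t N) n"
    if n: "1 \<le> n" "n \<le> N" for N n
  proof -
    have mm: "is_mesh T N (t N)" using mesh n by simp
    have pos: "0 < t N k" if "1 \<le> k" "k \<le> N" for k
      using that
    proof (induction k rule: dec_induct)
      case base
      then show ?case using mm unfolding is_mesh_def by (metis One_nat_def Suc_le_lessD)
    next
      case (step k)
      then show ?case using mm unfolding is_mesh_def by (metis Suc_le_lessD Suc_leD less_trans)
    qed
    show m1: "mstep (t N) 1 = t N 1" using mm by (simp add: mstep_def is_mesh_def)
    show t1: "0 < t N 1" and tn: "0 < t N n" using pos n by auto
    have np: "0 < real n powr r" using n by simp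
    have dp: "0 < t N 1 * real n powr r" using t1 np by simp
    have A: "c1 \<le> t N n / (t N 1 * real n powr r)" "t N n / (t N 1 * real n powr r) \<le> C1"
      using a(3)[rule_format, of N n] n unfolding m1 by auto
    have "t N n \<le> C1 * (t N 1 * real n powr r)" using A(2) dp by (simp only: pos_divide_le_eq)
    also have "\<dots> \<le> q1 * (t N 1 * real n powr r)" using q1(2) dp by (intro mult_right_mono) auto
    finally show u: "t N n \<le> q1 * (t N 1 * real n powr r)" .
    have "c1 * (t N 1 * real n powr r) \<le> t N n" using A(1) dp by (simp only: pos_le_divide_eq)
    then have "t N 1 * real n powr r \<le> 1 / c1 * t N n" using a(1) by (simp add: field_simps)
    also have "\<dots> \<le> q1 * t N n" using q1(3) tn by (intro mult_right_mono) auto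
    finally show l: "t N 1 * real n powr r \<le> q1 * t N n" .
    define w where "w = t N 1 powr (1 / r) * t N n powr (1 - 1 / r)"
    have w: "0 < w" using t1 tn by (simp add: w_def)
    have root: "(t N 1 * real n powr r) powr (1 / r) = t N 1 powr (1 / r) * real n"
      using t1 n r by (simp add: powr_mult powr_powr)
    have qr: "(q1 * x) powr (1 / r) \<le> q1 * x powr (1 / r)" if "0 < x" for x
    proof -
      have "q1 powr (1 / r) \<le> q1 powr 1" using q1 r by (intro powr_mono) auto
      then show ?thesis using q1 that by (simp add: powr_mult mult_right_mono)
    qed
    have split: "t N n powr (1 / r) * t N n powr (1 - 1 / r) = t N n" using tn by (simp flip: powr_add)
    have w1: "real n * w \<le> q1 * t N n"
    proof -
      have "t N 1 powr (1 / r) * real n \<le> (q1 * t N n) powr (1 / r)"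
        unfolding root[symmetric] using l dp r by (intro powr_mono2) auto
      also have "\<dots> \<le> q1 * t N n powr (1 / r)" by (rule qr[OF tn])
      finally have "t N 1 powr (1 / r) * real n * t N n powr (1 - 1 / r) \<le> q1 * t N n powr (1 / r) * t N n powr (1 - 1 / r)"
        by (intro mult_right_mono) auto
      then show ?thesis by (simp only: w_def mult.assoc split mult.left_commute[of "real n"])
    qed
    have w2: "t N n \<le> q1 * (real n * w)"
    proof -
      have "t N n powr (1 / r) \<le> (q1 * (t N 1 * real n powr r)) powr (1 / r)" using u tn r by (intro powr_mono2) auto
      also have "\<dots> \<le> q1 * (t N 1 powr (1 / r) * real n)" using qr[OF dp] unfolding root .
      finally have "t N n powr (1 / r) * t N n powr (1 - 1 / r) \<le> q1 * (t N 1 powr (1 / r) * real n) * t N n powr (1 - 1 / r)"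
        by (intro mult_right_mono) auto
      then show ?thesis by (simp only: split) (simp only: w_def mult_ac)
    qed
    have Bb: "c2 \<le> mstep (t N) n / w" "mstep (t N) n / w \<le> C2"
      using b(3)[rule_format, of N n] n unfolding m1 w_def by auto
    have "mstep (t N) n \<le> C2 * w" using Bb(2) w by (simp only: pos_divide_le_eq)
    also have "\<dots> \<le> C2 * (q1 * t N n / real n)" using w1 n b(2) by (intro mult_left_mono) (auto simp: field_simps)
    also have "\<dots> = C2 * q1 * (t N n / real n)" by simp
    also have "\<dots> \<le> q * (t N n / real n)" using q(3) tn by (intro mult_right_mono) auto
    finally show "mstep (t N) n \<le> q * (t N n / real n)" .
    have cw: "c2 * w \<le> mstep (t N) n" using Bb(1) w by (simp only: pos_le_divide_eq)
    have m0: "0 \<le> mstep (t N) n" using cw w b(1) by (meson less_imp_le mult_pos_pos order_trans)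
    have "t N n / real n \<le> q1 * w" using w2 n by (simp add: field_simps)
    also have "\<dots> \<le> q1 * (1 / c2 * mstep (t N) n)" using cw b(1) q1 by (intro mult_left_mono) (auto simp: field_simps)
    also have "\<dots> = 1 / c2 * q1 * mstep (t N) n" by simp
    also have "\<dots> \<le> q * mstep (t N) n" using q(4) m0 by (intro mult_right_mono)
    finally show "t N n / real n \<le> q * mstep (t N) n" .
  qed
  show thesis
  proof (rule that[of q])
    fix N n assume n: "1 \<le> n" "n \<le> (N::nat)"
    have "q1 * (t N 1 * real n powr r) \<le> q * (t N 1 * real n powr r)" using q(2) T(2)[OF n] by (intro mult_right_mono) auto
    then show "t N n \<le> q * (t N 1 * real n powr r)" using T(4)[OF n] by linarith
    have "q1 * t N n \<le> q * t N n" using q(2) T(3)[OF n] by (intro mult_right_mono) auto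
    then show "t N 1 * real n powr r \<le> q * t N n" using T(5)[OF n] by linarith
    show "mstep (t N) n \<le> q * (t N n / real n)" "t N n / real n \<le> q * mstep (t N) n" by (rule T(6)[OF n], rule T(7)[OF n])
  qed (rule q(1))
qed

theorem theorem5p1:
  fixes L T \<nu> \<kappa> \<alpha> \<beta> \<sigma> r Creg :: real
    and \<psi> \<phi> :: "real \<Rightarrow> real \<Rightarrow> real"
    and u ubar p :: "real \<Rightarrow> real \<Rightarrow> real \<Rightarrow> real"
    and t :: "nat \<Rightarrow> nat \<Rightarrow> real"
  assumes "L > 0" and "T > 0" and "\<nu> > 0"
    and "1 < \<alpha>" and "\<alpha> < 2"
    and "\<beta> = \<alpha> / 2" and "\<sigma> = 1 - \<beta> / 2" and "r \<ge> 1"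
    and "C_space L 2 \<phi>"
    and "\<forall>x\<in>{0..L}. \<forall>y\<in>{0..L}. x \<in> {0, L} \<or> y \<in> {0, L} \<longrightarrow> \<phi> x y = 0"
    and "sine_gordon_solution L T \<alpha> \<nu> \<kappa> \<psi> \<phi> u"
    and "ubar = (\<lambda>x y s. u x y s - s * \<phi> x y)"
    and "p = (\<lambda>x y s. caputo \<beta> (ubar x y) s)"
    and "C_space_time L T 4 1 ubar"
    and "C_space_time L T 2 0 p"
    and "weakly_singular L T Creg \<alpha> ubar"
    and "weakly_singular L T Creg (\<alpha> / 2) p"
    and "\<forall>N\<ge>1. is_mesh T N (t N)"
    and "quasi_graded r t"
    and "\<forall>N\<ge>1. P1 \<beta> \<sigma> N (t N)"
    and "\<forall>N\<ge>1. P2 \<beta> \<sigma> N (t N)"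
  shows "\<exists>C>0. \<exists>\<tau>\<^sub>0>0. \<forall>N\<ge>1. \<forall>M\<ge>1. \<forall>P Ub.
     max_step N (t N) \<le> \<tau>\<^sub>0 \<and> scheme_solution L \<beta> \<sigma> \<nu> \<kappa> \<psi> \<phi> N (t N) M P Ub \<longrightarrow>
     (\<forall>n\<in>{1..N}.
        let h = L / real M;
            \<tau>\<^sub>1 = mstep (t N) 1;
            tn = t N n;
            perr = (\<lambda>i j. p (real i * h) (real j * h) tn - P n i j);
            uerr = (\<lambda>i j. ubar (real i * h) (real j * h) tn - Ub n i j)
        in grid_norm h M perr + grid_grad_norm h M uerr \<le> C *
          (if r \<le> 2 / (\<beta> + 1) then
             \<tau>\<^sub>1 * tn powr (\<beta> - 1) + h\<^sup>2 * tn powr \<beta>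
           else if r < 3 - \<beta> then
             \<tau>\<^sub>1 * tn powr (\<beta> - 1) + \<tau>\<^sub>1 powr (2 / r) * tn powr (2 * \<beta> - 2 / r)
               + h\<^sup>2 * tn powr \<beta>
           else if r = 3 - \<beta> then
             (1 + ln (tn / \<tau>\<^sub>1)) * \<tau>\<^sub>1 * tn powr (\<beta> - 1)
               + \<tau>\<^sub>1 powr (2 / r) * tn powr (2 * \<beta> - 2 / r) + h\<^sup>2 * tn powr \<beta>
           else
             \<tau>\<^sub>1 powr ((3 - \<beta>) / r) * tn powr (\<beta> - (3 - \<beta>) / r)
               + \<tau>\<^sub>1 powr (2 / r) * tn powr (2 * \<beta> - 2 / r) + h\<^sup>2 * tn powr \<beta>))"
proof -
  note a = assms
  obtain Q where Q: "1 \<le> Q" "\<And>N n. 1 \<le> n \<Longrightarrow> n \<le> N \<Longrightarrow> t N n \<le> Q * (t N 1 * real n powr r)"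
    "\<And>N n. 1 \<le> n \<Longrightarrow> n \<le> N \<Longrightarrow> t N 1 * real n powr r \<le> Q * t N n"
    "\<And>N n. 1 \<le> n \<Longrightarrow> n \<le> N \<Longrightarrow> mstep (t N) n \<le> Q * (t N n / real n)"
    "\<And>N n. 1 \<le> n \<Longrightarrow> n \<le> N \<Longrightarrow> t N n / real n \<le> Q * mstep (t N) n"
    by (rule quasi_graded_bounds[OF a(8,18,19)]) blast
  have \<alpha>: "\<alpha> / 2 = \<beta>" using a(6) by simp
  interpret sine_gordon \<beta> \<sigma> r T Q t L \<nu> \<kappa> \<alpha> Creg \<psi> \<phi> u ubar p
  proof unfold_locales
    show "1 / 2 < \<beta>" "\<beta> < 1" "\<alpha> = 2 * \<beta>" using a(4-6) by auto
    show "weakly_singular L T Creg \<beta> p" using a(17) unfolding \<alpha> .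
    fix N n :: nat assume n: "1 \<le> n" "n \<le> N"
    show "t N n \<le> Q * (t N 1 * real n powr r)" "t N 1 * real n powr r \<le> Q * t N n"
      "mstep (t N) n \<le> Q * (t N n / real n)" "t N n / real n \<le> Q * mstep (t N) n" using Q(2-5)[OF n] by auto
  qed (use a(1-3,7-16,18,20,21) Q(1) in blast)+
  obtain C \<tau>0 where C: "0 < C" "0 < \<tau>0" "\<And>N M P Ub m. 1 \<le> M \<Longrightarrow> 1 \<le> m \<Longrightarrow> m \<le> N \<Longrightarrow> max_step N (t N) \<le> \<tau>0 \<Longrightarrow>
    scheme_solution L \<beta> \<sigma> \<nu> \<kappa> \<psi> \<phi> N (t N) M P Ub \<Longrightarrow>
    grid_norm (L / real M) M (\<lambda>i j. p (real i * (L / real M)) (real j * (L / real M)) (t N m) - P m i j)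
      + grid_grad_norm (L / real M) M (\<lambda>i j. ubar (real i * (L / real M)) (real j * (L / real M)) (t N m) - Ub m i j)
    \<le> C * rate (t N 1) (t N m) ((L / real M)\<^sup>2)"
    by (rule error_estimate) blast
  show ?thesis
    unfolding Let_def rate_def[symmetric]
  proof (rule exI[of _ C], rule conjI[OF C(1)], rule exI[of _ \<tau>0], rule conjI[OF C(2)], intro allI impI ballI)
    fix N M P Ub n assume N: "1 \<le> N" and M: "1 \<le> M" and n: "n \<in> {1..N}"
      and s: "max_step N (t N) \<le> \<tau>0 \<and> scheme_solution L \<beta> \<sigma> \<nu> \<kappa> \<psi> \<phi> N (t N) M P Ub"
    show "grid_norm (L / real M) M (\<lambda>i j. p (real i * (L / real M)) (real j * (L / real M)) (t N n) - P n i j)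
      + grid_grad_norm (L / real M) M (\<lambda>i j. ubar (real i * (L / real M)) (real j * (L / real M)) (t N n) - Ub n i j)
      \<le> C * rate (mstep (t N) 1) (t N n) ((L / real M)\<^sup>2)"
      unfolding mstep_1[OF N] using C(3)[OF M _ _ conjunct1[OF s] conjunct2[OF s]] n by auto
  qed
qed

end
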